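(* Let $\theta^*\in\mathrm{interior}(D)$ be a contracting zero of $f(\theta)=\mathbb E[F(\theta,U)]$ and suppose that there exist $H\in\mathbb R^{d\times d}$ and $\lambda\in(0,1]$ with $|f(\theta)-H(\theta-\theta^* )|=\mathcal O(|\theta-\theta^*|^{1+\lambda})$ as $\theta\to\theta^*$. Let $M>1$ and $\alpha,\beta>0$ with $\beta<2\alpha$ and $\beta<1$, and suppose that $F_1,F_2,\dots$ are approximations for $F$ of order $(\alpha,\beta)$ with asymptotic bias $\mu\in\mathbb R^d$ and variance $\Gamma\in\mathbb R^{d\times d}$ around $\theta^*$ on scale $M$. Let $\varphi,\rho,\psi$ be reals with $$\frac1{2\alpha-\beta}<\varphi,\qquad \varphi+1<2(\rho+1),\qquad \Bigl(1-\frac{2\lambda}{\lambda+1}(\varphi+1)\mathfrak r\Bigr)_+<\psi<1,\qquad\text{where } \mathfrak r=\frac{\alpha}{2\alpha-\beta+1}.$$ For parameters $\kappa_K,\kappa_s>0$ let $(\bar\theta_n)$ be the output of the multilevel stochastic approximation algorithm (see context) with parameters $$\gamma_n=n^{-\psi},\quad K_n=\kappa_K(\varphi+1)n^\varphi,\quad s_n=\max\Bigl(\Bigl\lfloor\log_M\bigl(\kappa_s\bar K_n^{\frac1{2\alpha-\beta+1}}\bigr)\Bigr\rfloor,1\Bigr),\quad b_n=n^\rho,$$ where $\bar K_n=\sum_{k=1}^nK_k$. Set $$\mathfrak r_1=\frac{\rho+1}{\varphi+1}(2\alpha-\beta+1),\qquad \mathfrak r_2=\Bigl(2\frac{\rho+1}{\varphi+1}-1\Bigr)(2\alpha-\beta+1),\qquad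 \xi_n=\log_M\bigl(\kappa_s\bar K_n^{\frac1{2\alpha-\beta+1}}\bigr)-s_n,$$ and for $u,v\in\mathbb R$ with $u>0$ and $u+v>0$ $$\psi_{u,v}(z)=M^{-z(u+v)}\Bigl(\frac{M^u-1}{M^{u+v}-1}+M^{uz}-1\Bigr)\qquad(z\in[0,1]).$$ Then on $\{\theta_n\to\theta^*\}$ $$\frac1{\varepsilon_n^{\mathrm{diff}}}\bigl(\bar\theta_n-\theta^*+\varepsilon_n^{\mathrm{bias}}H^{-1}\mu\bigr)\Rightarrow\mathcal N\bigl(0,H^{-1}\Gamma(H^{-1})^\dagger\bigr),$$ where $$\varepsilon_n^{\mathrm{bias}}=\kappa_s^{-\alpha}\kappa_K^{-\mathfrak r}\,\psi_{\mathfrak r_1,-\alpha}(\xi_n)\,n^{-(\varphi+1)\mathfrak r}$$ and $$\varepsilon_n^{\mathrm{diff}}=\frac1{\sqrt{1-M^{-\frac{1-\beta}2}}}\,\frac{\frac{\rho+1}{\varphi+1}}{\sqrt{2\frac{\rho+1}{\varphi+1}-1}}\,\kappa_s^{\frac{1-\beta}2}\kappa_K^{-\mathfrak r}\sqrt{\psi_{\mathfrak r_2,1-\beta}(\xi_n)}\;n^{-(\varphi+1)\mathfrak r}.$$ Supposing further that $C_1,C_2,\dots$ are cost functions of scale $M$ with constant $\kappa_C>0$ around $\theta^*$, one has in terms of $\mathrm{cost}_n$, on $\{\theta_n\to\theta^*\}$, $$\varepsilon_n^{\mathrm{bias}}\sim\kappa_C^{\mathfrak r}\,(1-M^{-\frac{1-\beta}2})^{-\mathfrak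 r}\,\kappa_s^{-\alpha}\,\psi_{\mathfrak r_1,-\alpha}(\xi_n)\,\mathrm{cost}_n^{-\mathfrak r}$$ and $$\varepsilon_n^{\mathrm{diff}}\sim\kappa_C^{\mathfrak r}\,(1-M^{-\frac{1-\beta}2})^{-(\mathfrak r+\frac12)}\,\frac{\frac{\rho+1}{\varphi+1}}{\sqrt{2\frac{\rho+1}{\varphi+1}-1}}\,\kappa_s^{\frac{1-\beta}2}\sqrt{\psi_{\mathfrak r_2,1-\beta}(\xi_n)}\;\mathrm{cost}_n^{-\mathfrak r}.$$
   Context: Setting: $D\subset\mathbb R^d$ is closed; $U$ is a random variable with values in a measurable space $\mathcal U$; $F:D\times\mathcal U\to\mathbb R^d$ is product measurable such that $f(\theta)=\mathbb E[F(\theta,U)]$ is well-defined for all $\theta\in D$. $\Pi:\mathbb R^d\to D$ is a measurable function that is the identity on $D$ and maps $D^c$ into $\partial D$. Contracting zero: a zero $\theta^*$ of $f$ in the interior of $D$ is contracting if there is a matrix $H\in\mathbb R^{d\times d}$ all of whose eigenvalues have strictly negative real part with $f(\theta)=H(\theta-\theta^* )+o(|\theta-\theta^*|)$ as $\theta\to\theta^*$ (this is the same $H$ as in the claim). Approximations: for every $k\in\mathbb N$ let $F_k:D\times\mathcal U\to\mathbb R^d$ be product measurable with $F_k(\theta,U)$ integrable for every $\theta\in D$; put $F_0:=0$. For $\theta^*\in D$, $\alpha,\beta>0$, $M>1$, $\mu\in\mathbb R^d$, $\Gamma\in\mathbb R^{d\times d}$, the $F_1,F_2,\dots$ are called approximations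 for $F$ of order $(\alpha,\beta)$ with asymptotic bias $\mu$ and variance $\Gamma$ around $\theta^*$ on scale $M$ if (BIAS) $\lim_{\theta\to\theta^*,k\to\infty}M^{\alpha k}(\mathbb E[F_k(\theta,U)]-f(\theta))=\mu$; (VAR) $\lim_{\theta\to\theta^*,k\to\infty}M^{\beta k}\,\mathrm{cov}(F_k(\theta,U)-F_{k-1}(\theta,U))=\Gamma$; (TAIL) there exist $q>2$, a neighbourhood $D_{\theta^*}$ of $\theta^*$ and a constant $C_{\mathrm{TAIL}}$ such that for all $\theta\in D_{\theta^*}$ and $k\in\mathbb N$, $\mathbb E\bigl[\|F_k(\theta,U)-F_{k-1}(\theta,U)-\mathbb E[F_k(\theta,U)-F_{k-1}(\theta,U)]\|^q\bigr]^{2/q}\le C_{\mathrm{TAIL}}M^{-\beta k}$. Cost functions: measurable functions $C_k:D\to(0,\infty)$ $(k\in\mathbb N)$ are cost functions of scale $M$ with constant $\kappa_C$ around $\theta^*$ if $\lim_{\theta\to\theta^*,k\to\infty}M^{-k}C_k(\theta)=\kappa_C$ and there are a neighbourhood $D_{\theta^*}$ of $\theta^*$ and a constant $C_{\mathrm{COST}}$ with $C_k(\theta)\le C_{\mathrm{COST}}M^k$ for all $\theta\in D_{\theta^*}$, $k\in\mathbb N$. Multilevel stochastic approximation algorithm with parameter tuple $((\gamma_n),(K_n),(s_n),(b_n))$, where $(\gamma_n)$ is a monotonically decreasing $(0,\infty)$-valued sequence, $(K_n)$ and $(b_n)$ are $(0,\infty)$-valued and $(s_n)$ is $\mathbb N$-valued: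 for $s\in\mathbb N$, $K>0$, $k\in\mathbb N$ let $$N_k(s,K)=\Bigl\lceil\frac K{M^s}M^{\frac{\beta+1}2(s-k)}\Bigr\rceil,$$ and for a $\mathcal U$-valued family $\mathbf u=(u_{k,l})_{k,l\in\mathbb N}$ and $\theta\in D$ let $$Z(\mathbf u;\theta,s,K)=\sum_{k=1}^s\frac1{N_k(s,K)}\sum_{l=1}^{N_k(s,K)}\bigl(F_k(\theta,u_{k,l})-F_{k-1}(\theta,u_{k,l})\bigr).$$ Let $\mathbb U=(U_{k,l})_{k,l\in\mathbb N}$ be a family of independent copies of $U$ and $(\mathbb U_n)_{n\in\mathbb N}$ a sequence of independent copies of $\mathbb U$. For given $\theta_0\in D$ define $\theta_n=\Pi(\theta_{n-1}+\gamma_nZ(\mathbb U_n;\theta_{n-1},s_n,K_n))$ for $n\in\mathbb N$. The output is $\bar\theta_n=\frac1{\bar b_n}\sum_{k=1}^nb_k\theta_k$ with $\bar b_n=\sum_{k=1}^nb_k$, and the cost is $\mathrm{cost}_n=\sum_{m=1}^n\sum_{k=1}^{s_m}N_k(s_m,K_m)\,C_k(\theta_{m-1})$. Notation: $x_+=\max(x,0)$; $A^\dagger$ is the transpose of $A$; $a_n\sim b_n$ means $a_n/b_n\to1$ (for random sequences on an event: almost surely on it). For an event $A$, "$X_n\Rightarrow\nu$ on $A$" means $\mathbb E[1_Ag(X_n)]\to\mathbb P(A)\int g\,d\nu$ for all bounded continuous $g$ (i.e. convergence in law under $\mathbb P(\cdot|A)$ if $\mathbb P(A)>0$). *)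

theory Defs
  imports "HOL-Probability.Probability"
begin

section \<open>Vectors, matrices and laws on \<open>\<real>\<^sup>d\<close>\<close>

definition complex_eigenvalue :: "real^'d^'d \<Rightarrow> complex \<Rightarrow> bool" where
  "complex_eigenvalue H c \<longleftrightarrow>
     (\<exists>v :: complex^'d. v \<noteq> 0 \<and> (\<chi> i j. complex_of_real (H $ i $ j)) *v v = c *s v)"

definition cov_matrix :: "'w measure \<Rightarrow> ('w \<Rightarrow> real^'d) \<Rightarrow> real^'d^'d" where
  "cov_matrix P X = (\<chi> i j. \<integral>\<omega>. (X \<omega> $ i - (\<integral>\<omega>'. X \<omega>' \<partial>P) $ i) *
                                  (X \<omega> $ j - (\<integral>\<omega>'. X \<omega>' \<partial>P) $ j) \<partial>P)"

definition std_normal_vec :: "(real^'d) measure" where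
  "std_normal_vec = density lborel (\<lambda>x. ennreal (\<Prod>i\<in>UNIV. std_normal_density (x $ i)))"

text \<open>
  The normal law with mean \<open>m\<close> and (possibly singular) covariance matrix \<open>S\<close> is the law of
  \<open>m + A Z\<close> for a standard normal vector \<open>Z\<close> and any \<open>A\<close> with \<open>A A\<^sup>T = S\<close>. Such an \<open>A\<close> exists
  exactly if \<open>S\<close> is symmetric and positive semidefinite, and the law does not depend on its choice.
  For any other \<open>S\<close> the definition carries no information.
\<close>

definition normal_vec :: "real^'d \<Rightarrow> real^'d^'d \<Rightarrow> (real^'d) measure" where
  "normal_vec m S =
     distr std_normal_vec borel (\<lambda>z. m + (SOME A :: real^'d^'d. A ** transpose A = S) *v z)"

definition converges_in_law_on ::
    "'w measure \<Rightarrow> 'w set \<Rightarrow> (nat \<Rightarrow> 'w \<Rightarrow> 'b::real_normed_vector) \<Rightarrow> 'b measure \<Rightarrow> bool" where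
  "converges_in_law_on P A X \<nu> \<longleftrightarrow>
     (\<forall>g :: 'b \<Rightarrow> real. continuous_on UNIV g \<longrightarrow> bounded (range g) \<longrightarrow>
        (\<lambda>n. \<integral>\<omega>. indicator A \<omega> * g (X n \<omega>) \<partial>P) \<longlonglongrightarrow> measure P A * (\<integral>x. g x \<partial>\<nu>))"

definition independent_copies ::
    "'w measure \<Rightarrow> 'b measure \<Rightarrow> ('w \<Rightarrow> 'b) \<Rightarrow> 'i set \<Rightarrow> ('i \<Rightarrow> 'w \<Rightarrow> 'b) \<Rightarrow> bool" where
  "independent_copies P S X I Y \<longleftrightarrow>
     prob_space.indep_vars P (\<lambda>_. S) Y I \<and> (\<forall>i\<in>I. distr P S (Y i) = distr P S X)"


section \<open>Contracting zeros, approximations and cost functions\<close>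

definition mean_field :: "'w measure \<Rightarrow> ('w \<Rightarrow> 'u) \<Rightarrow> (real^'d \<Rightarrow> 'u \<Rightarrow> real^'d) \<Rightarrow> real^'d \<Rightarrow> real^'d" where
  "mean_field P U F \<theta> = (\<integral>\<omega>. F \<theta> (U \<omega>) \<partial>P)"

definition contracting_zero ::
    "(real^'d) set \<Rightarrow> (real^'d \<Rightarrow> real^'d) \<Rightarrow> real^'d \<Rightarrow> real^'d^'d \<Rightarrow> bool" where
  "contracting_zero D f \<theta>s H \<longleftrightarrow>
     \<theta>s \<in> interior D \<and> f \<theta>s = 0 \<and>
     (\<forall>c. complex_eigenvalue H c \<longrightarrow> Re c < 0) \<and>
     (\<lambda>\<theta>. norm (f \<theta> - H *v (\<theta> - \<theta>s))) \<in> o[at \<theta>s within D](\<lambda>\<theta>. norm (\<theta> - \<theta>s))"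

text \<open>
  The filter of the joint limit \<open>\<theta> \<rightarrow> \<theta>s\<close> in \<open>D\<close>, \<open>k \<rightarrow> \<infinity>\<close>. The value \<open>\<theta> = \<theta>s\<close> is not excluded,
  hence \<^const>\<open>nhds\<close> instead of \<^const>\<open>at_within\<close>.
\<close>

definition joint_limit :: "(real^'d) set \<Rightarrow> real^'d \<Rightarrow> ((real^'d) \<times> nat) filter" where
  "joint_limit D \<theta>s = inf (nhds \<theta>s) (principal D) \<times>\<^sub>F sequentially"

text \<open>
  A sequence of approximations is indexed by \<open>k \<ge> 1\<close>; the entry \<open>Fs 0\<close> is required to vanish
  wherever the increments below are used.
\<close>

definition level_diff :: "(nat \<Rightarrow> real^'d \<Rightarrow> 'u \<Rightarrow> real^'d) \<Rightarrow> nat \<Rightarrow> real^'d \<Rightarrow> 'u \<Rightarrow> real^'d" where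
  "level_diff Fs k \<theta> u = Fs k \<theta> u - Fs (k - 1) \<theta> u"

definition approximations ::
    "'w measure \<Rightarrow> ('w \<Rightarrow> 'u) \<Rightarrow> (real^'d) set \<Rightarrow> (real^'d \<Rightarrow> 'u \<Rightarrow> real^'d) \<Rightarrow>
     (nat \<Rightarrow> real^'d \<Rightarrow> 'u \<Rightarrow> real^'d) \<Rightarrow> real \<Rightarrow> real \<Rightarrow> real^'d \<Rightarrow> real^'d^'d \<Rightarrow> real^'d \<Rightarrow> real \<Rightarrow> bool" where
  "approximations P U D F Fs \<alpha> \<beta> \<mu> \<Gamma> \<theta>s M \<longleftrightarrow>
     \<comment> \<open>BIAS\<close>
     ((\<lambda>(\<theta>, k). M powr (\<alpha> * real k) *\<^sub>R ((\<integral>\<omega>. Fs k \<theta> (U \<omega>) \<partial>P) - mean_field P U F \<theta>))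
        \<longlongrightarrow> \<mu>) (joint_limit D \<theta>s) \<and>
     \<comment> \<open>VAR\<close>
     ((\<lambda>(\<theta>, k). M powr (\<beta> * real k) *\<^sub>R cov_matrix P (\<lambda>\<omega>. level_diff Fs k \<theta> (U \<omega>)))
        \<longlongrightarrow> \<Gamma>) (joint_limit D \<theta>s) \<and>
     \<comment> \<open>TAIL; integrability expresses that the moment is finite\<close>
     (\<exists>q > 2. \<exists>V C. open V \<and> \<theta>s \<in> V \<and> (\<forall>\<theta> \<in> V \<inter> D. \<forall>k \<ge> 1.
        (let Y = (\<lambda>\<omega>. norm (level_diff Fs k \<theta> (U \<omega>) - (\<integral>\<omega>'. level_diff Fs k \<theta> (U \<omega>') \<partial>P)) powr q)
         in integrable P Y \<and> (\<integral>\<omega>. Y \<omega> \<partial>P) powr (2 / q) \<le> C * M powr (- \<beta> * real k))))"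

definition cost_functions ::
    "(real^'d) set \<Rightarrow> (nat \<Rightarrow> real^'d \<Rightarrow> real) \<Rightarrow> real \<Rightarrow> real \<Rightarrow> real^'d \<Rightarrow> bool" where
  "cost_functions D C M \<kappa>\<^sub>C \<theta>s \<longleftrightarrow>
     (\<forall>k \<ge> 1. C k \<in> borel_measurable (restrict_space borel D) \<and> (\<forall>\<theta>\<in>D. 0 < C k \<theta>)) \<and>
     ((\<lambda>(\<theta>, k). M powr (- real k) * C k \<theta>) \<longlongrightarrow> \<kappa>\<^sub>C) (joint_limit D \<theta>s) \<and>
     (\<exists>V B. open V \<and> \<theta>s \<in> V \<and> (\<forall>\<theta> \<in> V \<inter> D. \<forall>k \<ge> 1. C k \<theta> \<le> B * M ^ k))"


section \<open>The multilevel stochastic approximation algorithm\<close>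

definition ml_N :: "real \<Rightarrow> real \<Rightarrow> nat \<Rightarrow> nat \<Rightarrow> real \<Rightarrow> nat" where
  "ml_N M \<beta> k s K = nat \<lceil>K / M ^ s * M powr ((\<beta> + 1) / 2 * (real s - real k))\<rceil>"

definition ml_Z ::
    "real \<Rightarrow> real \<Rightarrow> (nat \<Rightarrow> real^'d \<Rightarrow> 'u \<Rightarrow> real^'d) \<Rightarrow> (nat \<times> nat \<Rightarrow> 'u) \<Rightarrow> real^'d \<Rightarrow> nat \<Rightarrow> real \<Rightarrow> real^'d" where
  "ml_Z M \<beta> Fs u \<theta> s K =
     (\<Sum>k = 1..s. (1 / real (ml_N M \<beta> k s K)) *\<^sub>R (\<Sum>l = 1..ml_N M \<beta> k s K. level_diff Fs k \<theta> (u (k, l))))"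

text \<open>Here \<open>u n\<close> is the realisation of the \<open>n\<close>-th family of innovations.\<close>

primrec ml_iter ::
    "real \<Rightarrow> real \<Rightarrow> (nat \<Rightarrow> real^'d \<Rightarrow> 'u \<Rightarrow> real^'d) \<Rightarrow> (real^'d \<Rightarrow> real^'d) \<Rightarrow>
     (nat \<Rightarrow> real) \<Rightarrow> (nat \<Rightarrow> real) \<Rightarrow> (nat \<Rightarrow> nat) \<Rightarrow> real^'d \<Rightarrow> (nat \<Rightarrow> nat \<times> nat \<Rightarrow> 'u) \<Rightarrow> nat \<Rightarrow> real^'d" where
  "ml_iter M \<beta> Fs proj \<gamma> K s \<theta>\<^sub>0 u 0 = \<theta>\<^sub>0"
| "ml_iter M \<beta> Fs proj \<gamma> K s \<theta>\<^sub>0 u (Suc n) =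
     (let \<theta> = ml_iter M \<beta> Fs proj \<gamma> K s \<theta>\<^sub>0 u n
      in proj (\<theta> + \<gamma> (Suc n) *\<^sub>R ml_Z M \<beta> Fs (u (Suc n)) \<theta> (s (Suc n)) (K (Suc n))))"

definition ml_average :: "(nat \<Rightarrow> real) \<Rightarrow> (nat \<Rightarrow> real^'d) \<Rightarrow> nat \<Rightarrow> real^'d" where
  "ml_average b \<theta> n = (1 / (\<Sum>k = 1..n. b k)) *\<^sub>R (\<Sum>k = 1..n. b k *\<^sub>R \<theta> k)"

definition ml_cost ::
    "real \<Rightarrow> real \<Rightarrow> (nat \<Rightarrow> real^'d \<Rightarrow> real) \<Rightarrow> (nat \<Rightarrow> real) \<Rightarrow> (nat \<Rightarrow> nat) \<Rightarrow> (nat \<Rightarrow> real^'d) \<Rightarrow> nat \<Rightarrow> real" where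
  "ml_cost M \<beta> C K s \<theta> n =
     (\<Sum>m = 1..n. \<Sum>k = 1..s m. real (ml_N M \<beta> k (s m) (K m)) * C k (\<theta> (m - 1)))"

definition psi_fun :: "real \<Rightarrow> real \<Rightarrow> real \<Rightarrow> real \<Rightarrow> real" where
  "psi_fun M u v z =
     M powr (- z * (u + v)) * ((M powr u - 1) / (M powr (u + v) - 1) + M powr (u * z) - 1)"

end

theory Submission
  imports Defs "HOL-Computational_Algebra.Fundamental_Theorem_Algebra" "HOL-Real_Asymp.Real_Asymp"
begin

text \<open>
  Near \<open>\<theta>s\<close> the iteration is \<open>\<theta> n = \<theta> (n - 1) + n powr (- \<psi>) * (m n (\<theta> (n - 1)) + Z n)\<close> with a
  centred noise \<open>Z n\<close> and \<open>m n x \<approx> H (x - \<theta>s) + \<eta> n * \<mu>\<close>. A Lyapunov form of \<open>H\<close> gives an \<open>L\<^sup>2\<close> rate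
  for the iterates stopped on leaving a small ball. Solving the recursion for the previous error
  and summing by parts turns the weighted average of the errors into \<open>H\<^sup>-\<^sup>1\<close> applied to a
  martingale and to the accumulated bias, with a remainder of smaller order; the condition on \<open>\<psi>\<close>
  makes the Taylor error negligible. The conditional characteristic functions of the martingale
  increments factor over the independent single samples, which gives the limit law directly.
  Both normalisations are sums of powers of \<open>M\<close> evaluated at the piecewise constant level \<open>s\<close>; they
  telescope when written as functions of the running length \<open>L\<close> of which \<open>s\<close> is the
  integer part of the logarithm, and this produces the periodic functions \<open>psi_fun\<close>.
\<close>

section \<open>Contracting matrices and the Lyapunov form\<close>

text \<open>Two obstacles shape the argument. Estimates exist only near \<open>\<theta>s\<close>,
  and the event of convergence belongs to no finite stage of the filtration. So an iterate that
  leaves the ball is replaced by \<open>\<theta>s\<close> for good while the noise goes on,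
  evaluated at \<open>\<theta>s\<close>: the martingale keeps its full variance on the whole space,
  its limit law holds on every event of a finite stage and extends to the sigma-algebra they
  generate, and the true average is compared with it only on paths that stay in the ball. Secondly,
  the fractional part \<open>\<xi>\<close> oscillates, so the rescaled rates need not converge;
  every limit is stated as a ratio or a normalised difference. Exponents: with R = (\<phi>+1)\<rr>
  the bias is of order n^(-R) and the noise variance of one step of order n^(1-2R), so steps
  n^(-\<psi>) give a mean square error n^(-e), e = 2R+\<psi>-1. The Taylor error is negligible if R
  < (1+lam)e/2, which is the lower bound on \<psi>; \<psi> < 1 makes the summation by parts
  negligible; the lower bound on \<phi> sends all replication numbers to infinity.\<close>

definition poly_apply :: "complex^'d^'d \<Rightarrow> complex poly \<Rightarrow> complex^'d \<Rightarrow> complex^'d" where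
  "poly_apply A p v = (\<Sum>i\<le>degree p. coeff p i *s (((*v) A ^^ i) v))"

definition geometric_decay :: "(nat \<Rightarrow> 'a::real_normed_vector) \<Rightarrow> bool" where
  "geometric_decay x \<longleftrightarrow> (\<exists>C r. 0 \<le> r \<and> r < 1 \<and> (\<forall>n. norm (x n) \<le> C * r ^ n))"

lemma poly_apply_altdef:
  assumes "degree p \<le> n"
  shows "poly_apply A p v = (\<Sum>i\<le>n. coeff p i *s (((*v) A ^^ i) v))"
  unfolding poly_apply_def
  by (rule sum.mono_neutral_left) (use assms in \<open>auto simp: coeff_eq_0\<close>)

lemma poly_apply_pCons: "poly_apply A (pCons a p) v = a *s v + A *v poly_apply A p v"
proof -
  have "poly_apply A (pCons a p) v = (\<Sum>i\<le>Suc (degree p). coeff (pCons a p) i *s (((*v) A ^^ i) v))"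
    by (rule poly_apply_altdef) (rule degree_pCons_le)
  also have "\<dots> = a *s v + (\<Sum>i\<le>degree p. coeff p i *s (A *v ((*v) A ^^ i) v))"
    by (subst sum.atMost_Suc_shift) simp
  also have "(\<Sum>i\<le>degree p. coeff p i *s (A *v ((*v) A ^^ i) v)) = A *v poly_apply A p v"
    by (simp add: poly_apply_def matrix_vector_right_distrib vec.sum vec.scale)
  finally show ?thesis .
qed

lemma poly_apply_diff_smult:
  "poly_apply A (p - Polynomial.smult c q) v = poly_apply A p v - c *s poly_apply A q v"
proof -
  define n where "n = max (degree p) (degree q)"
  have "degree (p - Polynomial.smult c q) \<le> n"
    unfolding n_def by (meson degree_diff_le degree_smult_le max.cobounded1 max.cobounded2 order_trans)
  moreover have "degree p \<le> n" "degree q \<le> n" by (auto simp: n_def)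
  ultimately show ?thesis
    by (simp add: poly_apply_altdef[of _ n] vec.scale_sum_right sum_subtractf[symmetric] vec.scale_left_diff_distrib)
qed

lemma funpow_linear_commute: "((*v) A ^^ i) (A *v v) = A *v ((*v) A ^^ i) v"
  by (simp add: funpow_swap1)

lemma funpow_matrix_diff_smult:
  fixes A :: "'a::field^'d^'d"
  shows "((*v) A ^^ i) (x - c *s y) = ((*v) A ^^ i) x - c *s ((*v) A ^^ i) y"
  by (induction i) (simp_all add: matrix_vector_mult_diff_distrib vec.scale)

text \<open>The factor may act last or first. The first form shows that q(A)v is an eigenvector or
  zero once the product annihilates v; the second passes annihilation by q on to the vector (A -
  c)v. The induction over the roots uses one form for each kind of root.\<close>

lemma poly_apply_linear_factor:
  "poly_apply A ([:-c, 1:] * q) v = A *v poly_apply A q v - c *s poly_apply A q v"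
  "poly_apply A ([:-c, 1:] * q) v = poly_apply A q (A *v v - c *s v)"
proof -
  have "[:-c, 1:] * q = pCons 0 q - Polynomial.smult c q" by simp
  then show *: "poly_apply A ([:-c, 1:] * q) v = A *v poly_apply A q v - c *s poly_apply A q v"
    by (simp only: poly_apply_diff_smult poly_apply_pCons) simp
  have "poly_apply A q (A *v v - c *s v) =
      (\<Sum>i\<le>degree q. coeff q i *s (A *v ((*v) A ^^ i) v) - c *s (coeff q i *s ((*v) A ^^ i) v))"
    unfolding poly_apply_def funpow_matrix_diff_smult funpow_linear_commute
    by (simp add: vec.scale_right_diff_distrib mult.commute)
  also have "\<dots> = A *v poly_apply A q v - c *s poly_apply A q v"
    by (simp add: poly_apply_def vec.sum vec.scale vec.scale_sum_right sum_subtractf)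
  finally show "poly_apply A ([:-c, 1:] * q) v = poly_apply A q (A *v v - c *s v)"
    using * by simp
qed

lemma poly_apply_diff_monom:
  "i \<noteq> j \<Longrightarrow> poly_apply A (monom 1 i - monom 1 j) v = ((*v) A ^^ i) v - ((*v) A ^^ j) v"
proof -
  have m: "poly_apply A (monom 1 i) v = ((*v) A ^^ i) v" for i
    by (simp add: poly_apply_def degree_monom_eq coeff_monom if_distrib[of "\<lambda>c. c *s _"] cong: if_cong)
  show ?thesis
    using poly_apply_diff_smult[of A "monom 1 i" 1 "monom 1 j" v] by (simp add: m)
qed

text \<open>The CARD('d) + 1 vectors v, Av, A^2 v, ... cannot be independent, and a relation for the
  single vector v is all that is asked for. Dependence is a property of sets, which is why
  coinciding powers form a separate case with the polynomial x^i - x^j.\<close>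

lemma ex_annihilating_poly:
  fixes A :: "complex^'d^'d"
  shows "\<exists>p. p \<noteq> 0 \<and> poly_apply A p v = 0"
proof (cases "inj_on (\<lambda>i. ((*v) A ^^ i) v) {..CARD('d)}")
  case False
  then obtain i j where "i \<noteq> j" "((*v) A ^^ i) v = ((*v) A ^^ j) v" by (auto simp: inj_on_def)
  moreover from \<open>i \<noteq> j\<close> have "monom 1 i - monom 1 j \<noteq> (0::complex poly)"
    by (metis degree_monom_eq one_neq_zero right_minus_eq)
  ultimately show ?thesis by (metis poly_apply_diff_monom right_minus_eq)
next
  case True
  let ?x = "\<lambda>i. ((*v) A ^^ i) v"
  let ?S = "?x ` {..CARD('d)}"
  have card: "card ?S = Suc CARD('d)" using True by (simp add: card_image)
  have "vec.dependent ?S"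
  proof (rule ccontr)
    assume "\<not> vec.dependent ?S"
    then have "card ?S \<le> vec.dim (UNIV :: (complex^'d) set)"
      using vec.independent_card_le_dim[of ?S UNIV] by auto
    then show False using card by (simp add: vec.dim_UNIV vec.dimension_def card_cart_basis)
  qed
  then obtain u w where u: "w \<in> ?S" "u w \<noteq> 0" "(\<Sum>w\<in>?S. u w *s w) = 0"
    using vec.dependent_finite[of ?S] by auto
  then obtain j where j: "j \<le> CARD('d)" "w = ?x j" by auto
  define p where "p = (\<Sum>i\<le>CARD('d). monom (u (?x i)) i)"
  have cf: "coeff p i = (if i \<le> CARD('d) then u (?x i) else 0)" for i
    by (simp add: p_def coeff_sum coeff_monom)
  have "degree p \<le> CARD('d)" by (rule degree_le) (simp add: cf)
  then have "poly_apply A p v = (\<Sum>i\<le>CARD('d). u (?x i) *s ?x i)"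
    by (simp add: poly_apply_altdef cf)
  also have "\<dots> = 0" using u(3) by (simp add: sum.reindex[OF True])
  finally have "poly_apply A p v = 0" .
  moreover have "p \<noteq> 0" using cf[of j] j u(2) by auto
  ultimately show ?thesis by blast
qed

lemma norm_vector_smult: "norm (c *s (v::complex^'d)) = norm c * norm v"
  by (simp add: norm_vec_def norm_mult L2_set_right_distrib)

text \<open>Any rate s strictly between max(|c|, r) and 1 works, because the surplus s - |c| absorbs
  the decaying forcing term.\<close>

lemma geometric_decay_step:
  fixes a w :: "nat \<Rightarrow> complex^'d"
  assumes "geometric_decay w" and c: "norm c < 1" and a: "\<And>n. a (Suc n) = c *s a n + w n"
  shows "geometric_decay a"
proof -
  obtain C r where C: "0 \<le> r" "r < 1" "\<And>n. norm (w n) \<le> C * r ^ n"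
    using assms(1) by (auto simp: geometric_decay_def)
  obtain s where s: "max (norm c) r < s" "s < 1" using dense[of "max (norm c) r" 1] c C(2) by auto
  have "0 \<le> C" using C(3)[of 0] norm_ge_zero[of "w 0"] by (simp del: norm_ge_zero)
  \<comment> \<open>The first summand starts the induction; the second gives C \<le> C' (s - |c|),
    which closes it.\<close>
  define C' where "C' = norm (a 0) + C / (s - norm c)"
  have s': "0 < s - norm c" using s by simp
  have C': "C \<le> C' * (s - norm c)"
  proof -
    have "C' * (s - norm c) = norm (a 0) * (s - norm c) + C"
      unfolding C'_def distrib_right using s' by simp
    then show ?thesis using s' by simp
  qed
  have "norm (a n) \<le> C' * s ^ n" for n
  proof (induction n)
    case 0
    show ?case using s' \<open>0 \<le> C\<close> by (simp add: C'_def)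
  next
    case (Suc n)
    have "norm (a (Suc n)) \<le> norm c * norm (a n) + norm (w n)"
      unfolding a using norm_triangle_ineq[of "c *s a n" "w n"] by (simp add: norm_vector_smult)
    also have "\<dots> \<le> norm c * (C' * s ^ n) + C * s ^ n"
      using Suc C(3)[of n] power_mono[of r s n] s C(1) \<open>0 \<le> C\<close>
      by (intro add_mono mult_left_mono) (auto intro: order_trans mult_left_mono)
    also have "\<dots> \<le> norm c * (C' * s ^ n) + C' * (s - norm c) * s ^ n"
      using C' s C(1) by (intro add_left_mono mult_right_mono) auto
    finally show ?case by (simp add: algebra_simps)
  qed
  then show ?thesis using s C(1) unfolding geometric_decay_def by (intro exI[of _ C'] exI[of _ s]) auto
qed

text \<open>Only the eigenvalue factors of an annihilating polynomial matter; the others are cancelled.\<close>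

lemma powers_decay_if_annihilated:
  fixes A :: "complex^'d^'d"
  assumes ev: "\<And>c v. v \<noteq> 0 \<Longrightarrow> A *v v = c *s v \<Longrightarrow> norm c < 1"
    and "p \<noteq> 0" "poly_apply A p v = 0"
  shows "geometric_decay (\<lambda>n. ((*v) A ^^ n) v)"
  using assms(2,3)
proof (induction "degree p" arbitrary: p v)
  case 0
  then have "coeff p 0 \<noteq> 0" by (metis leading_coeff_0_iff)
  then have "v = 0" using 0 by (simp add: poly_apply_def)
  moreover have "((*v) A ^^ n) 0 = 0" for n by (induction n) auto
  ultimately show ?case by (auto simp: geometric_decay_def intro!: exI[of _ 0])
next
  case (Suc n)
  then have "\<not> constant (poly p)" by (simp add: constant_degree)
  then obtain c where "poly p c = 0" using fundamental_theorem_of_algebra by blast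
  then obtain q where q: "p = [:-c, 1:] * q" by (metis dvdE poly_eq_0_iff_dvd)
  have q0: "q \<noteq> 0" using Suc.prems q by auto
  have dq: "n = degree q" using Suc.hyps(2) q0 unfolding q by (subst (asm) degree_mult_eq) auto
  show ?case
  \<comment> \<open>A root inside the disc is peeled off: (A - c)v is annihilated by q, and a n =
    A^n v solves a (Suc n) = c a n + A^n (A - c)v. For any other root q(A)v would be an eigenvector
    with eigenvalue of modulus at least 1, hence it vanishes.\<close>
  proof (cases "norm c < 1")
    case True
    have "geometric_decay (\<lambda>n. ((*v) A ^^ n) (A *v v - c *s v))"
      using Suc.hyps(1)[OF dq q0] Suc.prems(2) unfolding q poly_apply_linear_factor(2) by blast
    then show ?thesis
      by (rule geometric_decay_step[OF _ True])
        (simp add: funpow_matrix_diff_smult funpow_linear_commute)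
  next
    case False
    then have "poly_apply A q v = 0"
      using ev[of "poly_apply A q v" c] Suc.prems(2) unfolding q poly_apply_linear_factor(1) by auto
    then show ?thesis using Suc.hyps(1)[OF dq q0] by blast
  qed
qed

section \<open>Complexification and the Cayley transform\<close>

definition complex_matrix :: "real^'n^'m \<Rightarrow> complex^'n^'m" where
  "complex_matrix A = (\<chi> i j. complex_of_real (A $ i $ j))"

definition complex_vector :: "real^'n \<Rightarrow> complex^'n" where
  "complex_vector v = (\<chi> i. complex_of_real (v $ i))"

lemma complex_matrix_simps:
  "complex_matrix (A ** B) = complex_matrix A ** complex_matrix B"
  "complex_matrix (A + C) = complex_matrix A + complex_matrix C"
  "complex_matrix (A - C) = complex_matrix A - complex_matrix C"
  "complex_matrix (mat 1 :: real^'d^'d) = mat 1"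
  by (simp_all add: complex_matrix_def matrix_matrix_mult_def vec_eq_iff mat_def)

lemma complex_matrix_vector: "complex_matrix A *v complex_vector v = complex_vector (A *v v)"
  by (simp add: complex_matrix_def complex_vector_def matrix_vector_mult_def vec_eq_iff)

lemma norm_complex_vector: "norm (complex_vector v) = norm v"
  by (simp add: complex_vector_def norm_vec_def)

text \<open>The Cayley transform A = (1 + H)(1 - H)^(-1) sends an eigenvalue c of H to (1 + c)/(1 -
  c), and so the left half plane to the open unit disc. Invertibility of 1 - H holds because 1 is
  not an eigenvalue. The equation A (1 - H) = 1 + H is the form in which the Lyapunov form uses
  it.\<close>

lemma stable_matrix_cayley:
  fixes H :: "real^'d^'d"
  assumes H: "\<And>c. complex_eigenvalue H c \<Longrightarrow> Re c < 0"
  obtains A where "A ** (mat 1 - H) = mat 1 + H" and "invertible (mat 1 - H)"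
    and "\<And>v. geometric_decay (\<lambda>n. ((*v) A ^^ n) v)"
proof -
  define G where "G = mat 1 - H"
  have "x = 0" if "G *v x = 0" for x
  proof (rule ccontr)
    assume "x \<noteq> 0"
    have "H *v x = x" using that by (simp add: G_def matrix_vector_mult_diff_rdistrib)
    then have "complex_matrix H *v complex_vector x = 1 *s complex_vector x"
      by (simp add: complex_matrix_vector)
    moreover have "complex_vector x \<noteq> 0" using \<open>x \<noteq> 0\<close> by (metis norm_complex_vector norm_eq_zero)
    ultimately have "complex_eigenvalue H 1" unfolding complex_eigenvalue_def complex_matrix_def by blast
    then show False using H by fastforce
  qed
  then obtain Gi where Gi: "Gi ** G = mat 1" using matrix_left_invertible_ker by metis
  then have Gi': "G ** Gi = mat 1" by (simp add: matrix_left_right_inverse)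
  define A where "A = (mat 1 + H) ** Gi"
  let ?A = "complex_matrix A" and ?H = "complex_matrix H"
  have A: "A ** G = mat 1 + H" by (simp add: A_def matrix_mul_assoc[symmetric] Gi)
  then have cA: "?A ** (mat 1 - ?H) = mat 1 + ?H"
    unfolding G_def by (metis complex_matrix_simps)
  have ev: "norm a < 1" if v: "v \<noteq> 0" "?A *v v = a *s v" for a v
  proof -
    \<comment> \<open>The inverse transform: if Av = av then y = (1 - H)^(-1) v satisfies Hy = cy
      with c = (a - 1)/(a + 1).\<close>
    define y where "y = complex_matrix Gi *v v"
    have vy: "v = y - ?H *v y"
    proof -
      have "(mat 1 - ?H) ** complex_matrix Gi = mat 1"
        using Gi' unfolding G_def by (metis complex_matrix_simps)
      then have "(mat 1 - ?H) *v y = v" by (simp add: y_def matrix_vector_mul_assoc)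
      then show ?thesis by (simp add: matrix_vector_mult_diff_rdistrib)
    qed
    have "y \<noteq> 0" using v vy by auto
    have "?A *v v = y + ?H *v y"
    proof -
      have "?A *v ((mat 1 - ?H) *v y) = (mat 1 + ?H) *v y" by (simp add: matrix_vector_mul_assoc cA)
      then show ?thesis using vy by (simp add: matrix_vector_mult_diff_rdistrib matrix_vector_mult_add_rdistrib)
    qed
    then have e: "(1 + a) *s (?H *v y) = (a - 1) *s y"
      using v(2) vy by (simp add: vec_eq_iff algebra_simps)
    have "a \<noteq> -1"
    proof
      assume "a = -1"
      then have "(-2) *s y = 0" using e by simp
      then show False using \<open>y \<noteq> 0\<close> by (simp add: vec_eq_iff)
    qed
    then have a1: "1 + a \<noteq> 0" by (simp add: add_eq_0_iff)
    define c where "c = (a - 1) / (1 + a)"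
    have "?H *v y = c *s y" using e a1 by (simp add: c_def vec_eq_iff field_simps)
    then have "complex_eigenvalue H c"
      unfolding complex_eigenvalue_def complex_matrix_def using \<open>y \<noteq> 0\<close> by blast
    then have "Re c < 0" by (rule H)
    \<comment> \<open>Multiplying c (1 + a) = a - 1 by the conjugate of 1 + a leaves the real part
      |a|^2 - 1, so the sign of Re c decides whether a lies in the disc.\<close>
    moreover have "Re c * (norm (1 + a))\<^sup>2 = (norm a)\<^sup>2 - 1"
    proof -
      have "c * (1 + a) = a - 1" using a1 by (simp add: c_def)
      then have "c * ((1 + a) * cnj (1 + a)) = (a - 1) * cnj (1 + a)" by (simp flip: mult.assoc)
      then have "Re (c * complex_of_real ((norm (1 + a))\<^sup>2)) = Re ((a - 1) * cnj (1 + a))"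
        by (simp only: complex_norm_square)
      then show ?thesis unfolding cmod_power2[of a] by (simp add: power2_eq_square algebra_simps)
    qed
    ultimately have "(norm a)\<^sup>2 < 1"
      using a1 by (metis diff_less_0_iff_less mult_neg_pos zero_less_norm_iff zero_less_power)
    then show ?thesis by (simp add: power_less_one_iff)
  qed
  have "geometric_decay (\<lambda>n. ((*v) A ^^ n) v)" for v
  proof -
    have "geometric_decay (\<lambda>n. ((*v) ?A ^^ n) (complex_vector v))"
      using ex_annihilating_poly[of ?A "complex_vector v"] powers_decay_if_annihilated[of ?A] ev by blast
    moreover have "((*v) ?A ^^ n) (complex_vector v) = complex_vector (((*v) A ^^ n) v)" for n
      by (induction n) (simp_all add: complex_matrix_vector)
    ultimately show ?thesis by (simp add: geometric_decay_def norm_complex_vector)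
  qed
  moreover have "invertible G" using Gi Gi' by (auto simp: invertible_def)
  ultimately show ?thesis using that A unfolding G_def by blast
qed

section \<open>The Lyapunov form of a contracting matrix\<close>

lemma geometric_decay_summable_inner:
  fixes x y :: "nat \<Rightarrow> 'a::real_inner"
  assumes "geometric_decay x" "geometric_decay y"
  shows "summable (\<lambda>n. x n \<bullet> y n)"
proof -
  obtain C r where C: "0 \<le> r" "r < 1" "\<And>n. norm (x n) \<le> C * r ^ n"
    using assms(1) by (auto simp: geometric_decay_def)
  obtain C' r' where C': "0 \<le> r'" "r' < 1" "\<And>n. norm (y n) \<le> C' * r' ^ n"
    using assms(2) by (auto simp: geometric_decay_def)
  have "0 \<le> C" using C(3)[of 0] norm_ge_zero[of "x 0"] by (simp del: norm_ge_zero)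
  have "norm (x n \<bullet> y n) \<le> (C * C') * (r * r') ^ n" for n
  proof -
    have "norm (x n \<bullet> y n) \<le> norm (x n) * norm (y n)" by (simp add: Cauchy_Schwarz_ineq2)
    also have "\<dots> \<le> (C * r ^ n) * (C' * r' ^ n)"
      using C C' \<open>0 \<le> C\<close> by (intro mult_mono) auto
    finally show ?thesis by (simp add: power_mult_distrib mult_ac)
  qed
  moreover have "summable (\<lambda>n. (C * C') * (r * r') ^ n)"
    using C C' by (intro summable_mult summable_geometric)
      (auto simp: abs_mult intro: mult_le_less_imp_less order_le_less_trans[OF mult_left_le])
  ultimately show ?thesis by (rule summable_comparison_test'[of _ 0, rotated])
qed

text \<open>The series of the inner products of A^n x and A^n y solves B x y = x . y + B (Ax) (Ay).
  At g = (1 - H)x one has Ag = (1 + H)x, and the difference of the two squares leaves 4 B x (Hx) = -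
  |g|^2, which is negative definite since 1 - H is invertible.\<close>

lemma lyapunov_form:
  fixes H :: "real^'d^'d"
  assumes H: "\<And>c. complex_eigenvalue H c \<Longrightarrow> Re c < 0"
  obtains B :: "real^'d \<Rightarrow> real^'d \<Rightarrow> real" and c
  where "bounded_bilinear B" "\<And>x y. B x y = B y x" "\<And>x. (norm x)\<^sup>2 \<le> B x x"
    "c > 0" "\<And>x. B x (H *v x) \<le> - c * (norm x)\<^sup>2"
proof -
  obtain A where A: "A ** (mat 1 - H) = mat 1 + H" and inv: "invertible (mat 1 - H)"
    and dec: "\<And>v. geometric_decay (\<lambda>n. ((*v) A ^^ n) v)"
    using stable_matrix_cayley[OF H] by metis
  let ?a = "\<lambda>n. ((*v) A ^^ n)"
  have lin: "linear (?a n)" for n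
  proof (induction n)
    case (Suc n)
    then show ?case using linear_compose[of "?a n" "(*v) A"] by (simp add: o_def)
  qed (simp add: linear_iff)
  define B where "B x y = (\<Sum>n. ?a n x \<bullet> ?a n y)" for x y
  have sm: "summable (\<lambda>n. ?a n x \<bullet> ?a n y)" for x y
    by (rule geometric_decay_summable_inner[OF dec dec])
  have sym: "B x y = B y x" for x y by (simp add: B_def inner_commute)
  have add: "B (x + y) z = B x z + B y z" for x y z
    by (simp add: B_def linear_add[OF lin] inner_add_left suminf_add[OF sm sm])
  have scale: "B (r *\<^sub>R x) z = r * B x z" for r x z
    using suminf_mult[OF sm] by (simp add: B_def linear_cmul[OF lin])
  have "bilinear B"
    unfolding bilinear_def
  proof (intro conjI allI linearI)
    fix x y z :: "real^'d" and r :: real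
    show "B x (y + z) = B x y + B x z" using add[of y z x] by (simp only: sym[of x])
    show "B x (r *\<^sub>R y) = r *\<^sub>R B x y" using scale[of r y x] by (simp only: sym[of x] real_scaleR_def)
  qed (simp_all add: add scale)
  then have bb: "bounded_bilinear B" by (simp add: bilinear_conv_bounded_bilinear)
  have step: "B x y = x \<bullet> y + B (A *v x) (A *v y)" for x y
    using suminf_split_head[OF sm[of x y]] by (simp add: B_def funpow_swap1)
  have pos: "0 \<le> B x x" for x unfolding B_def by (rule suminf_nonneg[OF sm]) simp
  have ge: "(norm x)\<^sup>2 \<le> B x x" for x using step[of x x] pos[of "A *v x"] by (simp add: power2_norm_eq_inner)
  obtain Gi where Gi: "Gi ** (mat 1 - H) = mat 1" using inv by (auto simp: invertible_def)
  obtain L where L: "L > 0" "\<And>x. norm (Gi *v x) \<le> norm x * L"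
    using bounded_linear.pos_bounded[of "(*v) Gi"] matrix_vector_mul_bounded_linear by blast
  \<comment> \<open>L bounds the inverse of 1 - H, so |x|^2 \<le> L^2 |g|^2; the 4 comes from the
    difference of the two squares.\<close>
  have key: "B x (H *v x) \<le> - (1 / (4 * L\<^sup>2)) * (norm x)\<^sup>2" for x
  proof -
    define g where "g = (mat 1 - H) *v x"
    have g: "g = x - H *v x" by (simp add: g_def matrix_vector_mult_diff_rdistrib)
    have Ag: "A *v g = x + H *v x"
      by (simp add: g_def matrix_vector_mul_assoc A matrix_vector_mult_add_rdistrib)
    interpret B: bounded_bilinear B by (rule bb)
    have "B g g = (norm g)\<^sup>2 + B (A *v g) (A *v g)" using step[of g g] by (simp add: power2_norm_eq_inner)
    then have "4 * B x (H *v x) = - (norm g)\<^sup>2"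
      unfolding Ag unfolding g by (simp add: B.add_left B.add_right B.diff_left B.diff_right sym[of "H *v x" x])
    moreover have "(norm x)\<^sup>2 \<le> L\<^sup>2 * (norm g)\<^sup>2"
    proof -
      have "Gi *v g = x" by (simp add: g_def matrix_vector_mul_assoc Gi)
      then have "norm x \<le> norm g * L" using L(2)[of g] by simp
      then have "(norm x)\<^sup>2 \<le> (norm g * L)\<^sup>2" by (rule power_mono) simp
      then show ?thesis by (simp add: power_mult_distrib mult.commute)
    qed
    ultimately have "(norm x)\<^sup>2 \<le> L\<^sup>2 * (- 4 * B x (H *v x))" by simp
    then show ?thesis using L(1) by (simp add: field_simps)
  qed
  have "1 / (4 * L\<^sup>2) > 0" using L(1) by simp
  with bb sym ge key show ?thesis using that by blast
qed

text \<open>A kernel vector x of H would give 0 = B x (Hx) \<le> - c |x|^2 for the Lyapunov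
  form.\<close>

lemma contracting_invertible:
  fixes H :: "real^'d^'d"
  assumes H: "\<And>c. complex_eigenvalue H c \<Longrightarrow> Re c < 0"
  shows "matrix_inv H ** H = mat 1" "H ** matrix_inv H = mat 1"
proof -
  have "x = 0" if "H *v x = 0" for x
  proof -
    obtain B c where B: "bounded_bilinear B" "c > 0" "\<And>x. B x (H *v x) \<le> - c * (norm x)\<^sup>2"
      using lyapunov_form[OF H] by metis
    have "0 \<le> - c * (norm x)\<^sup>2" using B(3)[of x] that bounded_bilinear.zero_right[OF B(1)] by simp
    then show ?thesis using B(2) by (simp add: mult_le_0_iff)
  qed
  then have "\<exists>B. B ** H = mat 1" using matrix_left_invertible_ker by blast
  then have "\<exists>B. H ** B = mat 1 \<and> B ** H = mat 1" by (metis matrix_left_right_inverse)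
  then have "H ** matrix_inv H = mat 1 \<and> matrix_inv H ** H = mat 1"
    unfolding matrix_inv_def by (rule someI_ex)
  then show "matrix_inv H ** H = mat 1" "H ** matrix_inv H = mat 1" by blast+
qed

section \<open>Square roots of positive semidefinite matrices\<close>

lemma inner_matrix_vector: "x \<bullet> (A *v y) = (transpose A *v x) \<bullet> (y :: real^'n)"
  unfolding transpose_matrix_vector dot_lmul_matrix ..

text \<open>Symmetric elimination: subtracting v v^T with v = S e_i / sqrt (S_ii) clears the i-th
  diagonal entry and revives no other one, so the number of nonzero diagonal entries drops. The
  clause on zero diagonal entries leaves slot i free for v in the induction.\<close>

lemma psd_matrix_sum_outer:
  fixes S :: "real^'d^'d"
  assumes "transpose S = S" and "\<And>x. 0 \<le> x \<bullet> (S *v x)"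
  shows "\<exists>a :: 'd \<Rightarrow> real^'d. (\<forall>j. S $ j $ j = 0 \<longrightarrow> a j = 0) \<and> (\<forall>x. x \<bullet> (S *v x) = (\<Sum>j\<in>UNIV. (x \<bullet> a j)\<^sup>2))"
  using assms
proof (induction "card {i. S $ i $ i \<noteq> 0}" arbitrary: S rule: less_induct)
  case less
  have sym: "x \<bullet> (S *v y) = y \<bullet> (S *v x)" for x y
    unfolding inner_matrix_vector[of x S y] less.prems(1) by (rule inner_commute)
  have quad: "0 \<le> x \<bullet> (S *v x) + 2 * t * (y \<bullet> (S *v x)) + t\<^sup>2 * (y \<bullet> (S *v y))" for x y t
    using less.prems(2)[of "x + t *\<^sub>R y"] sym[of x y]
    by (simp add: matrix_vector_right_distrib inner_add_left inner_add_right matrix_vector_mult_scaleR power2_eq_square algebra_simps)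
  have diag: "axis i 1 \<bullet> (S *v axis i 1) = S $ i $ i" for i
    by (simp add: inner_axis' matrix_vector_mult_basis column_def)
  \<comment> \<open>With a vanishing diagonal entry the quadratic form is affine in t along e_i;
    being nonnegative it must be constant.\<close>
  have col: "axis i 1 \<bullet> (S *v x) = 0" if "S $ i $ i = 0" for i x
  proof (rule ccontr)
    assume nz: "axis i 1 \<bullet> (S *v x) \<noteq> 0"
    define e where "e = axis i 1 \<bullet> (S *v x)"
    have "0 \<le> x \<bullet> (S *v x) + 2 * t * e" for t
      using quad[of x t "axis i 1"] that by (simp add: diag e_def)
    from this[of "- (x \<bullet> (S *v x) + 1) / (2 * e)"] show False
      using nz unfolding e_def[symmetric] by (simp add: field_simps)
  qed
  show ?case
  proof (cases "\<exists>i. S $ i $ i \<noteq> 0")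
    case False
    then have "S *v x = 0" for x
      using col[of _ x] by (simp add: vec_eq_iff inner_axis')
    then show ?thesis by (intro exI[of _ "\<lambda>_. 0"]) simp
  next
    case True
    then obtain i where i: "S $ i $ i \<noteq> 0" by blast
    define p where "p = S $ i $ i"
    have p: "p > 0" using less.prems(2)[of "axis i 1"] i by (simp add: diag p_def less_le)
    define v where "v = (1 / sqrt p) *\<^sub>R (S *v axis i 1)"
    define S' where "S' = S - (\<chi> k l. v $ k * v $ l)"
    have ov: "(\<chi> k l. v $ k * v $ l) *v x = (v \<bullet> x) *\<^sub>R v" for x
      by (simp add: matrix_vector_mult_def vec_eq_iff inner_vec_def sum_distrib_left sum_distrib_right mult_ac)
    have S'x: "x \<bullet> (S' *v x) = x \<bullet> (S *v x) - (x \<bullet> v)\<^sup>2" for x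
      by (simp add: S'_def matrix_vector_mult_diff_rdistrib ov inner_diff_right power2_eq_square inner_commute)
    have tr: "transpose S' = S'"
      using less.prems(1) by (simp add: S'_def transpose_def vec_eq_iff mult.commute)
    \<comment> \<open>The minimum of the quadratic form over x + t e_i, attained at t = - e/p, is
      the value of the eliminated form.\<close>
    have psd: "0 \<le> x \<bullet> (S' *v x)" for x
    proof -
      define e where "e = axis i 1 \<bullet> (S *v x)"
      have "0 \<le> x \<bullet> (S *v x) + 2 * (- e / p) * e + (- e / p)\<^sup>2 * p"
        using quad[of x "- e / p" "axis i 1"] by (simp add: diag p_def e_def)
      moreover have "(x \<bullet> v)\<^sup>2 = e\<^sup>2 / p"
        using p sym[of x "axis i 1"] by (simp add: v_def e_def power_divide)
      moreover have "2 * (- e / p) * e + (- e / p)\<^sup>2 * p = - (e\<^sup>2 / p)"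
        using p by (simp add: power2_eq_square field_simps)
      ultimately show ?thesis by (simp add: S'x)
    qed
    have diag': "S' $ j $ j = S $ j $ j - (v $ j)\<^sup>2" for j by (simp add: S'_def power2_eq_square)
    have vi: "(v $ i)\<^sup>2 = p"
      using p by (simp add: v_def matrix_vector_mult_basis column_def p_def power2_eq_square field_simps)
    have zero: "S' $ j $ j = 0" if "S $ j $ j = 0" for j
    proof -
      have "v $ j = 0" using col[OF that, of "axis i 1"] by (simp add: v_def inner_axis')
      then show ?thesis using that by (simp add: diag')
    qed
    have zi: "S' $ i $ i = 0" by (simp add: diag' vi p_def)
    have "{j. S' $ j $ j \<noteq> 0} \<subset> {j. S $ j $ j \<noteq> 0}" using zero zi i by auto
    then have "card {j. S' $ j $ j \<noteq> 0} < card {j. S $ j $ j \<noteq> 0}" by (rule psubset_card_mono[rotated]) simp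
    from less.hyps[OF this tr psd] obtain a where
      a: "\<And>j. S' $ j $ j = 0 \<Longrightarrow> a j = 0" "\<And>x. x \<bullet> (S' *v x) = (\<Sum>j\<in>UNIV. (x \<bullet> a j)\<^sup>2)"
      by blast
    have "x \<bullet> (S *v x) = (\<Sum>j\<in>UNIV. (x \<bullet> (a(i := v)) j)\<^sup>2)" for x
    proof -
      have "(\<Sum>j\<in>UNIV. (x \<bullet> (a(i := v)) j)\<^sup>2) = (x \<bullet> v)\<^sup>2 + (\<Sum>j\<in>UNIV - {i}. (x \<bullet> a j)\<^sup>2)"
        by (subst sum.remove[of _ i]) auto
      also have "(\<Sum>j\<in>UNIV - {i}. (x \<bullet> a j)\<^sup>2) = (\<Sum>j\<in>UNIV. (x \<bullet> a j)\<^sup>2)"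
        using a(1)[OF zi] by (subst sum.remove[of UNIV i]) auto
      finally show ?thesis using a(2)[of x] S'x[of x] by simp
    qed
    moreover have "(a(i := v)) j = 0" if "S $ j $ j = 0" for j using a(1) zero[OF that] that i by auto
    ultimately show ?thesis by blast
  qed
qed

text \<open>The vectors of the decomposition become the columns of A. The square root is what gives
  \<open>normal_vec\<close> its meaning, since the choice made there is otherwise
  unspecified.\<close>

lemma psd_matrix_sqrt:
  fixes S :: "real^'d^'d"
  assumes S: "transpose S = S" and "\<And>x. 0 \<le> x \<bullet> (S *v x)"
  shows "\<exists>A :: real^'d^'d. A ** transpose A = S"
proof -
  obtain a :: "'d \<Rightarrow> real^'d" where a: "\<And>x. x \<bullet> (S *v x) = (\<Sum>j\<in>UNIV. (x \<bullet> a j)\<^sup>2)"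
    using psd_matrix_sum_outer[OF assms] by blast
  define A where "A = (\<chi> k j. a j $ k)"
  have q: "x \<bullet> ((A ** transpose A) *v x) = x \<bullet> (S *v x)" for x
  proof -
    have "x \<bullet> ((A ** transpose A) *v x) = (transpose A *v x) \<bullet> (transpose A *v x)"
      unfolding matrix_vector_mul_assoc[symmetric] inner_matrix_vector ..
    also have "\<dots> = (\<Sum>j\<in>UNIV. ((transpose A *v x) $ j)\<^sup>2)"
      by (simp add: inner_vec_def power2_eq_square)
    also have "\<dots> = (\<Sum>j\<in>UNIV. (x \<bullet> a j)\<^sup>2)"
      by (rule sum.cong) (auto simp: matrix_vector_mult_def transpose_def A_def inner_vec_def mult.commute)
    finally show ?thesis using a by simp
  qed
  have sym: "x \<bullet> (T *v y) = y \<bullet> (T *v x)" if "transpose T = T" for T :: "real^'d^'d" and x y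
    unfolding inner_matrix_vector[of x T y] that by (rule inner_commute)
  define T where "T = A ** transpose A - S"
  have T: "transpose T = T" using S by (simp add: T_def transpose_def vec_eq_iff matrix_matrix_mult_def mult.commute)
  have Tq: "x \<bullet> (T *v x) = 0" for x using q[of x] by (simp add: T_def matrix_vector_mult_diff_rdistrib inner_diff_right)
  \<comment> \<open>Polarisation: a symmetric matrix with vanishing quadratic form is zero.\<close>
  have Txy: "x \<bullet> (T *v y) = 0" for x y
    using Tq[of "x + y"] Tq[of x] Tq[of y] sym[OF T, of x y]
    by (simp add: matrix_vector_right_distrib inner_add_left inner_add_right)
  have "T *v y = 0" for y using Txy[of "T *v y" y] by simp
  then have "T = 0" by (simp add: matrix_eq)
  then have "A ** transpose A = S" by (simp add: T_def)
  then show ?thesis by (rule exI)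
qed

section \<open>Convergence in law via characteristic functions\<close>

lemma fubini_bounded:
  fixes f :: "'a \<Rightarrow> 'b \<Rightarrow> 'c::{banach, second_countable_topology}"
  assumes "finite_measure M1" "finite_measure M2"
    and [measurable]: "(\<lambda>(x, y). f x y) \<in> borel_measurable (M1 \<Otimes>\<^sub>M M2)"
    and B: "\<And>x y. norm (f x y) \<le> B"
  shows "(\<integral>x. \<integral>y. f x y \<partial>M2 \<partial>M1) = (\<integral>y. \<integral>x. f x y \<partial>M1 \<partial>M2)"
proof -
  interpret M1: finite_measure M1 by fact
  interpret M2: finite_measure M2 by fact
  interpret pair_sigma_finite M1 M2 ..
  interpret M12: finite_measure "M1 \<Otimes>\<^sub>M M2" by (rule finite_measure_pair_measure) fact+
  have "integrable (M1 \<Otimes>\<^sub>M M2) (\<lambda>(x, y). f x y)"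
    by (rule M12.integrable_const_bound[of _ B]) (auto simp: B)
  then show ?thesis by (simp add: Fubini_integral)
qed

section \<open>The standard Gaussian measure\<close>

lemma integral_prod_lborel_vec:
  fixes f :: "'d::finite \<Rightarrow> real \<Rightarrow> complex"
  assumes "\<And>i. integrable lborel (f i)"
  shows "(\<integral>x. (\<Prod>i\<in>UNIV. f i (x $ i)) \<partial>(lborel :: (real^'d) measure)) = (\<Prod>i\<in>UNIV. \<integral>x. f i x \<partial>lborel)"
proof -
  interpret product_sigma_finite "\<lambda>_ :: real^'d. lborel :: real measure" ..
  have [measurable]: "f i \<in> borel_measurable borel" for i using assms[of i] by auto
  \<comment> \<open>The product formula for \<open>lborel\<close> is indexed by basis vectors, so
    the coordinate functions are relabelled along \<open>axis\<close>.\<close>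
  define g where "g b = f (THE i. b = axis i 1)" for b :: "real^'d"
  have g: "g (axis i 1) = f i" for i by (simp add: g_def axis_eq_axis)
  have B: "(Basis :: (real^'d) set) = range (\<lambda>i. axis i 1)" by (auto simp: Basis_vec_def)
  have inj: "inj (\<lambda>i. axis i 1 :: real^'d)" by (auto simp: inj_def axis_eq_axis)
  have eq: "(\<Prod>i\<in>UNIV. f i (x $ i)) = (\<Prod>b\<in>Basis. g b (x \<bullet> b))" for x :: "real^'d"
    unfolding B by (subst prod.reindex[OF inj]) (simp add: g inner_axis)
  have [measurable]: "g b \<in> borel_measurable borel" for b by (simp add: g_def)
  have "(\<integral>x. (\<Prod>b\<in>Basis. g b (x \<bullet> b)) \<partial>(lborel :: (real^'d) measure)) =
      (\<integral>x. (\<Prod>b\<in>Basis. g b (x b)) \<partial>(\<Pi>\<^sub>M b\<in>Basis. lborel))"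
    by (subst lborel_eq) (simp add: integral_distr inner_sum_left inner_Basis if_distrib[of "\<lambda>c. _ * c"] cong: if_cong prod.cong)
  also have "\<dots> = (\<Prod>b\<in>Basis. \<integral>x. g b x \<partial>lborel)"
    by (rule product_integral_prod) (auto simp: g_def assms)
  also have "\<dots> = (\<Prod>i\<in>UNIV. \<integral>x. f i x \<partial>lborel)"
    unfolding B by (subst prod.reindex[OF inj]) (simp add: g)
  finally show ?thesis unfolding eq .
qed

abbreviation std_normal_vec_density :: "real^'d \<Rightarrow> real" where
  "std_normal_vec_density x \<equiv> (\<Prod>i\<in>UNIV. std_normal_density (x $ i))"

lemma sets_std_normal_vec [simp, measurable_cong]: "sets std_normal_vec = sets borel"
  by (simp add: std_normal_vec_def)

lemma space_std_normal_vec [simp]: "space std_normal_vec = UNIV"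
  by (simp add: std_normal_vec_def)

lemma char_std_normal_vec:
  "(\<integral>x. iexp (u \<bullet> x) \<partial>std_normal_vec) = complex_of_real (exp (- (norm u)\<^sup>2 / 2))"
proof -
  let ?f = "\<lambda>i x. complex_of_real (std_normal_density x) * iexp (u $ i * x)"
  have int: "integrable lborel (?f i)" for i
  proof -
    have "integrable lborel (\<lambda>x. std_normal_density x)" by simp
    then show ?thesis
      by (rule Bochner_Integration.integrable_bound) (auto simp: norm_mult)
  qed
  have "(\<integral>x. iexp (u \<bullet> x) \<partial>std_normal_vec) = (\<integral>x. std_normal_vec_density x *\<^sub>R iexp (u \<bullet> x) \<partial>lborel)"
    unfolding std_normal_vec_def by (rule integral_density) (auto intro!: prod_nonneg AE_I2)
  also have "\<dots> = (\<integral>x. (\<Prod>i\<in>UNIV. ?f i (x $ i)) \<partial>lborel)"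
    by (rule Bochner_Integration.integral_cong)
      (simp_all add: inner_vec_def prod.distrib scaleR_conv_of_real exp_sum[symmetric] sum_distrib_left[symmetric])
  also have "\<dots> = (\<Prod>i\<in>UNIV. \<integral>x. ?f i x \<partial>lborel)" by (rule integral_prod_lborel_vec[OF int])
  also have "(\<integral>x. ?f i x \<partial>lborel) = complex_of_real (exp (- (u $ i)\<^sup>2 / 2))" for i
  proof -
    have "(\<integral>x. ?f i x \<partial>lborel) = char std_normal_distribution (u $ i)"
      unfolding char_def by (subst integral_density) (auto simp: scaleR_conv_of_real mult.commute)
    then show ?thesis by (simp add: char_std_normal_distribution)
  qed
  then have "(\<Prod>i\<in>UNIV. \<integral>x. ?f i x \<partial>lborel) = (\<Prod>i\<in>UNIV. complex_of_real (exp (- (u $ i)\<^sup>2 / 2)))" by simp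
  also have "\<dots> = complex_of_real (exp (- (norm u)\<^sup>2 / 2))"
    unfolding of_real_prod[symmetric] exp_sum[OF finite, symmetric] power2_norm_eq_inner inner_vec_def sum_negf[symmetric] sum_divide_distrib
    by (simp add: power2_eq_square)
  finally show ?thesis .
qed

lemma nn_integral_std_normal_density: "(\<integral>\<^sup>+x. ennreal (std_normal_density x) \<partial>lborel) = 1"
proof -
  interpret prob_space "density lborel (\<lambda>x. ennreal (std_normal_density x))"
    by (rule prob_space_normal_density) simp
  show ?thesis using emeasure_space_1 by (simp add: emeasure_density)
qed

lemma prob_space_std_normal_vec: "prob_space (std_normal_vec :: (real^'d) measure)"
proof
  have inj: "inj (\<lambda>i. axis i 1 :: real^'d)" by (auto simp: inj_def axis_eq_axis)
  have B: "(Basis :: (real^'d) set) = range (\<lambda>i. axis i 1)" by (auto simp: Basis_vec_def)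
  have eq: "ennreal (std_normal_vec_density x) = (\<Prod>b\<in>Basis. ennreal (std_normal_density (x \<bullet> b)))" for x :: "real^'d"
    unfolding B by (subst prod.reindex[OF inj]) (simp add: inner_axis prod_ennreal)
  have "emeasure (std_normal_vec :: (real^'d) measure) UNIV = (\<integral>\<^sup>+x. (\<Prod>b\<in>Basis. ennreal (std_normal_density (x \<bullet> b))) \<partial>(lborel :: (real^'d) measure))"
    by (simp add: std_normal_vec_def emeasure_density eq)
  also have "\<dots> = 1"
    by (subst nn_integral_lborel_prod) (simp_all add: nn_integral_std_normal_density)
  finally show "emeasure (std_normal_vec :: (real^'d) measure) (space std_normal_vec) = 1" by simp
qed

lemma std_normal_vec_density_eq:
  "std_normal_vec_density (x :: real^'d) = (1 / sqrt (2 * pi)) ^ CARD('d) * exp (- (norm x)\<^sup>2 / 2)"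
proof -
  have "std_normal_vec_density x = (1 / sqrt (2 * pi)) ^ CARD('d) * (\<Prod>i\<in>UNIV. exp (- (x $ i)\<^sup>2 / 2))"
    unfolding std_normal_density_def prod.distrib by simp
  also have "(\<Prod>i\<in>UNIV. exp (- (x $ i)\<^sup>2 / 2)) = exp (- (norm x)\<^sup>2 / 2)"
    unfolding exp_sum[OF finite, symmetric] power2_norm_eq_inner inner_vec_def sum_negf[symmetric] sum_divide_distrib
    by (simp add: power2_eq_square)
  finally show ?thesis .
qed

text \<open>The substitution y = x + s z exhibits the smoothed function as a mixture of Gaussian
  bumps centred at y, which is how convergence for Gaussian test functions carries over to
  it.\<close>

lemma gaussian_smoothing_eq:
  fixes g :: "real^'d \<Rightarrow> real"
  assumes [measurable]: "g \<in> borel_measurable borel" and s: "s > 0"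
  shows "(\<integral>z. g (x + s *\<^sub>R z) \<partial>std_normal_vec) =
    (1 / (s * sqrt (2 * pi))) ^ CARD('d) * (\<integral>y. g y * exp (- (norm ((1 / s) *\<^sub>R (y - x)))\<^sup>2 / 2) \<partial>lborel)"
proof -
  have "(\<integral>y. g y * exp (- (norm ((1 / s) *\<^sub>R (y - x)))\<^sup>2 / 2) \<partial>lborel) =
      (\<integral>y. g y * exp (- (norm ((1 / s) *\<^sub>R (y - x)))\<^sup>2 / 2)
         \<partial>density (distr lborel borel (\<lambda>z. x + s *\<^sub>R z)) (\<lambda>_. ennreal (\<bar>s\<bar> ^ DIM(real^'d))))"
    using lborel_affine[of s x] s by simp
  also have "\<dots> = s ^ CARD('d) * (\<integral>z. g (x + s *\<^sub>R z) * exp (- (norm z)\<^sup>2 / 2) \<partial>lborel)"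
    using s by (simp add: integral_density integral_distr)
  finally have *: "(\<integral>y. g y * exp (- (norm ((1 / s) *\<^sub>R (y - x)))\<^sup>2 / 2) \<partial>lborel) =
     s ^ CARD('d) * (\<integral>z. g (x + s *\<^sub>R z) * exp (- (norm z)\<^sup>2 / 2) \<partial>lborel)" .
  have "(\<integral>z. g (x + s *\<^sub>R z) \<partial>std_normal_vec) = (\<integral>z. std_normal_vec_density z *\<^sub>R g (x + s *\<^sub>R z) \<partial>lborel)"
    unfolding std_normal_vec_def by (rule integral_density) (auto intro!: prod_nonneg AE_I2)
  also have "\<dots> = (1 / sqrt (2 * pi)) ^ CARD('d) * (\<integral>z. g (x + s *\<^sub>R z) * exp (- (norm z)\<^sup>2 / 2) \<partial>lborel)"
    unfolding std_normal_vec_density_eq by (subst integral_mult_right_zero[symmetric]) (simp add: mult_ac)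
  finally show ?thesis unfolding * using s by (simp add: power_divide power_mult_distrib)
qed

text \<open>Levy's continuity theorem on an event: the laws are restricted to A rather than
  conditioned, so the limit has mass P(A) and an event of probability zero is included.\<close>

locale char_convergence = prob_space P for P :: "'w measure" +
  fixes A :: "'w set" and X :: "nat \<Rightarrow> 'w \<Rightarrow> real^'d" and \<nu> :: "(real^'d) measure"
  assumes A [measurable]: "A \<in> sets P"
    and X [measurable]: "\<And>n. X n \<in> borel_measurable P"
    and prob_nu: "prob_space \<nu>" and sets_nu [measurable_cong, simp]: "sets \<nu> = sets borel"
    and char_conv: "\<And>u. (\<lambda>n. \<integral>\<omega>. indicator A \<omega> * iexp (u \<bullet> X n \<omega>) \<partial>P) \<longlonglongrightarrow> measure P A * (\<integral>x. iexp (u \<bullet> x) \<partial>\<nu>)"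
begin

sublocale nu: prob_space \<nu> by (rule prob_nu)

lemma space_nu [simp]: "space \<nu> = UNIV"
  using sets_eq_imp_space_eq[OF sets_nu] by simp

abbreviation "mean_on_A g n \<equiv> (\<integral>\<omega>. indicator A \<omega> * (g (X n \<omega>) :: real) \<partial>P)"

definition test_conv :: "(real^'d \<Rightarrow> real) \<Rightarrow> bool" where
  "test_conv g \<longleftrightarrow> (\<lambda>n. mean_on_A g n) \<longlonglongrightarrow> measure P A * (\<integral>x. g x \<partial>\<nu>)"

text \<open>A Gaussian bump is itself a characteristic function: at x it is the mean of
  \<open>iexp ((c *\<^sub>R (y - x)) \<bullet> t)\<close> over a standard normal t. Fubini's theorem
  then expresses the test integral through the given characteristic functions, all of modulus at
  most 1.\<close>

lemma test_conv_gaussian: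
  "test_conv (\<lambda>x. exp (- (norm (c *\<^sub>R (y - x)))\<^sup>2 / 2))"
proof -
  interpret N: prob_space "std_normal_vec :: (real^'d) measure" by (rule prob_space_std_normal_vec)
  let ?E = "\<lambda>n t. \<integral>\<omega>. indicator A \<omega> * iexp ((- c *\<^sub>R t) \<bullet> X n \<omega>) \<partial>P"
  let ?N = "std_normal_vec :: (real^'d) measure"
  have ie: "iexp ((c *\<^sub>R (y - x)) \<bullet> t) = iexp (c * (y \<bullet> t)) * iexp ((- c *\<^sub>R t) \<bullet> x)" for x t :: "real^'d"
    by (simp add: exp_add[symmetric] inner_diff_left algebra_simps inner_commute)
  have 1: "complex_of_real (\<integral>\<omega>. indicator A \<omega> * exp (- (norm (c *\<^sub>R (y - X n \<omega>)))\<^sup>2 / 2) \<partial>P) =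
      (\<integral>t. iexp (c * (y \<bullet> t)) * ?E n t \<partial>?N)" for n
  proof -
    have "complex_of_real (\<integral>\<omega>. indicator A \<omega> * exp (- (norm (c *\<^sub>R (y - X n \<omega>)))\<^sup>2 / 2) \<partial>P) =
      (\<integral>\<omega>. indicator A \<omega> * complex_of_real (exp (- (norm (c *\<^sub>R (y - X n \<omega>)))\<^sup>2 / 2)) \<partial>P)"
      by (subst integral_complex_of_real[symmetric], intro Bochner_Integration.integral_cong) (auto simp: indicator_def)
    also have "\<dots> = (\<integral>\<omega>. \<integral>t. indicator A \<omega> * (iexp (c * (y \<bullet> t)) * iexp ((- c *\<^sub>R t) \<bullet> X n \<omega>)) \<partial>?N \<partial>P)"
      unfolding char_std_normal_vec[symmetric] ie by simp
    also have "\<dots> = (\<integral>t. \<integral>\<omega>. indicator A \<omega> * (iexp (c * (y \<bullet> t)) * iexp ((- c *\<^sub>R t) \<bullet> X n \<omega>)) \<partial>P \<partial>?N)"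
      by (rule fubini_bounded[of _ _ _ 1])
        (auto simp: norm_mult indicator_def prob_space.finite_measure prob_space_axioms prob_space_std_normal_vec)
    also have "\<dots> = (\<integral>t. iexp (c * (y \<bullet> t)) * ?E n t \<partial>?N)"
      by (simp add: mult.left_commute[of "indicator A _"])
    finally show ?thesis .
  qed
  have 2: "complex_of_real (\<integral>x. exp (- (norm (c *\<^sub>R (y - x)))\<^sup>2 / 2) \<partial>\<nu>) =
      (\<integral>t. iexp (c * (y \<bullet> t)) * (\<integral>x. iexp ((- c *\<^sub>R t) \<bullet> x) \<partial>\<nu>) \<partial>?N)"
  proof -
    have "complex_of_real (\<integral>x. exp (- (norm (c *\<^sub>R (y - x)))\<^sup>2 / 2) \<partial>\<nu>) =
      (\<integral>x. \<integral>t. iexp (c * (y \<bullet> t)) * iexp ((- c *\<^sub>R t) \<bullet> x) \<partial>?N \<partial>\<nu>)"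
      unfolding integral_complex_of_real[symmetric] char_std_normal_vec[symmetric] ie by simp
    also have "\<dots> = (\<integral>t. \<integral>x. iexp (c * (y \<bullet> t)) * iexp ((- c *\<^sub>R t) \<bullet> x) \<partial>\<nu> \<partial>?N)"
      by (rule fubini_bounded[of _ _ _ 1])
        (auto simp: norm_mult prob_space.finite_measure prob_nu prob_space_std_normal_vec)
    finally show ?thesis by simp
  qed
  have "(\<lambda>n. \<integral>t. iexp (c * (y \<bullet> t)) * ?E n t \<partial>?N) \<longlonglongrightarrow>
      (\<integral>t. iexp (c * (y \<bullet> t)) * (measure P A * (\<integral>x. iexp ((- c *\<^sub>R t) \<bullet> x) \<partial>\<nu>)) \<partial>?N)"
  proof (rule integral_dominated_convergence[where w = "\<lambda>_. 1"])
    show "AE t in ?N. (\<lambda>n. iexp (c * (y \<bullet> t)) * ?E n t) \<longlonglongrightarrow> iexp (c * (y \<bullet> t)) * (measure P A * (\<integral>x. iexp ((- c *\<^sub>R t) \<bullet> x) \<partial>\<nu>))"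
      by (intro AE_I2 tendsto_mult tendsto_const char_conv)
    have "norm (?E n t) \<le> 1" for n t
    proof -
      have "norm (?E n t) \<le> (\<integral>\<omega>. norm (indicator A \<omega> * iexp ((- c *\<^sub>R t) \<bullet> X n \<omega>)) \<partial>P)"
        by (rule integral_norm_bound)
      also have "\<dots> \<le> (\<integral>\<omega>. 1 \<partial>P)"
        by (rule integral_mono') (auto simp: norm_mult indicator_def)
      finally show ?thesis by (simp add: prob_space)
    qed
    then show "AE t in ?N. norm (iexp (c * (y \<bullet> t)) * ?E n t) \<le> 1" for n
      by (simp add: norm_mult)
  qed auto
  then have "(\<lambda>n. complex_of_real (\<integral>\<omega>. indicator A \<omega> * exp (- (norm (c *\<^sub>R (y - X n \<omega>)))\<^sup>2 / 2) \<partial>P)) \<longlonglongrightarrow>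
      complex_of_real (measure P A * (\<integral>x. exp (- (norm (c *\<^sub>R (y - x)))\<^sup>2 / 2) \<partial>\<nu>))"
    unfolding 1 of_real_mult 2 by (simp add: mult.left_commute)
  then show ?thesis unfolding test_conv_def by (simp only: tendsto_of_real_iff)
qed

text \<open>The mixture weight g vanishes outside the ball of radius r, so Lebesgue measure is cut
  down to the finite measure L on that ball; this makes Fubini's theorem and dominated convergence
  available.\<close>

lemma test_conv_smoothing:
  fixes g :: "real^'d \<Rightarrow> real"
  assumes [measurable]: "g \<in> borel_measurable borel" and G: "\<And>x. \<bar>g x\<bar> \<le> G"
    and r: "\<And>x. norm x > r \<Longrightarrow> g x = 0" and s: "s > 0"
  shows "test_conv (\<lambda>x. \<integral>z. g (x + s *\<^sub>R z) \<partial>std_normal_vec)"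
proof -
  define L where "L = density lborel (\<lambda>x. ennreal (indicator (cball (0::real^'d) r) x))"
  have [measurable_cong, simp]: "sets L = sets borel" "space L = UNIV" by (auto simp: L_def)
  have L: "finite_measure L"
    by (rule finite_measureI)
      (use emeasure_lborel_cball_finite[of "0::real^'d" r] in
        \<open>simp add: L_def ennreal_indicator emeasure_restricted less_top del: emeasure_lborel_cball_finite\<close>)
  interpret L: finite_measure L by (rule L)
  define k where "k x y = exp (- (norm ((1 / s) *\<^sub>R (y - x)))\<^sup>2 / 2)" for x y :: "real^'d"
  have k: "0 \<le> k x y" "k x y \<le> 1" for x y by (auto simp: k_def)
  have [measurable]: "(\<lambda>(x, y). k x y) \<in> borel_measurable (borel \<Otimes>\<^sub>M borel)" unfolding k_def by measurable
  have G0: "0 \<le> G" using G[of 0] by simp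
  have bound: "\<bar>g y * k x y\<bar> \<le> G" for x y
    using k[of x y] G[of y] G0 by (simp add: abs_mult mult_le_one mult_left_le order_trans[OF mult_left_le])
  have 1: "(\<integral>z. g (x + s *\<^sub>R z) \<partial>std_normal_vec) = (1 / (s * sqrt (2 * pi))) ^ CARD('d) * (\<integral>y. g y * k x y \<partial>L)" for x
  proof -
    have "(\<integral>y. g y * k x y \<partial>L) = (\<integral>y. indicator (cball 0 r) y *\<^sub>R (g y * k x y) \<partial>lborel)"
      unfolding L_def by (rule integral_density) (auto intro!: borel_measurable_indicator)
    also have "\<dots> = (\<integral>y. g y * k x y \<partial>lborel)"
      by (rule Bochner_Integration.integral_cong) (auto simp: indicator_def r)
    finally show ?thesis unfolding k_def using gaussian_smoothing_eq[of g s x] s by simp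
  qed
  have 2: "(\<integral>\<omega>. indicator A \<omega> * (\<integral>y. g y * k (X n \<omega>) y \<partial>L) \<partial>P) =
      (\<integral>y. g y * (\<integral>\<omega>. indicator A \<omega> * k (X n \<omega>) y \<partial>P) \<partial>L)" for n
  proof -
    have "(\<integral>\<omega>. \<integral>y. indicator A \<omega> * (g y * k (X n \<omega>) y) \<partial>L \<partial>P) = (\<integral>y. \<integral>\<omega>. indicator A \<omega> * (g y * k (X n \<omega>) y) \<partial>P \<partial>L)"
      using bound G0 by (intro fubini_bounded[of _ _ _ G]) (auto simp: indicator_def L finite_measure_axioms)
    moreover have "(\<integral>\<omega>. indicator A \<omega> * (g y * k (X n \<omega>) y) \<partial>P) = g y * (\<integral>\<omega>. indicator A \<omega> * k (X n \<omega>) y \<partial>P)" for y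
      by (subst mult.left_commute) (rule integral_mult_right_zero)
    moreover have "(\<integral>y. indicator A \<omega> * (g y * k (X n \<omega>) y) \<partial>L) = indicator A \<omega> * (\<integral>y. g y * k (X n \<omega>) y \<partial>L)" for \<omega>
      by (rule integral_mult_right_zero)
    ultimately show ?thesis by simp
  qed
  have 3: "(\<integral>x. (\<integral>y. g y * k x y \<partial>L) \<partial>\<nu>) = (\<integral>y. g y * (\<integral>x. k x y \<partial>\<nu>) \<partial>L)"
  proof -
    have "(\<integral>x. \<integral>y. g y * k x y \<partial>L \<partial>\<nu>) = (\<integral>y. \<integral>x. g y * k x y \<partial>\<nu> \<partial>L)"
      using bound by (intro fubini_bounded[of _ _ _ G]) (auto simp: L nu.finite_measure_axioms)
    then show ?thesis by simp
  qed
  have "(\<lambda>n. \<integral>y. g y * (\<integral>\<omega>. indicator A \<omega> * k (X n \<omega>) y \<partial>P) \<partial>L) \<longlonglongrightarrow> (\<integral>y. g y * (measure P A * (\<integral>x. k x y \<partial>\<nu>)) \<partial>L)"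
  proof (rule integral_dominated_convergence[where w = "\<lambda>_. G"])
    show "AE y in L. (\<lambda>n. g y * (\<integral>\<omega>. indicator A \<omega> * k (X n \<omega>) y \<partial>P)) \<longlonglongrightarrow> g y * (measure P A * (\<integral>x. k x y \<partial>\<nu>))"
      using test_conv_gaussian unfolding test_conv_def k_def by (intro AE_I2 tendsto_mult tendsto_const) blast
    have "\<bar>\<integral>\<omega>. indicator A \<omega> * k (X n \<omega>) y \<partial>P\<bar> \<le> 1" for n y
    proof -
      have "\<bar>\<integral>\<omega>. indicator A \<omega> * k (X n \<omega>) y \<partial>P\<bar> \<le> (\<integral>\<omega>. \<bar>indicator A \<omega> * k (X n \<omega>) y\<bar> \<partial>P)"
        by (rule integral_abs_bound)
      also have "\<dots> \<le> (\<integral>\<omega>. 1 \<partial>P)" by (rule integral_mono') (auto simp: indicator_def k)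
      finally show ?thesis by (simp add: prob_space)
    qed
    then have "norm (g y * (\<integral>\<omega>. indicator A \<omega> * k (X n \<omega>) y \<partial>P)) \<le> G * 1" for n y
      unfolding real_norm_def abs_mult using G[of y] G0 by (intro mult_mono) auto
    then show "AE y in L. norm (g y * (\<integral>\<omega>. indicator A \<omega> * k (X n \<omega>) y \<partial>P)) \<le> G" for n by simp
  qed auto
  moreover have "(\<integral>y. g y * (measure P A * (\<integral>x. k x y \<partial>\<nu>)) \<partial>L) = measure P A * (\<integral>x. (\<integral>y. g y * k x y \<partial>L) \<partial>\<nu>)"
    unfolding 3 by (subst mult.left_commute) (rule integral_mult_right_zero)
  ultimately have lim: "(\<lambda>n. \<integral>\<omega>. indicator A \<omega> * (\<integral>y. g y * k (X n \<omega>) y \<partial>L) \<partial>P) \<longlonglongrightarrow> measure P A * (\<integral>x. (\<integral>y. g y * k x y \<partial>L) \<partial>\<nu>)"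
    unfolding 2 by simp
  have c: "(\<integral>\<omega>. indicator A \<omega> * (c * I \<omega>) \<partial>P) = c * (\<integral>\<omega>. indicator A \<omega> * I \<omega> \<partial>P)" for c :: real and I
    by (subst mult.left_commute) (rule integral_mult_right_zero)
  show ?thesis
    unfolding test_conv_def 1 c integral_mult_right_zero mult.left_commute[of "measure P A"]
    by (rule tendsto_mult_left[OF lim])
qed

lemma integrable_nu: "g \<in> borel_measurable borel \<Longrightarrow> (\<And>x. \<bar>g x\<bar> \<le> G) \<Longrightarrow> integrable \<nu> (g :: real^'d \<Rightarrow> real)"
  by (rule nu.integrable_const_bound[of _ G]) auto

lemma integrable_ind: "g \<in> borel_measurable borel \<Longrightarrow> (\<And>x. \<bar>g x\<bar> \<le> G) \<Longrightarrow>
    integrable P (\<lambda>\<omega>. indicator A \<omega> * (g :: real^'d \<Rightarrow> real) (X n \<omega>))"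
  using order_trans[OF abs_ge_zero, of "g 0" G]
  by (intro integrable_const_bound[of _ G]) (auto simp: indicator_def)

lemma test_conv_approx:
  fixes g :: "real^'d \<Rightarrow> real"
  assumes [measurable]: "g \<in> borel_measurable borel" and G: "\<And>x. \<bar>g x\<bar> \<le> G"
    and approx: "\<And>e. e > 0 \<Longrightarrow> \<exists>h. h \<in> borel_measurable borel \<and> test_conv h \<and> (\<forall>x. \<bar>g x - h x\<bar> \<le> e)"
  shows "test_conv g"
  unfolding test_conv_def
proof (rule LIMSEQ_I)
  fix e :: real assume "e > 0"
  then obtain h where [measurable]: "h \<in> borel_measurable borel" and h: "test_conv h" "\<And>x. \<bar>g x - h x\<bar> \<le> e / 4"
    using approx[of "e / 4"] by auto
  have H: "\<bar>h x\<bar> \<le> G + e / 4" for x using G[of x] h(2)[of x] by linarith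
  obtain n0 where n0: "\<And>n. n \<ge> n0 \<Longrightarrow> \<bar>mean_on_A h n - measure P A * (\<integral>x. h x \<partial>\<nu>)\<bar> < e / 4"
    using LIMSEQ_D[OF h(1)[unfolded test_conv_def], of "e / 4"] \<open>e > 0\<close> by auto
  have "\<bar>mean_on_A g n - measure P A * (\<integral>x. g x \<partial>\<nu>)\<bar> < e" if "n \<ge> n0" for n
  proof -
    have "\<bar>mean_on_A g n - mean_on_A h n\<bar> \<le> e / 4"
    proof -
      have "mean_on_A g n - mean_on_A h n = (\<integral>\<omega>. indicator A \<omega> * (g (X n \<omega>) - h (X n \<omega>)) \<partial>P)"
        by (subst Bochner_Integration.integral_diff[symmetric]) (auto simp: algebra_simps intro!: integrable_ind G H)
      also have "\<bar>\<dots>\<bar> \<le> (\<integral>\<omega>. \<bar>indicator A \<omega> * (g (X n \<omega>) - h (X n \<omega>))\<bar> \<partial>P)" by (rule integral_abs_bound)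
      also have "\<dots> \<le> (\<integral>\<omega>. e / 4 \<partial>P)"
        using h(2) \<open>e > 0\<close> by (intro integral_mono') (auto simp: indicator_def)
      finally show ?thesis by (simp add: prob_space)
    qed
    moreover have "\<bar>(\<integral>x. g x \<partial>\<nu>) - (\<integral>x. h x \<partial>\<nu>)\<bar> \<le> e / 4"
    proof -
      have "(\<integral>x. g x \<partial>\<nu>) - (\<integral>x. h x \<partial>\<nu>) = (\<integral>x. g x - h x \<partial>\<nu>)"
        by (rule Bochner_Integration.integral_diff[symmetric]) (auto intro!: integrable_nu G H)
      also have "\<bar>\<dots>\<bar> \<le> (\<integral>x. \<bar>g x - h x\<bar> \<partial>\<nu>)" by (rule integral_abs_bound)
      also have "\<dots> \<le> (\<integral>x. e / 4 \<partial>\<nu>)"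
        using h(2) \<open>e > 0\<close> by (intro integral_mono') auto
      finally show ?thesis by (simp add: nu.prob_space[simplified])
    qed
    then have "\<bar>measure P A * (\<integral>x. g x \<partial>\<nu>) - measure P A * (\<integral>x. h x \<partial>\<nu>)\<bar> \<le> e / 4"
      using mult_left_le_one_le[of "\<bar>(\<integral>x. g x \<partial>\<nu>) - (\<integral>x. h x \<partial>\<nu>)\<bar>" "measure P A"]
      by (simp add: right_diff_distrib[symmetric] abs_mult)
    ultimately show ?thesis using n0[OF that] \<open>e > 0\<close> by linarith
  qed
  then show "\<exists>n0. \<forall>n\<ge>n0. norm (mean_on_A g n - measure P A * (\<integral>x. g x \<partial>\<nu>)) < e" by auto
qed

text \<open>Smoothing with a narrow Gaussian changes a uniformly continuous function little: |s z|
  stays below the modulus of continuity d except for large z, which are rare.\<close>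

lemma test_conv_compact_support:
  fixes g :: "real^'d \<Rightarrow> real"
  assumes cont: "continuous_on UNIV g" and r: "\<And>x. norm x > r \<Longrightarrow> g x = 0"
  shows "test_conv g"
proof -
  interpret N: prob_space "std_normal_vec :: (real^'d) measure" by (rule prob_space_std_normal_vec)
  have [measurable]: "g \<in> borel_measurable borel" using cont by (rule borel_measurable_continuous_onI)
  have "compact (g ` cball 0 r)" by (intro compact_continuous_image continuous_on_subset[OF cont]) auto
  then obtain G0 where G0: "\<And>x. x \<in> cball 0 r \<Longrightarrow> \<bar>g x\<bar> \<le> G0"
    using compact_imp_bounded[of "g ` cball 0 r"] unfolding bounded_iff by fastforce
  define G where "G = max G0 0"
  have G: "\<bar>g x\<bar> \<le> G" for x
  proof (cases "norm x \<le> r")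
    case True
    then show ?thesis using G0[of x] by (simp add: G_def)
  qed (simp add: r G_def)
  have uc: "uniformly_continuous_on (cball 0 (r + 1)) g"
    by (intro compact_uniformly_continuous continuous_on_subset[OF cont]) auto
  show ?thesis
  proof (rule test_conv_approx[OF _ G])
    fix e :: real assume "e > 0"
    obtain d0 where d0: "d0 > 0" "\<And>x y. x \<in> cball 0 (r + 1) \<Longrightarrow> y \<in> cball 0 (r + 1) \<Longrightarrow> dist y x < d0 \<Longrightarrow> dist (g y) (g x) < e / 2"
      using uc[unfolded uniformly_continuous_on_def, rule_format, of "e / 2"] \<open>e > 0\<close> by auto
    \<comment> \<open>The bound 1 guarantees that two points closer than d both lie outside the
      support as soon as one of them leaves the ball of radius r + 1.\<close>
    define d where "d = min d0 1"
    have d: "d > 0" using d0 by (simp add: d_def)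
    have ud: "\<bar>g y - g x\<bar> \<le> e / 2" if "norm (y - x) < d" for x y
    proof (cases "norm x \<le> r + 1 \<and> norm y \<le> r + 1")
      case True
      then show ?thesis using d0(2)[of x y] that by (auto simp: d_def dist_norm)
    next
      case False
      have "norm x \<le> norm y + norm (y - x)" by norm
      moreover have "norm y \<le> norm x + norm (y - x)" by norm
      ultimately have "norm x > r" "norm y > r" using that False by (auto simp: d_def)
      then show ?thesis using r \<open>e > 0\<close> by simp
    qed
    have "(\<lambda>n. N.prob {z. norm z \<ge> real n}) \<longlonglongrightarrow> N.prob (\<Inter>n. {z::real^'d. norm z \<ge> real n})"
      by (rule N.finite_Lim_measure_decseq) (auto simp: decseq_def)
    moreover have "(\<Inter>n. {z::real^'d. norm z \<ge> real n}) = {}"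
      using reals_Archimedean2[of "norm _"] by (fastforce simp: not_le[symmetric])
    ultimately have "(\<lambda>n. N.prob {z::real^'d. norm z \<ge> real n}) \<longlonglongrightarrow> 0" by simp
    from LIMSEQ_D[OF this, of "e / (4 * (G + 1))"]
    obtain n where n: "N.prob {z::real^'d. norm z \<ge> real n} < e / (4 * (G + 1))"
      using \<open>e > 0\<close> by (auto simp: G_def)
    \<comment> \<open>Small enough that |s z| < d whenever |z| < n; larger z have probability below
      e / (4 (G + 1)).\<close>
    define s where "s = d / (real n + 1)"
    have s: "s > 0" using d by (simp add: s_def)
    define h where "h x = (\<integral>z. g (x + s *\<^sub>R z) \<partial>std_normal_vec)" for x
    have [measurable]: "h \<in> borel_measurable borel" unfolding h_def by measurable
    have "\<bar>g x - h x\<bar> \<le> e" for x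
    proof -
      have int: "integrable std_normal_vec (\<lambda>z. g (x + s *\<^sub>R z))"
        by (rule N.integrable_const_bound[of _ G]) (auto simp: G)
      have "g x - h x = (\<integral>z. g x - g (x + s *\<^sub>R z) \<partial>std_normal_vec)"
        unfolding h_def by (subst Bochner_Integration.integral_diff) (auto simp: int N.prob_space[simplified])
      also have "\<bar>\<dots>\<bar> \<le> (\<integral>z. \<bar>g x - g (x + s *\<^sub>R z)\<bar> \<partial>std_normal_vec)" by (rule integral_abs_bound)
      also have "\<dots> \<le> (\<integral>z. e / 2 + 2 * G * indicator {z::real^'d. norm z \<ge> real n} z \<partial>std_normal_vec)"
      proof (rule Bochner_Integration.integral_mono)
        show "integrable std_normal_vec (\<lambda>z. \<bar>g x - g (x + s *\<^sub>R z)\<bar>)" using int by auto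
        have "0 \<le> G" by (simp add: G_def)
        then show "integrable std_normal_vec (\<lambda>z::real^'d. e / 2 + 2 * G * indicator {z. norm z \<ge> real n} z)"
          using \<open>e > 0\<close> by (intro N.integrable_const_bound[of _ "e / 2 + 2 * G"]) (auto simp: indicator_def)
        fix z :: "real^'d"
        show "\<bar>g x - g (x + s *\<^sub>R z)\<bar> \<le> e / 2 + 2 * G * indicator {z. norm z \<ge> real n} z"
        proof (cases "norm z \<ge> real n")
          case True
          then show ?thesis using G[of x] G[of "x + s *\<^sub>R z"] \<open>e > 0\<close> by simp
        next
          case False
          then have "s * norm z < s * (real n + 1)" using s by (intro mult_strict_left_mono) auto
          moreover have "s * (real n + 1) = d" by (simp add: s_def)
          ultimately have "norm (s *\<^sub>R z) < d" using s by simp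
          then show ?thesis using ud[of "x + s *\<^sub>R z" x] False by (simp add: abs_minus_commute)
        qed
      qed
      also have "\<dots> = e / 2 + 2 * G * N.prob {z. norm z \<ge> real n}"
        by (subst Bochner_Integration.integral_add) (auto simp: N.prob_space[simplified] N.emeasure_eq_measure)
      also have "\<dots> \<le> e / 2 + 2 * G * (e / (4 * (G + 1)))"
        using n by (intro add_left_mono mult_left_mono) (auto simp: G_def)
      also have "\<dots> \<le> e" using \<open>e > 0\<close> by (auto simp: G_def field_simps max_def)
      finally show ?thesis .
    qed
    moreover have "test_conv h" unfolding h_def by (rule test_conv_smoothing[OF _ G r s]) auto
    ultimately show "\<exists>h. h \<in> borel_measurable borel \<and> test_conv h \<and> (\<forall>x. \<bar>g x - h x\<bar> \<le> e)"
      by (intro exI[of _ h]) simp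
  qed auto
qed

text \<open>Since the limit \<open>\<nu>\<close> has full mass, no mass escapes and compactly supported test functions suffice.\<close>

theorem converges_in_law: "converges_in_law_on P A X \<nu>"
  unfolding converges_in_law_on_def
proof (intro allI impI)
  fix g :: "real^'d \<Rightarrow> real"
  assume cont: "continuous_on UNIV g" and "bounded (range g)"
  then obtain G where G: "G > 0" "\<And>x. \<bar>g x\<bar> \<le> G" by (auto simp: bounded_pos)
  have gm [measurable]: "g \<in> borel_measurable borel" using cont by (rule borel_measurable_continuous_onI)
  \<comment> \<open>Continuous cutoffs that increase to 1; the integral of \<open>1 - c r\<close>
    measures the mass far out.\<close>
  define c where "c r x = max 0 (min 1 (real r + 1 - norm x))" for r and x :: "real^'d"
  have c: "0 \<le> c r x" "c r x \<le> 1" "\<bar>c r x\<bar> \<le> 1" for r x by (auto simp: c_def)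
  have c_cont: "continuous_on UNIV (c r)" for r unfolding c_def by (intro continuous_intros)
  have c_m [measurable]: "c r \<in> borel_measurable borel" for r using c_cont by (rule borel_measurable_continuous_onI)
  have c_conv: "test_conv (c r)" for r
    by (rule test_conv_compact_support[OF c_cont, of "real r + 1"]) (auto simp: c_def)
  have gc_conv: "test_conv (\<lambda>x. g x * c r x)" for r
    by (rule test_conv_compact_support[of _ "real r + 1"]) (auto simp: c_def intro!: continuous_intros cont c_cont[unfolded c_def])
  have gcb: "\<bar>g x * c r x\<bar> \<le> G" for x r
    using mult_mono[OF G(2)[of x] c(3)[of r x]] G(1) by (simp add: abs_mult)
  have c1: "(\<lambda>r. \<integral>x. c r x \<partial>\<nu>) \<longlonglongrightarrow> (\<integral>x. 1 \<partial>\<nu>)"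
  proof (rule integral_dominated_convergence[where w = "\<lambda>_. 1"])
    show "AE x in \<nu>. (\<lambda>r. c r x) \<longlonglongrightarrow> 1"
    proof (rule AE_I2)
      fix x :: "real^'d"
      obtain n where "norm x < real n" using reals_Archimedean2 by blast
      then have "eventually (\<lambda>r. c r x = 1) sequentially"
        by (intro eventually_sequentiallyI[of n]) (auto simp: c_def)
      then show "(\<lambda>r. c r x) \<longlonglongrightarrow> 1" by (rule tendsto_eventually)
    qed
  qed (auto simp: c)
  show "(\<lambda>n. mean_on_A g n) \<longlonglongrightarrow> measure P A * (\<integral>x. g x \<partial>\<nu>)"
  proof (rule LIMSEQ_I)
    fix e :: real assume "e > 0"
    define d where "d = e / (4 * G)"
    have d: "d > 0" using \<open>e > 0\<close> G by (simp add: d_def)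
    obtain r where r0: "\<bar>(\<integral>x. c r x \<partial>\<nu>) - 1\<bar> < d"
      using LIMSEQ_D[OF c1 d] by (auto simp: nu.prob_space[simplified])
    have r: "1 - (\<integral>x. c r x \<partial>\<nu>) < d" using r0 by linarith
    let ?p = "measure P A"
    have Ex: "eventually (\<lambda>n. \<bar>(\<integral>\<omega>. indicator A \<omega> * c r (X n \<omega>) \<partial>P) - ?p * (\<integral>x. c r x \<partial>\<nu>)\<bar> < d \<and>
        \<bar>(\<integral>\<omega>. indicator A \<omega> * (g (X n \<omega>) * c r (X n \<omega>)) \<partial>P) - ?p * (\<integral>x. g x * c r x \<partial>\<nu>)\<bar> < e / 4) sequentially"
      using c_conv[of r, unfolded test_conv_def tendsto_iff, rule_format, OF d]
        gc_conv[of r, unfolded test_conv_def tendsto_iff, rule_format, of "e / 4"] \<open>e > 0\<close>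
      by (intro eventually_conj) (simp_all only: dist_real_def zero_less_divide_iff zero_less_numeral simp_thms)
    have "eventually (\<lambda>n. norm (mean_on_A g n - ?p * (\<integral>x. g x \<partial>\<nu>)) < e) sequentially"
      using Ex
    proof eventually_elim
      case (elim n)
      have i0: "integrable P (indicat_real A)" by (simp add: emeasure_eq_measure)
      have i1: "integrable P (\<lambda>\<omega>. indicator A \<omega> * g (X n \<omega>))" by (rule integrable_ind[OF gm G(2)])
      have i2: "integrable P (\<lambda>\<omega>. indicator A \<omega> * (g (X n \<omega>) * c r (X n \<omega>)))"
        by (rule integrable_ind[of "\<lambda>x. g x * c r x", OF _ gcb]) auto
      have i3: "integrable P (\<lambda>\<omega>. indicator A \<omega> * c r (X n \<omega>))" by (rule integrable_ind[OF c_m c(3)])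
      have i4: "integrable \<nu> g" by (rule integrable_nu[OF gm G(2)])
      have i5: "integrable \<nu> (\<lambda>x. g x * c r x)" by (rule integrable_nu[OF _ gcb]) auto
      have i6: "integrable \<nu> (c r)" by (rule integrable_nu[OF c_m c(3)])
      have "\<bar>mean_on_A g n - (\<integral>\<omega>. indicator A \<omega> * (g (X n \<omega>) * c r (X n \<omega>)) \<partial>P)\<bar>
          = \<bar>\<integral>\<omega>. indicator A \<omega> * (g (X n \<omega>) * (1 - c r (X n \<omega>))) \<partial>P\<bar>"
        using i1 i2 by (subst Bochner_Integration.integral_diff[symmetric]) (auto simp: algebra_simps)
      also have "\<dots> \<le> (\<integral>\<omega>. \<bar>indicator A \<omega> * (g (X n \<omega>) * (1 - c r (X n \<omega>)))\<bar> \<partial>P)" by (rule integral_abs_bound)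
      also have "\<dots> \<le> (\<integral>\<omega>. G * (indicator A \<omega> - indicator A \<omega> * c r (X n \<omega>)) \<partial>P)"
      proof (rule integral_mono')
        show "integrable P (\<lambda>\<omega>. G * (indicator A \<omega> - indicator A \<omega> * c r (X n \<omega>)))"
          by (intro integrable_mult_right Bochner_Integration.integrable_diff i0 i3)
        fix \<omega>
        show "\<bar>indicator A \<omega> * (g (X n \<omega>) * (1 - c r (X n \<omega>)))\<bar> \<le> G * (indicator A \<omega> - indicator A \<omega> * c r (X n \<omega>))"
          using mult_right_mono[OF G(2)[of "X n \<omega>"], of "1 - c r (X n \<omega>)"] c[of r "X n \<omega>"]
          by (auto simp: indicator_def abs_mult)
        show "0 \<le> G * (indicator A \<omega> - indicator A \<omega> * c r (X n \<omega>))"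
          using G(1) c[of r "X n \<omega>"] by (auto simp: indicator_def)
      qed
      also have "\<dots> = G * (?p - (\<integral>\<omega>. indicator A \<omega> * c r (X n \<omega>) \<partial>P))"
        using i3 i0 by (simp add: Bochner_Integration.integral_diff)
      \<comment> \<open>Tightness: the cutoff is itself a test function, so the mass that X n loses
        by it differs from the loss of the limit by less than d, and the latter is at most d as
        well.\<close>
      also have "\<dots> \<le> G * (2 * d)"
      proof -
        have "?p * (1 - (\<integral>x. c r x \<partial>\<nu>)) \<le> 1 * d"
        proof (rule mult_mono)
          have "(\<integral>x. c r x \<partial>\<nu>) \<le> (\<integral>x. 1 \<partial>\<nu>)" by (rule integral_mono[OF i6]) (auto simp: c)
          then show "0 \<le> 1 - (\<integral>x. c r x \<partial>\<nu>)" by (simp add: nu.prob_space[simplified])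
        qed (use r in auto)
        then have "?p - (\<integral>\<omega>. indicator A \<omega> * c r (X n \<omega>) \<partial>P) \<le> 2 * d"
          using elim by (simp add: algebra_simps abs_if split: if_splits)
        then show ?thesis using G(1) by (intro mult_left_mono) auto
      qed
      also have "G * (2 * d) = e / 2" using G(1) by (simp add: d_def)
      finally have a1: "\<bar>mean_on_A g n - (\<integral>\<omega>. indicator A \<omega> * (g (X n \<omega>) * c r (X n \<omega>)) \<partial>P)\<bar> \<le> e / 2" .
      have "\<bar>(\<integral>x. g x \<partial>\<nu>) - (\<integral>x. g x * c r x \<partial>\<nu>)\<bar> = \<bar>\<integral>x. g x * (1 - c r x) \<partial>\<nu>\<bar>"
        using i4 i5 by (subst Bochner_Integration.integral_diff[symmetric]) (auto simp: algebra_simps)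
      also have "\<dots> \<le> (\<integral>x. \<bar>g x * (1 - c r x)\<bar> \<partial>\<nu>)" by (rule integral_abs_bound)
      also have "\<dots> \<le> (\<integral>x. G * (1 - c r x) \<partial>\<nu>)"
      proof (rule integral_mono')
        show "integrable \<nu> (\<lambda>x. G * (1 - c r x))" using i6 by auto
        show "\<bar>g x * (1 - c r x)\<bar> \<le> G * (1 - c r x)" for x
          using mult_right_mono[OF G(2)[of x], of "1 - c r x"] c[of r x] by (simp add: abs_mult)
        show "0 \<le> G * (1 - c r x)" for x using G(1) c[of r x] by simp
      qed
      also have "\<dots> = G * (1 - (\<integral>x. c r x \<partial>\<nu>))" using i6 by (simp add: Bochner_Integration.integral_diff nu.prob_space[simplified])
      also have "\<dots> < G * d" using r G(1) by (intro mult_strict_left_mono) auto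
      also have "G * d = e / 4" using G(1) by (simp add: d_def)
      finally have "\<bar>?p * (\<integral>x. g x \<partial>\<nu>) - ?p * (\<integral>x. g x * c r x \<partial>\<nu>)\<bar> < e / 4"
        using mult_left_le_one_le[of "\<bar>(\<integral>x. g x \<partial>\<nu>) - (\<integral>x. g x * c r x \<partial>\<nu>)\<bar>" ?p]
        by (simp add: right_diff_distrib[symmetric] abs_mult)
      with a1 elim[THEN conjunct2] show ?case unfolding real_norm_def by linarith
    qed
    then show "\<exists>n0. \<forall>n\<ge>n0. norm (mean_on_A g n - ?p * (\<integral>x. g x \<partial>\<nu>)) < e"
      by (simp add: eventually_sequentially)
  qed
qed

end

text \<open>The hypothesis turns the choice in \<open>normal_vec\<close> into an actual square root,
  and the characteristic function depends on it only through A A^T = S.\<close>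

lemma normal_vec_char:
  fixes S :: "real^'d^'d"
  assumes "\<exists>A :: real^'d^'d. A ** transpose A = S"
  shows "(\<integral>x. iexp (u \<bullet> x) \<partial>normal_vec 0 S) = complex_of_real (exp (- (u \<bullet> (S *v u)) / 2))"
    and "prob_space (normal_vec 0 S)" and "sets (normal_vec 0 S) = sets borel"
proof -
  define A where "A = (SOME A :: real^'d^'d. A ** transpose A = S)"
  have A: "A ** transpose A = S" unfolding A_def using assms by (rule someI_ex)
  have nv: "normal_vec 0 S = distr std_normal_vec borel (\<lambda>z. A *v z)"
    by (simp add: normal_vec_def A_def)
  have [measurable]: "(\<lambda>z. A *v z) \<in> borel_measurable borel"
    by (rule borel_measurable_continuous_onI) (intro linear_continuous_on matrix_vector_mul_bounded_linear)
  show "sets (normal_vec 0 S) = sets borel" by (simp add: nv)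
  show "prob_space (normal_vec 0 S)"
    unfolding nv by (rule prob_space.prob_space_distr[OF prob_space_std_normal_vec]) measurable
  have tr: "u \<bullet> (A *v z) = (transpose A *v u) \<bullet> z" for z
    unfolding transpose_matrix_vector dot_lmul_matrix ..
  have "(\<integral>x. iexp (u \<bullet> x) \<partial>normal_vec 0 S) = (\<integral>z. iexp ((transpose A *v u) \<bullet> z) \<partial>std_normal_vec)"
    unfolding nv by (subst integral_distr) (simp_all add: tr)
  also have "\<dots> = complex_of_real (exp (- (norm (transpose A *v u))\<^sup>2 / 2))" by (rule char_std_normal_vec)
  also have "(norm (transpose A *v u))\<^sup>2 = u \<bullet> (A *v (transpose A *v u))"
    unfolding tr by (rule power2_norm_eq_inner)
  also have "\<dots> = u \<bullet> (S *v u)" by (simp only: matrix_vector_mul_assoc A)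
  finally show "(\<integral>x. iexp (u \<bullet> x) \<partial>normal_vec 0 S) = complex_of_real (exp (- (u \<bullet> (S *v u)) / 2))" .
qed

section \<open>Sums of powers and of quantities that jump with the level\<close>

text \<open>A Cesaro argument: from some k0 on each term is at most r/2 times its weight, and the
  finite head is swamped by the divergent sum of the weights.\<close>

lemma sum_negligible:
  fixes d e :: "nat \<Rightarrow> real" and E :: "nat \<Rightarrow> 'a::real_normed_vector"
  assumes d: "\<And>k. 0 \<le> d k" and D: "filterlim (\<lambda>n. \<Sum>k=1..n. d k) at_top sequentially"
    and E: "eventually (\<lambda>k. norm (E k) \<le> e k * d k) sequentially" and e: "e \<longlonglongrightarrow> 0"
  shows "(\<lambda>n. (1 / (\<Sum>k=1..n. d k)) *\<^sub>R (\<Sum>k=1..n. E k)) \<longlonglongrightarrow> 0"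
proof (rule LIMSEQ_I)
  fix r :: real assume r: "r > 0"
  have "eventually (\<lambda>k. e k < r / 2) sequentially" using order_tendstoD(2)[OF e, of "r / 2"] r by simp
  with E have "eventually (\<lambda>k. norm (E k) \<le> r / 2 * d k) sequentially"
  proof eventually_elim
    case (elim k)
    then have "e k * d k \<le> r / 2 * d k" using d by (intro mult_right_mono) auto
    with elim show ?case by linarith
  qed
  then obtain k0 where k0: "\<And>k. k \<ge> k0 \<Longrightarrow> norm (E k) \<le> r / 2 * d k"
    by (auto simp: eventually_sequentially)
  define B where "B = (\<Sum>k=1..k0. norm (E k))"
  have B: "0 \<le> B" by (simp add: B_def sum_nonneg)
  have "eventually (\<lambda>n. (\<Sum>k=1..n. d k) > 2 * B / r + 1) sequentially"
    using D by (auto simp: filterlim_at_top_dense)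
  then obtain n0 where n0: "\<And>n. n \<ge> n0 \<Longrightarrow> (\<Sum>k=1..n. d k) > 2 * B / r + 1"
    by (auto simp: eventually_sequentially)
  have "norm ((1 / (\<Sum>k=1..n. d k)) *\<^sub>R (\<Sum>k=1..n. E k)) < r" if "n \<ge> n0" for n
  proof -
    let ?D = "\<Sum>k=1..n. d k"
    have Dp: "?D > 2 * B / r + 1" "?D > 0" using n0[OF that] B r by (auto intro: le_less_trans[of _ "2 * B / r + 1"] add_nonneg_nonneg)
    have "norm (\<Sum>k=1..n. E k) \<le> (\<Sum>k=1..n. norm (E k))" by (rule norm_sum)
    also have "\<dots> \<le> (\<Sum>k=1..n. (if k \<le> k0 then norm (E k) else 0) + r / 2 * d k)"
      using k0 r d by (intro sum_mono) (auto simp: not_le)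
    also have "\<dots> = (\<Sum>k=1..n. if k \<le> k0 then norm (E k) else 0) + r / 2 * ?D"
      by (simp add: sum.distrib sum_distrib_left)
    also have "(\<Sum>k=1..n. if k \<le> k0 then norm (E k) else 0) = (\<Sum>k\<in>{1..n} \<inter> {..k0}. norm (E k))"
      by (subst sum.inter_restrict) auto
    also have "\<dots> \<le> B" unfolding B_def by (rule sum_mono2) auto
    finally have "norm (\<Sum>k=1..n. E k) \<le> B + r / 2 * ?D" by simp
    moreover have "B < r / 2 * ?D" using Dp(1) r by (simp add: field_simps)
    ultimately show ?thesis using Dp(2) by (simp add: field_simps)
  qed
  then show "\<exists>n0. \<forall>n\<ge>n0. norm ((1 / (\<Sum>k=1..n. d k)) *\<^sub>R (\<Sum>k=1..n. E k) - 0) < r" by auto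
qed

lemma weighted_cesaro:
  fixes d x :: "nat \<Rightarrow> real"
  assumes d: "\<And>k. 0 \<le> d k" and D: "filterlim (\<lambda>n. \<Sum>k=1..n. d k) at_top sequentially"
    and x: "x \<longlonglongrightarrow> l"
  shows "(\<lambda>n. (\<Sum>k=1..n. d k * x k) / (\<Sum>k=1..n. d k)) \<longlonglongrightarrow> l"
proof -
  have "(\<lambda>n. (1 / (\<Sum>k=1..n. d k)) *\<^sub>R (\<Sum>k=1..n. d k * (x k - l))) \<longlonglongrightarrow> 0"
  proof (rule sum_negligible[OF d D, of _ "\<lambda>k. \<bar>x k - l\<bar>"])
    show "(\<lambda>k. \<bar>x k - l\<bar>) \<longlonglongrightarrow> 0"
      using x by (intro tendsto_rabs_zero) (simp add: LIM_zero_iff)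
  qed (simp add: abs_mult d mult.commute)
  moreover have "eventually (\<lambda>n. (\<Sum>k=1..n. d k * x k) / (\<Sum>k=1..n. d k) =
      l + (1 / (\<Sum>k=1..n. d k)) *\<^sub>R (\<Sum>k=1..n. d k * (x k - l))) sequentially"
    using filterlim_at_top_dense[THEN iffD1, OF D, rule_format, of 0]
    by eventually_elim (simp add: right_diff_distrib sum_subtractf sum_distrib_right[symmetric] diff_divide_distrib)
  ultimately show ?thesis
    using tendsto_cong[THEN iffD2, of _ _ sequentially l] tendsto_add[OF tendsto_const[of l]] by fastforce
qed

text \<open>The Toeplitz lemma for a triangular array: every fixed column vanishes, so only indices
  with small \<open>x k\<close> contribute, and the row sums are bounded.\<close>

lemma toeplitz_zero:
  fixes c :: "nat \<Rightarrow> nat \<Rightarrow> real" and x :: "nat \<Rightarrow> real"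
  assumes c: "\<And>n k. 0 \<le> c n k" and C: "\<And>n. (\<Sum>k=1..n. c n k) \<le> C"
    and c0: "\<And>k. (\<lambda>n. c n k) \<longlonglongrightarrow> 0" and x: "x \<longlonglongrightarrow> 0"
  shows "(\<lambda>n. \<Sum>k=1..n. c n k * x k) \<longlonglongrightarrow> 0"
proof (rule LIMSEQ_I)
  fix r :: real assume r: "r > 0"
  have C0: "0 \<le> C" using C[of 0] by simp
  have "eventually (\<lambda>k. \<bar>x k\<bar> < r / (2 * (C + 1))) sequentially"
    using order_tendstoD(2)[OF tendsto_rabs_zero[OF x], of "r / (2 * (C + 1))"] r C0 by simp
  then obtain k0 where k0: "\<And>k. k \<ge> k0 \<Longrightarrow> \<bar>x k\<bar> < r / (2 * (C + 1))"
    by (auto simp: eventually_sequentially)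
  have "(\<lambda>n. \<Sum>k\<le>k0. c n k * \<bar>x k\<bar>) \<longlonglongrightarrow> (\<Sum>k\<le>k0. 0 * \<bar>x k\<bar>)"
    by (intro tendsto_sum tendsto_mult c0 tendsto_const)
  then have "eventually (\<lambda>n. (\<Sum>k\<le>k0. c n k * \<bar>x k\<bar>) < r / 2) sequentially"
    using r by (intro order_tendstoD) auto
  then obtain n0 where n0: "\<And>n. n \<ge> n0 \<Longrightarrow> (\<Sum>k\<le>k0. c n k * \<bar>x k\<bar>) < r / 2"
    by (auto simp: eventually_sequentially)
  have "norm (\<Sum>k=1..n. c n k * x k) < r" if "n \<ge> n0" for n
  proof -
    let ?q = "r / (2 * (C + 1))"
    have "norm (\<Sum>k=1..n. c n k * x k) \<le> (\<Sum>k=1..n. c n k * \<bar>x k\<bar>)"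
      using norm_sum[of "\<lambda>k. c n k * x k" "{1..n}"] by (simp add: abs_mult c)
    also have "\<dots> \<le> (\<Sum>k=1..n. (if k \<le> k0 then c n k * \<bar>x k\<bar> else 0) + c n k * ?q)"
    proof (rule sum_mono)
      fix k
      show "c n k * \<bar>x k\<bar> \<le> (if k \<le> k0 then c n k * \<bar>x k\<bar> else 0) + c n k * ?q"
        using mult_left_mono[OF less_imp_le[OF k0[of k]] c[of n k]] c[of n k] r C0 by auto
    qed
    also have "\<dots> = (\<Sum>k\<in>{1..n} \<inter> {..k0}. c n k * \<bar>x k\<bar>) + (\<Sum>k=1..n. c n k) * ?q"
      unfolding sum.distrib sum_distrib_right by (subst sum.inter_restrict) auto
    also have "\<dots> \<le> (\<Sum>k\<le>k0. c n k * \<bar>x k\<bar>) + C * ?q"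
      using C0 r by (intro add_mono sum_mono2 mult_right_mono C) (auto simp: c)
    also have "C * ?q \<le> r / 2" using C0 r by (simp add: field_simps)
    finally show ?thesis using n0[OF that] by simp
  qed
  then show "\<exists>n0. \<forall>n\<ge>n0. norm ((\<Sum>k=1..n. c n k * x k) - 0) < r" by auto
qed

lemma sum_telescope_from_1: "(\<Sum>k=1..n. f k - f (k - 1)) = f n - (f 0 :: 'a::ab_group_add)" for n :: nat
  by (induction n) auto

text \<open>The increments of k^a serve as weights: they telescope to n^a, and k^(a-1) is
  asymptotically 1/a times the k-th increment.\<close>

lemma power_sum_asymp:
  fixes a :: real
  assumes a: "a > 0"
  shows "(\<lambda>n. (\<Sum>k=1..n. real k powr (a - 1)) / real n powr a) \<longlonglongrightarrow> 1 / a"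
proof -
  define d where "d k = real k powr a - real (k - 1) powr a" for k
  have d0: "0 \<le> d k" for k unfolding d_def using a by (auto intro!: powr_mono2)
  have D: "(\<Sum>k=1..n. d k) = real n powr a" for n
    using sum_telescope_from_1[of "\<lambda>k. real k powr a" n] a by (simp add: d_def)
  have x: "(\<lambda>k. real k powr (a - 1) / d k) \<longlonglongrightarrow> 1 / a"
  proof (subst tendsto_cong)
    show "eventually (\<lambda>k. real k powr (a - 1) / d k = real k powr (a - 1) / (real k powr a - (real k - 1) powr a)) sequentially"
      using eventually_ge_at_top[of "1::nat"] by eventually_elim (simp add: d_def of_nat_diff)
    show "(\<lambda>k. real k powr (a - 1) / (real k powr a - (real k - 1) powr a)) \<longlonglongrightarrow> 1 / a"
      unfolding inverse_eq_divide[symmetric] using a by real_asymp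
  qed
  have "filterlim (\<lambda>n. real n powr a) at_top sequentially" using a by real_asymp
  then have lim: "(\<lambda>n. (\<Sum>k=1..n. d k * (real k powr (a - 1) / d k)) / (\<Sum>k=1..n. d k)) \<longlonglongrightarrow> 1 / a"
    by (intro weighted_cesaro d0 x) (simp only: D)
  have "d k \<noteq> 0" if "k \<ge> 1" for k
    using that a powr_less_mono2[of a "real (k - 1)" "real k"] by (simp add: d_def)
  then have "(\<Sum>k=1..n. d k * (real k powr (a - 1) / d k)) = (\<Sum>k=1..n. real k powr (a - 1))" for n
    by (intro sum.cong) auto
  then show ?thesis using lim by (simp only: D)
qed

lemma power_sum_bound:
  fixes a :: real
  assumes a: "a > 0"
  obtains C where "C > 0" "\<And>n. (\<Sum>k=1..n. real k powr (a - 1)) \<le> C * real n powr a"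
proof -
  from convergent_imp_Bseq[OF convergentI[OF power_sum_asymp[OF a]]]
  obtain C where C: "C > 0" "\<And>n. \<bar>(\<Sum>k=1..n. real k powr (a - 1)) / real n powr a\<bar> \<le> C"
    by (auto simp: Bseq_def)
  have "(\<Sum>k=1..n. real k powr (a - 1)) \<le> C * real n powr a" for n
    using C(2)[of n] by (cases "n = 0") (auto simp: abs_le_iff field_simps)
  then show ?thesis using that C(1) by blast
qed

lemma power_sum_weighted:
  fixes a :: real and x :: "nat \<Rightarrow> real"
  assumes a: "a > 0" and x: "x \<longlonglongrightarrow> 0"
  shows "(\<lambda>n. (\<Sum>k=1..n. real k powr (a - 1) * x k) / real n powr a) \<longlonglongrightarrow> 0"
proof -
  obtain C where C: "C > 0" "\<And>n. (\<Sum>k=1..n. real k powr (a - 1)) \<le> C * real n powr a"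
    using power_sum_bound[OF a] by blast
  have "(\<lambda>n. \<Sum>k=1..n. (real k powr (a - 1) / real n powr a) * x k) \<longlonglongrightarrow> 0"
  proof (rule toeplitz_zero[OF _ _ _ x])
    show "(\<Sum>k=1..n. real k powr (a - 1) / real n powr a) \<le> C" for n
      using C(2)[of n] C(1) by (cases "n = 0") (auto simp: sum_divide_distrib[symmetric] field_simps)
    show "(\<lambda>n. real k powr (a - 1) / real n powr a) \<longlonglongrightarrow> 0" for k using a by real_asymp
  qed auto
  then show ?thesis by (simp add: sum_divide_distrib)
qed

lemma power_increment_bound:
  fixes w :: real
  obtains C where "C > 0" "\<And>k. k \<ge> 1 \<Longrightarrow> \<bar>real (Suc k) powr w - real k powr w\<bar> \<le> C * real k powr (w - 1)"
proof -
  have "(\<lambda>k. ((real k + 1) powr w - real k powr w) / real k powr (w - 1)) \<longlonglongrightarrow> w"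
    by real_asymp
  from convergent_imp_Bseq[OF convergentI[OF this]]
  obtain C where C: "C > 0" "\<And>k. \<bar>((real k + 1) powr w - real k powr w) / real k powr (w - 1)\<bar> \<le> C"
    by (auto simp: Bseq_def)
  have "\<bar>real (Suc k) powr w - real k powr w\<bar> \<le> C * real k powr (w - 1)" if "k \<ge> 1" for k
    using C(2)[of k] that by (simp add: abs_divide field_simps)
  then show ?thesis using that C(1) by blast
qed

text \<open>C' n^(-e) is a supersolution. Passing from n to n + 1 changes n^(-e) only by order
  n^(-e-1), which for psi < 1 is smaller than the contraction c n^(-psi-e); half of the contraction
  is left to absorb the inhomogeneity.\<close>

lemma robbins_monro_recursion:
  fixes v :: "nat \<Rightarrow> real"
  assumes psi: "0 < psi" "psi < 1" and c: "c > 0" and e: "e > 0" and v0: "\<And>n. 0 \<le> v n"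
    and rec: "\<And>n. n \<ge> N \<Longrightarrow> v (Suc n) \<le> (1 - c * real (Suc n) powr (- psi)) * v n + C * real (Suc n) powr (- psi - e)"
  obtains C' where "C' > 0" "\<And>n. n \<ge> 1 \<Longrightarrow> v n \<le> C' * real n powr (- e)"
proof -
  have "eventually (\<lambda>n. (1 - c * (real n + 1) powr (- psi)) * real n powr (- e) + c / 2 * (real n + 1) powr (- psi - e) \<le> (real n + 1) powr (- e)) sequentially"
  proof -
    have "((\<lambda>n. ((1 - c * (real n + 1) powr (- psi)) * real n powr (- e) - (real n + 1) powr (- e)) / (real n + 1) powr (- psi - e)) \<longlongrightarrow> - c) sequentially"
      using psi c e by real_asymp
    from order_tendstoD(2)[OF this, of "- c / 2"] c
    have "eventually (\<lambda>n. ((1 - c * (real n + 1) powr (- psi)) * real n powr (- e) - (real n + 1) powr (- e)) / (real n + 1) powr (- psi - e) < - c / 2) sequentially"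
      by simp
    then show ?thesis
    proof eventually_elim
      case (elim n)
      have "(real n + 1) powr (- psi - e) > 0" by simp
      with elim have "(1 - c * (real n + 1) powr (- psi)) * real n powr (- e) - (real n + 1) powr (- e) < - c / 2 * (real n + 1) powr (- psi - e)"
        by (simp only: pos_divide_less_eq)
      then show ?case by simp
    qed
  qed
  moreover have "eventually (\<lambda>n. c * (real n + 1) powr (- psi) \<le> 1) sequentially"
    using psi c by real_asymp
  ultimately have "eventually (\<lambda>n. n \<ge> max N 1 \<and> c * (real n + 1) powr (- psi) \<le> 1 \<and>
     (1 - c * (real n + 1) powr (- psi)) * real n powr (- e) + c / 2 * (real n + 1) powr (- psi - e) \<le> (real n + 1) powr (- e)) sequentially"
    by (intro eventually_conj eventually_ge_at_top) auto
  then obtain m where m: "\<And>n. n \<ge> m \<Longrightarrow> n \<ge> max N 1 \<and> c * (real n + 1) powr (- psi) \<le> 1 \<and>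
     (1 - c * (real n + 1) powr (- psi)) * real n powr (- e) + c / 2 * (real n + 1) powr (- psi - e) \<le> (real n + 1) powr (- e)"
    by (auto simp: eventually_sequentially)
  \<comment> \<open>The maximum gives C \<le> c/2 C', the condition for the induction step; the sum
    covers the indices up to m, where the asymptotic inequality may fail.\<close>
  define C' where "C' = max 1 (2 * C / c) + (\<Sum>k\<le>m. v k * real k powr e)"
  have S0: "0 \<le> (\<Sum>k\<le>m. v k * real k powr e)" by (intro sum_nonneg mult_nonneg_nonneg v0) auto
  have C'1: "C' > 0" "C \<le> c / 2 * C'" using S0 c by (auto simp: C'_def field_simps max_def intro: add_pos_nonneg)
      (smt (verit) mult_nonneg_nonneg S0 mult_less_cancel_left_pos)
  have init: "v n \<le> C' * real n powr (- e)" if "n \<ge> 1" "n \<le> m" for n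
  proof -
    have "v n * real n powr e \<le> (\<Sum>k\<le>m. v k * real k powr e)"
      using that by (intro member_le_sum[of n "{..m}" "\<lambda>k. v k * real k powr e"]) (auto simp: v0)
    then have "v n * real n powr e \<le> C'" by (simp add: C'_def)
    then show ?thesis using that by (simp add: powr_minus field_simps)
  qed
  have "v n \<le> C' * real n powr (- e)" if "n \<ge> m" for n
    using that
  proof (induction n rule: dec_induct)
    case base
    show ?case using init[of m] m[of m] by simp
  next
    case (step n)
    let ?g = "c * (real n + 1) powr (- psi)"
    have mn: "n \<ge> N" "?g \<le> 1"
      "(1 - ?g) * real n powr (- e) + c / 2 * (real n + 1) powr (- psi - e) \<le> (real n + 1) powr (- e)"
      using m[OF step.hyps(1)] by auto
    have "v (Suc n) \<le> (1 - ?g) * v n + C * (real n + 1) powr (- psi - e)"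
      using rec[OF mn(1)] by (simp add: add.commute)
    also have "\<dots> \<le> (1 - ?g) * (C' * real n powr (- e)) + (c / 2 * C') * (real n + 1) powr (- psi - e)"
      using mn C'1 step.IH by (intro add_mono mult_left_mono mult_right_mono) auto
    also have "\<dots> = C' * ((1 - ?g) * real n powr (- e) + c / 2 * (real n + 1) powr (- psi - e))"
      by (simp add: algebra_simps)
    also have "\<dots> \<le> C' * (real n + 1) powr (- e)" using mn C'1 by (intro mult_left_mono) auto
    finally show ?case by (simp add: add.commute)
  qed
  with init C'1(1) show ?thesis using that by (meson nle_le)
qed

lemma summation_by_parts:
  fixes x :: "nat \<Rightarrow> 'a::real_vector" and w :: "nat \<Rightarrow> real"
  assumes "N < n"
  shows "(\<Sum>k=Suc N..n. w k *\<^sub>R (x k - x (k - 1))) =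
    w n *\<^sub>R x n - w (Suc N) *\<^sub>R x N - (\<Sum>k=Suc N..<n. (w (Suc k) - w k) *\<^sub>R x k)"
  using assms
proof -
  from assms have "Suc N \<le> n" by simp
  then show ?thesis
  proof (induction n rule: dec_induct)
    case base
    show ?case by (simp add: scaleR_diff_right)
  next
    case (step n)
    have 1: "(\<Sum>k=Suc N..Suc n. w k *\<^sub>R (x k - x (k - 1))) =
        (\<Sum>k=Suc N..n. w k *\<^sub>R (x k - x (k - 1))) + w (Suc n) *\<^sub>R (x (Suc n) - x n)"
      using step.hyps by simp
    have 2: "(\<Sum>k=Suc N..<Suc n. (w (Suc k) - w k) *\<^sub>R x k) =
        (\<Sum>k=Suc N..<n. (w (Suc k) - w k) *\<^sub>R x k) + (w (Suc n) - w n) *\<^sub>R x n"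
      using step.hyps by simp
    show ?case unfolding 1 2 step.IH by (simp add: scaleR_diff_left scaleR_diff_right)
  qed
qed

text \<open>The kernel g^(s-k) has its mass near k = s, hence only large k count, and the total
  weight tends to 1/(1 - g). The index runs along an arbitrary filter because the kernel is met both
  in the joint limit of state and step and along a single path.\<close>

lemma geometric_kernel_limit:
  fixes c :: "'i \<Rightarrow> nat \<Rightarrow> real" and s :: "'i \<Rightarrow> nat"
  assumes g: "0 < g" "g < 1" and s: "filterlim s at_top Fl"
    and C: "eventually (\<lambda>i. \<forall>k\<in>{1..s i}. \<bar>c i k\<bar> \<le> C) Fl"
    and lim: "\<And>e. e > 0 \<Longrightarrow> \<exists>k0. eventually (\<lambda>i. \<forall>k\<in>{k0..s i}. \<bar>c i k - l\<bar> \<le> e) Fl"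
  shows "((\<lambda>i. \<Sum>k=1..s i. g ^ (s i - k) * c i k) \<longlongrightarrow> l / (1 - g)) Fl"
proof -
  have geo: "(\<Sum>k=1..m. g ^ (m - k)) = (1 - g ^ m) / (1 - g)" for m
  proof -
    have "(\<Sum>k=1..m. g ^ (m - k)) = (\<Sum>k<m. g ^ k)"
      by (rule sum.reindex_bij_witness[of _ "\<lambda>k. m - k" "\<lambda>k. m - k"]) auto
    then show ?thesis using g by (simp add: sum_gp_strict)
  qed
  have gs: "((\<lambda>i. g ^ (s i)) \<longlongrightarrow> 0) Fl"
    using filterlim_compose[OF LIMSEQ_realpow_zero s] g by simp
  \<comment> \<open>A bound for |c i k - l| on the early indices, whose weights are at most g^(s-k0)
    each.\<close>
  define C' where "C' = max C 0 + \<bar>l\<bar>"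
  have C'0: "0 \<le> C'" by (simp add: C'_def)
  have "((\<lambda>i. (\<Sum>k=1..s i. g ^ (s i - k) * c i k) - (\<Sum>k=1..s i. g ^ (s i - k) * l)) \<longlongrightarrow> 0) Fl"
  proof (rule tendstoI)
    fix e :: real assume e: "e > 0"
    define e' where "e' = e * (1 - g) / 2"
    have e': "e' > 0" using e g by (simp add: e'_def)
    obtain k0 where k0: "eventually (\<lambda>i. \<forall>k\<in>{k0..s i}. \<bar>c i k - l\<bar> \<le> e') Fl"
      using lim[OF e'] by blast
    have "((\<lambda>i. C' * real k0 * (g ^ (s i) / g ^ k0)) \<longlongrightarrow> C' * real k0 * (0 / g ^ k0)) Fl"
      using g by (intro tendsto_intros gs) auto
    then have "eventually (\<lambda>i. C' * real k0 * (g ^ (s i) / g ^ k0) < e / 2) Fl"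
      using e by (intro order_tendstoD) auto
    moreover have "eventually (\<lambda>i. s i \<ge> k0) Fl" using s by (auto simp: filterlim_at_top)
    ultimately show "eventually (\<lambda>i. dist ((\<Sum>k=1..s i. g ^ (s i - k) * c i k) - (\<Sum>k=1..s i. g ^ (s i - k) * l)) 0 < e) Fl"
      using k0 C
    proof eventually_elim
      case (elim i)
      have "dist ((\<Sum>k=1..s i. g ^ (s i - k) * c i k) - (\<Sum>k=1..s i. g ^ (s i - k) * l)) 0 = \<bar>\<Sum>k=1..s i. g ^ (s i - k) * (c i k - l)\<bar>"
        by (simp add: sum_subtractf right_diff_distrib)
      also have "\<dots> \<le> (\<Sum>k=1..s i. \<bar>g ^ (s i - k) * (c i k - l)\<bar>)" by (rule sum_abs)
      also have "\<dots> \<le> (\<Sum>k=1..s i. g ^ (s i - k) * e' + (if k < k0 then g ^ (s i) / g ^ k0 * C' else 0))"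
      proof (rule sum_mono)
        fix k assume k: "k \<in> {1..s i}"
        show "\<bar>g ^ (s i - k) * (c i k - l)\<bar> \<le> g ^ (s i - k) * e' + (if k < k0 then g ^ (s i) / g ^ k0 * C' else 0)"
        proof (cases "k < k0")
          case True
          have "\<bar>c i k - l\<bar> \<le> C'" using elim k by (fastforce simp: C'_def)
          moreover have "g ^ (s i - k) \<le> g ^ (s i) / g ^ k0"
          proof -
            have "g ^ (s i - k) \<le> g ^ (s i - k0)" using True g by (intro power_decreasing) auto
            also have "\<dots> = g ^ (s i) / g ^ k0" using elim g by (simp add: power_diff)
            finally show ?thesis .
          qed
          ultimately have "\<bar>g ^ (s i - k) * (c i k - l)\<bar> \<le> g ^ (s i) / g ^ k0 * C'"
            using g C'0 unfolding abs_mult by (intro mult_mono) auto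
          then show ?thesis using True e' g by (simp add: add_increasing)
        next
          case False
          then have "\<bar>c i k - l\<bar> \<le> e'" using elim k by auto
          then show ?thesis using False g by (simp add: abs_mult mult_left_mono)
        qed
      qed
      also have "\<dots> = (1 - g ^ (s i)) / (1 - g) * e' + (\<Sum>k\<in>{1..s i} \<inter> {..<k0}. g ^ (s i) / g ^ k0 * C')"
        unfolding sum.distrib sum_distrib_right[symmetric, where A = "{1..s i}" and f = "\<lambda>k. g ^ (s i - k)"] geo
        by (subst sum.inter_restrict) (auto simp: lessThan_def)
      also have "\<dots> \<le> 1 / (1 - g) * e' + real k0 * (g ^ (s i) / g ^ k0 * C')"
      proof (rule add_mono)
        show "(1 - g ^ (s i)) / (1 - g) * e' \<le> 1 / (1 - g) * e'"
          using g e' by (intro mult_right_mono divide_right_mono) auto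
        have "card ({1..s i} \<inter> {..<k0}) \<le> card {..<k0}" by (rule card_mono) auto
        then show "(\<Sum>k\<in>{1..s i} \<inter> {..<k0}. g ^ (s i) / g ^ k0 * C') \<le> real k0 * (g ^ (s i) / g ^ k0 * C')"
          using C'0 g unfolding sum_constant by (intro mult_right_mono) auto
      qed
      also have "1 / (1 - g) * e' = e / 2" using g by (simp add: e'_def)
      also have "real k0 * (g ^ (s i) / g ^ k0 * C') = C' * real k0 * (g ^ (s i) / g ^ k0)" by simp
      finally show ?case using elim(1) by linarith
    qed
  qed
  moreover have "((\<lambda>i. (\<Sum>k=1..s i. g ^ (s i - k) * l)) \<longlongrightarrow> l / (1 - g)) Fl"
  proof -
    have "((\<lambda>i. (1 - g ^ (s i)) / (1 - g) * l) \<longlongrightarrow> (1 - 0) / (1 - g) * l) Fl"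
      using g by (intro tendsto_intros gs) auto
    then show ?thesis unfolding sum_distrib_right[symmetric] geo by simp
  qed
  ultimately show ?thesis using tendsto_add by fastforce
qed

text \<open>The argument z will be a fractional part that oscillates, so \<open>psi_fun\<close> need
  not converge along the sequence; two-sided bounds take the place of a limit.\<close>

lemma psi_fun_bounds:
  fixes M u v z :: real
  assumes M: "M > 1" and u: "u > 0" "u + v > 0" and z: "0 \<le> z" "z \<le> 1"
  shows "M powr (- (u + v)) * ((M powr u - 1) / (M powr (u + v) - 1)) \<le> psi_fun M u v z"
    and "psi_fun M u v z \<le> (M powr u - 1) / (M powr (u + v) - 1) + M powr u"
    and "0 < psi_fun M u v z"
proof -
  have a: "M powr u > 1" "M powr (u + v) > 1" using M u by (auto intro: gr_one_powr)
  let ?c = "(M powr u - 1) / (M powr (u + v) - 1)"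
  have c: "?c > 0" using a by simp
  have uz: "1 \<le> M powr (u * z)" "M powr (u * z) \<le> M powr u"
    using M u z by (auto intro!: ge_one_powr_ge_zero powr_mono mult_left_le)
  have zu: "0 \<le> z * (u + v)" "z * (u + v) \<le> u + v" using u z by (auto intro: mult_left_le_one_le)
  have "M powr (- (u + v)) \<le> M powr (- (z * (u + v)))" using M zu by (intro powr_mono) auto
  moreover have "M powr (- (z * (u + v))) \<le> M powr 0" using M zu by (intro powr_mono) auto
  ultimately have e: "M powr (- (u + v)) \<le> M powr (- z * (u + v))" "M powr (- z * (u + v)) \<le> 1"
    using M by auto
  show l: "M powr (- (u + v)) * ?c \<le> psi_fun M u v z"
    unfolding psi_fun_def using e uz c by (intro mult_mono) auto
  show "psi_fun M u v z \<le> ?c + M powr u"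
  proof -
    have "psi_fun M u v z \<le> 1 * (?c + M powr u)"
      unfolding psi_fun_def using e uz c by (intro mult_mono) auto
    then show ?thesis by simp
  qed
  have "0 < M powr (- (u + v)) * ?c" using c M by (intro mult_pos_pos) auto
  with l show "0 < psi_fun M u v z" by linarith
qed

text \<open>The level s is the integer part of the logarithm of L, kept at least 1. The sums to be
  evaluated have increments of L^u as weights and the factor M^(v s), which is constant between
  jumps of s.\<close>

locale level_sequence =
  fixes M :: real and L :: "nat \<Rightarrow> real" and s :: "nat \<Rightarrow> nat" and u v :: real
  assumes M: "M > 1" and L_pos: "\<And>n. n \<ge> 1 \<Longrightarrow> 0 < L n" and L_0: "L 0 = 0" and L_mono: "\<And>m n. m \<le> n \<Longrightarrow> L m \<le> L n"
    and L_top: "filterlim L at_top sequentially" and L_ratio: "(\<lambda>n. L (Suc n) / L n) \<longlonglongrightarrow> 1"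
    and s_def: "\<And>n. s n = nat (max \<lfloor>log M (L n)\<rfloor> 1)" and u: "u > 0" "u + v > 0"
begin

definition \<xi> :: "nat \<Rightarrow> real" where "\<xi> n = log M (L n) - real (s n)"
text \<open>Chosen so that \<open>Psi\<close> is continuous in L at a jump: at L = M^(s+1) the
  expressions for s and s + 1 agree exactly if M^u + c0 - 1 = c0 M^(u+v).\<close>

definition c0 :: real where "c0 = (M powr u - 1) / (M powr (u + v) - 1)"
definition W :: "nat \<Rightarrow> real" where "W n = M powr ((u + v) * real (s n))"
text \<open>A discrete antiderivative: between jumps its increment is the increment of L^u times
  M^(v s), and the second term compensates the jumps.\<close>

definition Psi :: "nat \<Rightarrow> real" where "Psi n = L n powr u * M powr (v * real (s n)) + (c0 - 1) * W n"

lemma M_powr_gt_1: "M powr u > 1" "M powr (u + v) > 1"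
  using M u by (auto intro: gr_one_powr)

lemma c0: "c0 > 0" using M_powr_gt_1 by (simp add: c0_def)

text \<open>Once L reaches M, the lower bound 1 in the definition of s is inactive.\<close>

lemma s_eventually: "eventually (\<lambda>n. n \<ge> 1 \<and> real (s n) \<le> log M (L n) \<and> log M (L n) < real (s n) + 1 \<and> int (s n) = \<lfloor>log M (L n)\<rfloor>) sequentially"
proof -
  have "eventually (\<lambda>n. L n \<ge> M) sequentially" using L_top by (simp add: filterlim_at_top)
  then show ?thesis using eventually_ge_at_top[of 1]
  proof eventually_elim
    case (elim n)
    have "log M (L n) \<ge> 1" using elim M L_pos[of n] by (simp add: le_log_iff)
    then have "\<lfloor>log M (L n)\<rfloor> \<ge> 1" by simp
    then have "int (s n) = \<lfloor>log M (L n)\<rfloor>" by (simp add: s_def)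
    moreover from this have "real (s n) = real_of_int \<lfloor>log M (L n)\<rfloor>" by (metis of_int_of_nat_eq)
    ultimately show ?case using elim floor_correct[of "log M (L n)"] by simp
  qed
qed

lemma xi_eventually: "eventually (\<lambda>n. 0 \<le> \<xi> n \<and> \<xi> n < 1) sequentially"
  using s_eventually by eventually_elim (auto simp: \<xi>_def)

lemma M_powr_s: "eventually (\<lambda>n. M powr real (s n) \<le> L n \<and> L n < M powr (real (s n) + 1)) sequentially"
  using s_eventually
proof eventually_elim
  case (elim n)
  then show ?case using M L_pos[of n] by (simp add: powr_le_iff less_log_iff le_log_iff[symmetric] log_less_iff)
qed

lemma s_mono: "m \<le> n \<Longrightarrow> s m \<le> s n"
proof -
  assume mn: "m \<le> n"
  show ?thesis
  proof (cases "m = 0")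
    \<comment> \<open>Here the logarithm of 0 is 0, so s takes its minimal value 1 at index
      0.\<close>
    case True
    then show ?thesis by (simp add: s_def L_0 log_def)
  next
    case False
    then have "0 < L m" "0 < L n" using L_pos[of m] L_pos[of n] mn by auto
    then have "log M (L m) \<le> log M (L n)" using L_mono[OF mn] M by simp
    then have "\<lfloor>log M (L m)\<rfloor> \<le> \<lfloor>log M (L n)\<rfloor>" by (rule floor_mono)
    then show ?thesis unfolding s_def by (intro nat_mono) auto
  qed
qed

lemma log_top: "filterlim (\<lambda>n. log M (L n)) at_top sequentially"
proof -
  have "filterlim (\<lambda>n. ln (L n)) at_top sequentially" by (rule filterlim_compose[OF ln_at_top L_top])
  then have "filterlim (\<lambda>n. (1 / ln M) * ln (L n)) at_top sequentially"
    using M by (intro filterlim_tendsto_pos_mult_at_top[OF tendsto_const]) auto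
  then show ?thesis by (simp add: log_def)
qed

lemma s_top: "filterlim s at_top sequentially"
proof -
  have "eventually (\<lambda>n. Z \<le> s n) sequentially" for Z
  proof -
    have "eventually (\<lambda>n. log M (L n) \<ge> real Z + 1) sequentially" using log_top by (simp add: filterlim_at_top)
    then show ?thesis using s_eventually by eventually_elim simp
  qed
  then show ?thesis by (simp add: filterlim_at_top)
qed

lemma W_top: "filterlim W at_top sequentially"
proof -
  have "filterlim (\<lambda>n. real n) at_top sequentially" by (rule filterlim_real_sequentially)
  from filterlim_compose[OF this s_top]
  have "filterlim (\<lambda>n. (u + v) * real (s n)) at_top sequentially"
    using u by (intro filterlim_tendsto_pos_mult_at_top[OF tendsto_const]) auto
  moreover have "filterlim (\<lambda>x. M powr x) at_top at_top" using M by real_asymp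
  ultimately show ?thesis unfolding W_def by (rule filterlim_compose[rotated])
qed

text \<open>This is where \<open>psi_fun\<close> comes from: with M^\<xi> = L M^(-s) the level s is
  eliminated in favour of L and \<xi>, and the power L^(u+v) splits off.\<close>

lemma Psi_eq:
  assumes "n \<ge> 1"
  shows "Psi n = L n powr (u + v) * psi_fun M u v (\<xi> n)"
proof -
  have L: "L n > 0" using L_pos assms by simp
  have x: "M powr (c * \<xi> n) = L n powr c * M powr (- c * real (s n))" for c
  proof -
    have "M powr (c * \<xi> n) = (M powr log M (L n)) powr c * M powr (- c * real (s n))"
      using M by (simp add: \<xi>_def powr_powr powr_add[symmetric] algebra_simps)
    then show ?thesis using M L by simp
  qed
  have "L n powr (u + v) * psi_fun M u v (\<xi> n) = L n powr (u + v) *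
     (M powr (- (u + v) * \<xi> n) * (c0 - 1) + M powr (- (u + v) * \<xi> n) * M powr (u * \<xi> n))"
    by (simp add: psi_fun_def c0_def algebra_simps)
  also have "M powr (- (u + v) * \<xi> n) * M powr (u * \<xi> n) = M powr (- v * \<xi> n)"
    by (simp add: powr_add[symmetric] algebra_simps)
  also have "L n powr (u + v) * (M powr (- (u + v) * \<xi> n) * (c0 - 1) + M powr (- v * \<xi> n)) =
     (L n powr (u + v) * L n powr (- (u + v))) * M powr ((u + v) * real (s n)) * (c0 - 1)
     + (L n powr (u + v) * L n powr (- v)) * M powr (v * real (s n))"
    unfolding x by (simp add: algebra_simps)
  also have "\<dots> = Psi n" using L by (simp add: powr_add[symmetric] Psi_def W_def mult.commute)
  finally show ?thesis ..
qed

lemma Psi_ge: "eventually (\<lambda>n. c0 * W n \<le> Psi n) sequentially"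
  using M_powr_s
proof eventually_elim
  case (elim n)
  have "(M powr real (s n)) powr u \<le> L n powr u" using elim u by (intro powr_mono2) auto
  then have "(M powr real (s n)) powr u * M powr (v * real (s n)) \<le> L n powr u * M powr (v * real (s n))"
    by (rule mult_right_mono) simp
  moreover have "(M powr real (s n)) powr u * M powr (v * real (s n)) = W n"
    by (simp add: W_def powr_powr powr_add[symmetric] algebra_simps)
  ultimately show ?case by (simp add: Psi_def algebra_simps)
qed

lemma Psi_top: "filterlim Psi at_top sequentially"
proof -
  have "filterlim (\<lambda>n. c0 * W n) at_top sequentially"
    using c0 by (intro filterlim_tendsto_pos_mult_at_top[OF tendsto_const _ W_top])
  then show ?thesis using Psi_ge by (rule filterlim_at_top_mono)
qed

lemma W_mono: "m \<le> n \<Longrightarrow> W m \<le> W n"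
  unfolding W_def using M u s_mono by (intro powr_mono mult_left_mono) auto

text \<open>As a function of \<open>L\<close> the quantity \<open>Psi\<close> is continuous across a jump of \<open>s\<close>, so the telescoping
  error is controlled by the relative increment of \<open>L\<close>.\<close>

lemma Psi_increment:
  "eventually (\<lambda>n. norm (Psi (Suc n) - Psi n - M powr (v * real (s (Suc n))) * (L (Suc n) powr u - L n powr u))
     \<le> ((L (Suc n) / L n) powr u - 1) * (\<bar>1 - M powr (- v)\<bar> / (1 - M powr (- (u + v)))) * (W (Suc n) - W n)) sequentially"
proof -
  \<comment> \<open>A ratio below M lets s increase by at most one per step, so a single jump has to
    be examined.\<close>
  have "eventually (\<lambda>n. L (Suc n) / L n < M) sequentially" using order_tendstoD(2)[OF L_ratio] M by simp
  then show ?thesis using s_eventually s_eventually[THEN eventually_sequentially_Suc[THEN iffD2]] M_powr_s M_powr_s[THEN eventually_sequentially_Suc[THEN iffD2]]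
  proof eventually_elim
    case (elim n)
    let ?s = "real (s n)"
    have L: "L n > 0" "L (Suc n) > 0" using elim L_pos by auto
    have "log M (L (Suc n)) < log M (M * L n)"
      using elim L M by (subst log_less_cancel_iff) (auto simp: field_simps)
    also have "\<dots> = 1 + log M (L n)" using L M by (simp add: log_mult)
    finally have "real (s (Suc n)) < ?s + 2" using elim by linarith
    then have "s (Suc n) \<le> Suc (s n)" by linarith
    with s_mono[of n "Suc n"] consider "s (Suc n) = s n" | "s (Suc n) = Suc (s n)" by force
    then show ?case
    proof cases
      case 1
      then show ?thesis by (simp add: Psi_def W_def algebra_simps)
    next
      case 2
      let ?a = "M powr ((u + v) * ?s)" and ?U = "M powr u" and ?V = "M powr v"
      have W1: "W (Suc n) = ?a * ?U * ?V" "W n = ?a"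
        by (simp_all add: W_def 2 powr_add[symmetric] algebra_simps)
      have UV: "M powr (u + v) = ?U * ?V" "M powr (- (u + v)) = 1 / (?U * ?V)" "M powr (- v) = 1 / ?V"
        by (simp_all only: powr_add powr_minus minus_add_distrib inverse_eq_divide) simp_all
      have pos: "?U > 0" "?V > 0" using M by auto
      have UV1: "?U * ?V > 1" using M_powr_gt_1 UV by simp
      have c0': "(c0 - 1) * (?U * ?V - 1) = ?U - ?U * ?V" using UV1 by (simp add: c0_def UV(1) field_simps)
      \<comment> \<open>The value of L^u at the jump; it lies between the values of L^u before and
        after the step, so its distance to the former is at most the increment of L^u.\<close>
      define q where "q = M powr (u * real (s (Suc n)))"
      define b where "b = M powr (v * ?s)"
      have qb: "q * b = ?a * ?U" by (simp add: q_def b_def 2 powr_add[symmetric] algebra_simps)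
      have vs: "M powr (v * real (s (Suc n))) = b * ?V" by (simp add: b_def 2 powr_add[symmetric] algebra_simps)
      have "Psi (Suc n) - Psi n - M powr (v * real (s (Suc n))) * (L (Suc n) powr u - L n powr u)
          = L n powr u * b * (?V - 1) + ?a * ((c0 - 1) * (?U * ?V - 1))"
        by (simp add: Psi_def W1 vs b_def[symmetric] algebra_simps)
      also have "?a * ((c0 - 1) * (?U * ?V - 1)) = - (q * b * (?V - 1))"
        unfolding c0' qb by (simp add: algebra_simps)
      also have "L n powr u * b * (?V - 1) + - (q * b * (?V - 1)) = - ((q - L n powr u) * b * (?V - 1))"
        by (simp add: algebra_simps)
      finally have E: "norm (Psi (Suc n) - Psi n - M powr (v * real (s (Suc n))) * (L (Suc n) powr u - L n powr u))
          = \<bar>q - L n powr u\<bar> * b * \<bar>?V - 1\<bar>"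
        using pos by (simp add: abs_mult b_def)
      have q1: "L n powr u \<le> q"
      proof -
        have "L n powr u \<le> (M powr (?s + 1)) powr u" using elim u L by (intro powr_mono2) auto
        then show ?thesis by (simp add: q_def powr_powr 2 mult.commute add.commute)
      qed
      have q2: "q \<le> L (Suc n) powr u"
      proof -
        have "(M powr (real (s (Suc n)))) powr u \<le> L (Suc n) powr u" using elim u by (intro powr_mono2) auto
        then show ?thesis by (simp add: q_def powr_powr mult.commute)
      qed
      let ?r = "(L (Suc n) / L n) powr u - 1"
      have r: "L (Suc n) powr u - L n powr u = L n powr u * ?r"
        using L by (simp add: powr_divide field_simps)
      have "0 \<le> L n powr u * ?r" using q1 q2 r by linarith
      then have r0: "0 \<le> ?r" using L by (simp add: zero_le_mult_iff)
      have "\<bar>q - L n powr u\<bar> \<le> q * ?r"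
        using q1 q2 r mult_right_mono[OF q1 r0] by linarith
      then have "\<bar>q - L n powr u\<bar> * b * \<bar>?V - 1\<bar> \<le> q * ?r * b * \<bar>?V - 1\<bar>"
        by (intro mult_right_mono) (auto simp: b_def)
      also have "\<dots> = ?r * (?a * ?U) * \<bar>?V - 1\<bar>" unfolding qb[symmetric] by (simp add: mult_ac)
      also have "\<dots> = ?r * (\<bar>1 - M powr (- v)\<bar> / (1 - M powr (- (u + v)))) * (W (Suc n) - W n)"
      proof -
        have "\<bar>1 - M powr (- v)\<bar> = \<bar>?V - 1\<bar> / ?V"
          unfolding UV using pos by (simp add: abs_if field_simps)
        moreover have "1 - M powr (- (u + v)) = (?U * ?V - 1) / (?U * ?V)" unfolding UV using pos by (simp add: field_simps)
        moreover have "W (Suc n) - W n = ?a * (?U * ?V - 1)" by (simp add: W1 algebra_simps)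
        moreover have "r * (a * U) * X = r * ((X / V) / ((U * V - 1) / (U * V))) * (a * (U * V - 1))"
          if "U > 0" "V > 0" "U * V > 1" for r a X U V :: real
          using that by (simp add: field_simps)
        ultimately show ?thesis using pos UV1 by (simp only:)
      qed
      finally show ?thesis unfolding E .
    qed
  qed
qed

text \<open>The telescoping errors are o(1) times increments of W, hence they sum to o(W), and W is
  at most a multiple of \<open>Psi\<close>.\<close>

lemma sum_increments_asymp:
  "(\<lambda>n. (\<Sum>k=1..n. (L k powr u - L (k - 1) powr u) * M powr (v * real (s k))) / Psi n) \<longlonglongrightarrow> 1"
proof -
  define E where "E k = Psi k - Psi (k - 1) - M powr (v * real (s k)) * (L k powr u - L (k - 1) powr u)" for k
  define K where "K = \<bar>1 - M powr (- v)\<bar> / (1 - M powr (- (u + v)))"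
  define e where "e k = ((L k / L (k - 1)) powr u - 1) * K" for k
  define d where "d k = W k - W (k - 1)" for k
  have D: "(\<Sum>k=1..n. d k) = W n - W 0" for n unfolding d_def by (rule sum_telescope_from_1)
  have "(\<lambda>n. (L (Suc n) / L n) powr u - 1) \<longlonglongrightarrow> 1 powr u - 1"
    using L_ratio by (intro tendsto_intros) auto
  then have "(\<lambda>n. e (Suc n)) \<longlonglongrightarrow> (1 powr u - 1) * K"
    unfolding e_def by (intro tendsto_mult tendsto_const) simp
  then have e0: "e \<longlonglongrightarrow> 0" by (simp add: filterlim_sequentially_Suc)
  have Ee: "eventually (\<lambda>k. norm (E k) \<le> e k * d k) sequentially"
    using Psi_increment unfolding eventually_sequentially_Suc[symmetric, of "\<lambda>k. norm (E k) \<le> e k * d k"]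
    by (simp add: E_def e_def d_def K_def)
  have Dtop: "filterlim (\<lambda>n. \<Sum>k=1..n. d k) at_top sequentially"
    unfolding D using filterlim_tendsto_add_at_top[OF tendsto_const[of "- W 0"] W_top] by (simp add: add.commute)
  have d0: "0 \<le> d k" for k unfolding d_def using W_mono[of "k - 1" k] by simp
  from sum_negligible[OF d0 Dtop Ee e0]
  have ED: "(\<lambda>n. (\<Sum>k=1..n. E k) / (W n - W 0)) \<longlonglongrightarrow> 0" unfolding D by simp
  have "(\<lambda>n. (\<Sum>k=1..n. E k) / Psi n) \<longlonglongrightarrow> 0"
  proof (rule tendsto_0_le[OF ED, of _ "1 / c0"])
    show "eventually (\<lambda>n. norm ((\<Sum>k=1..n. E k) / Psi n) \<le> norm ((\<Sum>k=1..n. E k) / (W n - W 0)) * (1 / c0)) sequentially"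
      using Psi_ge filterlim_at_top_dense[THEN iffD1, OF W_top, rule_format, of "W 0"]
    proof eventually_elim
      case (elim n)
      have W0: "W 0 > 0" using M by (simp add: W_def)
      have "(W n - W 0) * c0 \<le> Psi n" using elim c0 W0 by (intro order_trans[OF _ elim(1)]) (simp add: algebra_simps)
      moreover have "(W n - W 0) * c0 > 0" using elim c0 by simp
      ultimately have "norm (\<Sum>k=1..n. E k) / \<bar>Psi n\<bar> \<le> norm (\<Sum>k=1..n. E k) / ((W n - W 0) * c0)"
        by (intro divide_left_mono) auto
      then show ?case using elim c0 by (simp add: abs_divide)
    qed
  qed
  moreover have "(\<lambda>n. Psi 0 / Psi n) \<longlonglongrightarrow> 0"
    by (rule tendsto_divide_0[OF tendsto_const]) (rule filterlim_at_top_imp_at_infinity[OF Psi_top])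
  ultimately have lim: "(\<lambda>n. 1 - Psi 0 / Psi n - (\<Sum>k=1..n. E k) / Psi n) \<longlonglongrightarrow> 1 - 0 - 0"
    by (intro tendsto_intros)
  have eq: "(\<Sum>k=1..n. (L k powr u - L (k - 1) powr u) * M powr (v * real (s k))) = Psi n - Psi 0 - (\<Sum>k=1..n. E k)" for n
    unfolding E_def sum_subtractf sum_telescope_from_1[of Psi, unfolded sum_subtractf] by (simp add: mult.commute)
  have "eventually (\<lambda>n. 1 - Psi 0 / Psi n - (\<Sum>k=1..n. E k) / Psi n =
      (\<Sum>k=1..n. (L k powr u - L (k - 1) powr u) * M powr (v * real (s k))) / Psi n) sequentially"
    using filterlim_at_top_dense[THEN iffD1, OF Psi_top, rule_format, of 0]
    by eventually_elim (simp add: eq diff_divide_distrib del: One_nat_def)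
  from Lim_transform_eventually[OF lim this] show ?thesis by simp
qed

text \<open>Weights asymptotic to c times the increments of L^u inherit the asymptotics, since the
  replacement error is o(1) relative to a divergent sum.\<close>

lemma level_sum_asymp:
  fixes w :: "nat \<Rightarrow> real"
  assumes pos: "eventually (\<lambda>k. L (k - 1) < L k) sequentially"
    and w: "(\<lambda>k. w k / (L k powr u - L (k - 1) powr u)) \<longlonglongrightarrow> c"
  shows "(\<lambda>n. (\<Sum>k=1..n. w k * M powr (v * real (s k))) / Psi n) \<longlonglongrightarrow> c"
proof -
  define d where "d k = (L k powr u - L (k - 1) powr u) * M powr (v * real (s k))" for k
  have L0: "0 \<le> L k" for k using L_mono[of 0 k] L_0 by simp
  have d0: "0 \<le> d k" for k unfolding d_def using u L_mono[of "k - 1" k] by (intro mult_nonneg_nonneg) (auto intro!: powr_mono2 simp: L0)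
  have DP: "(\<lambda>n. (\<Sum>k=1..n. d k) / Psi n) \<longlonglongrightarrow> 1" unfolding d_def by (rule sum_increments_asymp)
  have Ppos: "eventually (\<lambda>n. Psi n > 0) sequentially"
    using filterlim_at_top_dense[THEN iffD1, OF Psi_top, rule_format, of 0] .
  have "filterlim (\<lambda>n. (\<Sum>k=1..n. d k) / Psi n * Psi n) at_top sequentially"
    by (rule filterlim_tendsto_pos_mult_at_top[OF DP _ Psi_top]) simp
  then have Dtop: "filterlim (\<lambda>n. \<Sum>k=1..n. d k) at_top sequentially"
    by (rule filterlim_cong[THEN iffD1, OF refl refl, rotated]) (use Ppos in eventually_elim, simp)
  define E where "E k = w k * M powr (v * real (s k)) - c * d k" for k
  have "(\<lambda>n. (1 / (\<Sum>k=1..n. d k)) *\<^sub>R (\<Sum>k=1..n. E k)) \<longlonglongrightarrow> 0"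
  proof (rule sum_negligible[OF d0 Dtop])
    show "(\<lambda>k. \<bar>w k / (L k powr u - L (k - 1) powr u) - c\<bar>) \<longlonglongrightarrow> 0"
      using w by (intro tendsto_rabs_zero) (simp add: LIM_zero_iff)
    show "eventually (\<lambda>k. norm (E k) \<le> \<bar>w k / (L k powr u - L (k - 1) powr u) - c\<bar> * d k) sequentially"
      using pos
    proof eventually_elim
      case (elim k)
      have "L (k - 1) powr u < L k powr u" using elim u L0 by (intro powr_less_mono2) auto
      then have "E k = (w k / (L k powr u - L (k - 1) powr u) - c) * d k"
        by (simp add: E_def d_def field_simps)
      then show ?case using d0[of k] by (simp add: abs_mult)
    qed
  qed
  then have "(\<lambda>n. ((1 / (\<Sum>k=1..n. d k)) *\<^sub>R (\<Sum>k=1..n. E k) + c) * ((\<Sum>k=1..n. d k) / Psi n)) \<longlonglongrightarrow> (0 + c) * 1"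
    by (intro tendsto_intros DP)
  moreover have "eventually (\<lambda>n. ((1 / (\<Sum>k=1..n. d k)) *\<^sub>R (\<Sum>k=1..n. E k) + c) * ((\<Sum>k=1..n. d k) / Psi n)
      = (\<Sum>k=1..n. w k * M powr (v * real (s k))) / Psi n) sequentially"
    using filterlim_at_top_dense[THEN iffD1, OF Dtop, rule_format, of 0]
  proof eventually_elim
    case (elim n)
    have "(\<Sum>k=1..n. E k) = (\<Sum>k=1..n. w k * M powr (v * real (s k))) - c * (\<Sum>k=1..n. d k)"
      by (simp add: E_def sum_subtractf sum_distrib_left)
    then show ?case using elim by (simp add: field_simps)
  qed
  ultimately show ?thesis by (auto intro: Lim_transform_eventually)
qed

end

section \<open>Filtration of the innovations\<close>

text \<open>E is the law of a single innovation, used as a probability space of its own;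
  conditioning on the past amounts to integrating the next innovation over E.\<close>

locale innovations = prob_space P + E: prob_space E
  for P :: "'w measure" and E :: "'e measure" and W :: "nat \<Rightarrow> 'w \<Rightarrow> 'e" +
  assumes W_indep: "indep_vars (\<lambda>_. E) W {1..}" and W_distr: "\<And>n. n \<ge> 1 \<Longrightarrow> distr P E (W n) = E"
begin

text \<open>For n = 0 the union is empty and the sigma-algebra trivial, in line with innovations
  numbered from 1.\<close>

definition Fil :: "nat \<Rightarrow> 'w measure" where
  "Fil n = sigma (space P) (\<Union>i\<in>{1..n}. {W i -` A \<inter> space P | A. A \<in> sets E})"

lemma W_meas [measurable]: "n \<ge> 1 \<Longrightarrow> W n \<in> measurable P E"
  using W_indep by (auto simp: indep_vars_def)

lemma gen_sub: "(\<Union>i\<in>{1..n}. {W i -` A \<inter> space P | A. A \<in> sets E}) \<subseteq> Pow (space P)" by auto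

lemma space_Fil [simp]: "space (Fil n) = space P"
  unfolding Fil_def by (rule space_measure_of[OF gen_sub])

lemma sets_Fil: "sets (Fil n) = sigma_sets (space P) (\<Union>i\<in>{1..n}. {W i -` A \<inter> space P | A. A \<in> sets E})"
  unfolding Fil_def by (rule sets_measure_of[OF gen_sub])

lemma sets_Fil_sub: "sets (Fil n) \<subseteq> sets P"
  unfolding sets_Fil by (rule sets.sigma_sets_subset) auto

lemma sets_Fil_mono: "m \<le> n \<Longrightarrow> sets (Fil m) \<subseteq> sets (Fil n)"
  unfolding sets_Fil by (intro sigma_sets_mono') force

lemma measurable_Fil: "X \<in> measurable (Fil n) N \<Longrightarrow> X \<in> measurable P N"
  using sets_Fil_sub by (auto simp: measurable_def)

lemma measurable_Fil_mono: "m \<le> n \<Longrightarrow> X \<in> measurable (Fil m) N \<Longrightarrow> X \<in> measurable (Fil n) N"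
  using sets_Fil_mono[of m n] by (auto simp: measurable_def)

lemma W_Fil: "1 \<le> i \<Longrightarrow> i \<le> n \<Longrightarrow> W i \<in> measurable (Fil n) E"
proof (rule measurableI)
  fix A assume i: "1 \<le> i" "i \<le> n" and A: "A \<in> sets E"
  then show "W i -` A \<inter> space (Fil n) \<in> sets (Fil n)"
    unfolding sets_Fil space_Fil by (intro sigma_sets.Basic UN_I[of i]) auto
qed (auto intro: measurable_space[OF W_meas])

text \<open>Independence survives the grouping of the indices into {1..n} and {n+1}.\<close>

lemma indep_next:
  assumes A: "A \<in> sets (Fil n)" and B: "B \<in> sets E"
  shows "prob (A \<inter> (W (Suc n) -` B \<inter> space P)) = prob A * measure E B"
proof -
  let ?E = "\<lambda>i. {W i -` A \<inter> space P | A. A \<in> sets E}"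
  let ?I = "case_bool {1..n} {Suc n}"
  have "indep_sets ?E {1..}" using W_indep by (simp add: indep_vars_def2)
  moreover have "?I j \<subseteq> {1..}" for j by (cases j) auto
  then have "(\<Union>j\<in>UNIV. ?I j) \<subseteq> {1..}" by blast
  ultimately have "indep_sets ?E (\<Union>j\<in>UNIV. ?I j)"
    using indep_sets_mono_index by blast
  then have 1: "indep_sets (\<lambda>j. sigma_sets (space P) (\<Union>i\<in>?I j. ?E i)) UNIV"
  proof (rule indep_sets_collect_sigma)
    show "Int_stable (?E i)" for i
    proof (rule Int_stableI)
      fix a b assume "a \<in> ?E i" "b \<in> ?E i"
      then obtain A B where "a = W i -` A \<inter> space P" "b = W i -` B \<inter> space P" "A \<in> sets E" "B \<in> sets E" by blast
      then show "a \<inter> b \<in> ?E i" by (intro CollectI exI[of _ "A \<inter> B"]) auto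
    qed
    show "disjoint_family_on ?I UNIV" by (auto simp: disjoint_family_on_def split: bool.splits)
  qed
  have "indep_set (sets (Fil n)) (sigma_sets (space P) (?E (Suc n)))"
    unfolding indep_set_def
    by (rule indep_sets_mono_sets[OF 1]) (auto simp: sets_Fil split: bool.splits)
  then have "prob (A \<inter> (W (Suc n) -` B \<inter> space P)) = prob A * prob (W (Suc n) -` B \<inter> space P)"
    using A B by (intro indep_setD) auto
  also have "prob (W (Suc n) -` B \<inter> space P) = measure (distr P E (W (Suc n))) B"
    using B by (simp add: measure_distr)
  finally show ?thesis by (simp add: W_distr)
qed

text \<open>Takes the place of conditional expectations: a quantity known at time n and the next
  innovation have a product law, because the two measures agree on rectangles.\<close>

lemma distr_next:
  assumes X: "X \<in> measurable (Fil n) N"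
  shows "distr P (N \<Otimes>\<^sub>M E) (\<lambda>\<omega>. (X \<omega>, W (Suc n) \<omega>)) = distr P N X \<Otimes>\<^sub>M E"
proof -
  note [measurable] = measurable_Fil[OF X]
  interpret X: prob_space "distr P N X" by (rule prob_space_distr) measurable
  show ?thesis
  proof (rule pair_measure_eqI[symmetric])
    fix A B assume A: "A \<in> sets (distr P N X)" and B: "B \<in> sets E"
    have "(\<lambda>\<omega>. (X \<omega>, W (Suc n) \<omega>)) -` (A \<times> B) \<inter> space P = (X -` A \<inter> space P) \<inter> (W (Suc n) -` B \<inter> space P)" by auto
    moreover have "X -` A \<inter> space P \<in> sets (Fil n)" using A measurable_sets[OF X] by simp
    ultimately show "emeasure (distr P N X) A * emeasure E B =
        emeasure (distr P (N \<Otimes>\<^sub>M E) (\<lambda>\<omega>. (X \<omega>, W (Suc n) \<omega>))) (A \<times> B)"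
      using A B indep_next[of "X -` A \<inter> space P" n B]
      by (simp add: emeasure_distr emeasure_eq_measure E.emeasure_eq_measure ennreal_mult'[symmetric])
  qed (auto intro: X.sigma_finite_measure_axioms E.sigma_finite_measure_axioms)
qed

lemma nn_integral_next:
  assumes X: "X \<in> measurable (Fil n) N" and f [measurable]: "f \<in> borel_measurable (N \<Otimes>\<^sub>M E)"
  shows "(\<integral>\<^sup>+\<omega>. f (X \<omega>, W (Suc n) \<omega>) \<partial>P) = (\<integral>\<^sup>+\<omega>. \<integral>\<^sup>+w. f (X \<omega>, w) \<partial>E \<partial>P)"
proof -
  note [measurable] = measurable_Fil[OF X]
  have "(\<integral>\<^sup>+\<omega>. f (X \<omega>, W (Suc n) \<omega>) \<partial>P) = (\<integral>\<^sup>+z. f z \<partial>(distr P N X \<Otimes>\<^sub>M E))"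
    unfolding distr_next[OF X, symmetric] by (subst nn_integral_distr) auto
  also have "\<dots> = (\<integral>\<^sup>+x. \<integral>\<^sup>+w. f (x, w) \<partial>E \<partial>distr P N X)"
    by (rule E.nn_integral_fst[symmetric]) auto
  also have "\<dots> = (\<integral>\<^sup>+\<omega>. \<integral>\<^sup>+w. f (X \<omega>, w) \<partial>E \<partial>P)"
    by (rule nn_integral_distr) auto
  finally show ?thesis .
qed

lemma integral_next:
  fixes f :: "'a \<times> 'e \<Rightarrow> 'b::{banach, second_countable_topology}"
  assumes X: "X \<in> measurable (Fil n) N" and f [measurable]: "f \<in> borel_measurable (N \<Otimes>\<^sub>M E)"
    and B: "\<And>z. norm (f z) \<le> B"
  shows "(\<integral>\<omega>. f (X \<omega>, W (Suc n) \<omega>) \<partial>P) = (\<integral>\<omega>. \<integral>w. f (X \<omega>, w) \<partial>E \<partial>P)"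
proof -
  note [measurable] = measurable_Fil[OF X]
  interpret X: prob_space "distr P N X" by (rule prob_space_distr) measurable
  interpret XE: pair_prob_space "distr P N X" E ..
  have "integrable (distr P N X \<Otimes>\<^sub>M E) f"
    by (rule XE.integrable_const_bound[of _ B]) (auto simp: B)
  then have "(\<integral>x. \<integral>w. f (x, w) \<partial>E \<partial>distr P N X) = (\<integral>z. f z \<partial>(distr P N X \<Otimes>\<^sub>M E))"
    by (rule XE.integral_fst')
  also have "\<dots> = (\<integral>\<omega>. f (X \<omega>, W (Suc n) \<omega>) \<partial>P)"
    unfolding distr_next[OF X, symmetric] by (subst integral_distr) auto
  also have "(\<integral>x. \<integral>w. f (x, w) \<partial>E \<partial>distr P N X) = (\<integral>\<omega>. \<integral>w. f (X \<omega>, w) \<partial>E \<partial>P)"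
    by (rule integral_distr) auto
  finally show ?thesis ..
qed

text \<open>Mixing convergence in the sense of Renyi, extended by a pi-lambda argument. The events
  of finite stages are stable under intersection, and the bound |Y| \<le> 1 makes the tail of a
  disjoint union small uniformly in n. The target is the event of convergence.\<close>

lemma stable_convergence_extend:
  fixes Y :: "nat \<Rightarrow> 'w \<Rightarrow> complex" and z :: complex
  assumes Y [measurable]: "\<And>n. Y n \<in> borel_measurable P" and Y1: "\<And>n \<omega>. norm (Y n \<omega>) \<le> 1"
    and F: "\<And>m G. G \<in> sets (Fil m) \<Longrightarrow> (\<lambda>n. \<integral>\<omega>. indicator G \<omega> * Y n \<omega> \<partial>P) \<longlonglongrightarrow> measure P G * z"
    and G: "G \<in> sigma_sets (space P) (\<Union>m. sets (Fil m))"
  shows "(\<lambda>n. \<integral>\<omega>. indicator G \<omega> * Y n \<omega> \<partial>P) \<longlonglongrightarrow> measure P G * z"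
proof -
  let ?J = "\<lambda>B n. \<integral>\<omega>. indicator B \<omega> * Y n \<omega> \<partial>P"
  let ?S = "\<Union>m. sets (Fil m)"
  have int: "integrable P (\<lambda>\<omega>. indicator G \<omega> * Y n \<omega>)" if "G \<in> sets P" for G n
    using that by (intro integrable_const_bound[of _ 1]) (auto simp: norm_mult indicator_def Y1)
  have nb: "norm (?J B n) \<le> measure P B" if B: "B \<in> sets P" for B n
  proof -
    have "norm (?J B n) \<le> (\<integral>\<omega>. norm (indicator B \<omega> * Y n \<omega>) \<partial>P)"
      by (rule integral_norm_bound)
    also have "\<dots> \<le> (\<integral>\<omega>. indicat_real B \<omega> \<partial>P)"
    proof (rule integral_mono')
      show "integrable P (indicat_real B)" using B by (simp add: emeasure_eq_measure)
    qed (auto simp: norm_mult indicator_def Y1)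
    finally show ?thesis using B by simp
  qed
  have sub: "?S \<subseteq> sets P" using sets_Fil_sub by auto
  have "Int_stable ?S"
  proof (rule Int_stableI)
    fix a b assume "a \<in> ?S" "b \<in> ?S"
    then obtain m n where "a \<in> sets (Fil m)" "b \<in> sets (Fil n)" by auto
    then have "a \<in> sets (Fil (max m n))" "b \<in> sets (Fil (max m n))"
      using sets_Fil_mono[of m "max m n"] sets_Fil_mono[of n "max m n"] by auto
    then show "a \<inter> b \<in> ?S" by blast
  qed
  moreover have "?S \<subseteq> Pow (space P)" using sub sets.sets_into_space by blast
  ultimately show ?thesis using G
  proof (induction rule: sigma_sets_induct_disjoint)
    case (basic A)
    then show ?case using F by auto
  next
    case empty
    then show ?case by simp
  next
    case (compl A)
    then have A: "A \<in> sets P" using sets.sigma_sets_subset[OF sub] by auto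
    have "indicator (space P - A) \<omega> * Y n \<omega> = indicator (space P) \<omega> * Y n \<omega> - indicator A \<omega> * Y n \<omega>" for \<omega> n
      using sets.sets_into_space[OF A] by (auto simp: indicator_def)
    then have "?J (space P - A) n =
        ?J (space P) n - ?J A n" for n
      by (simp add: int[OF A] int[OF sets.top] Bochner_Integration.integral_diff)
    moreover have "(\<lambda>n. ?J (space P) n) \<longlonglongrightarrow> measure P (space P) * z"
      using F[of "space P" 0] sets.top[of "Fil 0"] by simp
    ultimately have "(\<lambda>n. ?J (space P - A) n) \<longlonglongrightarrow> measure P (space P) * z - measure P A * z"
      using compl.IH by (simp add: tendsto_diff)
    then show ?case unfolding prob_compl[OF A] by (simp add: prob_space left_diff_distrib)
  next
    case (union A)
    then have A: "A i \<in> sets P" for i using sets.sigma_sets_subset[OF sub] by auto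
    have sums: "(\<lambda>i. measure P (A i)) sums measure P (\<Union>i. A i)"
      using A union.hyps(1) by (intro finite_measure_UNION) auto
    show ?case
    proof (rule LIMSEQ_I)
      fix r :: real assume r: "r > 0"
      \<comment> \<open>The tail of the union costs q in the integral and q |z| in the limit; both
        stay at most r / 4.\<close>
      define q where "q = (r / 4) / (norm z + 1)"
      have q: "q > 0" using r by (simp add: q_def add_nonneg_pos)
      obtain K where K: "\<bar>(\<Sum>i<K. measure P (A i)) - measure P (\<Union>i. A i)\<bar> < q"
        using LIMSEQ_D[OF sums[unfolded sums_def] q] by (auto)
      define B where "B = (\<Union>i<K. A i)"
      have Bs: "B \<in> sets P" "(\<Union>i. A i) \<in> sets P" using A by (auto simp: B_def)
      have mB: "measure P B = (\<Sum>i<K. measure P (A i))"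
        unfolding B_def using A union.hyps(1) by (intro finite_measure_finite_Union) (auto simp: disjoint_family_on_def)
      have mD: "measure P ((\<Union>i. A i) - B) < q"
        using K Bs mB by (subst finite_measure_Diff) (auto simp: B_def)
      have "(\<lambda>n. \<Sum>i<K. ?J (A i) n) \<longlonglongrightarrow> (\<Sum>i<K. measure P (A i) * z)"
        by (intro tendsto_sum union.IH)
      moreover have "(\<Sum>i<K. ?J (A i) n) = ?J B n" for n
      proof -
        have "indicator B \<omega> = (\<Sum>i<K. indicator (A i) \<omega> :: complex)" for \<omega>
          unfolding B_def using union.hyps(1) by (intro indicator_UN_disjoint) (auto simp: disjoint_family_on_def)
        then have "?J B n = (\<integral>\<omega>. (\<Sum>i<K. indicator (A i) \<omega> * Y n \<omega>) \<partial>P)"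
          by (simp only: sum_distrib_right)
        then show ?thesis by (simp only: Bochner_Integration.integral_sum[OF int[OF A]])
      qed
      moreover have "(\<Sum>i<K. measure P (A i) * z) = measure P B * z" by (simp add: mB sum_distrib_right)
      ultimately have "(\<lambda>n. ?J B n) \<longlonglongrightarrow> measure P B * z" by simp
      from LIMSEQ_D[OF this, of "r / 4"] r obtain n0 where
        n0: "\<And>n. n \<ge> n0 \<Longrightarrow> norm (?J B n - measure P B * z) < r / 4" by auto
      have z1: "norm z + 1 > 0" by (simp add: add_nonneg_pos)
      then have "q * (norm z + 1) = r / 4" unfolding q_def by (metis less_irrefl nonzero_eq_divide_eq)
      then have "q * norm z + q = r / 4" by (simp add: distrib_left)
      moreover have "0 \<le> q * norm z" using q by simp
      ultimately have qr: "q \<le> r / 4" "q * norm z \<le> r / 4" using q by linarith+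
      have "norm (?J (\<Union>i. A i) n - measure P (\<Union>i. A i) * z) < r" if "n \<ge> n0" for n
      proof -
        have "?J (\<Union>i. A i) n - ?J B n
            = ?J ((\<Union>i. A i) - B) n"
          unfolding Bochner_Integration.integral_diff[OF int[OF Bs(2)] int[OF Bs(1)], symmetric]
          by (intro Bochner_Integration.integral_cong) (auto simp: indicator_def B_def)
        also have "norm \<dots> < q" using mD Bs by (intro le_less_trans[OF nb]) auto
        finally have 1: "norm (?J (\<Union>i. A i) n - ?J B n) < q" .
        have "norm (measure P B * z - measure P (\<Union>i. A i) * z) = \<bar>measure P B - measure P (\<Union>i. A i)\<bar> * norm z"
          unfolding left_diff_distrib[symmetric] of_real_diff[symmetric] norm_mult norm_of_real ..
        also have "\<dots> \<le> q * norm z" using K mB by (intro mult_right_mono) auto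
        finally have 2: "norm (measure P B * z - measure P (\<Union>i. A i) * z) \<le> q * norm z" .
        have "norm (?J (\<Union>i. A i) n - measure P (\<Union>i. A i) * z)
          \<le> norm (?J (\<Union>i. A i) n - ?J B n)
            + norm (?J B n - measure P B * z) + norm (measure P B * z - measure P (\<Union>i. A i) * z)"
          by (smt (verit) norm_triangle_ineq add.commute diff_add_cancel norm_minus_commute add_diff_eq)
        then show ?thesis using 1 2 n0[OF that] qr r by linarith
      qed
      then show "\<exists>n0. \<forall>n\<ge>n0. norm (?J (\<Union>i. A i) n - measure P (\<Union>i. A i) * z) < r" by auto
    qed
  qed
qed

end

section \<open>A central limit theorem for averaged stochastic approximation\<close>

text \<open>Countably many radii make the event of convergence measurable.\<close>

lemma LIMSEQ_countable_iff:
  "X \<longlonglongrightarrow> (x :: 'a::metric_space) \<longleftrightarrow> (\<forall>j::nat. \<exists>N. \<forall>n\<ge>N. dist (X n) x < 1 / real (Suc j))"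
proof
  assume R: "\<forall>j::nat. \<exists>N. \<forall>n\<ge>N. dist (X n) x < 1 / real (Suc j)"
  show "X \<longlonglongrightarrow> x"
  proof (rule metric_LIMSEQ_I)
    fix r :: real assume "r > 0"
    then obtain j where "1 / real (Suc j) < r" using nat_approx_posE by blast
    with R show "\<exists>N. \<forall>n\<ge>N. dist (X n) x < r" by (meson less_trans)
  qed
qed (auto intro: metric_LIMSEQ_D simp del: of_nat_Suc)

text \<open>With s the scale of the q-th moment, integration bounds a lower moment by a constant
  times s^p; this plays the part of the monotonicity of L^p norms.\<close>

lemma powr_le_one_plus:
  fixes t s p q :: real
  assumes "0 \<le> t" "0 < s" "0 \<le> p" "p \<le> q"
  shows "t powr p \<le> s powr p * (1 + (t / s) powr q)"
proof -
  have "(t / s) powr p \<le> 1 + (t / s) powr q"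
  proof (cases "t \<le> s")
    case True
    then have "(t / s) powr p \<le> 1" using assms by (intro powr_le1) auto
    then show ?thesis by (simp add: add_increasing2)
  next
    case False
    then have "1 \<le> t / s" using assms by simp
    then have "(t / s) powr p \<le> (t / s) powr q" using assms by (intro powr_mono) auto
    then show ?thesis by simp
  qed
  then have "s powr p * (t / s) powr p \<le> s powr p * (1 + (t / s) powr q)" by (intro mult_left_mono) auto
  then show ?thesis using assms by (simp add: powr_divide)
qed

text \<open>The recursion is demanded only between consecutive visits to the ball, where the
  projection of the concrete scheme is inactive. \<open>\<tau>\<close> is the variance scale of the
  noise, \<open>\<beta>\<close> the size of the bias, \<open>A\<close> the normalisation and
  \<open>A'\<close> the accumulated bias. In \<open>char_step\<close> the errors are the oscillation
  of the covariance near \<open>xs\<close>, its variation over the ball, and the deviation of one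
  increment from a normal law; the squared distance is there to be integrated against the mean
  square error.\<close>

locale stochastic_approximation = innovations P E W
  for P :: "'w measure" and E :: "'e measure" and W :: "nat \<Rightarrow> 'w \<Rightarrow> 'e" +
  fixes \<theta> :: "nat \<Rightarrow> 'w \<Rightarrow> real^'d" and Z :: "nat \<Rightarrow> real^'d \<Rightarrow> 'e \<Rightarrow> real^'d" and m :: "nat \<Rightarrow> real^'d \<Rightarrow> real^'d"
    and xs \<mu> :: "real^'d" and H Hi \<Gamma> :: "real^'d^'d" and Q :: "real^'d \<Rightarrow> real^'d \<Rightarrow> real"
    and r0 \<psi> R \<rho> cQ Cd C\<tau> lam :: real and A A' \<tau> \<beta> :: "nat \<Rightarrow> real" and n0 :: nat
  assumes \<theta>_Fil: "\<And>n. \<theta> n \<in> borel_measurable (Fil n)"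
    and Z_meas [measurable]: "\<And>n. n \<ge> 1 \<Longrightarrow> (\<lambda>(x, w). Z n x w) \<in> borel_measurable (borel \<Otimes>\<^sub>M E)"
    and m_meas [measurable]: "\<And>n. n \<ge> 1 \<Longrightarrow> m n \<in> borel_measurable borel"
    and r0: "r0 > 0"
    and step: "\<And>n \<omega>. \<omega> \<in> space P \<Longrightarrow> \<theta> n \<omega> \<in> cball xs r0 \<Longrightarrow> \<theta> (Suc n) \<omega> \<in> cball xs r0 \<Longrightarrow>
      \<theta> (Suc n) \<omega> = \<theta> n \<omega> + real (Suc n) powr (- \<psi>) *\<^sub>R (m (Suc n) (\<theta> n \<omega>) + Z (Suc n) (\<theta> n \<omega>) (W (Suc n) \<omega>))"
    and Q: "bounded_bilinear Q" "\<And>x y. Q x y = Q y x" "\<And>x. (norm x)\<^sup>2 \<le> Q x x"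
    and cQ: "cQ > 0" and Cd: "Cd > 0" and C\<tau>: "C\<tau> > 0"
    and n0: "n0 \<ge> 1"
    and drift: "\<And>n x. n \<ge> n0 \<Longrightarrow> x \<in> cball xs r0 \<Longrightarrow> Q (x - xs) (m n x) \<le> - cQ * (norm (x - xs))\<^sup>2 + Cd * norm (x - xs) * real n powr (- R)"
      "\<And>n x. n \<ge> n0 \<Longrightarrow> x \<in> cball xs r0 \<Longrightarrow> norm (m n x) \<le> Cd * (norm (x - xs) + real n powr (- R))"
    and Z_int: "\<And>n x. n \<ge> 1 \<Longrightarrow> x \<in> cball xs r0 \<Longrightarrow> integrable E (Z n x)"
      "\<And>n x. n \<ge> 1 \<Longrightarrow> x \<in> cball xs r0 \<Longrightarrow> (\<integral>w. Z n x w \<partial>E) = 0"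
      "\<And>n x. n \<ge> 1 \<Longrightarrow> x \<in> cball xs r0 \<Longrightarrow> integrable E (\<lambda>w. (norm (Z n x w))\<^sup>2)"
      "\<And>n x. n \<ge> 1 \<Longrightarrow> x \<in> cball xs r0 \<Longrightarrow> (\<integral>w. (norm (Z n x w))\<^sup>2 \<partial>E) \<le> C\<tau> * real n powr (1 - 2 * R)"
    and \<psi>: "0 < \<psi>" "\<psi> < 1" and R: "0 < R" "R < \<rho> + 1" "0 < 2 * R + \<psi> - 1"
    and lam: "0 < lam" "lam \<le> 1" "R < (1 + lam) * ((2 * R + \<psi> - 1) / 2)"
    and A: "\<exists>cA>0. eventually (\<lambda>n. cA * real n powr (\<rho> + 1 - R) \<le> A n) sequentially"
    and \<tau>0: "\<And>k. 0 \<le> \<tau> k"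
    and \<tau>: "(\<lambda>n. \<Sum>k=1..n. (real k powr \<rho> / A n)\<^sup>2 * \<tau> k) \<longlonglongrightarrow> 1"
    and char_step: "\<And>u. \<exists>p>0. \<exists>\<delta> C. (\<delta> \<longlonglongrightarrow> 0) \<and> (\<forall>k. 0 \<le> \<delta> k) \<and> (\<forall>\<epsilon>>0. \<exists>C' k0. \<forall>k\<ge>k0. \<forall>x\<in>cball xs r0. \<forall>a.
      norm ((\<integral>w. iexp (a * (u \<bullet> Z k x w)) \<partial>E) - exp (- (a\<^sup>2 * \<tau> k * (u \<bullet> (\<Gamma> *v u)) / 2)))
        \<le> a\<^sup>2 * \<tau> k * (\<epsilon> + C' * (norm (x - xs))\<^sup>2 + C * (a\<^sup>2 * \<tau> k * \<delta> k) powr p))"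
    and psd: "\<And>u. 0 \<le> u \<bullet> (\<Gamma> *v u)"
    and \<beta>: "\<exists>C. \<forall>n\<ge>1. 0 \<le> \<beta> n \<and> \<beta> n \<le> C * real n powr (- R)"
    and remainder: "\<exists>C. \<forall>\<epsilon>>0. \<exists>C' k0. \<forall>k\<ge>k0. \<forall>x\<in>cball xs r0.
      norm (m k x - H *v (x - xs) - \<beta> k *\<^sub>R \<mu>) \<le> C * norm (x - xs) powr (1 + lam) + \<beta> k * (\<epsilon> + C' * (norm (x - xs))\<^sup>2)"
    and A': "(\<lambda>n. ((\<Sum>k=1..n. real k powr \<rho> * \<beta> k) - A' n) / real n powr (\<rho> + 1 - R)) \<longlonglongrightarrow> 0"
    and Hi: "Hi ** H = mat 1"
begin

abbreviation "B \<equiv> cball xs r0"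
text \<open>Exponent of the mean square error: step size n^(-\<psi>) times noise variance
  n^(1-2R).\<close>

definition e :: real where "e = 2 * R + \<psi> - 1"
lemma e: "e > 0" using R by (simp add: e_def)

lemma \<theta>_meas [measurable]: "\<theta> n \<in> borel_measurable P"
  by (rule measurable_Fil[OF \<theta>_Fil])

section \<open>Stopped iterates and their mean square error\<close>

definition inside :: "nat \<Rightarrow> nat \<Rightarrow> 'w \<Rightarrow> bool" where
  "inside N n \<omega> \<longleftrightarrow> N \<le> n \<and> (\<forall>k\<in>{N..n}. \<theta> k \<omega> \<in> B)"

text \<open>After an exit the value is \<open>xs\<close> and not the exit point: the error is then
  zero, the Lyapunov recursion persists as an inequality, and the process never leaves the
  ball.\<close>

definition stopped :: "nat \<Rightarrow> nat \<Rightarrow> 'w \<Rightarrow> real^'d" where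
  "stopped N n \<omega> = (if inside N n \<omega> then \<theta> n \<omega> else xs)"

abbreviation "mse N n \<equiv> \<integral>\<omega>. (norm (stopped N n \<omega> - xs))\<^sup>2 \<partial>P"
abbreviation "mse_rate N \<equiv> \<exists>C>0. \<forall>n\<ge>1. mse N n \<le> C * real n powr (- e)"
abbreviation "moved w N n \<omega> \<equiv> \<Sum>k=Suc N..n. real k powr w *\<^sub>R (stopped N k \<omega> - stopped N (k - 1) \<omega>)"
abbreviation "Q2 x \<equiv> Q x x"

lemma stopped_in_B: "stopped N n \<omega> \<in> B"
  using r0 by (auto simp: stopped_def inside_def)

lemma stopped_Fil: "stopped N n \<in> borel_measurable (Fil n)"
proof -
  note [measurable] = \<theta>_Fil[of n]
  have "Measurable.pred (Fil n) (\<lambda>\<omega>. \<forall>k\<in>{N..n}. \<theta> k \<omega> \<in> B)"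
  proof (rule pred_intros_finite)
    fix k assume "k \<in> {N..n}"
    then have [measurable]: "\<theta> k \<in> borel_measurable (Fil n)" using measurable_Fil_mono[OF _ \<theta>_Fil] by auto
    show "Measurable.pred (Fil n) (\<lambda>\<omega>. \<theta> k \<omega> \<in> B)" unfolding mem_cball by measurable
  qed simp
  then have [measurable]: "Measurable.pred (Fil n) (inside N n)" unfolding inside_def by measurable
  show ?thesis unfolding stopped_def by measurable
qed

lemma stopped_meas [measurable]: "stopped N n \<in> borel_measurable P"
  by (rule measurable_Fil[OF stopped_Fil])

lemma Q_bound: obtains KQ where "KQ > 0" "\<And>x. Q x x \<le> KQ * (norm x)\<^sup>2" "\<And>x y. \<bar>Q x y\<bar> \<le> KQ * norm x * norm y"
proof -
  obtain K where "K > 0" "\<And>x y. norm (Q x y) \<le> norm x * norm y * K" using bounded_bilinear.pos_bounded[OF Q(1)] by blast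
  then show ?thesis by (intro that[of K]) (auto simp: power2_eq_square mult_ac abs_le_iff)
qed

lemma Q_meas [measurable]: "f \<in> borel_measurable N \<Longrightarrow> g \<in> borel_measurable N \<Longrightarrow> (\<lambda>x. Q (f x) (g x)) \<in> borel_measurable N"
proof -
  assume [measurable]: "f \<in> borel_measurable N" "g \<in> borel_measurable N"
  have "continuous_on UNIV (\<lambda>z. Q (fst z) (snd z))"
    by (intro bounded_bilinear.continuous_on[OF Q(1)] continuous_intros)
  from borel_measurable_continuous_on[OF this, of "\<lambda>x. (f x, g x)" N]
  show ?thesis by simp
qed

text \<open>The term linear in the noise is centred and the drift contracts at rate 2 cQ. Half of
  that is given up, to Young's inequality for the bias and to the square of the drift.\<close>

lemma one_step:
  "\<exists>N0 C. N0 \<ge> 1 \<and> C > 0 \<and> (\<forall>n\<ge>N0. \<forall>x\<in>B.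
      (\<integral>\<^sup>+w. ennreal (Q2 (x - xs + real n powr (- \<psi>) *\<^sub>R (m n x + Z n x w))) \<partial>E)
        \<le> ennreal (Q (x - xs) (x - xs) - cQ * real n powr (- \<psi>) * (norm (x - xs))\<^sup>2 + C * real n powr (- \<psi> - e)))"
proof -
  obtain KQ where KQ: "KQ > 0" "\<And>x. Q x x \<le> KQ * (norm x)\<^sup>2" "\<And>x y. \<bar>Q x y\<bar> \<le> KQ * norm x * norm y"
    using Q_bound by blast
  interpret Q: bounded_bilinear Q by (rule Q(1))
  have "(\<lambda>n. real n powr (- \<psi>)) \<longlonglongrightarrow> 0" using \<psi> by real_asymp
  \<comment> \<open>The threshold makes the squared drift cost at most cQ/2 of the
    contraction.\<close>
  from order_tendstoD(2)[OF this, of "cQ / (4 * KQ * Cd\<^sup>2)"] cQ KQ Cd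
  have "eventually (\<lambda>n. real n powr (- \<psi>) < cQ / (4 * KQ * Cd\<^sup>2)) sequentially" by simp
  then obtain N1 where N1: "\<And>n. n \<ge> N1 \<Longrightarrow> real n powr (- \<psi>) < cQ / (4 * KQ * Cd\<^sup>2)"
    by (auto simp: eventually_sequentially)
  \<comment> \<open>In this order: Young's inequality for the bias, the squared bias inside the
    drift, and the variance of the noise.\<close>
  define C where "C = 2 * Cd\<^sup>2 / cQ + 2 * KQ * Cd\<^sup>2 + KQ * C\<tau>"
  have C: "C > 0" using Cd cQ KQ C\<tau> by (auto simp: C_def intro!: add_pos_pos)
  show ?thesis
  proof (intro exI[of _ "max n0 N1"] exI[of _ C] conjI allI ballI impI)
    fix n x assume n: "max n0 N1 \<le> n" and x: "x \<in> B"
    define g where "g = real n powr (- \<psi>)"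
    define t where "t = real n powr (- R)"
    define y where "y = x - xs"
    define mm where "mm = m n x"
    have n1: "n \<ge> 1" "n \<ge> n0" using n n0 by auto
    have g: "0 < g" "g \<le> 1" using n1 \<psi> by (auto simp: g_def powr_minus field_simps intro: ge_one_powr_ge_zero)
    have t: "t > 0" using n1 by (simp add: t_def)
    have gs: "4 * KQ * Cd\<^sup>2 * g \<le> cQ" using N1[of n] n KQ Cd by (simp add: g_def field_simps)
    have d1: "Q y mm \<le> - cQ * (norm y)\<^sup>2 + Cd * norm y * t" and d2: "norm mm \<le> Cd * (norm y + t)"
      using drift[OF n1(2) x] by (simp_all add: y_def mm_def t_def)
    have int: "integrable E (Z n x)" "(\<integral>w. Z n x w \<partial>E) = 0" "integrable E (\<lambda>w. (norm (Z n x w))\<^sup>2)"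
       "(\<integral>w. (norm (Z n x w))\<^sup>2 \<partial>E) \<le> C\<tau> * real n powr (1 - 2 * R)" using Z_int[OF n1(1) x] by auto
    have [measurable]: "Z n x \<in> borel_measurable E" using int(1) by auto
    have iQ: "integrable E (\<lambda>w. Q2 (Z n x w))"
      by (rule Bochner_Integration.integrable_bound[OF integrable_mult_right[OF int(3), of KQ]])
        (use KQ(3) KQ(1) in \<open>auto simp: power2_eq_square abs_mult mult.assoc\<close>)
    have Q1: "integrable E (\<lambda>w. Q (y + g *\<^sub>R mm) (Z n x w))" "(\<integral>w. Q (y + g *\<^sub>R mm) (Z n x w) \<partial>E) = 0"
      using integrable_bounded_linear[OF Q.bounded_linear_right int(1)]
        integral_bounded_linear[OF Q.bounded_linear_right int(1), of "y + g *\<^sub>R mm"] int(2) by (auto simp: Q.zero_right)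
    have expand: "Q2 (y + g *\<^sub>R (mm + z)) =
        Q2 (y + g *\<^sub>R mm) + (2 * g) * Q (y + g *\<^sub>R mm) z + g\<^sup>2 * Q z z" for z
      by (simp add: Q.add_left Q.add_right Q.scaleR_left Q.scaleR_right scaleR_add_right
          Q(2)[of mm y] Q(2)[of z y] Q(2)[of z mm] power2_eq_square algebra_simps)
    have "(\<integral>\<^sup>+w. ennreal (Q2 (y + g *\<^sub>R (mm + Z n x w))) \<partial>E)
        = ennreal (\<integral>w. Q2 (y + g *\<^sub>R (mm + Z n x w)) \<partial>E)"
    proof (rule nn_integral_eq_integral)
      show "integrable E (\<lambda>w. Q2 (y + g *\<^sub>R (mm + Z n x w)))"
        unfolding expand using iQ Q1 by auto
      show "AE w in E. 0 \<le> Q2 (y + g *\<^sub>R (mm + Z n x w))"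
        using Q(3) by (auto intro: order_trans[OF zero_le_power2])
    qed
    also have "(\<integral>w. Q2 (y + g *\<^sub>R (mm + Z n x w)) \<partial>E)
        = Q2 (y + g *\<^sub>R mm) + g\<^sup>2 * (\<integral>w. Q2 (Z n x w) \<partial>E)"
      unfolding expand using iQ Q1 by (simp add: E.prob_space)
    also have "\<dots> \<le> Q y y - cQ * g * (norm y)\<^sup>2 + C * real n powr (- \<psi> - e)"
    proof -
      have "(\<integral>w. Q2 (Z n x w) \<partial>E) \<le> (\<integral>w. KQ * (norm (Z n x w))\<^sup>2 \<partial>E)"
        by (intro Bochner_Integration.integral_mono iQ KQ) (use int in auto)
      also have "\<dots> \<le> KQ * (C\<tau> * real n powr (1 - 2 * R))"
        using int(4) KQ(1) by (simp add: mult_left_mono)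
      finally have q1: "g\<^sup>2 * (\<integral>w. Q2 (Z n x w) \<partial>E) \<le> g\<^sup>2 * (KQ * (C\<tau> * real n powr (1 - 2 * R)))"
        by (rule mult_left_mono) simp
      have g2: "g\<^sup>2 * real n powr (1 - 2 * R) = real n powr (- \<psi> - e)"
        using n1 by (simp add: g_def e_def power2_eq_square powr_add[symmetric])
      \<comment> \<open>Here \<psi> < 1 enters: it gives e \<le> 2R.\<close>
      have gt: "g * t\<^sup>2 \<le> real n powr (- \<psi> - e)"
      proof -
        have "g * t\<^sup>2 = real n powr (- \<psi> - 2 * R)"
          using n1 by (simp add: g_def t_def power2_eq_square powr_add[symmetric])
        also have "\<dots> \<le> real n powr (- \<psi> - e)" using n1 \<psi> by (intro powr_mono) (auto simp: e_def)
        finally show ?thesis .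
      qed
      have q2: "Q2 (y + g *\<^sub>R mm) = Q y y + g * (2 * Q y mm) + g\<^sup>2 * Q mm mm"
        by (simp add: Q.add_left Q.add_right Q.scaleR_left Q.scaleR_right Q(2)[of mm y] power2_eq_square algebra_simps)
      have q3: "Q mm mm \<le> 2 * KQ * Cd\<^sup>2 * ((norm y)\<^sup>2 + t\<^sup>2)"
      proof -
        have "(norm mm)\<^sup>2 \<le> (Cd * (norm y + t))\<^sup>2" using d2 by (rule power_mono) simp
        also have "\<dots> \<le> Cd\<^sup>2 * (2 * ((norm y)\<^sup>2 + t\<^sup>2))"
          unfolding power_mult_distrib using sum_squares_bound[of "norm y" t]
          by (intro mult_left_mono) (auto simp: power2_sum)
        finally have "KQ * (norm mm)\<^sup>2 \<le> KQ * (Cd\<^sup>2 * (2 * ((norm y)\<^sup>2 + t\<^sup>2)))" using KQ(1) by (intro mult_left_mono) auto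
        then show ?thesis using KQ(2)[of mm] by (simp add: algebra_simps)
      qed
      have "2 * Cd * norm y * t \<le> cQ / 2 * (norm y)\<^sup>2 + 2 * Cd\<^sup>2 / cQ * t\<^sup>2"
      proof -
        have "0 \<le> (cQ * norm y - 2 * Cd * t)\<^sup>2" by simp
        then have "2 * (2 * Cd * norm y * t) * cQ \<le> (cQ * norm y)\<^sup>2 + (2 * Cd * t)\<^sup>2"
          by (simp add: power2_diff algebra_simps)
        then show ?thesis using cQ by (simp add: field_simps power2_eq_square)
      qed
      then have q4: "2 * Q y mm \<le> - (3 / 2) * cQ * (norm y)\<^sup>2 + 2 * Cd\<^sup>2 / cQ * t\<^sup>2"
        using d1 by (simp add: algebra_simps)
      have "g * (2 * Q y mm) + g\<^sup>2 * Q mm mm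
          \<le> g * (- (3 / 2) * cQ * (norm y)\<^sup>2 + 2 * Cd\<^sup>2 / cQ * t\<^sup>2) + g\<^sup>2 * (2 * KQ * Cd\<^sup>2 * ((norm y)\<^sup>2 + t\<^sup>2))"
        using q3 q4 g by (intro add_mono mult_left_mono) auto
      also have "\<dots> = g * (- (3 / 2) * cQ * (norm y)\<^sup>2 + 2 * Cd\<^sup>2 / cQ * t\<^sup>2 + (2 * KQ * Cd\<^sup>2 * g) * (norm y)\<^sup>2 + (2 * KQ * Cd\<^sup>2 * g) * t\<^sup>2)"
        by (simp add: power2_eq_square algebra_simps)
      also have "\<dots> \<le> g * (- (3 / 2) * cQ * (norm y)\<^sup>2 + 2 * Cd\<^sup>2 / cQ * t\<^sup>2 + (cQ / 2) * (norm y)\<^sup>2 + (2 * KQ * Cd\<^sup>2) * t\<^sup>2)"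
      proof -
        have "(2 * KQ * Cd\<^sup>2 * g) * (norm y)\<^sup>2 \<le> (cQ / 2) * (norm y)\<^sup>2"
          using gs by (intro mult_right_mono) auto
        moreover have "(2 * KQ * Cd\<^sup>2 * g) * t\<^sup>2 \<le> (2 * KQ * Cd\<^sup>2) * t\<^sup>2"
          using g KQ(1) by (intro mult_right_mono mult_left_le) auto
        ultimately show ?thesis using g by (intro mult_left_mono add_mono order_refl) auto
      qed
      also have "\<dots> = - cQ * g * (norm y)\<^sup>2 + (2 * Cd\<^sup>2 / cQ + 2 * KQ * Cd\<^sup>2) * (g * t\<^sup>2)"
        by (simp add: algebra_simps)
      also have "\<dots> \<le> - cQ * g * (norm y)\<^sup>2 + (2 * Cd\<^sup>2 / cQ + 2 * KQ * Cd\<^sup>2) * real n powr (- \<psi> - e)"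
        using gt cQ KQ(1) by (intro add_left_mono mult_left_mono) auto
      finally have q5: "g * (2 * Q y mm) + g\<^sup>2 * Q mm mm \<le> - cQ * g * (norm y)\<^sup>2 + (2 * Cd\<^sup>2 / cQ + 2 * KQ * Cd\<^sup>2) * real n powr (- \<psi> - e)" .
      have "g\<^sup>2 * (KQ * (C\<tau> * real n powr (1 - 2 * R))) = KQ * C\<tau> * real n powr (- \<psi> - e)"
        unfolding g2[symmetric] by (simp add: mult_ac)
      then have "g\<^sup>2 * (\<integral>w. Q2 (Z n x w) \<partial>E) \<le> KQ * C\<tau> * real n powr (- \<psi> - e)" using q1 by (simp only:)
      then show ?thesis using q5 unfolding q2 C_def distrib_right by linarith
    qed
    finally show "(\<integral>\<^sup>+w. ennreal (Q2 (x - xs + real n powr (- \<psi>) *\<^sub>R (m n x + Z n x w))) \<partial>E)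
        \<le> ennreal (Q (x - xs) (x - xs) - cQ * real n powr (- \<psi>) * (norm (x - xs))\<^sup>2 + C * real n powr (- \<psi> - e))"
      by (simp add: y_def g_def mm_def ennreal_leI)
  qed (use C n0 in auto)
qed

lemma stopped_norm: "norm (stopped N n \<omega> - xs) \<le> r0"
  using stopped_in_B[of N n \<omega>] by (simp add: dist_norm norm_minus_commute)

lemma stopped_step:
  assumes "\<omega> \<in> space P" "N \<le> n" "inside N (Suc n) \<omega>"
  shows "stopped N (Suc n) \<omega> = stopped N n \<omega> +
    real (Suc n) powr (- \<psi>) *\<^sub>R (m (Suc n) (stopped N n \<omega>) + Z (Suc n) (stopped N n \<omega>) (W (Suc n) \<omega>))"
proof -
  have "inside N n \<omega>" "\<theta> n \<omega> \<in> B" "\<theta> (Suc n) \<omega> \<in> B" using assms by (auto simp: inside_def)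
  then show ?thesis using step[OF assms(1)] assms(3) by (simp add: stopped_def)
qed

text \<open>After an exit the left side vanishes while the right side is nonnegative, so the
  one-step bound survives the stopping. Comparing Q with the squared norm turns it into a
  Robbins-Monro recursion for the mean of Q.\<close>

lemma stopped_second_moment:
  obtains N0 where "N0 \<ge> 1" "\<And>N. N \<ge> N0 \<Longrightarrow> mse_rate N"
proof -
  obtain KQ where KQ: "KQ > 0" "\<And>x. Q x x \<le> KQ * (norm x)\<^sup>2" "\<And>x y. \<bar>Q x y\<bar> \<le> KQ * norm x * norm y"
    using Q_bound by blast
  obtain N0 C where C: "N0 \<ge> 1" "C > 0" and one: "\<And>n x. n \<ge> N0 \<Longrightarrow> x \<in> B \<Longrightarrow>
      (\<integral>\<^sup>+w. ennreal (Q2 (x - xs + real n powr (- \<psi>) *\<^sub>R (m n x + Z n x w))) \<partial>E)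
        \<le> ennreal (Q (x - xs) (x - xs) - cQ * real n powr (- \<psi>) * (norm (x - xs))\<^sup>2 + C * real n powr (- \<psi> - e))"
    using one_step by blast
  have "(\<lambda>n. cQ / KQ * real n powr (- \<psi>)) \<longlonglongrightarrow> 0" using \<psi> by real_asymp
  from order_tendstoD(2)[OF this, of 1]
  obtain N2 where N2: "\<And>n. n \<ge> N2 \<Longrightarrow> cQ / KQ * real n powr (- \<psi>) \<le> 1"
    by (auto simp: eventually_sequentially intro: less_imp_le)
  show ?thesis
  proof (rule that[of "max N0 N2"])
    show "1 \<le> max N0 N2" using C(1) by simp
    fix N assume "N \<ge> max N0 N2"
    then have N: "N \<ge> N0" "N \<ge> N2" by auto
    define v where "v n = (\<integral>\<omega>. Q2 (stopped N n \<omega> - xs) \<partial>P)" for n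
    have Q0: "0 \<le> Q x x" for x using order_trans[OF zero_le_power2 Q(3)] .
    have iQ: "integrable P (\<lambda>\<omega>. Q2 (stopped N n \<omega> - xs))" for n
    proof (rule integrable_const_bound[of _ "KQ * r0\<^sup>2"])
      show "AE \<omega> in P. norm (Q2 (stopped N n \<omega> - xs)) \<le> KQ * r0\<^sup>2"
        using KQ Q0 stopped_norm by (auto intro!: AE_I2 order_trans[OF KQ(2)] mult_left_mono power_mono)
    qed measurable
    have in2: "integrable P (\<lambda>\<omega>. (norm (stopped N n \<omega> - xs))\<^sup>2)" for n
      by (rule integrable_const_bound[of _ "r0\<^sup>2"]) (auto intro!: AE_I2 power_mono stopped_norm)
    have v0: "0 \<le> v n" for n unfolding v_def by (rule Bochner_Integration.integral_nonneg) (rule Q0)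
    have rec: "v (Suc n) \<le> (1 - cQ / KQ * real (Suc n) powr (- \<psi>)) * v n + C * real (Suc n) powr (- \<psi> - e)" if n: "n \<ge> N" for n
    proof -
      let ?g = "real (Suc n) powr (- \<psi>)"
      let ?f = "\<lambda>(x, w). Q2 (x - xs + ?g *\<^sub>R (m (Suc n) x + Z (Suc n) x w))"
      let ?D = "C * real (Suc n) powr (- \<psi> - e)"
      have fm: "(\<lambda>z. ennreal (?f z)) \<in> borel_measurable (borel \<Otimes>\<^sub>M E)" by measurable auto
      have "ennreal (v (Suc n)) = (\<integral>\<^sup>+\<omega>. ennreal (Q2 (stopped N (Suc n) \<omega> - xs)) \<partial>P)"
        unfolding v_def by (rule nn_integral_eq_integral[symmetric, OF iQ]) (simp add: Q0)
      also have "\<dots> \<le> (\<integral>\<^sup>+\<omega>. ennreal (?f (stopped N n \<omega>, W (Suc n) \<omega>)) \<partial>P)"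
      proof (intro nn_integral_mono ennreal_leI)
        fix \<omega> assume \<omega>: "\<omega> \<in> space P"
        show "Q2 (stopped N (Suc n) \<omega> - xs) \<le> ?f (stopped N n \<omega>, W (Suc n) \<omega>)"
        proof (cases "inside N (Suc n) \<omega>")
          case True
          show ?thesis by (simp add: stopped_step[OF \<omega> n True] algebra_simps)
        next
          case False
          then have "stopped N (Suc n) \<omega> = xs" by (simp add: stopped_def)
          then show ?thesis by (simp add: bounded_bilinear.zero_left[OF Q(1)] Q0)
        qed
      qed
      also have "\<dots> = (\<integral>\<^sup>+\<omega>. \<integral>\<^sup>+w. ennreal (?f (stopped N n \<omega>, w)) \<partial>E \<partial>P)"
        by (rule nn_integral_next[OF stopped_Fil fm])
      also have "\<dots> \<le> (\<integral>\<^sup>+\<omega>. ennreal (Q2 (stopped N n \<omega> - xs) - cQ * ?g * (norm (stopped N n \<omega> - xs))\<^sup>2 + ?D) \<partial>P)"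
        using one[OF _ stopped_in_B, of "Suc n"] n N by (intro nn_integral_mono) simp
      also have "\<dots> \<le> (\<integral>\<^sup>+\<omega>. ennreal ((1 - cQ / KQ * ?g) * Q2 (stopped N n \<omega> - xs) + ?D) \<partial>P)"
      proof (intro nn_integral_mono ennreal_leI)
        fix \<omega>
        let ?y = "stopped N n \<omega> - xs"
        have "cQ / KQ * ?g * Q ?y ?y \<le> cQ / KQ * ?g * (KQ * (norm ?y)\<^sup>2)"
          using cQ KQ by (intro mult_left_mono) auto
        also have "\<dots> = cQ * ?g * (norm ?y)\<^sup>2" using KQ(1) by simp
        finally show "Q ?y ?y - cQ * ?g * (norm ?y)\<^sup>2 + ?D \<le> (1 - cQ / KQ * ?g) * Q ?y ?y + ?D"
          by (simp add: left_diff_distrib)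
      qed
      finally have le: "ennreal (v (Suc n)) \<le> (\<integral>\<^sup>+\<omega>. ennreal ((1 - cQ / KQ * ?g) * Q2 (stopped N n \<omega> - xs) + ?D) \<partial>P)" .
      have g1: "cQ / KQ * ?g \<le> 1" using N2[of "Suc n"] n N by simp
      have "0 \<le> ?D" using C by simp
      then have "(\<integral>\<^sup>+\<omega>. ennreal ((1 - cQ / KQ * ?g) * Q2 (stopped N n \<omega> - xs) + ?D) \<partial>P)
          = ennreal (\<integral>\<omega>. (1 - cQ / KQ * ?g) * Q2 (stopped N n \<omega> - xs) + ?D \<partial>P)"
        using iQ g1 Q0 by (intro nn_integral_eq_integral) (auto intro!: AE_I2 add_nonneg_nonneg)
      also have "(\<integral>\<omega>. (1 - cQ / KQ * ?g) * Q2 (stopped N n \<omega> - xs) + ?D \<partial>P)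
          = (1 - cQ / KQ * ?g) * v n + ?D"
        using iQ by (simp add: v_def prob_space)
      finally have "ennreal (v (Suc n)) \<le> ennreal ((1 - cQ / KQ * ?g) * v n + ?D)" using le by simp
      then show ?thesis using g1 v0 \<open>0 \<le> ?D\<close> by (subst (asm) ennreal_le_iff) (auto intro!: add_nonneg_nonneg)
    qed
    have "cQ / KQ > 0" using cQ KQ by simp
    from robbins_monro_recursion[OF \<psi> this e v0 rec] obtain C' where
      C': "C' > 0" "\<And>n. n \<ge> 1 \<Longrightarrow> v n \<le> C' * real n powr (- e)" by blast
    have "mse N n \<le> v n" for n
      unfolding v_def by (intro Bochner_Integration.integral_mono in2 iQ Q(3))
    then show "mse_rate N"
      using C' by (meson order_trans)
  qed
qed

text \<open>The innovation is evaluated at the stopped iterate, that is at \<open>xs\<close> after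
  an exit. The noise is never switched off, so the normalised sum keeps its full variance on the
  whole space.\<close>

definition incr :: "nat \<Rightarrow> nat \<Rightarrow> 'w \<Rightarrow> real^'d" where
  "incr N k \<omega> = Z k (stopped N (k - 1) \<omega>) (W k \<omega>)"

text \<open>A triangular array: n fixes the normalisation and j is the time, so that the induction
  over time runs within one row; the limit concerns j = n.\<close>

definition partial_S :: "nat \<Rightarrow> nat \<Rightarrow> nat \<Rightarrow> 'w \<Rightarrow> real^'d" where
  "partial_S N n j \<omega> = (1 / A n) *\<^sub>R (\<Sum>k=Suc N..j. real k powr \<rho> *\<^sub>R incr N k \<omega>)"

lemma incr_Fil: "k \<ge> 1 \<Longrightarrow> incr N k \<in> borel_measurable (Fil k)"
proof -
  assume k: "k \<ge> 1"
  have [measurable]: "stopped N (k - 1) \<in> borel_measurable (Fil k)" "W k \<in> measurable (Fil k) E"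
    using measurable_Fil_mono[OF _ stopped_Fil, of "k - 1" k] W_Fil[of k k] k by auto
  have "(\<lambda>\<omega>. (\<lambda>(x, w). Z k x w) (stopped N (k - 1) \<omega>, W k \<omega>)) \<in> borel_measurable (Fil k)"
    using Z_meas[OF k] by (rule measurable_compose[rotated]) measurable
  then show ?thesis by (simp add: incr_def[abs_def])
qed

lemma partial_S_Fil: "partial_S N n j \<in> borel_measurable (Fil j)"
proof -
  have [measurable]: "incr N k \<in> borel_measurable (Fil j)" if "k \<in> {Suc N..j}" for k
    using measurable_Fil_mono[OF _ incr_Fil, of k j] that by auto
  have "(\<lambda>\<omega>. \<Sum>k=Suc N..j. real k powr \<rho> *\<^sub>R incr N k \<omega>) \<in> borel_measurable (Fil j)"
    by (intro borel_measurable_sum borel_measurable_scaleR borel_measurable_const) simp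
  then show ?thesis unfolding partial_S_def by measurable
qed

lemma partial_S_meas [measurable]: "partial_S N n j \<in> borel_measurable P"
  by (rule measurable_Fil[OF partial_S_Fil])

lemma A_top: "filterlim A at_top sequentially"
proof -
  obtain cA where cA: "cA > 0" "eventually (\<lambda>n. cA * real n powr (\<rho> + 1 - R) \<le> A n) sequentially" using A by blast
  have "filterlim (\<lambda>n. cA * real n powr (\<rho> + 1 - R)) at_top sequentially" using cA(1) R by real_asymp
  then show ?thesis using cA(2) by (rule filterlim_at_top_mono)
qed

lemma A_inverse: "(\<lambda>n. c / A n) \<longlonglongrightarrow> 0"
  by (rule tendsto_divide_0[OF tendsto_const filterlim_at_top_imp_at_infinity[OF A_top]])

lemma over_A:
  assumes "(\<lambda>n. f n / real n powr (\<rho> + 1 - R)) \<longlonglongrightarrow> 0"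
  shows "(\<lambda>n. f n / A n) \<longlonglongrightarrow> (0::real)"
proof -
  obtain cA where cA: "cA > 0" "eventually (\<lambda>n. cA * real n powr (\<rho> + 1 - R) \<le> A n) sequentially" using A by blast
  show ?thesis
  proof (rule tendsto_0_le[OF assms, of _ "1 / cA"])
    show "eventually (\<lambda>n. norm (f n / A n) \<le> norm (f n / real n powr (\<rho> + 1 - R)) * (1 / cA)) sequentially"
      using cA(2) eventually_ge_at_top[of 1]
    proof eventually_elim
      case (elim n)
      have p: "cA * real n powr (\<rho> + 1 - R) > 0" using cA elim by simp
      then have A0: "A n > 0" using elim by linarith
      from p have "\<bar>f n\<bar> / A n \<le> \<bar>f n\<bar> / (cA * real n powr (\<rho> + 1 - R))"
        using elim by (intro divide_left_mono) auto
      then show ?case using p A0 cA by (simp add: abs_divide mult.commute)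
    qed
  qed
qed

text \<open>Share of the k-th increment in the total variance of row n; these weights are
  deterministic.\<close>

definition c :: "nat \<Rightarrow> nat \<Rightarrow> real" where "c n k = (real k powr \<rho> / A n)\<^sup>2 * \<tau> k"

lemma c_nonneg: "0 \<le> c n k" by (simp add: c_def \<tau>0)

lemma c_sum: "(\<lambda>n. \<Sum>k=1..n. c n k) \<longlonglongrightarrow> 1" using \<tau> by (simp add: c_def)

lemma c_sum_bound: obtains Cs where "Cs > 0" "\<And>n. (\<Sum>k=1..n. c n k) \<le> Cs" "\<And>n k. 1 \<le> k \<Longrightarrow> k \<le> n \<Longrightarrow> c n k \<le> Cs"
proof -
  from convergent_imp_Bseq[OF convergentI[OF c_sum]]
  obtain Cs where Cs: "Cs > 0" "\<And>n. \<bar>\<Sum>k=1..n. c n k\<bar> \<le> Cs" by (auto simp: Bseq_def)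
  have 1: "(\<Sum>k=1..n. c n k) \<le> Cs" for n using Cs(2)[of n] by linarith
  have "c n k \<le> Cs" if "1 \<le> k" "k \<le> n" for n k
    using member_le_sum[of k "{1..n}" "c n"] that 1[of n] c_nonneg by auto
  with 1 Cs(1) that show ?thesis by blast
qed

lemma c_zero: "(\<lambda>n. c n k) \<longlonglongrightarrow> 0"
proof -
  have "(\<lambda>n. (real k powr \<rho> / A n)\<^sup>2 * \<tau> k) \<longlonglongrightarrow> 0\<^sup>2 * \<tau> k"
    by (intro tendsto_intros A_inverse)
  then show ?thesis by (simp add: c_def)
qed

lemma c_tail_sum: "(\<lambda>n. \<Sum>k=Suc l..n. c n k) \<longlonglongrightarrow> 1"
proof -
  have "(\<lambda>n. \<Sum>k=1..l. c n k) \<longlonglongrightarrow> (\<Sum>k=1..l. 0)" by (intro tendsto_sum c_zero)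
  then have lim: "(\<lambda>n. (\<Sum>k=1..n. c n k) - (\<Sum>k=1..l. c n k)) \<longlonglongrightarrow> 1 - 0" by (intro tendsto_diff c_sum) simp
  have "(\<Sum>k=1..n. c n k) - (\<Sum>k=1..l. c n k) = (\<Sum>k=Suc l..n. c n k)" if "n \<ge> l" for n
    using sum.ub_add_nat[of 1 l "c n" "n - l"] that by simp
  then have "eventually (\<lambda>n. (\<Sum>k=1..n. c n k) - (\<Sum>k=1..l. c n k) = (\<Sum>k=Suc l..n. c n k)) sequentially"
    by (intro eventually_sequentiallyI[of l])
  from Lim_transform_eventually[OF lim this] show ?thesis by simp
qed

abbreviation "char_on G u Y \<equiv> \<integral>\<omega>. indicator G \<omega> * iexp (u \<bullet> Y \<omega>) \<partial>P"

text \<open>The past factor and the conditional characteristic function separate under the product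
  law. If the latter is close to a constant q at each state, then multiplication by q is correct up
  to the mean of the distance, which is where the mean square error comes in.\<close>

lemma char_one_step:
  fixes u :: "real^'d" and n j :: nat
  assumes G: "G \<in> sets (Fil j)" and NJ: "N \<le> j"
  defines "y \<equiv> \<lambda>j. char_on G u (partial_S N n j)"
  assumes bound: "\<And>x. x \<in> B \<Longrightarrow> norm ((\<integral>w. iexp (real (Suc j) powr \<rho> / A n * (u \<bullet> Z (Suc j) x w)) \<partial>E) - q) \<le> b + b' * (norm (x - xs))\<^sup>2"
    and b: "0 \<le> b" "0 \<le> b'"
  shows "norm (y (Suc j) - q * y j) \<le> b + b' * mse N j"
proof -
  define a where "a = real (Suc j) powr \<rho> / A n"
  define X where "X \<omega> = indicator G \<omega> * iexp (u \<bullet> partial_S N n j \<omega>)" for \<omega>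
  define \<Phi> where "\<Phi> x = (\<integral>w. iexp (a * (u \<bullet> Z (Suc j) x w)) \<partial>E)" for x
  have XF: "X \<in> borel_measurable (Fil j)"
    unfolding X_def using G partial_S_Fil[of N n j] by measurable
  have X1: "norm (X \<omega>) \<le> 1" for \<omega> by (simp add: X_def norm_mult indicator_def)
  note [measurable] = measurable_Fil[OF XF]
  have \<Phi>m [measurable]: "\<Phi> \<in> borel_measurable borel"
  proof -
    have "(\<lambda>(x, w). iexp (a * (u \<bullet> Z (Suc j) x w))) \<in> borel_measurable (borel \<Otimes>\<^sub>M E)" by measurable
    then show ?thesis unfolding \<Phi>_def by (rule E.borel_measurable_lebesgue_integral)
  qed
  have \<Phi>1: "norm (\<Phi> x) \<le> 1" for x
  proof -
    have "norm (\<Phi> x) \<le> (\<integral>w. norm (iexp (a * (u \<bullet> Z (Suc j) x w))) \<partial>E)" unfolding \<Phi>_def by (rule integral_norm_bound)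
    then show ?thesis by (simp add: E.prob_space)
  qed
  \<comment> \<open>The cut at modulus 1 keeps f bounded on the whole product space; it does not
    affect X, whose modulus is at most 1.\<close>
  define f where "f z = (if norm (fst (fst z)) \<le> 1 then fst (fst z) else 0) * iexp (a * (u \<bullet> Z (Suc j) (snd (fst z)) (snd z)))"
    for z :: "(complex \<times> (real^'d)) \<times> 'e"
  have fm: "f \<in> borel_measurable ((borel \<Otimes>\<^sub>M borel) \<Otimes>\<^sub>M E)"
  proof -
    have [measurable]: "(\<lambda>z. Z (Suc j) (snd (fst z)) (snd z)) \<in> borel_measurable ((borel \<Otimes>\<^sub>M borel) \<Otimes>\<^sub>M E)"
      using measurable_compose[OF _ Z_meas[of "Suc j"], of "\<lambda>z. (snd (fst z), snd z)"] by simp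
    show ?thesis unfolding f_def by measurable
  qed
  have "y (Suc j) = (\<integral>\<omega>. f ((X \<omega>, stopped N j \<omega>), W (Suc j) \<omega>) \<partial>P)"
    unfolding y_def
  proof (rule Bochner_Integration.integral_cong)
    fix \<omega>
    have "partial_S N n (Suc j) \<omega> = partial_S N n j \<omega> + a *\<^sub>R Z (Suc j) (stopped N j \<omega>) (W (Suc j) \<omega>)"
      using NJ by (simp add: partial_S_def incr_def a_def scaleR_add_right)
    then show "indicator G \<omega> * iexp (u \<bullet> partial_S N n (Suc j) \<omega>) = f ((X \<omega>, stopped N j \<omega>), W (Suc j) \<omega>)"
      using X1[of \<omega>] by (simp add: f_def X_def inner_add_right exp_add[symmetric] distrib_left)
  qed simp
  also have "\<dots> = (\<integral>\<omega>. \<integral>w. f ((X \<omega>, stopped N j \<omega>), w) \<partial>E \<partial>P)"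
  proof (rule integral_next[OF _ fm, of _ _ 1])
    show "(\<lambda>\<omega>. (X \<omega>, stopped N j \<omega>)) \<in> measurable (Fil j) (borel \<Otimes>\<^sub>M borel)"
      using XF stopped_Fil by measurable
    show "norm (f z) \<le> 1" for z by (auto simp: f_def norm_mult)
  qed
  also have "\<dots> = (\<integral>\<omega>. X \<omega> * \<Phi> (stopped N j \<omega>) \<partial>P)"
    using X1 by (simp add: f_def \<Phi>_def)
  finally have "y (Suc j) - q * y j = (\<integral>\<omega>. X \<omega> * \<Phi> (stopped N j \<omega>) \<partial>P) - (\<integral>\<omega>. X \<omega> * q \<partial>P)"
    by (simp add: y_def X_def[symmetric] mult.commute)
  also have "\<dots> = (\<integral>\<omega>. X \<omega> * \<Phi> (stopped N j \<omega>) - X \<omega> * q \<partial>P)"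
  proof (rule Bochner_Integration.integral_diff[symmetric])
    show "integrable P (\<lambda>\<omega>. X \<omega> * \<Phi> (stopped N j \<omega>))"
      by (rule integrable_const_bound[of _ 1]) (auto simp: norm_mult X1 \<Phi>1 intro!: mult_le_one)
    show "integrable P (\<lambda>\<omega>. X \<omega> * q)"
      by (rule integrable_const_bound[of _ "norm q"]) (auto simp: norm_mult X1 intro!: mult_left_le_one_le)
  qed
  also have "norm \<dots> \<le> (\<integral>\<omega>. norm (X \<omega> * \<Phi> (stopped N j \<omega>) - X \<omega> * q) \<partial>P)" by (rule integral_norm_bound)
  also have "\<dots> \<le> (\<integral>\<omega>. b + b' * (norm (stopped N j \<omega> - xs))\<^sup>2 \<partial>P)"
  proof (rule integral_mono')
    show "integrable P (\<lambda>\<omega>. b + b' * (norm (stopped N j \<omega> - xs))\<^sup>2)"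
      using b by (intro integrable_const_bound[of _ "b + b' * r0\<^sup>2"])
        (auto intro!: AE_I2 mult_left_mono power_mono stopped_norm)
    fix \<omega>
    have "norm (X \<omega> * \<Phi> (stopped N j \<omega>) - X \<omega> * q) = norm (X \<omega>) * norm (\<Phi> (stopped N j \<omega>) - q)"
      by (simp add: right_diff_distrib[symmetric] norm_mult)
    also have "\<dots> \<le> norm (\<Phi> (stopped N j \<omega>) - q)" using X1 by (intro mult_left_le_one_le) auto
    also have "\<dots> \<le> b + b' * (norm (stopped N j \<omega> - xs))\<^sup>2"
      using bound[OF stopped_in_B] by (simp add: \<Phi>_def a_def)
    finally show "norm (X \<omega> * \<Phi> (stopped N j \<omega>) - X \<omega> * q) \<le> b + b' * (norm (stopped N j \<omega> - xs))\<^sup>2" .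
    show "0 \<le> b + b' * (norm (stopped N j \<omega> - xs))\<^sup>2" using b by simp
  qed
  also have "\<dots> = b + b' * mse N j"
  proof -
    have "integrable P (\<lambda>\<omega>. (norm (stopped N j \<omega> - xs))\<^sup>2)"
      by (rule integrable_const_bound[of _ "r0\<^sup>2"]) (auto intro!: AE_I2 power_mono stopped_norm)
    then show ?thesis by (simp add: prob_space)
  qed
  finally show ?thesis .
qed

lemma stopped_moment_zero:
  assumes "mse_rate N"
  shows "mse N \<longlonglongrightarrow> 0"
proof -
  obtain C where C: "C > 0" "\<And>n. n \<ge> 1 \<Longrightarrow> mse N n \<le> C * real n powr (- e)"
    using assms by blast
  have "(\<lambda>n. C * real n powr (- e)) \<longlonglongrightarrow> 0" using e by real_asymp
  then show ?thesis
    by (rule tendsto_sandwich[OF _ _ tendsto_const, rotated 2])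
      (auto intro!: eventually_sequentiallyI[of 1] C Bochner_Integration.integral_nonneg)
qed

text \<open>Lindeberg's method on the characteristic function: from time m on each increment is
  replaced by the factor exp(- c s / 2), at a cost of c times a small error. The weights c sum to 1
  in the limit, so the product of the factors converges, and the total cost is small by the Toeplitz
  lemma. The event G only has to precede m.\<close>

lemma clt_stopped:
  fixes u :: "real^'d"
  assumes G: "G \<in> sets (Fil m0)"
    and M2: "mse_rate N"
  shows "(\<lambda>n. char_on G u (partial_S N n n)) \<longlonglongrightarrow>
      measure P G * complex_of_real (exp (- (u \<bullet> (\<Gamma> *v u)) / 2))"
proof (rule LIMSEQ_I)
  fix r :: real assume r: "r > 0"
  define s where "s = u \<bullet> (\<Gamma> *v u)"
  have s: "0 \<le> s" using psd by (simp add: s_def)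
  obtain Cs where Cs: "Cs > 0" "\<And>n. (\<Sum>k=1..n. c n k) \<le> Cs" "\<And>n k. 1 \<le> k \<Longrightarrow> k \<le> n \<Longrightarrow> c n k \<le> Cs"
    using c_sum_bound by blast
  obtain p \<delta> C where p: "p > 0" and \<delta>: "\<delta> \<longlonglongrightarrow> 0" "\<And>k. 0 \<le> \<delta> k"
    and ch: "\<And>\<epsilon>. \<epsilon> > 0 \<Longrightarrow> \<exists>C' k0. \<forall>k\<ge>k0. \<forall>x\<in>B. \<forall>a.
      norm ((\<integral>w. iexp (a * (u \<bullet> Z k x w)) \<partial>E) - exp (- (a\<^sup>2 * \<tau> k * (u \<bullet> (\<Gamma> *v u)) / 2)))
        \<le> a\<^sup>2 * \<tau> k * (\<epsilon> + C' * (norm (x - xs))\<^sup>2 + C * (a\<^sup>2 * \<tau> k * \<delta> k) powr p)"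
    using char_step[of u] by blast
  define \<epsilon> where "\<epsilon> = r / (4 * Cs)"
  have \<epsilon>: "\<epsilon> > 0" using r Cs by (simp add: \<epsilon>_def)
  obtain C' k0 where k0: "\<And>k x a. k \<ge> k0 \<Longrightarrow> x \<in> B \<Longrightarrow>
      norm ((\<integral>w. iexp (a * (u \<bullet> Z k x w)) \<partial>E) - exp (- (a\<^sup>2 * \<tau> k * s / 2)))
        \<le> a\<^sup>2 * \<tau> k * (\<epsilon> + C' * (norm (x - xs))\<^sup>2 + C * (a\<^sup>2 * \<tau> k * \<delta> k) powr p)"
    using ch[OF \<epsilon>] unfolding s_def by blast
  \<comment> \<open>Past m the event G is known, the stopped process has started, and the bound on
    the characteristic functions applies.\<close>
  define m where "m = max (max m0 N) k0"
  let ?decay = "\<lambda>n j. complex_of_real (exp (- ((\<Sum>k=Suc m..j. c n k) * s / 2)))"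
  define y where "y n j = char_on G u (partial_S N n j)" for n j
  \<comment> \<open>The part of the error that tends to zero: the mean square distance to
    \<open>xs\<close> and the non-normality of a single increment.\<close>
  define z where "z k = \<bar>C'\<bar> * mse N (k - 1) + \<bar>C\<bar> * (Cs * \<delta> k) powr p" for k
  have Gm: "G \<in> sets (Fil j)" if "m \<le> j" for j using G sets_Fil_mono[of m0 j] that by (auto simp: m_def)
  have [measurable]: "G \<in> sets P" using G sets_Fil_sub by auto
  have y1: "norm (y n (Suc j) - complex_of_real (exp (- (c n (Suc j) * s / 2))) * y n j) \<le> c n (Suc j) * (\<epsilon> + z (Suc j))"
    if j: "m \<le> j" "Suc j \<le> n" for n j
  proof -
    let ?a = "real (Suc j) powr \<rho> / A n"
    have cn: "c n (Suc j) = ?a\<^sup>2 * \<tau> (Suc j)" by (simp add: c_def)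
    have "norm (y n (Suc j) - complex_of_real (exp (- (c n (Suc j) * s / 2))) * y n j)
      \<le> c n (Suc j) * (\<epsilon> + \<bar>C\<bar> * (Cs * \<delta> (Suc j)) powr p) + c n (Suc j) * \<bar>C'\<bar> * mse N j"
      unfolding y_def
    proof (rule char_one_step[OF Gm[OF j(1)]])
      show "N \<le> j" using j by (simp add: m_def)
      show "0 \<le> c n (Suc j) * (\<epsilon> + \<bar>C\<bar> * (Cs * \<delta> (Suc j)) powr p)" "0 \<le> c n (Suc j) * \<bar>C'\<bar>"
        using c_nonneg \<epsilon> by auto
      fix x assume x: "x \<in> B"
      have "norm ((\<integral>w. iexp (?a * (u \<bullet> Z (Suc j) x w)) \<partial>E) - exp (- (c n (Suc j) * s / 2)))
        \<le> c n (Suc j) * (\<epsilon> + C' * (norm (x - xs))\<^sup>2 + C * (c n (Suc j) * \<delta> (Suc j)) powr p)"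
        unfolding cn using j x by (intro k0) (auto simp: m_def)
      also have "\<dots> \<le> c n (Suc j) * (\<epsilon> + \<bar>C'\<bar> * (norm (x - xs))\<^sup>2 + \<bar>C\<bar> * (Cs * \<delta> (Suc j)) powr p)"
        using c_nonneg \<delta>(2) p Cs(1) Cs(3)[of "Suc j" n] j
        by (intro mult_left_mono add_mono mult_mono powr_mono2) auto
      also have "\<dots> = c n (Suc j) * (\<epsilon> + \<bar>C\<bar> * (Cs * \<delta> (Suc j)) powr p) + c n (Suc j) * \<bar>C'\<bar> * (norm (x - xs))\<^sup>2"
        by (simp add: algebra_simps)
      finally show "norm ((\<integral>w. iexp (?a * (u \<bullet> Z (Suc j) x w)) \<partial>E) - exp (- (c n (Suc j) * s / 2))) \<le> \<dots>" .
    qed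
    then show ?thesis by (simp add: z_def algebra_simps)
  qed
  \<comment> \<open>Factors of modulus at most 1 let the errors of the single replacements simply
    add up.\<close>
  have y2: "norm (y n j - ?decay n j * y n m) \<le> (\<Sum>k=Suc m..j. c n k * (\<epsilon> + z k))"
    if "m \<le> j" "j \<le> n" for n j
    using that
  proof (induction j rule: dec_induct)
    case base
    then show ?case by simp
  next
    case (step j)
    let ?q = "complex_of_real (exp (- (c n (Suc j) * s / 2)))" and ?Q = "?decay n j"
    have q1: "norm ?q \<le> 1" using c_nonneg s by simp
    have QQ: "?decay n (Suc j) = ?q * ?Q"
      using step.hyps by (simp add: exp_add[symmetric] of_real_mult[symmetric] field_simps del: of_real_mult)
    have "y n (Suc j) - ?q * ?Q * y n m = (y n (Suc j) - ?q * y n j) + ?q * (y n j - ?Q * y n m)"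
      by (simp add: algebra_simps)
    also have "norm \<dots> \<le> norm (y n (Suc j) - ?q * y n j) + norm ?q * norm (y n j - ?Q * y n m)"
      by (rule order_trans[OF norm_triangle_ineq]) (simp add: norm_mult)
    also have "\<dots> \<le> c n (Suc j) * (\<epsilon> + z (Suc j)) + (\<Sum>k=Suc m..j. c n k * (\<epsilon> + z k))"
    proof (rule add_mono)
      show "norm (y n (Suc j) - ?q * y n j) \<le> c n (Suc j) * (\<epsilon> + z (Suc j))"
        using y1 step by simp
      have "norm ?q * norm (y n j - ?Q * y n m) \<le> norm (y n j - ?Q * y n m)"
        using q1 by (intro mult_left_le_one_le) auto
      also have "\<dots> \<le> (\<Sum>k=Suc m..j. c n k * (\<epsilon> + z k))" using step by simp
      finally show "norm ?q * norm (y n j - ?Q * y n m) \<le> (\<Sum>k=Suc m..j. c n k * (\<epsilon> + z k))" .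
    qed
    finally show ?case using step.hyps unfolding QQ by simp
  qed
  \<comment> \<open>The increments up to m are finitely many and fade under the growing
    normalisation, leaving the mass of G.\<close>
  have ym: "(\<lambda>n. y n m) \<longlonglongrightarrow> measure P G"
  proof -
    have "(\<lambda>n. y n m) \<longlonglongrightarrow> (\<integral>\<omega>. indicator G \<omega> * iexp (u \<bullet> 0) \<partial>P)"
      unfolding y_def
    proof (rule integral_dominated_convergence[where w = "\<lambda>_. 1"])
      show "AE \<omega> in P. (\<lambda>n. indicator G \<omega> * iexp (u \<bullet> partial_S N n m \<omega>)) \<longlonglongrightarrow> indicator G \<omega> * iexp (u \<bullet> 0)"
      proof (rule AE_I2)
        fix \<omega>
        have "(\<lambda>n. partial_S N n m \<omega>) \<longlonglongrightarrow> 0 *\<^sub>R (\<Sum>k=Suc N..m. real k powr \<rho> *\<^sub>R incr N k \<omega>)"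
          unfolding partial_S_def by (intro tendsto_scaleR A_inverse tendsto_const)
        then show "(\<lambda>n. indicator G \<omega> * iexp (u \<bullet> partial_S N n m \<omega>)) \<longlonglongrightarrow> indicator G \<omega> * iexp (u \<bullet> 0)"
          by (intro tendsto_intros) simp
      qed
    qed (auto simp: norm_mult indicator_def)
    moreover have "(\<integral>\<omega>. indicator G \<omega> * iexp (u \<bullet> 0) \<partial>P) = (\<integral>\<omega>. complex_of_real (indicat_real G \<omega>) \<partial>P)"
      by (intro Bochner_Integration.integral_cong) (auto simp: indicator_def)
    moreover have "\<dots> = complex_of_real (measure P G)" by (simp add: integral_complex_of_real)
    ultimately show ?thesis by simp
  qed
  have "(\<lambda>n. ?decay n n * y n m) \<longlonglongrightarrow>
      complex_of_real (exp (- (1 * s / 2))) * measure P G"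
    by (intro tendsto_intros ym c_tail_sum) simp_all
  from LIMSEQ_D[OF this, of "r / 4"] r
  obtain n1 where n1: "\<And>n. n \<ge> n1 \<Longrightarrow> norm (?decay n n * y n m -
      complex_of_real (exp (- (1 * s / 2))) * measure P G) < r / 4" by auto
  have z0: "z \<longlonglongrightarrow> 0"
  proof -
    have "(\<lambda>k. \<integral>\<omega>. (norm (stopped N (k - 1) \<omega> - xs))\<^sup>2 \<partial>P) \<longlonglongrightarrow> 0"
      by (rule LIMSEQ_imp_Suc) (simp add: stopped_moment_zero[OF M2])
    moreover have "(\<lambda>k. (Cs * \<delta> k) powr p) \<longlonglongrightarrow> 0"
    proof -
      have "(\<lambda>k. Cs * \<delta> k) \<longlonglongrightarrow> Cs * 0" by (intro tendsto_intros \<delta>)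
      then show ?thesis using tendsto_zero_powrI[OF _ tendsto_const _ p, of "\<lambda>k. Cs * \<delta> k" sequentially] \<delta>(2) Cs(1) by auto
    qed
    ultimately have "z \<longlonglongrightarrow> \<bar>C'\<bar> * 0 + \<bar>C\<bar> * 0"
      unfolding z_def by (intro tendsto_intros)
    then show ?thesis by simp
  qed
  have z_nonneg: "0 \<le> z k" for k unfolding z_def by (intro add_nonneg_nonneg mult_nonneg_nonneg Bochner_Integration.integral_nonneg) auto
  from LIMSEQ_D[OF toeplitz_zero[OF c_nonneg Cs(2) c_zero z0], of "r / 4"] r
  obtain n2 where n2: "\<And>n. n \<ge> n2 \<Longrightarrow> \<bar>\<Sum>k=1..n. c n k * z k\<bar> < r / 4" by auto
  have "norm (y n n - measure P G * complex_of_real (exp (- s / 2))) < r" if n: "n \<ge> max m (max n1 n2)" for n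
  proof -
    let ?Q = "?decay n n"
    have "(\<Sum>k=Suc m..n. c n k * (\<epsilon> + z k)) \<le> (\<Sum>k=1..n. c n k * (\<epsilon> + z k))"
      using c_nonneg \<epsilon> z_nonneg by (intro sum_mono2) auto
    also have "\<dots> = (\<Sum>k=1..n. c n k) * \<epsilon> + (\<Sum>k=1..n. c n k * z k)"
      by (simp add: distrib_left sum.distrib sum_distrib_right)
    also have "\<dots> \<le> Cs * \<epsilon> + r / 4"
      using Cs(2)[of n] n2[of n] n \<epsilon> by (intro add_mono mult_right_mono) auto
    also have "Cs * \<epsilon> = r / 4" using Cs(1) by (simp add: \<epsilon>_def)
    finally have "norm (y n n - ?Q * y n m) \<le> r / 4 + r / 4" using y2[of n n] n by simp
    moreover have "norm (?Q * y n m - complex_of_real (exp (- s / 2)) * measure P G) < r / 4" using n1[of n] n by simp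
    ultimately have "norm ((y n n - ?Q * y n m) + (?Q * y n m - complex_of_real (exp (- s / 2)) * measure P G)) < r"
      using norm_triangle_ineq[of "y n n - ?Q * y n m" "?Q * y n m - complex_of_real (exp (- s / 2)) * measure P G"] r by linarith
    then show ?thesis by (simp add: mult.commute)
  qed
  then show "\<exists>n0. \<forall>n\<ge>n0. norm (char_on G u (partial_S N n n) -
      measure P G * complex_of_real (exp (- (u \<bullet> (\<Gamma> *v u)) / 2))) < r"
    unfolding y_def s_def by blast
qed

section \<open>Remainder terms\<close>

lemma integrable_stopped [intro]:
  assumes [measurable]: "f \<in> borel_measurable borel" and "\<And>x. x \<in> B \<Longrightarrow> \<bar>f x\<bar> \<le> K"
  shows "integrable P (\<lambda>\<omega>. f (stopped N n \<omega>) :: real)"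
  using assms(2) stopped_in_B by (intro integrable_const_bound[of _ K]) auto

lemma integrable_powr_stopped: "p \<ge> 0 \<Longrightarrow> integrable P (\<lambda>\<omega>. norm (stopped N n \<omega> - xs) powr p)"
  by (rule integrable_stopped[of "\<lambda>x. norm (x - xs) powr p" "r0 powr p"])
    (auto simp: dist_norm norm_minus_commute intro!: powr_mono2)

lemma integrable_norm_stopped: "integrable P (\<lambda>\<omega>. norm (stopped N n \<omega> - xs))"
  by (rule integrable_stopped[of "\<lambda>x. norm (x - xs)" "r0"]) (auto simp: dist_norm norm_minus_commute)

lemma integrable_square_stopped: "integrable P (\<lambda>\<omega>. (norm (stopped N n \<omega> - xs))\<^sup>2)"
  by (rule integrable_stopped[of "\<lambda>x. (norm (x - xs))\<^sup>2" "r0\<^sup>2"]) (auto simp: dist_norm norm_minus_commute intro!: power_mono)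

lemma stopped_moment:
  assumes C: "C > 0" "\<And>n. n \<ge> 1 \<Longrightarrow> mse N n \<le> C * real n powr (- e)"
    and p: "0 \<le> p" "p \<le> 2" and n: "n \<ge> 1"
  shows "(\<integral>\<omega>. norm (stopped N n \<omega> - xs) powr p \<partial>P) \<le> (1 + C) * real n powr (- (p * e / 2))"
proof -
  define s where "s = real n powr (- (e / 2))"
  have s: "s > 0" using n by (simp add: s_def)
  have s2: "s\<^sup>2 = real n powr (- e)" using n by (simp add: s_def power2_eq_square powr_add[symmetric])
  have "(\<integral>\<omega>. norm (stopped N n \<omega> - xs) powr p \<partial>P) \<le> (\<integral>\<omega>. s powr p * (1 + (norm (stopped N n \<omega> - xs) / s)\<^sup>2) \<partial>P)"
    using integrable_square_stopped[of N n] integrable_powr_stopped[OF p(1), of N n]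
    using powr_le_one_plus[OF norm_ge_zero s p] s
    by (intro Bochner_Integration.integral_mono) (auto simp: power_divide powr_numeral)
  also have "\<dots> = s powr p * (1 + mse N n / s\<^sup>2)"
    using integrable_square_stopped[of N n] by (simp add: power_divide prob_space)
  also have "\<dots> \<le> s powr p * (1 + C)"
    using C(2)[OF n] s unfolding s2[symmetric] by (intro mult_left_mono add_left_mono) (auto simp: field_simps)
  also have "s powr p = real n powr (- (p * e / 2))" using n by (simp add: s_def powr_powr mult.commute)
  finally show ?thesis by (simp add: mult.commute)
qed

definition rem :: "nat \<Rightarrow> real^'d \<Rightarrow> real^'d" where
  "rem k x = m k x - H *v (x - xs) - \<beta> k *\<^sub>R \<mu>"

abbreviation "mean_rem N k \<equiv> \<integral>\<omega>. norm (rem k (stopped N (k - 1) \<omega>)) \<partial>P"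

lemma H_meas [measurable]: "f \<in> borel_measurable N \<Longrightarrow> (\<lambda>x. (G :: real^'d^'d) *v f x) \<in> borel_measurable N"
  by (rule borel_measurable_continuous_on[OF linear_continuous_on[OF matrix_vector_mul_bounded_linear]])

lemma rem_meas [measurable]: "k \<ge> 1 \<Longrightarrow> rem k \<in> borel_measurable borel"
  unfolding rem_def by measurable

lemma integrable_rem: assumes k: "k \<ge> n0" shows "integrable P (\<lambda>\<omega>. norm (rem k (stopped N n \<omega>)))"
proof -
  obtain L where L: "L > 0" "\<And>x. norm (H *v x) \<le> norm x * L"
    using bounded_linear.pos_bounded[of "(*v) H"] matrix_vector_mul_bounded_linear by blast
  show ?thesis
  proof (rule integrable_stopped[of "\<lambda>x. norm (rem k x)" "Cd * (r0 + real k powr (- R)) + r0 * L + norm (\<beta> k *\<^sub>R \<mu>)"])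
    show "(\<lambda>x. norm (rem k x)) \<in> borel_measurable borel" using order_trans[OF n0 k] by measurable
    fix x assume x: "x \<in> B"
    then have xr: "norm (x - xs) \<le> r0" by (simp add: dist_norm norm_minus_commute)
    have "norm (rem k x) \<le> norm (m k x) + norm (H *v (x - xs)) + norm (\<beta> k *\<^sub>R \<mu>)"
      unfolding rem_def using norm_triangle_ineq4 by (smt (verit))
    also have "\<dots> \<le> Cd * (r0 + real k powr (- R)) + r0 * L + norm (\<beta> k *\<^sub>R \<mu>)"
    proof (intro add_mono order_refl)
      show "norm (m k x) \<le> Cd * (r0 + real k powr (- R))"
        using drift(2)[OF k x] xr Cd by (auto intro: order_trans mult_left_mono)
      show "norm (H *v (x - xs)) \<le> r0 * L"
        using L(2)[of "x - xs"] xr L(1) by (auto intro: order_trans mult_right_mono)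
    qed
    finally show "\<bar>norm (rem k x)\<bar> \<le> Cd * (r0 + real k powr (- R)) + r0 * L + norm (\<beta> k *\<^sub>R \<mu>)" by simp
  qed
qed

text \<open>The inequality R < (1 + lam) e / 2 is used here: the moment of order 1 + lam decays like
  n^(-(1+lam) e/2), which is o(n^(-R)). The bias part is n^(-R) times an error made small by
  \<epsilon> and by the mean square error.\<close>

lemma rem_negligible:
  assumes M2: "mse_rate N"
  shows "(\<lambda>k. real k powr R * mean_rem N k) \<longlonglongrightarrow> 0"
proof (rule LIMSEQ_I)
  fix r :: real assume r: "r > 0"
  obtain C2 where C2: "C2 > 0" "\<And>n. n \<ge> 1 \<Longrightarrow> mse N n \<le> C2 * real n powr (- e)"
    using M2 by blast
  obtain C\<beta>0 where C\<beta>0: "\<And>n. n \<ge> 1 \<Longrightarrow> 0 \<le> \<beta> n \<and> \<beta> n \<le> C\<beta>0 * real n powr (- R)" using \<beta> by blast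
  define C\<beta> where "C\<beta> = \<bar>C\<beta>0\<bar> + 1"
  have C\<beta>: "C\<beta> > 0" "\<And>n. n \<ge> 1 \<Longrightarrow> 0 \<le> \<beta> n \<and> \<beta> n \<le> C\<beta> * real n powr (- R)"
  proof -
    fix n :: nat assume n: "n \<ge> 1"
    have "C\<beta>0 * real n powr (- R) \<le> C\<beta> * real n powr (- R)" by (intro mult_right_mono) (auto simp: C\<beta>_def)
    then show "0 \<le> \<beta> n \<and> \<beta> n \<le> C\<beta> * real n powr (- R)" using C\<beta>0[OF n] by linarith
  qed (simp add: C\<beta>_def)
  obtain C where rm: "\<And>\<epsilon>. \<epsilon> > 0 \<Longrightarrow> \<exists>C' k0. \<forall>k\<ge>k0. \<forall>x\<in>B.
      norm (rem k x) \<le> C * norm (x - xs) powr (1 + lam) + \<beta> k * (\<epsilon> + C' * (norm (x - xs))\<^sup>2)"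
    using remainder unfolding rem_def by blast
  define \<epsilon> where "\<epsilon> = r / (4 * C\<beta>)"
  have \<epsilon>: "\<epsilon> > 0" using r C\<beta> by (simp add: \<epsilon>_def)
  obtain C' k0 where k0: "\<And>k x. k \<ge> k0 \<Longrightarrow> x \<in> B \<Longrightarrow>
      norm (rem k x) \<le> C * norm (x - xs) powr (1 + lam) + \<beta> k * (\<epsilon> + C' * (norm (x - xs))\<^sup>2)"
    using rm[OF \<epsilon>] by blast
  \<comment> \<open>The shift to k - 1 appears because the remainder is evaluated at the previous
    iterate.\<close>
  define h where "h k = \<bar>C\<bar> * (1 + C2) * (real k powr R * (real k - 1) powr (- ((1 + lam) * e / 2))) + C\<beta> * \<bar>C'\<bar> * C2 * (real k - 1) powr (- e)" for k :: nat
  have "h \<longlonglongrightarrow> 0"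
  proof -
    have "R < (1 + lam) * e / 2" using lam by (simp add: e_def)
    then have 1: "(\<lambda>k. real k powr R * (real k - 1) powr (- ((1 + lam) * e / 2))) \<longlonglongrightarrow> 0" using R by real_asymp
    have 2: "(\<lambda>k. (real k - 1) powr (- e)) \<longlonglongrightarrow> 0" using e by real_asymp
    have "h \<longlonglongrightarrow> \<bar>C\<bar> * (1 + C2) * 0 + C\<beta> * \<bar>C'\<bar> * C2 * 0" unfolding h_def by (intro tendsto_intros 1 2)
    then show ?thesis by simp
  qed
  from LIMSEQ_D[OF this, of "r / 2"] r obtain k1 where k1: "\<And>k. k \<ge> k1 \<Longrightarrow> \<bar>h k\<bar> < r / 2" by auto
  have "norm (real k powr R * mean_rem N k) < r" if k: "k \<ge> max (max k0 k1) (max n0 2)" for k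
  proof -
    let ?y = "\<lambda>\<omega>. norm (stopped N (k - 1) \<omega> - xs)"
    have k2: "k \<ge> 1" "k - 1 \<ge> 1" "real (k - 1) = real k - 1" using k by auto
    have b: "0 \<le> \<beta> k" "\<beta> k \<le> C\<beta> * real k powr (- R)" using C\<beta>(2)[OF k2(1)] by auto
    have "mean_rem N k \<le> (\<integral>\<omega>. \<bar>C\<bar> * ?y \<omega> powr (1 + lam) + \<beta> k * (\<epsilon> + \<bar>C'\<bar> * (?y \<omega>)\<^sup>2) \<partial>P)"
    proof (rule Bochner_Integration.integral_mono)
      show "integrable P (\<lambda>\<omega>. norm (rem k (stopped N (k - 1) \<omega>)))" using k by (intro integrable_rem) auto
      show "integrable P (\<lambda>\<omega>. \<bar>C\<bar> * ?y \<omega> powr (1 + lam) + \<beta> k * (\<epsilon> + \<bar>C'\<bar> * (?y \<omega>)\<^sup>2))"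
        using lam integrable_powr_stopped[of "1 + lam"] integrable_square_stopped by auto
      fix \<omega>
      have "norm (rem k (stopped N (k - 1) \<omega>)) \<le> C * ?y \<omega> powr (1 + lam) + \<beta> k * (\<epsilon> + C' * (?y \<omega>)\<^sup>2)"
        using k0[OF _ stopped_in_B] k by auto
      also have "\<dots> \<le> \<bar>C\<bar> * ?y \<omega> powr (1 + lam) + \<beta> k * (\<epsilon> + \<bar>C'\<bar> * (?y \<omega>)\<^sup>2)"
        using b by (intro add_mono mult_right_mono mult_left_mono) auto
      finally show "norm (rem k (stopped N (k - 1) \<omega>)) \<le> \<bar>C\<bar> * ?y \<omega> powr (1 + lam) + \<beta> k * (\<epsilon> + \<bar>C'\<bar> * (?y \<omega>)\<^sup>2)" .
    qed
    also have "\<dots> = \<bar>C\<bar> * (\<integral>\<omega>. ?y \<omega> powr (1 + lam) \<partial>P) + \<beta> k * (\<epsilon> + \<bar>C'\<bar> * (\<integral>\<omega>. (?y \<omega>)\<^sup>2 \<partial>P))"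
      using lam integrable_powr_stopped[of "1 + lam"] integrable_square_stopped by (simp add: prob_space)
    also have "\<dots> \<le> \<bar>C\<bar> * ((1 + C2) * (real k - 1) powr (- ((1 + lam) * e / 2))) + (C\<beta> * real k powr (- R)) * (\<epsilon> + \<bar>C'\<bar> * (C2 * (real k - 1) powr (- e)))"
    proof (intro add_mono mult_left_mono mult_mono order_refl)
      show "(\<integral>\<omega>. ?y \<omega> powr (1 + lam) \<partial>P) \<le> (1 + C2) * (real k - 1) powr (- ((1 + lam) * e / 2))"
        using stopped_moment[OF C2, of "1 + lam" "k - 1"] lam k2 by simp
      show "(\<integral>\<omega>. (?y \<omega>)\<^sup>2 \<partial>P) \<le> C2 * (real k - 1) powr (- e)"
        using C2(2)[OF k2(2)] k2(3) by simp
    qed (use b \<epsilon> C\<beta> in \<open>auto intro!: add_nonneg_nonneg mult_nonneg_nonneg Bochner_Integration.integral_nonneg\<close>)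
    finally have le: "mean_rem N k \<le> \<dots>" .
    have rr: "real k powr R * real k powr (- R) = 1" using k2 by (simp add: powr_add[symmetric])
    have "real k powr R * mean_rem N k \<le>
       real k powr R * (\<bar>C\<bar> * ((1 + C2) * (real k - 1) powr (- ((1 + lam) * e / 2))) + (C\<beta> * real k powr (- R)) * (\<epsilon> + \<bar>C'\<bar> * (C2 * (real k - 1) powr (- e))))"
      using le by (intro mult_left_mono) auto
    also have "\<dots> = \<bar>C\<bar> * (1 + C2) * (real k powr R * (real k - 1) powr (- ((1 + lam) * e / 2)))
       + (real k powr R * real k powr (- R)) * (C\<beta> * (\<epsilon> + \<bar>C'\<bar> * (C2 * (real k - 1) powr (- e))))"
      by (simp add: algebra_simps)
    also have "\<dots> = h k + C\<beta> * \<epsilon>" unfolding rr h_def by (simp add: algebra_simps)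
    also have "C\<beta> * \<epsilon> = r / 4" using C\<beta>(1) by (simp add: \<epsilon>_def)
    also have "h k + r / 4 < r" using k1[of k] k r by auto
    finally show ?thesis by (simp add: abs_mult Bochner_Integration.integral_nonneg)
  qed
  then show "\<exists>n0. \<forall>n\<ge>n0. norm (real n powr R * mean_rem N n - 0) < r"
    unfolding diff_zero by blast
qed

text \<open>Summation by parts moves the difference from the iterates to the weights, which leaves
  terms k^(w-1) times a root mean square error k^(-e/2). For w = \<rho> + \<psi>, the critical case,
  the condition on w says exactly \<psi> < 1.\<close>

lemma abel_negligible:
  assumes M2: "mse_rate N"
    and N: "N \<ge> 1" and w: "w - e / 2 < \<rho> + 1 - R"
  shows "(\<lambda>n. (\<integral>\<omega>. norm (moved w N n \<omega>) \<partial>P) / A n) \<longlonglongrightarrow> 0"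
proof -
  obtain C2 where C2: "C2 > 0" "\<And>n. n \<ge> 1 \<Longrightarrow> mse N n \<le> C2 * real n powr (- e)"
    using M2 by blast
  obtain Cw where Cw: "Cw > 0" "\<And>k. k \<ge> 1 \<Longrightarrow> \<bar>real (Suc k) powr w - real k powr w\<bar> \<le> Cw * real k powr (w - 1)"
    using power_increment_bound by blast
  define a where "a = \<rho> + 1 - R"
  have a: "a > 0" using R by (simp add: a_def)
  let ?y = "\<lambda>k \<omega>. norm (stopped N k \<omega> - xs)"
  have m1: "(\<integral>\<omega>. ?y k \<omega> \<partial>P) \<le> (1 + C2) * real k powr (- (e / 2))" if "k \<ge> 1" for k
    using stopped_moment[OF C2, of 1 k] that by simp
  \<comment> \<open>Two boundary terms and the sum; the power a - 1 is split off so that the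
    remaining power of k tends to zero.\<close>
  define h where "h n = (1 + C2) * real n powr (w - e / 2) + (1 + C2) * real (Suc N) powr w + Cw * (1 + C2) * (\<Sum>k=1..n. real k powr (a - 1) * real k powr (w - e / 2 - a))" for n
  have bound: "(\<integral>\<omega>. norm (moved w N n \<omega>) \<partial>P) \<le> h n" if n: "n > N" for n
  proof -
    have "(\<integral>\<omega>. norm (moved w N n \<omega>) \<partial>P)
      \<le> (\<integral>\<omega>. real n powr w * ?y n \<omega> + real (Suc N) powr w * ?y N \<omega> + (\<Sum>k=Suc N..<n. (Cw * real k powr (w - 1)) * ?y k \<omega>) \<partial>P)"
    proof (rule integral_mono')
      show "integrable P (\<lambda>\<omega>. real n powr w * ?y n \<omega> + real (Suc N) powr w * ?y N \<omega> + (\<Sum>k=Suc N..<n. (Cw * real k powr (w - 1)) * ?y k \<omega>))"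
        using integrable_norm_stopped by auto
      fix \<omega>
      show "0 \<le> real n powr w * ?y n \<omega> + real (Suc N) powr w * ?y N \<omega> + (\<Sum>k=Suc N..<n. (Cw * real k powr (w - 1)) * ?y k \<omega>)"
        using Cw by (intro add_nonneg_nonneg sum_nonneg) auto
      have "(moved w N n \<omega>) =
          (\<Sum>k=Suc N..n. real k powr w *\<^sub>R ((stopped N k \<omega> - xs) - (stopped N (k - 1) \<omega> - xs)))" by simp
      also have "\<dots> = real n powr w *\<^sub>R (stopped N n \<omega> - xs) - real (Suc N) powr w *\<^sub>R (stopped N N \<omega> - xs)
         - (\<Sum>k=Suc N..<n. (real (Suc k) powr w - real k powr w) *\<^sub>R (stopped N k \<omega> - xs))"
        by (rule summation_by_parts[OF n])
      also have "norm \<dots> \<le> norm (real n powr w *\<^sub>R (stopped N n \<omega> - xs)) + norm (real (Suc N) powr w *\<^sub>R (stopped N N \<omega> - xs))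
         + norm (\<Sum>k=Suc N..<n. (real (Suc k) powr w - real k powr w) *\<^sub>R (stopped N k \<omega> - xs))"
        by (rule order_trans[OF norm_triangle_ineq4 add_right_mono[OF norm_triangle_ineq4]])
      also have "\<dots> \<le> real n powr w * ?y n \<omega> + real (Suc N) powr w * ?y N \<omega> + (\<Sum>k=Suc N..<n. (Cw * real k powr (w - 1)) * ?y k \<omega>)"
        by (intro add_mono order_trans[OF norm_sum] sum_mono) (auto intro!: mult_right_mono Cw simp del: of_nat_Suc)
      finally show "norm (moved w N n \<omega>) \<le>
         real n powr w * ?y n \<omega> + real (Suc N) powr w * ?y N \<omega> + (\<Sum>k=Suc N..<n. (Cw * real k powr (w - 1)) * ?y k \<omega>)" .
    qed
    also have "\<dots> = real n powr w * (\<integral>\<omega>. ?y n \<omega> \<partial>P) + real (Suc N) powr w * (\<integral>\<omega>. ?y N \<omega> \<partial>P) + (\<Sum>k=Suc N..<n. (Cw * real k powr (w - 1)) * (\<integral>\<omega>. ?y k \<omega> \<partial>P))"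
      using integrable_norm_stopped by simp
    also have "\<dots> \<le> (1 + C2) * real n powr (w - e / 2) + (1 + C2) * real (Suc N) powr w + Cw * (1 + C2) * (\<Sum>k=1..n. real k powr (a - 1) * real k powr (w - e / 2 - a))"
    proof (intro add_mono)
      have "real n powr w * (\<integral>\<omega>. ?y n \<omega> \<partial>P) \<le> real n powr w * ((1 + C2) * real n powr (- (e / 2)))"
        using m1[of n] n by (intro mult_left_mono) auto
      also have "\<dots> = (1 + C2) * (real n powr w * real n powr (- (e / 2)))" by simp
      also have "real n powr w * real n powr (- (e / 2)) = real n powr (w - e / 2)" using n by (simp add: powr_add[symmetric])
      finally show "real n powr w * (\<integral>\<omega>. ?y n \<omega> \<partial>P) \<le> (1 + C2) * real n powr (w - e / 2)" .
      have "(\<integral>\<omega>. ?y N \<omega> \<partial>P) \<le> (1 + C2) * real N powr (- (e / 2))" using m1[OF N] .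
      also have "\<dots> \<le> (1 + C2) * 1" using e N C2 by (intro mult_left_mono) (auto simp: powr_minus field_simps ge_one_powr_ge_zero)
      finally show "real (Suc N) powr w * (\<integral>\<omega>. ?y N \<omega> \<partial>P) \<le> (1 + C2) * real (Suc N) powr w"
        by (subst mult.commute) (intro mult_right_mono, auto)
      have "(\<Sum>k=Suc N..<n. (Cw * real k powr (w - 1)) * (\<integral>\<omega>. ?y k \<omega> \<partial>P)) \<le> (\<Sum>k=Suc N..<n. Cw * (1 + C2) * (real k powr (a - 1) * real k powr (w - e / 2 - a)))"
      proof (rule sum_mono)
        fix k assume "k \<in> {Suc N..<n}"
        then have k: "k \<ge> 1" by simp
        have "(Cw * real k powr (w - 1)) * (\<integral>\<omega>. ?y k \<omega> \<partial>P) \<le> (Cw * real k powr (w - 1)) * ((1 + C2) * real k powr (- (e / 2)))"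
          using m1[OF k] Cw by (intro mult_left_mono) auto
        also have "\<dots> = Cw * (1 + C2) * (real k powr (w - 1) * real k powr (- (e / 2)))" by simp
        also have "real k powr (w - 1) * real k powr (- (e / 2)) = real k powr (a - 1) * real k powr (w - e / 2 - a)"
          using k by (simp add: powr_add[symmetric] algebra_simps)
        finally show "(Cw * real k powr (w - 1)) * (\<integral>\<omega>. ?y k \<omega> \<partial>P) \<le> Cw * (1 + C2) * (real k powr (a - 1) * real k powr (w - e / 2 - a))" .
      qed
      also have "\<dots> = Cw * (1 + C2) * (\<Sum>k=Suc N..<n. (real k powr (a - 1) * real k powr (w - e / 2 - a)))"
        by (rule sum_distrib_left[symmetric])
      also have "\<dots> \<le> Cw * (1 + C2) * (\<Sum>k=1..n. (real k powr (a - 1) * real k powr (w - e / 2 - a)))"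
        using Cw C2 by (intro mult_left_mono sum_mono2) auto
      finally show "(\<Sum>k=Suc N..<n. (Cw * real k powr (w - 1)) * (\<integral>\<omega>. ?y k \<omega> \<partial>P)) \<le> Cw * (1 + C2) * (\<Sum>k=1..n. real k powr (a - 1) * real k powr (w - e / 2 - a))" .
    qed
    finally show ?thesis by (simp add: h_def)
  qed
  have "(\<lambda>n. h n / real n powr (\<rho> + 1 - R)) \<longlonglongrightarrow> 0"
  proof -
    have wa: "w - e / 2 < a" using w by (simp add: a_def)
    have 1: "(\<lambda>n. real n powr (w - e / 2) / real n powr a) \<longlonglongrightarrow> 0" using wa a by real_asymp
    have 2: "(\<lambda>n. 1 / real n powr a) \<longlonglongrightarrow> 0" using a by real_asymp
    have "(\<lambda>k. real k powr (w - e / 2 - a)) \<longlonglongrightarrow> 0" using wa by real_asymp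
    from power_sum_weighted[OF a this]
    have "(\<lambda>n. (1 + C2) * (real n powr (w - e / 2) / real n powr a) + (1 + C2) * real (Suc N) powr w * (1 / real n powr a)
      + Cw * (1 + C2) * ((\<Sum>k=1..n. real k powr (a - 1) * real k powr (w - e / 2 - a)) / real n powr a)) \<longlonglongrightarrow>
      (1 + C2) * 0 + (1 + C2) * real (Suc N) powr w * 0 + Cw * (1 + C2) * 0"
      by (intro tendsto_intros 1 2)
    then show ?thesis unfolding h_def a_def[symmetric] by (simp add: add_divide_distrib)
  qed
  from over_A[OF this] have hA: "(\<lambda>n. h n / A n) \<longlonglongrightarrow> 0" .
  show ?thesis
  proof (rule tendsto_0_le[OF hA, of _ 1])
    show "eventually (\<lambda>n. norm ((\<integral>\<omega>. norm (moved w N n \<omega>) \<partial>P) / A n) \<le> norm (h n / A n) * 1) sequentially"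
      using eventually_gt_at_top[of N]
    proof eventually_elim
      case (elim n)
      then show ?case using bound[OF elim]
        by (auto simp: abs_divide Bochner_Integration.integral_nonneg intro!: divide_right_mono)
    qed
  qed
qed

section \<open>The event of convergence and the limit of the characteristic functions\<close>

definition conv :: "'w set" where
  "conv = {\<omega> \<in> space P. (\<lambda>n. \<theta> n \<omega>) \<longlonglongrightarrow> xs}"

definition X :: "nat \<Rightarrow> 'w \<Rightarrow> real^'d" where
  "X n \<omega> = (1 / A n) *\<^sub>R ((\<Sum>k=1..n. real k powr \<rho> *\<^sub>R (\<theta> k \<omega> - xs)) + A' n *\<^sub>R (Hi *v \<mu>))"

lemma X_meas [measurable]: "X n \<in> borel_measurable P"
  unfolding X_def by measurable

text \<open>The event is determined by all finite stages together but in general by none of them,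
  whence the passage to the generated sigma-algebra.\<close>

lemma conv_Finf: "conv \<in> sigma_sets (space P) (\<Union>l. sets (Fil l))"
proof -
  have sub: "(\<Union>l. sets (Fil l)) \<subseteq> Pow (space P)"
    using sets.sets_into_space[of _ "Fil _"] by fastforce
  define Finf where "Finf = sigma (space P) (\<Union>l. sets (Fil l))"
  have sp: "space Finf = space P" unfolding Finf_def by (rule space_measure_of[OF sub])
  have st: "sets Finf = sigma_sets (space P) (\<Union>l. sets (Fil l))" unfolding Finf_def by (rule sets_measure_of[OF sub])
  have [measurable]: "\<theta> n \<in> borel_measurable Finf" for n
  proof (rule measurableI)
    fix A :: "(real^'d) set" assume "A \<in> sets borel"
    then have "\<theta> n -` A \<inter> space P \<in> sets (Fil n)" using measurable_sets[OF \<theta>_Fil[of n]] by simp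
    then show "\<theta> n -` A \<inter> space Finf \<in> sets Finf" unfolding sp st by (intro sigma_sets.Basic) blast
  qed simp
  have "{\<omega> \<in> space Finf. \<forall>j::nat. \<exists>N. \<forall>n. N \<le> n \<longrightarrow> dist (\<theta> n \<omega>) xs < 1 / real (Suc j)} \<in> sets Finf"
    by measurable
  then show ?thesis unfolding conv_def LIMSEQ_countable_iff sp st .
qed

lemma conv_sets [measurable]: "conv \<in> sets P"
  using conv_Finf sets.sigma_sets_subset[of "\<Union>l. sets (Fil l)" P] sets_Fil_sub by blast

definition stay :: "nat \<Rightarrow> 'w set" where
  "stay N = {\<omega> \<in> space P. \<forall>n\<ge>N. \<theta> n \<omega> \<in> B}"

lemma stay_sets [measurable]: "stay N \<in> sets P"
proof -
  have "{\<omega> \<in> space P. \<forall>n. N \<le> n \<longrightarrow> dist xs (\<theta> n \<omega>) \<le> r0} \<in> sets P" by measurable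
  then show ?thesis by (simp add: stay_def)
qed

text \<open>Convergence forces the path into the ball from some time on, so the exceptional sets
  shrink to the empty set. On \<open>stay N\<close> the stopped and the true iterates agree from N
  on.\<close>

lemma stay_conv: "(\<lambda>N. measure P (conv - stay N)) \<longlonglongrightarrow> 0"
proof -
  have "(\<lambda>N. measure P (conv - stay N)) \<longlonglongrightarrow> measure P (\<Inter>N. conv - stay N)"
    by (rule finite_Lim_measure_decseq) (auto simp: decseq_def stay_def)
  moreover have "(\<Inter>N. conv - stay N) = {}"
  proof -
    have "\<exists>N. \<omega> \<in> stay N" if "\<omega> \<in> conv" for \<omega>
    proof -
      have "(\<lambda>n. \<theta> n \<omega>) \<longlonglongrightarrow> xs" "\<omega> \<in> space P" using that by (auto simp: conv_def)
      from metric_LIMSEQ_D[OF this(1) r0] obtain N where "\<And>n. n \<ge> N \<Longrightarrow> dist (\<theta> n \<omega>) xs < r0" by blast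
      then have "\<omega> \<in> stay N" using \<open>\<omega> \<in> space P\<close> by (auto simp: stay_def dist_commute less_imp_le)
      then show ?thesis ..
    qed
    then show ?thesis by blast
  qed
  ultimately show ?thesis by (simp only: measure_empty)
qed

lemma stopped_stay: "\<omega> \<in> stay N \<Longrightarrow> N \<le> n \<Longrightarrow> stopped N n \<omega> = \<theta> n \<omega>"
  by (auto simp: stopped_def inside_def stay_def)

text \<open>Solving the recursion for the previous iterate turns the weighted sum of errors into the
  martingale part, two sums of increments and the averaged bias.\<close>

lemma average_decomposition:
  assumes \<omega>: "\<omega> \<in> stay N" and n: "N < n"
  shows "X n \<omega> + Hi *v partial_S N n n \<omega> = (1 / A n) *\<^sub>R
    ((\<Sum>k=1..N. real k powr \<rho> *\<^sub>R (\<theta> k \<omega> - xs))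
     - ((\<Sum>k=Suc N..n. real k powr \<rho> * \<beta> k) - A' n) *\<^sub>R (Hi *v \<mu>)
     + (moved \<rho> N n \<omega>)
     + Hi *v (moved (\<rho> + \<psi>) N n \<omega>)
     - Hi *v (\<Sum>k=Suc N..n. real k powr \<rho> *\<^sub>R rem k (stopped N (k - 1) \<omega>)))"
proof -
  note mlin = matrix_vector_mul_linear
  have term_eq: "real k powr \<rho> *\<^sub>R (\<theta> k \<omega> - xs) =
      real k powr \<rho> *\<^sub>R (stopped N k \<omega> - stopped N (k - 1) \<omega>)
      + Hi *v (real k powr (\<rho> + \<psi>) *\<^sub>R (stopped N k \<omega> - stopped N (k - 1) \<omega>))
      - (real k powr \<rho> * \<beta> k) *\<^sub>R (Hi *v \<mu>)
      - Hi *v (real k powr \<rho> *\<^sub>R rem k (stopped N (k - 1) \<omega>))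
      - Hi *v (real k powr \<rho> *\<^sub>R incr N k \<omega>)" if k: "k \<in> {Suc N..n}" for k
  proof -
    have k1: "k \<ge> 1" "k - 1 \<ge> N" "Suc (k - 1) = k" using k by auto
    have st: "stopped N k \<omega> = \<theta> k \<omega>" "stopped N (k - 1) \<omega> = \<theta> (k - 1) \<omega>" using stopped_stay[OF \<omega>] k1 k by auto
    have "\<omega> \<in> space P" "\<theta> (k - 1) \<omega> \<in> B" "\<theta> k \<omega> \<in> B" using \<omega> k1 k by (auto simp: stay_def)
    then have "\<theta> k \<omega> = \<theta> (k - 1) \<omega> + real k powr (- \<psi>) *\<^sub>R (m k (\<theta> (k - 1) \<omega>) + Z k (\<theta> (k - 1) \<omega>) (W k \<omega>))"
      using step[of \<omega> "k - 1"] k1 by simp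
    then have d: "\<theta> k \<omega> - \<theta> (k - 1) \<omega> = real k powr (- \<psi>) *\<^sub>R (m k (\<theta> (k - 1) \<omega>) + incr N k \<omega>)"
      unfolding incr_def st by simp
    \<comment> \<open>The weight k^(\<rho>+\<psi>) cancels the step size and leaves the weight
      k^\<rho> of the average in front of drift and noise.\<close>
    have pw: "real k powr (\<rho> + \<psi>) * real k powr (- \<psi>) = real k powr \<rho>" using k1 by (simp add: powr_add[symmetric])
    have "real k powr (\<rho> + \<psi>) *\<^sub>R (\<theta> k \<omega> - \<theta> (k - 1) \<omega>) = real k powr \<rho> *\<^sub>R (m k (\<theta> (k - 1) \<omega>) + incr N k \<omega>)"
      unfolding d scaleR_scaleR pw ..
    also have "m k (\<theta> (k - 1) \<omega>) = H *v (\<theta> (k - 1) \<omega> - xs) + \<beta> k *\<^sub>R \<mu> + rem k (\<theta> (k - 1) \<omega>)" by (simp add: rem_def)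
    finally have "Hi *v (real k powr (\<rho> + \<psi>) *\<^sub>R (\<theta> k \<omega> - \<theta> (k - 1) \<omega>)) =
       real k powr \<rho> *\<^sub>R (Hi *v (H *v (\<theta> (k - 1) \<omega> - xs))) + (real k powr \<rho> * \<beta> k) *\<^sub>R (Hi *v \<mu>)
       + Hi *v (real k powr \<rho> *\<^sub>R rem k (\<theta> (k - 1) \<omega>)) + Hi *v (real k powr \<rho> *\<^sub>R incr N k \<omega>)"
      by (simp add: linear_add[OF mlin] linear_cmul[OF mlin] scaleR_add_right)
    also have "Hi *v (H *v (\<theta> (k - 1) \<omega> - xs)) = \<theta> (k - 1) \<omega> - xs"
      by (simp add: matrix_vector_mul_assoc Hi)
    finally show ?thesis unfolding st by (simp add: scaleR_diff_right)
  qed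
  have split: "(\<Sum>k=1..n. real k powr \<rho> *\<^sub>R (\<theta> k \<omega> - xs)) = (\<Sum>k=1..N. real k powr \<rho> *\<^sub>R (\<theta> k \<omega> - xs)) + (\<Sum>k=Suc N..n. real k powr \<rho> *\<^sub>R (\<theta> k \<omega> - xs))"
    using sum.ub_add_nat[of 1 N "\<lambda>k. real k powr \<rho> *\<^sub>R (\<theta> k \<omega> - xs)" "n - N"] n by simp
  have "(\<Sum>k=Suc N..n. real k powr \<rho> *\<^sub>R (\<theta> k \<omega> - xs)) =
      (moved \<rho> N n \<omega>)
      + Hi *v (moved (\<rho> + \<psi>) N n \<omega>)
      - (\<Sum>k=Suc N..n. real k powr \<rho> * \<beta> k) *\<^sub>R (Hi *v \<mu>)
      - Hi *v (\<Sum>k=Suc N..n. real k powr \<rho> *\<^sub>R rem k (stopped N (k - 1) \<omega>))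
      - Hi *v (\<Sum>k=Suc N..n. real k powr \<rho> *\<^sub>R incr N k \<omega>)"
    by (simp only: sum.cong[OF refl term_eq] sum.distrib sum_subtractf linear_sum[OF mlin] scaleR_sum_left)
  then show ?thesis
    unfolding X_def partial_S_def split
    by (simp only: linear_cmul[OF mlin] scaleR_add_right[symmetric]) (simp add: algebra_simps)
qed

text \<open>On \<open>stay N\<close> the vector X is minus \<open>Hi\<close> times the martingale up
  to errors T1 and T2; off it the two exponentials differ by at most 2 and the event is rare. The
  sign and \<open>Hi\<close> are moved to the argument, which explains v.\<close>

theorem char_limit:
  "(\<lambda>n. char_on conv u (X n)) \<longlonglongrightarrow>
     measure P conv * complex_of_real (exp (- ((transpose Hi *v u) \<bullet> (\<Gamma> *v (transpose Hi *v u))) / 2))"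
proof (rule LIMSEQ_I)
  fix r :: real assume r: "r > 0"
  define v where "v = - (transpose Hi *v u)"
  define z where "z = complex_of_real (exp (- (v \<bullet> (\<Gamma> *v v)) / 2))"
  have v: "u \<bullet> (- (Hi *v y)) = v \<bullet> y" for y by (simp add: v_def inner_matrix_vector)
  obtain N0 where N0: "N0 \<ge> 1" "\<And>N. N \<ge> N0 \<Longrightarrow> mse_rate N"
    using stopped_second_moment by blast
  obtain N1 where N1: "\<And>N. N \<ge> N1 \<Longrightarrow> measure P (conv - stay N) < r / 8"
    using LIMSEQ_D[OF stay_conv, of "r / 8"] r by auto
  define N where "N = max n0 (max N0 N1)"
  have N: "N \<ge> 1" "N \<ge> N0" "N \<ge> N1" "N \<ge> n0" using N0 by (auto simp: N_def)
  note M2 = N0(2)[OF N(2)]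
  obtain L where L: "L > 0" "\<And>x. norm (Hi *v x) \<le> norm x * L"
    using bounded_linear.pos_bounded[of "(*v) Hi"] matrix_vector_mul_bounded_linear by blast
  have "(\<lambda>n. char_on conv v (partial_S N n n)) \<longlonglongrightarrow> measure P conv * z"
  proof (rule stable_convergence_extend[OF _ _ _ conv_Finf])
    fix l G assume "G \<in> sets (Fil l)"
    from clt_stopped[OF this M2, of v]
    show "(\<lambda>n. char_on G v (partial_S N n n)) \<longlonglongrightarrow> measure P G * z"
      by (simp add: z_def)
  qed auto
  from LIMSEQ_D[OF this, of "r / 4"] r obtain n1 where
    n1: "\<And>n. n \<ge> n1 \<Longrightarrow> norm (char_on conv v (partial_S N n n) - measure P conv * z) < r / 4" by auto
  \<comment> \<open>Small along every path but with no integrable bound at hand, hence truncated at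
    2 and treated by dominated convergence.\<close>
  define T1 where "T1 n \<omega> = norm ((1 / A n) *\<^sub>R (\<Sum>k=1..N. real k powr \<rho> *\<^sub>R (\<theta> k \<omega> - xs)))
     + norm (((\<Sum>k=Suc N..n. real k powr \<rho> * \<beta> k) - A' n) / A n) * norm (Hi *v \<mu>)" for n \<omega>
  define V where "V w n \<omega> = norm (moved w N n \<omega>)" for w n \<omega>
  define V' where "V' n \<omega> = (\<Sum>k=Suc N..n. real k powr \<rho> * norm (rem k (stopped N (k - 1) \<omega>)))" for n \<omega>
  \<comment> \<open>Small in mean: two sums of increments, and the remainders of drift and
    bias.\<close>
  define T2 where "T2 n \<omega> = V \<rho> n \<omega> / A n + L * (V (\<rho> + \<psi>) n \<omega> / A n) + L * (V' n \<omega> / A n)" for n \<omega>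
  have [measurable]: "T1 n \<in> borel_measurable P" for n unfolding T1_def by measurable
  have [measurable]: "V w n \<in> borel_measurable P" for w n unfolding V_def by measurable
  have iV: "integrable P (V w n)" for w n
  proof -
    have "integrable P (\<lambda>\<omega>. stopped N k \<omega>)" for k
      using stopped_in_B by (intro integrable_const_bound[of _ "norm xs + r0"])
        (auto intro!: AE_I2 order_trans[OF norm_triangle_sub[of _ xs]] add_left_mono stopped_norm)
    then show ?thesis unfolding V_def by auto
  qed
  have iV': "integrable P (V' n)" for n
    unfolding V'_def using N by (intro Bochner_Integration.integrable_sum integrable_mult_right integrable_rem) auto
  have iT2: "integrable P (T2 n)" for n unfolding T2_def using iV iV' by auto
  have Apos: "eventually (\<lambda>n. A n > 0) sequentially" using filterlim_at_top_dense[THEN iffD1, OF A_top, rule_format, of 0] .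
  have ET2: "(\<lambda>n. \<integral>\<omega>. T2 n \<omega> \<partial>P) \<longlonglongrightarrow> 0"
  proof -
    have eq: "(\<integral>\<omega>. T2 n \<omega> \<partial>P) = (\<integral>\<omega>. V \<rho> n \<omega> \<partial>P) / A n + L * ((\<integral>\<omega>. V (\<rho> + \<psi>) n \<omega> \<partial>P) / A n) + L * ((\<integral>\<omega>. V' n \<omega> \<partial>P) / A n)" for n
      unfolding T2_def using iV iV' by simp
    have 1: "(\<lambda>n. (\<integral>\<omega>. V \<rho> n \<omega> \<partial>P) / A n) \<longlonglongrightarrow> 0"
      unfolding V_def using \<psi> R by (intro abel_negligible[OF M2 N(1)]) (auto simp: e_def field_simps)
    have 2: "(\<lambda>n. (\<integral>\<omega>. V (\<rho> + \<psi>) n \<omega> \<partial>P) / A n) \<longlonglongrightarrow> 0"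
      unfolding V_def using \<psi> R by (intro abel_negligible[OF M2 N(1)]) (auto simp: e_def field_simps)
    have 3: "(\<lambda>n. (\<integral>\<omega>. V' n \<omega> \<partial>P) / A n) \<longlonglongrightarrow> 0"
    proof -
      define g where "g k = real k powr R * mean_rem N k" for k
      have g0: "0 \<le> g k" for k unfolding g_def by (intro mult_nonneg_nonneg Bochner_Integration.integral_nonneg) auto
      have "0 < \<rho> + 1 - R" using R by simp
      from over_A[OF power_sum_weighted[OF this rem_negligible[OF M2]]]
      have lim: "(\<lambda>n. (\<Sum>k=1..n. real k powr (\<rho> + 1 - R - 1) * g k) / A n) \<longlonglongrightarrow> 0" by (simp add: g_def)
      show ?thesis
      proof (rule tendsto_0_le[OF lim, of _ 1])
        show "eventually (\<lambda>n. norm ((\<integral>\<omega>. V' n \<omega> \<partial>P) / A n) \<le> norm ((\<Sum>k=1..n. real k powr (\<rho> + 1 - R - 1) * g k) / A n) * 1) sequentially"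
          using Apos
        proof eventually_elim
          case (elim n)
          have "(\<integral>\<omega>. V' n \<omega> \<partial>P) = (\<Sum>k=Suc N..n. real k powr \<rho> * mean_rem N k)"
            unfolding V'_def using integrable_rem N by (subst Bochner_Integration.integral_sum) auto
          also have "\<dots> = (\<Sum>k=Suc N..n. real k powr (\<rho> + 1 - R - 1) * g k)"
            by (intro sum.cong) (auto simp: g_def mult.assoc[symmetric] powr_add[symmetric])
          also have "\<dots> \<le> (\<Sum>k=1..n. real k powr (\<rho> + 1 - R - 1) * g k)"
            using g0 by (intro sum_mono2) auto
          finally have "(\<integral>\<omega>. V' n \<omega> \<partial>P) \<le> (\<Sum>k=1..n. real k powr (\<rho> + 1 - R - 1) * g k)" .
          moreover have "0 \<le> (\<integral>\<omega>. V' n \<omega> \<partial>P)" unfolding V'_def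
            by (intro Bochner_Integration.integral_nonneg sum_nonneg) auto
          ultimately show ?case using elim by (simp add: divide_right_mono)
        qed
      qed
    qed
    have "(\<lambda>n. (\<integral>\<omega>. V \<rho> n \<omega> \<partial>P) / A n + L * ((\<integral>\<omega>. V (\<rho> + \<psi>) n \<omega> \<partial>P) / A n) + L * ((\<integral>\<omega>. V' n \<omega> \<partial>P) / A n)) \<longlonglongrightarrow> 0 + L * 0 + L * 0"
      by (intro tendsto_intros 1 2 3)
    then show ?thesis unfolding eq by simp
  qed
  have T1_lim: "(\<lambda>n. T1 n \<omega>) \<longlonglongrightarrow> 0" for \<omega>
  proof -
    have 1: "(\<lambda>n. norm ((1 / A n) *\<^sub>R (\<Sum>k=1..N. real k powr \<rho> *\<^sub>R (\<theta> k \<omega> - xs)))) \<longlonglongrightarrow> norm (0 *\<^sub>R (\<Sum>k=1..N. real k powr \<rho> *\<^sub>R (\<theta> k \<omega> - xs)))"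
      by (intro tendsto_intros A_inverse)
    have "(\<lambda>n. ((\<Sum>k=1..n. real k powr \<rho> * \<beta> k) - A' n) / A n - (\<Sum>k=1..N. real k powr \<rho> * \<beta> k) / A n) \<longlonglongrightarrow> 0 - 0"
      by (intro tendsto_diff over_A[OF A'] A_inverse)
    moreover have "eventually (\<lambda>n. ((\<Sum>k=1..n. real k powr \<rho> * \<beta> k) - A' n) / A n - (\<Sum>k=1..N. real k powr \<rho> * \<beta> k) / A n
        = ((\<Sum>k=Suc N..n. real k powr \<rho> * \<beta> k) - A' n) / A n) sequentially"
      using eventually_ge_at_top[of N]
    proof eventually_elim
      case (elim n)
      show ?case using sum.ub_add_nat[of 1 N "\<lambda>k. real k powr \<rho> * \<beta> k" "n - N"] elim
        by (simp add: diff_divide_distrib add_divide_distrib)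
    qed
    ultimately have "(\<lambda>n. ((\<Sum>k=Suc N..n. real k powr \<rho> * \<beta> k) - A' n) / A n) \<longlonglongrightarrow> 0"
      using Lim_transform_eventually by fastforce
    then have "(\<lambda>n. norm (((\<Sum>k=Suc N..n. real k powr \<rho> * \<beta> k) - A' n) / A n) * norm (Hi *v \<mu>)) \<longlonglongrightarrow> norm (0::real) * norm (Hi *v \<mu>)"
      by (intro tendsto_intros)
    from tendsto_add[OF 1 this] show ?thesis unfolding T1_def by simp
  qed
  have ET1: "(\<lambda>n. \<integral>\<omega>. min 2 (norm u * T1 n \<omega>) \<partial>P) \<longlonglongrightarrow> 0"
  proof -
    have "(\<lambda>n. \<integral>\<omega>. min 2 (norm u * T1 n \<omega>) \<partial>P) \<longlonglongrightarrow> (\<integral>\<omega>. 0 \<partial>P)"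
    proof (rule integral_dominated_convergence[where w = "\<lambda>_. 2"])
      show "AE \<omega> in P. (\<lambda>n. min 2 (norm u * T1 n \<omega>)) \<longlonglongrightarrow> 0"
      proof (rule AE_I2)
        fix \<omega>
        have "(\<lambda>n. min 2 (norm u * T1 n \<omega>)) \<longlonglongrightarrow> min 2 (norm u * 0)" by (intro tendsto_intros T1_lim)
        then show "(\<lambda>n. min 2 (norm u * T1 n \<omega>)) \<longlonglongrightarrow> 0" by simp
      qed
      have "0 \<le> norm u * T1 n \<omega>" for n \<omega> unfolding T1_def by (intro mult_nonneg_nonneg add_nonneg_nonneg) auto
      then show "AE \<omega> in P. norm (min 2 (norm u * T1 n \<omega>)) \<le> 2" for n by (auto simp: min_def)
    qed auto
    then show ?thesis by simp
  qed
  have "(\<lambda>n. (\<integral>\<omega>. min 2 (norm u * T1 n \<omega>) \<partial>P) + norm u * (\<integral>\<omega>. T2 n \<omega> \<partial>P)) \<longlonglongrightarrow> 0 + norm u * 0"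
    by (intro tendsto_intros ET1 ET2)
  from LIMSEQ_D[OF this, of "r / 4"] r obtain n2 where
    n2: "\<And>n. n \<ge> n2 \<Longrightarrow> \<bar>(\<integral>\<omega>. min 2 (norm u * T1 n \<omega>) \<partial>P) + norm u * (\<integral>\<omega>. T2 n \<omega> \<partial>P)\<bar> < r / 4" by auto
  obtain n3 where n3: "\<And>n. n \<ge> n3 \<Longrightarrow> A n > 0" using Apos by (auto simp: eventually_sequentially)
  have main: "norm (char_on conv u (X n) - measure P conv * z) < r"
    if n: "n \<ge> max (max n1 n2) (max n3 (Suc N))" for n
  proof -
    have An: "A n > 0" using n3 n by simp
    have int: "integrable P (\<lambda>\<omega>. indicator conv \<omega> * iexp (f \<omega>))" if [measurable]: "f \<in> borel_measurable P" for f
      by (rule integrable_const_bound[of _ 1]) (auto simp: norm_mult indicator_def)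
    have T1nn: "0 \<le> norm u * T1 n \<omega>" for \<omega> unfolding T1_def by (intro mult_nonneg_nonneg add_nonneg_nonneg) auto
    have T2nn: "0 \<le> norm u * T2 n \<omega>" for \<omega> unfolding T2_def V_def V'_def using An L
      by (intro mult_nonneg_nonneg add_nonneg_nonneg divide_nonneg_nonneg sum_nonneg) auto
    have iT1: "integrable P (\<lambda>\<omega>. min 2 (norm u * T1 n \<omega>))"
      by (rule integrable_const_bound[of _ 2]) (use T1nn in \<open>auto simp: min_def\<close>)
    have iD: "integrable P (\<lambda>\<omega>. 2 * indicat_real (conv - stay N) \<omega> + (min 2 (norm u * T1 n \<omega>) + norm u * T2 n \<omega>))"
      using iT1 iT2 by (auto simp: emeasure_eq_measure)
    have diff: "char_on conv u (X n) - char_on conv v (partial_S N n n)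
      = (\<integral>\<omega>. indicator conv \<omega> * iexp (u \<bullet> X n \<omega>) - indicator conv \<omega> * iexp (v \<bullet> partial_S N n n \<omega>) \<partial>P)"
      by (rule Bochner_Integration.integral_diff[symmetric]) (auto intro!: int)
    have "norm (char_on conv u (X n) - char_on conv v (partial_S N n n))
      \<le> (\<integral>\<omega>. norm (indicator conv \<omega> * iexp (u \<bullet> X n \<omega>) - indicator conv \<omega> * iexp (v \<bullet> partial_S N n n \<omega>)) \<partial>P)"
      unfolding diff by (rule integral_norm_bound)
    also have "\<dots> \<le> (\<integral>\<omega>. 2 * indicat_real (conv - stay N) \<omega> + (min 2 (norm u * T1 n \<omega>) + norm u * T2 n \<omega>) \<partial>P)"
    proof (rule integral_mono'[OF iD])
      fix \<omega>
      show "0 \<le> 2 * indicat_real (conv - stay N) \<omega> + (min 2 (norm u * T1 n \<omega>) + norm u * T2 n \<omega>)"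
        using T1nn T2nn by (intro add_nonneg_nonneg) auto
      have d2: "norm (iexp a - iexp b) \<le> 2" for a b :: real
        by (rule order_trans[OF norm_triangle_ineq4]) simp
      have d1: "norm (iexp a - iexp b) \<le> \<bar>a - b\<bar>" for a b :: real
      proof -
        have "iexp a - iexp b = iexp b * (iexp (a - b) - 1)" by (simp add: exp_diff field_simps)
        then have "norm (iexp a - iexp b) = norm (iexp (a - b) - 1)" by (simp add: norm_mult)
        then show ?thesis using iexp_approx1[of "a - b" 0] by simp
      qed
      show "norm (indicator conv \<omega> * iexp (u \<bullet> X n \<omega>) - indicator conv \<omega> * iexp (v \<bullet> partial_S N n n \<omega>))
          \<le> 2 * indicat_real (conv - stay N) \<omega> + (min 2 (norm u * T1 n \<omega>) + norm u * T2 n \<omega>)"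
      proof (cases "\<omega> \<in> conv")
        case False
        then show ?thesis using T1nn[of \<omega>] T2nn[of \<omega>] by simp
      next
        case True
        show ?thesis
        proof (cases "\<omega> \<in> stay N")
          case False
          have "norm (iexp (u \<bullet> X n \<omega>) - iexp (v \<bullet> partial_S N n n \<omega>)) \<le> 2" by (rule d2)
          moreover have "0 \<le> min 2 (norm u * T1 n \<omega>) + norm u * T2 n \<omega>" using T1nn[of \<omega>] T2nn[of \<omega>] by simp
          ultimately show ?thesis using True False by simp
        next
          case st: True
          let ?s1 = "\<Sum>k=1..N. real k powr \<rho> *\<^sub>R (\<theta> k \<omega> - xs)" and ?s2 = "((\<Sum>k=Suc N..n. real k powr \<rho> * \<beta> k) - A' n) *\<^sub>R (Hi *v \<mu>)"
          let ?s3 = "moved \<rho> N n \<omega>"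
          let ?s4 = "Hi *v (moved (\<rho> + \<psi>) N n \<omega>)"
          let ?s5 = "Hi *v (\<Sum>k=Suc N..n. real k powr \<rho> *\<^sub>R rem k (stopped N (k - 1) \<omega>))"
          have "norm (X n \<omega> + Hi *v partial_S N n n \<omega>) = norm (?s1 - ?s2 + ?s3 + ?s4 - ?s5) / A n"
            using average_decomposition[OF st, of n] n An by simp
          also have "\<dots> \<le> (norm ?s1 + norm ?s2 + norm ?s3 + norm ?s4 + norm ?s5) / A n"
            using An by (intro divide_right_mono order_trans[OF norm_triangle_ineq4] order_trans[OF norm_triangle_ineq] add_mono order_refl) auto
          also have "\<dots> \<le> (norm ?s1 + norm ?s2 + V \<rho> n \<omega> + L * V (\<rho> + \<psi>) n \<omega> + L * V' n \<omega>) / A n"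
          proof (intro divide_right_mono add_mono order_refl)
            show "norm ?s3 \<le> V \<rho> n \<omega>" by (simp add: V_def)
            show "norm ?s4 \<le> L * V (\<rho> + \<psi>) n \<omega>" using L(2) by (simp add: V_def mult.commute)
            have "norm (\<Sum>k=Suc N..n. real k powr \<rho> *\<^sub>R rem k (stopped N (k - 1) \<omega>)) \<le> V' n \<omega>"
              unfolding V'_def by (rule order_trans[OF norm_sum]) simp
            then have "norm (\<Sum>k=Suc N..n. real k powr \<rho> *\<^sub>R rem k (stopped N (k - 1) \<omega>)) * L \<le> V' n \<omega> * L"
              using L(1) by (intro mult_right_mono) auto
            then show "norm ?s5 \<le> L * V' n \<omega>"
              using order_trans[OF L(2)] by (simp only: mult.commute)
          qed (use An in simp)
          also have "\<dots> = T1 n \<omega> + T2 n \<omega>"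
            using An by (simp add: T1_def T2_def add_divide_distrib abs_mult abs_divide)
          finally have D: "norm (X n \<omega> + Hi *v partial_S N n n \<omega>) \<le> T1 n \<omega> + T2 n \<omega>" .
          have "\<bar>u \<bullet> X n \<omega> - v \<bullet> partial_S N n n \<omega>\<bar> = \<bar>u \<bullet> (X n \<omega> + Hi *v partial_S N n n \<omega>)\<bar>"
            unfolding v[symmetric] by (simp add: inner_add_right)
          also have "\<dots> \<le> norm u * (T1 n \<omega> + T2 n \<omega>)"
            by (rule order_trans[OF Cauchy_Schwarz_ineq2 mult_left_mono[OF D]]) simp
          finally have "norm (iexp (u \<bullet> X n \<omega>) - iexp (v \<bullet> partial_S N n n \<omega>)) \<le> norm u * T1 n \<omega> + norm u * T2 n \<omega>"
            using d1[of "u \<bullet> X n \<omega>" "v \<bullet> partial_S N n n \<omega>"] by (simp add: distrib_left)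
          then have "norm (iexp (u \<bullet> X n \<omega>) - iexp (v \<bullet> partial_S N n n \<omega>)) \<le> min 2 (norm u * T1 n \<omega>) + norm u * T2 n \<omega>"
            using d2[of "u \<bullet> X n \<omega>" "v \<bullet> partial_S N n n \<omega>"] T2nn[of \<omega>] by linarith
          then show ?thesis using True st by simp
        qed
      qed
    qed
    also have "\<dots> = 2 * measure P (conv - stay N) + ((\<integral>\<omega>. min 2 (norm u * T1 n \<omega>) \<partial>P) + norm u * (\<integral>\<omega>. T2 n \<omega> \<partial>P))"
      using iT1 iT2 by (simp add: emeasure_eq_measure)
    also have "\<dots> < 2 * (r / 8) + r / 4"
      using N1[OF N(3)] abs_less_iff[THEN iffD1, OF n2[of n]] n by (intro add_strict_mono) auto
    finally have "norm (char_on conv u (X n) - char_on conv v (partial_S N n n)) < r / 2" by simp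
    moreover have "norm (char_on conv v (partial_S N n n) - measure P conv * z) < r / 4" using n1 n by simp
    ultimately show ?thesis using norm_diff_triangle_less[of _ _ "r / 2" _ "r / 4"] r by fastforce
  qed
  have zeq: "z = complex_of_real (exp (- ((transpose Hi *v u) \<bullet> (\<Gamma> *v (transpose Hi *v u))) / 2))"
    unfolding z_def v_def by (simp add: linear_neg[OF matrix_vector_mul_linear])
  show "\<exists>n0. \<forall>n\<ge>n0. norm (char_on conv u (X n) -
      measure P conv * complex_of_real (exp (- ((transpose Hi *v u) \<bullet> (\<Gamma> *v (transpose Hi *v u))) / 2))) < r"
    using main unfolding zeq by blast
qed

end

section \<open>Moment estimates\<close>

text \<open>The factor 2 is 1 from the values below s plus 1 from the q-th moment above s.\<close>

lemma (in prob_space) lower_moment: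
  fixes Y :: "'a \<Rightarrow> real"
  assumes [measurable]: "Y \<in> borel_measurable M" and Y0: "\<And>\<omega>. 0 \<le> Y \<omega>"
    and int: "integrable M (\<lambda>\<omega>. Y \<omega> powr q)" and E: "expectation (\<lambda>\<omega>. Y \<omega> powr q) \<le> s powr q"
    and s: "s > 0" and p: "0 \<le> p" "p \<le> q"
  shows "integrable M (\<lambda>\<omega>. Y \<omega> powr p)" "expectation (\<lambda>\<omega>. Y \<omega> powr p) \<le> 2 * s powr p"
proof -
  have b: "Y \<omega> powr p \<le> s powr p * (1 + Y \<omega> powr q / s powr q)" for \<omega>
    using powr_le_one_plus[OF Y0 s p, of \<omega>] s Y0 by (simp add: powr_divide)
  have i: "integrable M (\<lambda>\<omega>. s powr p * (1 + Y \<omega> powr q / s powr q))" using int by auto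
  show ip: "integrable M (\<lambda>\<omega>. Y \<omega> powr p)"
    by (rule Bochner_Integration.integrable_bound[OF i]) (use b in \<open>auto intro: order_trans[OF b abs_ge_self]\<close>)
  have "expectation (\<lambda>\<omega>. Y \<omega> powr p) \<le> expectation (\<lambda>\<omega>. s powr p * (1 + Y \<omega> powr q / s powr q))"
    by (rule Bochner_Integration.integral_mono[OF ip i b])
  also have "\<dots> = s powr p * (1 + expectation (\<lambda>\<omega>. Y \<omega> powr q) / s powr q)"
    using int by (simp add: prob_space)
  also have "\<dots> \<le> s powr p * (1 + 1)"
    using E s by (intro mult_left_mono add_left_mono) (auto simp: field_simps)
  finally show "expectation (\<lambda>\<omega>. Y \<omega> powr p) \<le> 2 * s powr p" by simp
qed

text \<open>Taylor's bounds |y|^3 / 6 and y^2 are interpolated, the first for |y| \<le> 1 and the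
  second beyond, because the tail hypothesis provides only a moment of some order above 2.\<close>

lemma iexp_second_order:
  fixes y q :: real
  assumes q: "2 \<le> q" "q \<le> 3"
  shows "norm (iexp y - (1 + \<i> * y - y\<^sup>2 / 2)) \<le> \<bar>y\<bar> powr q"
proof -
  have eq: "(\<Sum>k\<le>2. (\<i> * complex_of_real y) ^ k / fact k) = 1 + \<i> * y - y\<^sup>2 / 2"
    by (simp add: numeral_2_eq_2 power2_eq_square algebra_simps)
  have 1: "norm (iexp y - (1 + \<i> * y - y\<^sup>2 / 2)) \<le> \<bar>y\<bar> ^ 3 / 6"
    using iexp_approx1[of y 2] unfolding eq by (simp add: numeral_3_eq_3 fact_numeral)
  have 2: "norm (iexp y - (1 + \<i> * y - y\<^sup>2 / 2)) \<le> y\<^sup>2"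
    using iexp_approx2[of y 2] unfolding eq by simp
  show ?thesis
  proof (cases "\<bar>y\<bar> \<le> 1")
    case True
    have "\<bar>y\<bar> ^ 3 / 6 \<le> \<bar>y\<bar> powr q"
    proof (cases "y = 0")
      case False
      then have "\<bar>y\<bar> powr 3 \<le> \<bar>y\<bar> powr q" using True q by (intro powr_mono') auto
      then have "\<bar>y\<bar> ^ 3 \<le> \<bar>y\<bar> powr q" using False by (simp add: powr_numeral)
      moreover have "0 \<le> \<bar>y\<bar> ^ 3" by simp
      ultimately show ?thesis by linarith
    qed simp
    with 1 show ?thesis by linarith
  next
    case False
    then have "\<bar>y\<bar> powr 2 \<le> \<bar>y\<bar> powr q" using q by (intro powr_mono) auto
    then have "y\<^sup>2 \<le> \<bar>y\<bar> powr q" using False by (simp add: powr_numeral)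
    with 2 show ?thesis by linarith
  qed
qed

text \<open>The counterpart on the normal side: x will be t^2 v / 2, and the exponent q/2 makes its
  power comparable to the q-th power of t times the standard deviation.\<close>

lemma exp_first_order:
  fixes x q :: real
  assumes q: "2 \<le> q" "q \<le> 4" and x: "0 \<le> x"
  shows "\<bar>exp (- x) - (1 - x)\<bar> \<le> x powr (q / 2)"
proof -
  have l: "0 \<le> exp (- x) - (1 - x)" using exp_ge_add_one_self[of "- x"] by simp
  show ?thesis
  proof (cases "x \<le> 1")
    case True
    have "exp (- x) \<le> 1 - x + x\<^sup>2"
    proof -
      have "1 \<le> (1 + x) * (1 - x + x\<^sup>2)" using x by (simp add: algebra_simps power2_eq_square)
      also have "\<dots> \<le> exp x * (1 - x + x\<^sup>2)"
        using exp_ge_add_one_self[of x] True x by (intro mult_right_mono) (auto intro: add_nonneg_nonneg)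
      finally show ?thesis by (simp add: exp_minus field_simps)
    qed
    then have "\<bar>exp (- x) - (1 - x)\<bar> \<le> x\<^sup>2" using l by simp
    also have "x\<^sup>2 \<le> x powr (q / 2)"
    proof (cases "x = 0")
      case False
      then have "x powr 2 \<le> x powr (q / 2)" using True q x by (intro powr_mono') auto
      then show ?thesis using False x by (simp add: powr_numeral)
    qed simp
    finally show ?thesis .
  next
    case False
    then have "exp (- x) - (1 - x) \<le> x" using x by simp
    also have "x \<le> x powr (q / 2)" using False q powr_mono[of 1 "q / 2" x] by simp
    finally show ?thesis using l by simp
  qed
qed

text \<open>Both sides are compared with 1 - t^2 v / 2. The factor 3 is 2 from the moment of order q
  and 1 from the normal side.\<close>

lemma (in prob_space) char_normal_approx:
  fixes Y :: "'a \<Rightarrow> real"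
  assumes Y: "integrable M Y" "expectation Y = 0" and q: "2 < q" "q \<le> 3" and s: "s > 0"
    and Y2: "integrable M (\<lambda>\<omega>. (Y \<omega>)\<^sup>2)" "expectation (\<lambda>\<omega>. (Y \<omega>)\<^sup>2) \<le> 2 * s\<^sup>2"
    and Yq: "integrable M (\<lambda>\<omega>. \<bar>Y \<omega>\<bar> powr q)" "expectation (\<lambda>\<omega>. \<bar>Y \<omega>\<bar> powr q) \<le> 2 * s powr q"
  shows "norm (expectation (\<lambda>\<omega>. iexp (t * Y \<omega>)) - exp (- (t\<^sup>2 * expectation (\<lambda>\<omega>. (Y \<omega>)\<^sup>2) / 2))) \<le> 3 * (\<bar>t\<bar> * s) powr q"
proof -
  have [measurable]: "Y \<in> borel_measurable M" using Y by auto
  define v where "v = expectation (\<lambda>\<omega>. (Y \<omega>)\<^sup>2)"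
  have v: "0 \<le> v" unfolding v_def by (rule Bochner_Integration.integral_nonneg) simp
  have iE: "integrable M (\<lambda>\<omega>. iexp (t * Y \<omega>))" by (rule integrable_const_bound[of _ 1]) auto
  have iP: "integrable M (\<lambda>\<omega>. 1 + \<i> * complex_of_real (t * Y \<omega>) - complex_of_real ((t * Y \<omega>)\<^sup>2) / 2)"
  proof -
    have "integrable M (\<lambda>\<omega>. complex_of_real (t * Y \<omega>))" "integrable M (\<lambda>\<omega>. complex_of_real ((t * Y \<omega>)\<^sup>2))"
      using Y Y2 by (auto simp: power_mult_distrib intro!: integrable_of_real simp del: of_real_mult of_real_power)
    then show ?thesis
      by (intro Bochner_Integration.integrable_diff Bochner_Integration.integrable_add integrable_mult_right integrable_divide) auto
  qed
  have P: "expectation (\<lambda>\<omega>. 1 + \<i> * complex_of_real (t * Y \<omega>) - complex_of_real ((t * Y \<omega>)\<^sup>2) / 2) = complex_of_real (1 - t\<^sup>2 * v / 2)"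
  proof -
    have "1 + \<i> * complex_of_real (t * Y \<omega>) - complex_of_real ((t * Y \<omega>)\<^sup>2) / 2 =
      complex_of_real (1 - t\<^sup>2 / 2 * (Y \<omega>)\<^sup>2) + \<i> * complex_of_real t * complex_of_real (Y \<omega>)" for \<omega>
      by (simp add: power_mult_distrib)
    moreover have "integrable M (\<lambda>\<omega>. complex_of_real (1 - t\<^sup>2 / 2 * (Y \<omega>)\<^sup>2))" "integrable M (\<lambda>\<omega>. \<i> * complex_of_real t * complex_of_real (Y \<omega>))"
      using Y Y2 by (auto intro!: integrable_of_real simp del: of_real_mult of_real_power of_real_diff)
    moreover have "expectation (\<lambda>\<omega>. 1 - t\<^sup>2 / 2 * (Y \<omega>)\<^sup>2) = 1 - t\<^sup>2 / 2 * v" using Y2 by (simp add: v_def prob_space)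
    ultimately show ?thesis using Y by (simp add: integral_complex_of_real del: of_real_mult of_real_power of_real_diff)
  qed
  have "norm (expectation (\<lambda>\<omega>. iexp (t * Y \<omega>)) - complex_of_real (1 - t\<^sup>2 * v / 2))
      = norm (expectation (\<lambda>\<omega>. iexp (t * Y \<omega>) - (1 + \<i> * complex_of_real (t * Y \<omega>) - complex_of_real ((t * Y \<omega>)\<^sup>2) / 2)))"
    unfolding P[symmetric] using iE iP by simp
  also have "\<dots> \<le> expectation (\<lambda>\<omega>. norm (iexp (t * Y \<omega>) - (1 + \<i> * complex_of_real (t * Y \<omega>) - complex_of_real ((t * Y \<omega>)\<^sup>2) / 2)))"
    by (rule integral_norm_bound)
  also have "\<dots> \<le> expectation (\<lambda>\<omega>. \<bar>t\<bar> powr q * \<bar>Y \<omega>\<bar> powr q)"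
  proof (rule Bochner_Integration.integral_mono)
    show "norm (iexp (t * Y \<omega>) - (1 + \<i> * complex_of_real (t * Y \<omega>) - complex_of_real ((t * Y \<omega>)\<^sup>2) / 2)) \<le> \<bar>t\<bar> powr q * \<bar>Y \<omega>\<bar> powr q" for \<omega>
      using iexp_second_order[of q "t * Y \<omega>"] q by (simp add: abs_mult powr_mult)
  qed (use iE iP Yq in \<open>auto intro!: integrable_norm\<close>)
  also have "\<dots> \<le> \<bar>t\<bar> powr q * (2 * s powr q)" using Yq by (simp add: mult_left_mono)
  also have "\<dots> = 2 * (\<bar>t\<bar> * s) powr q" using s by (simp add: powr_mult)
  finally have 1: "norm (expectation (\<lambda>\<omega>. iexp (t * Y \<omega>)) - complex_of_real (1 - t\<^sup>2 * v / 2)) \<le> 2 * (\<bar>t\<bar> * s) powr q" .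
  have x: "0 \<le> t\<^sup>2 * v / 2" using v by simp
  have "\<bar>exp (- (t\<^sup>2 * v / 2)) - (1 - t\<^sup>2 * v / 2)\<bar> \<le> (t\<^sup>2 * v / 2) powr (q / 2)"
    using exp_first_order[OF _ _ x, of q] q by simp
  also have "\<dots> \<le> ((\<bar>t\<bar> * s) powr 2) powr (q / 2)"
  proof (rule powr_mono2)
    have "t\<^sup>2 * v \<le> t\<^sup>2 * (2 * s\<^sup>2)" using Y2 by (intro mult_left_mono) (auto simp: v_def)
    then show "t\<^sup>2 * v / 2 \<le> (\<bar>t\<bar> * s) powr 2" using s by (simp add: powr_numeral power_mult_distrib)
  qed (use x q in auto)
  also have "\<dots> = (\<bar>t\<bar> * s) powr q" unfolding powr_powr by simp
  finally have 2: "norm (complex_of_real (1 - t\<^sup>2 * v / 2) - complex_of_real (exp (- (t\<^sup>2 * v / 2)))) \<le> (\<bar>t\<bar> * s) powr q"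
    unfolding of_real_diff[symmetric] norm_of_real by (simp add: abs_minus_commute)
  show ?thesis unfolding v_def[symmetric]
    using norm_triangle_ineq[of "expectation (\<lambda>\<omega>. iexp (t * Y \<omega>)) - complex_of_real (1 - t\<^sup>2 * v / 2)"
        "complex_of_real (1 - t\<^sup>2 * v / 2) - complex_of_real (exp (- (t\<^sup>2 * v / 2)))"] 1 2 by simp
qed

lemma (in prob_space) indep_centred_sum_square:
  fixes X :: "'i \<Rightarrow> 'a \<Rightarrow> real"
  assumes "finite I" and indep: "indep_vars (\<lambda>_. borel) X I"
    and X: "\<And>i. i \<in> I \<Longrightarrow> integrable M (X i)" "\<And>i. i \<in> I \<Longrightarrow> expectation (X i) = 0" "\<And>i. i \<in> I \<Longrightarrow> integrable M (\<lambda>\<omega>. (X i \<omega>)\<^sup>2)"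
  shows "integrable M (\<lambda>\<omega>. (\<Sum>i\<in>I. X i \<omega>)\<^sup>2) \<and> expectation (\<lambda>\<omega>. (\<Sum>i\<in>I. X i \<omega>)\<^sup>2) = (\<Sum>i\<in>I. expectation (\<lambda>\<omega>. (X i \<omega>)\<^sup>2))"
  using assms
proof (induction I rule: finite_induct)
  case empty
  then show ?case by simp
next
  case (insert i I)
  have ind: "indep_var borel (X i) borel (\<lambda>\<omega>. \<Sum>i\<in>I. X i \<omega>)"
    by (rule indep_vars_sum[OF insert.hyps insert.prems(1)])
  have IH: "integrable M (\<lambda>\<omega>. (\<Sum>i\<in>I. X i \<omega>)\<^sup>2)" "expectation (\<lambda>\<omega>. (\<Sum>i\<in>I. X i \<omega>)\<^sup>2) = (\<Sum>i\<in>I. expectation (\<lambda>\<omega>. (X i \<omega>)\<^sup>2))"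
    using insert.IH[OF indep_vars_subset[OF insert.prems(1)]] insert.prems by auto
  have iS: "integrable M (\<lambda>\<omega>. \<Sum>i\<in>I. X i \<omega>)" using insert.prems by auto
  have prod: "integrable M (\<lambda>\<omega>. X i \<omega> * (\<Sum>i\<in>I. X i \<omega>))" "expectation (\<lambda>\<omega>. X i \<omega> * (\<Sum>i\<in>I. X i \<omega>)) = 0"
    using indep_var_integrable[OF ind] indep_var_lebesgue_integral[OF ind] insert.prems(2,3) iS by auto
  have eq: "(\<lambda>\<omega>. (\<Sum>i\<in>insert i I. X i \<omega>)\<^sup>2) = (\<lambda>\<omega>. (X i \<omega>)\<^sup>2 + 2 * (X i \<omega> * (\<Sum>i\<in>I. X i \<omega>)) + (\<Sum>i\<in>I. X i \<omega>)\<^sup>2)"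
    using insert.hyps by (auto simp: power2_sum algebra_simps)
  show ?case unfolding eq using IH prod insert.prems(4)[of i] insert.hyps by simp
qed

text \<open>The relative increment of \<open>Kbar\<close> is asymptotically (phi + 1)/n and tends to
  zero, so the relative increment of \<open>Kbar powr e\<close> is asymptotically e times as large,
  e being the derivative of (1 + x)^e at 0.\<close>

lemma power_sum_diff_asymp:
  fixes K :: "nat \<Rightarrow> real"
  assumes phi: "phi > 0" and kap: "kap > 0" and e: "e > 0"
    and K: "\<And>n. K n = kap * (phi + 1) * real n powr phi" and Kbar: "\<And>n. Kbar n = (\<Sum>k=1..n. K k)"
  shows "(\<lambda>n. Kbar n / (kap * real n powr (phi + 1))) \<longlonglongrightarrow> 1"
    and "(\<lambda>k. real k powr ((phi + 1) * e - 1) / (Kbar k powr e - Kbar (k - 1) powr e)) \<longlonglongrightarrow> 1 / ((phi + 1) * e * kap powr e)"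
proof -
  have Ks: "Kbar n = kap * (phi + 1) * (\<Sum>k=1..n. real k powr (phi + 1 - 1))" for n
    by (simp add: Kbar K sum_distrib_left)
  have lim: "(\<lambda>n. (phi + 1) * ((\<Sum>k=1..n. real k powr (phi + 1 - 1)) / real n powr (phi + 1))) \<longlonglongrightarrow> (phi + 1) * (1 / (phi + 1))"
    using phi by (intro tendsto_intros power_sum_asymp) auto
  show 1: "(\<lambda>n. Kbar n / (kap * real n powr (phi + 1))) \<longlonglongrightarrow> 1"
    using lim phi kap unfolding Ks by (simp del: add_diff_cancel_right')
  define a where "a = phi + 1"
  have a: "a > 1" using phi by (simp add: a_def)
  define y where "y n = Kbar n / (kap * real n powr a)" for n
  have y1: "y \<longlonglongrightarrow> 1" using 1 by (simp add: y_def[abs_def] a_def)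
  have Kpos: "Kbar n > 0" if "n \<ge> 1" for n
    unfolding Kbar using that phi kap by (intro sum_pos) (auto simp: K)
  have Kstep: "Kbar (Suc n) = Kbar n + K (Suc n)" for n by (simp add: Kbar)
  define r where "r n = Kbar (Suc n) / Kbar n - 1" for n
  have r_eq: "r n = a * real (Suc n) powr phi / (y n * real n powr a)" if "n \<ge> 1" for n
    using Kpos[OF that] kap that by (simp add: r_def Kstep K y_def a_def field_simps)
  have nr: "(\<lambda>n. real n * r n) \<longlonglongrightarrow> a"
  proof -
    have "(\<lambda>n. a * (real n * (real n + 1) powr phi / real n powr a) / y n) \<longlonglongrightarrow> a * 1 / 1"
    proof (intro tendsto_intros y1)
      show "(\<lambda>n. real n * (real n + 1) powr phi / real n powr a) \<longlonglongrightarrow> 1" unfolding a_def by real_asymp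
    qed simp
    moreover have "eventually (\<lambda>n. a * (real n * (real n + 1) powr phi / real n powr a) / y n = real n * r n) sequentially"
      using eventually_ge_at_top[of 1] by eventually_elim (simp add: r_eq add.commute mult_ac)
    ultimately show ?thesis by (auto intro: Lim_transform_eventually)
  qed
  have r0: "r \<longlonglongrightarrow> 0"
  proof -
    have "(\<lambda>n. (1 / real n) * (real n * r n)) \<longlonglongrightarrow> 0 * a" by (intro tendsto_mult nr lim_1_over_n)
    moreover have "eventually (\<lambda>n. (1 / real n) * (real n * r n) = r n) sequentially"
      using eventually_gt_at_top[of 0] by eventually_elim simp
    ultimately show ?thesis by (auto intro: Lim_transform_eventually)
  qed
  have rpos: "r n > 0" if "n \<ge> 1" for n
  proof -
    have "K (Suc n) > 0" using phi kap by (simp add: K)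
    moreover have "r n = K (Suc n) / Kbar n" using Kpos[OF that] by (simp add: r_def Kstep add_divide_distrib)
    ultimately show ?thesis using Kpos[OF that] by simp
  qed
  have der: "((\<lambda>x. ((1 + x) powr e - 1) / x) \<longlongrightarrow> e) (at 0)"
  proof -
    have "((\<lambda>x. (1 + x) powr e) has_real_derivative e) (at 0)"
      by (auto intro!: derivative_eq_intros)
    then show ?thesis by (simp add: has_field_derivative_iff)
  qed
  have q: "(\<lambda>n. ((1 + r n) powr e - 1) / r n) \<longlonglongrightarrow> e"
  proof (rule tendsto_compose_eventually[OF der r0])
    show "eventually (\<lambda>n. r n \<noteq> 0) sequentially"
      using eventually_ge_at_top[of 1] by eventually_elim (use rpos in force)
  qed
  have "(\<lambda>n. (real n + 1) powr (a * e - 1) / real n powr (a * e - 1) / (kap powr e * y n powr e * (((1 + r n) powr e - 1) / r n) * (real n * r n)))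
      \<longlonglongrightarrow> 1 / (kap powr e * 1 powr e * e * a)"
  proof (intro tendsto_divide tendsto_mult tendsto_const q nr)
    show "(\<lambda>n. (real n + 1) powr (a * e - 1) / real n powr (a * e - 1)) \<longlonglongrightarrow> 1" by real_asymp
    show "(\<lambda>n. y n powr e) \<longlonglongrightarrow> 1 powr e" by (intro tendsto_powr y1 tendsto_const) simp
  qed (use kap e a in auto)
  moreover have "eventually (\<lambda>n. (real n + 1) powr (a * e - 1) / real n powr (a * e - 1) / (kap powr e * y n powr e * (((1 + r n) powr e - 1) / r n) * (real n * r n))
      = real (Suc n) powr ((phi + 1) * e - 1) / (Kbar (Suc n) powr e - Kbar (Suc n - 1) powr e)) sequentially"
    using eventually_ge_at_top[of 1]
  proof eventually_elim
    case (elim n)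
    have K0: "Kbar n > 0" "Kbar (Suc n) > 0" using Kpos elim by auto
    have n0: "real n > 0" using elim by simp
    have y0: "y n > 0" using K0 kap n0 by (simp add: y_def)
    have "Kbar n = kap * y n * real n powr a" using kap n0 by (simp add: y_def)
    then have Ke: "Kbar n powr e = kap powr e * y n powr e * real n powr (a * e)"
      using kap y0 by (simp add: powr_mult powr_powr)
    have "Kbar (Suc n) = Kbar n * (1 + r n)" using K0 by (simp add: r_def)
    then have "Kbar (Suc n) powr e - Kbar n powr e = Kbar n powr e * ((1 + r n) powr e - 1)"
      by (simp only: powr_mult right_diff_distrib mult_1_right)
    also have "\<dots> = kap powr e * y n powr e * (((1 + r n) powr e - 1) / r n) * (real n * r n) * real n powr (a * e - 1)"
    proof -
      have "real n powr (a * e) = real n * real n powr (a * e - 1)" using n0 by (simp add: powr_diff)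
      then show ?thesis unfolding Ke using rpos[OF elim] by simp
    qed
    finally show ?case using elim by (simp add: a_def add.commute mult.commute)
  qed
  ultimately have "(\<lambda>n. real (Suc n) powr ((phi + 1) * e - 1) / (Kbar (Suc n) powr e - Kbar (Suc n - 1) powr e)) \<longlonglongrightarrow> 1 / (kap powr e * 1 powr e * e * a)"
    by (rule Lim_transform_eventually)
  then show "(\<lambda>k. real k powr ((phi + 1) * e - 1) / (Kbar k powr e - Kbar (k - 1) powr e)) \<longlonglongrightarrow> 1 / ((phi + 1) * e * kap powr e)"
    unfolding filterlim_sequentially_Suc[where f = "\<lambda>k. real k powr ((phi + 1) * e - 1) / (Kbar k powr e - Kbar (k - 1) powr e)"]
    by (simp add: a_def mult_ac)
qed

section \<open>The parameters of the multilevel algorithm\<close>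

locale ml_parameters =
  fixes M \<alpha> \<beta> \<phi> \<rho> \<kappa>\<^sub>K \<kappa>\<^sub>s \<rr> \<rr>\<^sub>1 \<rr>\<^sub>2 :: real
    and K Kbar b \<xi> \<epsilon>bias \<epsilon>diff :: "nat \<Rightarrow> real" and s :: "nat \<Rightarrow> nat"
  assumes M: "M > 1" and \<alpha>: "\<alpha> > 0" and \<beta>: "\<beta> > 0" "\<beta> < 2 * \<alpha>" "\<beta> < 1"
    and \<rr>: "\<rr> = \<alpha> / (2 * \<alpha> - \<beta> + 1)"
    and \<phi>: "1 / (2 * \<alpha> - \<beta>) < \<phi>" and \<rho>: "\<phi> + 1 < 2 * (\<rho> + 1)"
    and \<kappa>: "\<kappa>\<^sub>K > 0" "\<kappa>\<^sub>s > 0"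
    and K: "\<And>n. K n = \<kappa>\<^sub>K * (\<phi> + 1) * real n powr \<phi>"
    and Kbar: "\<And>n. Kbar n = (\<Sum>k = 1..n. K k)"
    and s: "\<And>n. s n = nat (max \<lfloor>log M (\<kappa>\<^sub>s * Kbar n powr (1 / (2 * \<alpha> - \<beta> + 1)))\<rfloor> 1)"
    and b: "\<And>n. b n = real n powr \<rho>"
    and \<rr>\<^sub>1: "\<rr>\<^sub>1 = (\<rho> + 1) / (\<phi> + 1) * (2 * \<alpha> - \<beta> + 1)"
    and \<rr>\<^sub>2: "\<rr>\<^sub>2 = (2 * ((\<rho> + 1) / (\<phi> + 1)) - 1) * (2 * \<alpha> - \<beta> + 1)"
    and \<xi>: "\<And>n. \<xi> n = log M (\<kappa>\<^sub>s * Kbar n powr (1 / (2 * \<alpha> - \<beta> + 1))) - real (s n)"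
    and \<epsilon>bias: "\<And>n. \<epsilon>bias n = \<kappa>\<^sub>s powr (- \<alpha>) * \<kappa>\<^sub>K powr (- \<rr>) * psi_fun M \<rr>\<^sub>1 (- \<alpha>) (\<xi> n)
                  * real n powr (- ((\<phi> + 1) * \<rr>))"
    and \<epsilon>diff: "\<And>n. \<epsilon>diff n = 1 / sqrt (1 - M powr (- ((1 - \<beta>) / 2)))
                  * (((\<rho> + 1) / (\<phi> + 1)) / sqrt (2 * ((\<rho> + 1) / (\<phi> + 1)) - 1))
                  * \<kappa>\<^sub>s powr ((1 - \<beta>) / 2) * \<kappa>\<^sub>K powr (- \<rr>)
                  * sqrt (psi_fun M \<rr>\<^sub>2 (1 - \<beta>) (\<xi> n)) * real n powr (- ((\<phi> + 1) * \<rr>))"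
begin

definition p :: real where "p = 2 * \<alpha> - \<beta> + 1"
text \<open>Ratio of consecutive levels, counted down from the finest one, in both the variance and
  the cost; \<beta> < 1 makes it less than 1.\<close>

definition g :: real where "g = M powr (- ((1 - \<beta>) / 2))"
definition L :: "nat \<Rightarrow> real" where "L n = \<kappa>\<^sub>s * Kbar n powr (1 / p)"
definition R :: real where "R = (\<phi> + 1) * \<rr>"
text \<open>With unrounded replication numbers the quotients M^(-\<beta> k) / N_k form a geometric
  progression dominated by k = s; this is the sum of the infinite series.\<close>

definition \<tau> :: "nat \<Rightarrow> real" where "\<tau> n = M powr ((1 - \<beta>) * real (s n)) / (K n * (1 - g))"
text \<open>Reciprocal of the unrounded replication number at the finest level, the smallest of all;
  it bounds the effect of rounding up and the influence of a single sample.\<close>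

definition \<delta> :: "nat \<Rightarrow> real" where "\<delta> n = M powr real (s n) / K n"
definition \<eta> :: "nat \<Rightarrow> real" where "\<eta> n = M powr (- \<alpha> * real (s n))"
definition bbar :: "nat \<Rightarrow> real" where "bbar n = (\<Sum>k=1..n. b k)"

section \<open>Arithmetic of the exponents\<close>

lemma p: "p > 1" "p > 0" using \<beta> by (auto simp: p_def)
lemma \<phi>0: "\<phi> > 0" using \<phi> \<beta> by (smt (verit) divide_pos_pos)
text \<open>The lower bound on \<phi> rewritten: M^s grows like n^((\<phi>+1)/p), more slowly than
  K, so even the finest level receives more and more replications.\<close>

lemma \<phi>p: "(\<phi> + 1) / p < \<phi>"
proof -
  have "1 < \<phi> * (p - 1)" using \<phi> \<beta> by (simp add: p_def field_simps)
  then have "\<phi> + 1 < \<phi> * p" by (simp add: algebra_simps)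
  then show ?thesis using p by (simp add: field_simps)
qed
lemma g: "0 < g" "g < 1"
  using M \<beta> by (auto simp: g_def powr_less_one)
lemma \<rr>p: "\<rr> = \<alpha> / p" by (simp add: \<rr> p_def)
lemma R_altdef: "R = (\<phi> + 1) / p * \<alpha>" unfolding R_def by (simp add: \<rr>p)
lemma \<rr>0: "\<rr> > 0" using \<alpha> p by (simp add: \<rr>p)
lemma R0: "R > 0" using \<phi>0 \<rr>0 by (simp add: R_def)
text \<open>The balance behind the choice of the level: M^((1-\<beta>) s) / K has order n^(1-2R), so
  an average over n steps has a variance of order n^(-2R), that of the squared bias.\<close>

lemma two_R: "2 * R = (\<phi> + 1) - (1 - \<beta>) * ((\<phi> + 1) / p)"
proof -
  have "2 * \<alpha> = p - (1 - \<beta>)" by (simp add: p_def)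
  moreover have "2 * R = (\<phi> + 1) * ((2 * \<alpha>) / p)" unfolding R_altdef by simp
  ultimately have "2 * R = (\<phi> + 1) * ((p - (1 - \<beta>)) / p)" by (simp only:)
  also have "(p - (1 - \<beta>)) / p = 1 - (1 - \<beta>) / p" using p by (simp add: diff_divide_distrib)
  finally show ?thesis by (simp add: algebra_simps)
qed
text \<open>Hence e = 2R + \<psi> - 1 is positive for every positive step exponent \<psi>.\<close>

lemma two_R_gt_1: "2 * R > 1"
proof -
  have "(1 - \<beta>) * ((\<phi> + 1) / p) \<le> 1 * ((\<phi> + 1) / p)" using \<beta> \<phi>0 p by (intro mult_right_mono) auto
  then show ?thesis using two_R \<phi>p by simp
qed
lemma \<rho>1: "\<rho> + 1 > 0" using \<rho> \<phi>0 by simp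
lemma R_less: "R < \<rho> + 1"
proof -
  define X where "X = (1 - \<beta>) * ((\<phi> + 1) / p)"
  have "0 < X" using \<beta> \<phi>0 p by (simp add: X_def)
  then have "2 * R < \<phi> + 1" unfolding two_R[folded X_def] by simp
  also note \<rho>
  finally show ?thesis by simp
qed
lemma \<rr>\<^sub>1p: "\<rr>\<^sub>1 = (\<rho> + 1) / (\<phi> + 1) * p" by (simp add: \<rr>\<^sub>1 p_def)
lemma \<rr>\<^sub>2p: "\<rr>\<^sub>2 = (2 * ((\<rho> + 1) / (\<phi> + 1)) - 1) * p" by (simp add: \<rr>\<^sub>2 p_def)
lemma t_gt: "2 * ((\<rho> + 1) / (\<phi> + 1)) - 1 > 0" using \<rho> \<phi>0 by (simp add: field_simps)
lemma \<rr>\<^sub>1_pos: "\<rr>\<^sub>1 > 0" "\<rr>\<^sub>1 + (- \<alpha>) > 0"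
proof -
  show "\<rr>\<^sub>1 > 0" using \<rho>1 \<phi>0 p by (simp add: \<rr>\<^sub>1p)
  have "R / (\<phi> + 1) < (\<rho> + 1) / (\<phi> + 1)" using R_less \<phi>0 by (simp add: divide_strict_right_mono)
  then have "\<rr> < (\<rho> + 1) / (\<phi> + 1)" using \<phi>0 by (simp add: R_def)
  then have "\<rr> * p < (\<rho> + 1) / (\<phi> + 1) * p" using p by (intro mult_strict_right_mono) auto
  then show "\<rr>\<^sub>1 + (- \<alpha>) > 0" using p by (simp add: \<rr>\<^sub>1p \<rr>p)
qed
lemma \<rr>\<^sub>2_pos: "\<rr>\<^sub>2 > 0" "\<rr>\<^sub>2 + (1 - \<beta>) > 0" using t_gt p \<beta> by (auto simp: \<rr>\<^sub>2p add_pos_pos)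

section \<open>Growth of the cumulative sample size and of the levels\<close>

lemma K_pos: "n \<ge> 1 \<Longrightarrow> K n > 0" using \<kappa> \<phi>0 by (simp add: K)
lemma K_nonneg: "0 \<le> K n" using \<kappa> \<phi>0 by (simp add: K)
lemma Kbar_pos: "n \<ge> 1 \<Longrightarrow> Kbar n > 0" unfolding Kbar by (intro sum_pos) (auto simp: K_pos)
lemma Kbar_mono: "m \<le> n \<Longrightarrow> Kbar m \<le> Kbar n" unfolding Kbar by (intro sum_mono2) (auto simp: K_nonneg)
lemma Kbar_strict: "1 \<le> k \<Longrightarrow> Kbar (k - 1) < Kbar k"
  using K_pos[of k] by (cases k) (auto simp: Kbar)

text \<open>Ratio of \<open>Kbar\<close> to its leading power; carrying it along exactly turns all
  later comparisons into identities until the limit is taken.\<close>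

definition y :: "nat \<Rightarrow> real" where "y n = Kbar n / (\<kappa>\<^sub>K * real n powr (\<phi> + 1))"
lemma y: "y \<longlonglongrightarrow> 1"
  using power_sum_diff_asymp(1)[OF \<phi>0 \<kappa>(1), of 1 K Kbar] K Kbar by (simp add: y_def[abs_def])
lemma y_pos: "n \<ge> 1 \<Longrightarrow> y n > 0" using Kbar_pos \<kappa> by (simp add: y_def)
lemma Kbar_y: "n \<ge> 1 \<Longrightarrow> Kbar n = \<kappa>\<^sub>K * real n powr (\<phi> + 1) * y n" using \<kappa> by (simp add: y_def)

lemma L_powr: "n \<ge> 1 \<Longrightarrow> L n powr c = \<kappa>\<^sub>s powr c * \<kappa>\<^sub>K powr (c / p) * y n powr (c / p) * real n powr ((\<phi> + 1) * (c / p))"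
  using \<kappa> y_pos[of n] Kbar_pos[of n] by (simp add: L_def powr_mult powr_powr Kbar_y mult_ac)

lemma L_powr_Kbar: "L n powr c = \<kappa>\<^sub>s powr c * Kbar n powr (c / p)"
proof (cases "n \<ge> 1")
  case True
  then show ?thesis using \<kappa> Kbar_pos[of n] by (simp add: L_def powr_mult powr_powr)
next
  case False
  then show ?thesis by (simp add: L_def Kbar)
qed

lemma L_pos: "n \<ge> 1 \<Longrightarrow> L n > 0" using \<kappa> Kbar_pos[of n] by (simp add: L_def)

lemma level_sequence_L: "u > 0 \<Longrightarrow> u + v > 0 \<Longrightarrow> level_sequence M L s u v"
proof
  assume u: "u > 0" "u + v > 0"
  show "1 < M" by (rule M)
  show "0 < u" "0 < u + v" by (fact u)+
  show "1 \<le> n \<Longrightarrow> 0 < L n" for n by (rule L_pos)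
  show "L 0 = 0" by (simp add: L_def Kbar)
  show "L m \<le> L n" if "m \<le> n" for m n
    unfolding L_def using \<kappa> p Kbar_mono[OF that] Kbar_mono[of 0 m] by (intro mult_left_mono powr_mono2) (auto simp: Kbar)
  have h: "0 < (\<phi> + 1) * (1 / p)" using \<phi>0 p by simp
  have yp: "(\<lambda>n. y n powr (1 / p)) \<longlonglongrightarrow> 1 powr (1 / p)" by (intro tendsto_powr y tendsto_const) simp
  have L1: "L n = \<kappa>\<^sub>s * \<kappa>\<^sub>K powr (1 / p) * y n powr (1 / p) * real n powr ((\<phi> + 1) * (1 / p))" if "n \<ge> 1" for n
    using L_powr[OF that, of 1] L_pos[OF that] \<kappa> by simp
  have "filterlim (\<lambda>n. (\<kappa>\<^sub>s * \<kappa>\<^sub>K powr (1 / p) * y n powr (1 / p)) * real n powr ((\<phi> + 1) * (1 / p))) at_top sequentially"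
  proof (rule filterlim_tendsto_pos_mult_at_top)
    show "(\<lambda>n. \<kappa>\<^sub>s * \<kappa>\<^sub>K powr (1 / p) * y n powr (1 / p)) \<longlonglongrightarrow> \<kappa>\<^sub>s * \<kappa>\<^sub>K powr (1 / p) * 1 powr (1 / p)"
      by (intro tendsto_intros yp)
    show "filterlim (\<lambda>n. real n powr ((\<phi> + 1) * (1 / p))) at_top sequentially" using h by real_asymp
  qed (use \<kappa> in simp)
  then show "filterlim L at_top sequentially"
    by (rule filterlim_cong[THEN iffD1, OF refl refl, rotated])
      (use eventually_ge_at_top[of "1::nat"] in eventually_elim, simp only: L1)
  have "(\<lambda>n. (y (Suc n) powr (1 / p) / y n powr (1 / p)) * ((real n + 1) powr ((\<phi> + 1) * (1 / p)) / real n powr ((\<phi> + 1) * (1 / p)))) \<longlonglongrightarrow> (1 powr (1 / p) / 1 powr (1 / p)) * 1"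
  proof (intro tendsto_mult tendsto_divide)
    show "(\<lambda>n. y (Suc n) powr (1 / p)) \<longlonglongrightarrow> 1 powr (1 / p)" using yp by (rule LIMSEQ_Suc)
    show "(\<lambda>n. (real n + 1) powr ((\<phi> + 1) * (1 / p)) / real n powr ((\<phi> + 1) * (1 / p))) \<longlonglongrightarrow> 1" by real_asymp
  qed (use yp in auto)
  moreover have "eventually (\<lambda>n. (y (Suc n) powr (1 / p) / y n powr (1 / p)) * ((real n + 1) powr ((\<phi> + 1) * (1 / p)) / real n powr ((\<phi> + 1) * (1 / p))) = L (Suc n) / L n) sequentially"
    using eventually_ge_at_top[of "1::nat"]
  proof eventually_elim
    case (elim n)
    have "\<kappa>\<^sub>s * \<kappa>\<^sub>K powr (1 / p) \<noteq> 0" using \<kappa> by simp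
    then show ?case using L1[OF elim] L1[of "Suc n"] by (simp add: add.commute)
  qed
  ultimately show "(\<lambda>n. L (Suc n) / L n) \<longlonglongrightarrow> 1" by (auto intro: Lim_transform_eventually)
  show "s n = nat (max \<lfloor>log M (L n)\<rfloor> 1)" for n by (simp add: s L_def p_def)
qed

text \<open>For the accumulated bias: increments of \<open>L powr \<rr>\<^sub>1\<close> are
  comparable to k^\<rho>, and the bias at level s contributes M^(-\<alpha> s).\<close>

sublocale LS1: level_sequence M L s \<rr>\<^sub>1 "- \<alpha>"
  by (rule level_sequence_L[OF \<rr>\<^sub>1_pos])

text \<open>For the variance: increments of \<open>L powr \<rr>\<^sub>2\<close> are comparable to
  k^(2\<rho>-\<phi>), the squared weight over the sample size, and the level contributes
  M^((1-\<beta>) s).\<close>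

sublocale LS2: level_sequence M L s \<rr>\<^sub>2 "1 - \<beta>"
  by (rule level_sequence_L[OF \<rr>\<^sub>2_pos])

lemma LS_\<xi>: "LS1.\<xi> n = \<xi> n" "LS2.\<xi> n = \<xi> n"
  by (simp_all add: LS1.\<xi>_def LS2.\<xi>_def \<xi> L_def p_def)

lemma \<xi>_eventually: "eventually (\<lambda>n. 0 \<le> \<xi> n \<and> \<xi> n \<le> 1 \<and> n \<ge> 1) sequentially"
  using LS1.xi_eventually eventually_ge_at_top[of 1] by eventually_elim (auto simp: LS_\<xi>)

lemma L_bound: obtains cL CL where "cL > 0" "CL > 0"
  "\<And>n. n \<ge> 1 \<Longrightarrow> cL * real n powr ((\<phi> + 1) / p) \<le> L n" "\<And>n. n \<ge> 1 \<Longrightarrow> L n \<le> CL * real n powr ((\<phi> + 1) / p)"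
proof -
  have "(\<lambda>n. y n powr (1 / p)) \<longlonglongrightarrow> 1 powr (1 / p)" by (intro tendsto_powr y tendsto_const) simp
  from convergent_imp_Bseq[OF convergentI[OF this]] obtain C1 where C1: "C1 > 0" "\<And>n. norm (y n powr (1 / p)) \<le> C1"
    by (auto simp: Bseq_def)
  have "(\<lambda>n. y n powr (- (1 / p))) \<longlonglongrightarrow> 1 powr (- (1 / p))" by (intro tendsto_powr y tendsto_const) simp
  from convergent_imp_Bseq[OF convergentI[OF this]] obtain C2 where C2: "C2 > 0" "\<And>n. norm (y n powr (- (1 / p))) \<le> C2"
    by (auto simp: Bseq_def)
  let ?k = "\<kappa>\<^sub>s * \<kappa>\<^sub>K powr (1 / p)"
  have k: "?k > 0" using \<kappa> by simp
  have L1: "L n = ?k * y n powr (1 / p) * real n powr ((\<phi> + 1) / p)" if "n \<ge> 1" for n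
    using L_powr[OF that, of 1] L_pos[OF that] \<kappa> by simp
  show ?thesis
  proof (rule that[of "?k * (1 / C2)" "?k * C1"])
    fix n :: nat assume n: "n \<ge> 1"
    show "L n \<le> ?k * C1 * real n powr ((\<phi> + 1) / p)"
      unfolding L1[OF n] using k C1(2)[of n] by (intro mult_right_mono mult_left_mono) auto
    have "1 / C2 \<le> y n powr (1 / p)"
      using C2(2)[of n] C2(1) y_pos[OF n] by (simp add: powr_minus field_simps)
    then show "?k * (1 / C2) * real n powr ((\<phi> + 1) / p) \<le> L n"
      unfolding L1[OF n] using k by (intro mult_right_mono mult_left_mono) auto
  qed (use k C1 C2 in auto)
qed

lemma M_s_upper: obtains C where "C > 0" "\<And>n. n \<ge> 1 \<Longrightarrow> M powr real (s n) \<le> C * real n powr ((\<phi> + 1) / p)"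
proof -
  obtain cL CL where CL: "CL > 0" "\<And>n. n \<ge> 1 \<Longrightarrow> L n \<le> CL * real n powr ((\<phi> + 1) / p)" using L_bound by metis
  show ?thesis
  \<comment> \<open>The summand M covers the indices at which the level is held at 1.\<close>
  proof (rule that[of "M + CL"])
    fix n :: nat assume n: "n \<ge> 1"
    have h: "1 \<le> real n powr ((\<phi> + 1) / p)" using n \<phi>0 p by (intro ge_one_powr_ge_zero) auto
    have "real (s n) \<le> max (log M (L n)) 1"
    proof -
      have "real (s n) = real_of_int (max \<lfloor>log M (L n)\<rfloor> 1)" by (simp add: s L_def p_def)
      also have "\<dots> \<le> max (log M (L n)) 1" by (auto simp: max_def)
      finally show ?thesis .
    qed
    then have "M powr real (s n) \<le> M powr (max (log M (L n)) 1)" using M by (intro powr_mono) auto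
    also have "\<dots> \<le> L n + M" using M L_pos[OF n] by (auto simp: max_def)
    also have "\<dots> \<le> CL * real n powr ((\<phi> + 1) / p) + M * real n powr ((\<phi> + 1) / p)"
      using CL(2)[OF n] h M by (intro add_mono) auto
    finally show "M powr real (s n) \<le> (M + CL) * real n powr ((\<phi> + 1) / p)" by (simp add: algebra_simps)
  qed (use M CL in simp)
qed

lemma M_s_lower: "n \<ge> 1 \<Longrightarrow> L n / M \<le> M powr real (s n)"
proof -
  assume n: "n \<ge> 1"
  have "real (s n) = real_of_int (max \<lfloor>log M (L n)\<rfloor> 1)" by (simp add: s L_def p_def)
  also have "\<dots> \<ge> log M (L n) - 1" by linarith
  finally have "M powr (log M (L n) - 1) \<le> M powr real (s n)" using M by (intro powr_mono) auto
  then show ?thesis using M L_pos[OF n] by (simp add: powr_diff)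
qed

lemma \<eta>_bound: "\<exists>C. \<forall>n\<ge>1. 0 \<le> \<eta> n \<and> \<eta> n \<le> C * real n powr (- R)"
proof -
  obtain cL CL where cL: "cL > 0" "\<And>n. n \<ge> 1 \<Longrightarrow> cL * real n powr ((\<phi> + 1) / p) \<le> L n" using L_bound by metis
  show ?thesis
  proof (intro exI[of _ "(cL / M) powr (- \<alpha>)"] allI impI conjI)
    fix n :: nat assume n: "n \<ge> 1"
    show "0 \<le> \<eta> n" by (simp add: \<eta>_def)
    have "(cL / M) * real n powr ((\<phi> + 1) / p) \<le> M powr real (s n)"
    proof -
      have "(cL / M) * real n powr ((\<phi> + 1) / p) = (cL * real n powr ((\<phi> + 1) / p)) / M" by simp
      also have "\<dots> \<le> L n / M" using cL(2)[OF n] M by (intro divide_right_mono) auto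
      finally show ?thesis using M_s_lower[OF n] by linarith
    qed
    then have "(M powr real (s n)) powr (- \<alpha>) \<le> ((cL / M) * real n powr ((\<phi> + 1) / p)) powr (- \<alpha>)"
      using cL(1) M n \<alpha> by (intro powr_mono2') auto
    also have "\<dots> = (cL / M) powr (- \<alpha>) * real n powr (- R)"
      unfolding powr_mult powr_powr R_altdef by simp
    finally show "\<eta> n \<le> (cL / M) powr (- \<alpha>) * real n powr (- R)" by (simp add: \<eta>_def powr_powr mult.commute)
  qed
qed

lemma \<tau>_nonneg: "0 \<le> \<tau> n" using g K_nonneg by (simp add: \<tau>_def)

lemma \<tau>_bound: "\<exists>C>0. \<forall>n\<ge>1. \<tau> n \<le> C * real n powr (1 - 2 * R)"
proof -
  obtain C where C: "C > 0" "\<And>n. n \<ge> 1 \<Longrightarrow> M powr real (s n) \<le> C * real n powr ((\<phi> + 1) / p)" using M_s_upper by blast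
  let ?k = "\<kappa>\<^sub>K * (\<phi> + 1) * (1 - g)"
  have k: "?k > 0" using \<kappa> \<phi>0 g by simp
  show ?thesis
  proof (intro exI[of _ "C powr (1 - \<beta>) / ?k"] conjI allI impI)
    show "0 < C powr (1 - \<beta>) / ?k" using C k by simp
    fix n :: nat assume n: "n \<ge> 1"
    have "M powr ((1 - \<beta>) * real (s n)) = (M powr real (s n)) powr (1 - \<beta>)" by (simp add: powr_powr mult.commute)
    also have "\<dots> \<le> (C * real n powr ((\<phi> + 1) / p)) powr (1 - \<beta>)" using C(2)[OF n] \<beta> by (intro powr_mono2) auto
    also have "\<dots> = C powr (1 - \<beta>) * real n powr ((1 - \<beta>) * ((\<phi> + 1) / p))"
      using C by (simp add: powr_mult powr_powr mult.commute)
    finally have "\<tau> n \<le> C powr (1 - \<beta>) * real n powr ((1 - \<beta>) * ((\<phi> + 1) / p)) / (K n * (1 - g))"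
      unfolding \<tau>_def using g K_nonneg by (intro divide_right_mono) auto
    also have "\<dots> = C powr (1 - \<beta>) / ?k * (real n powr ((1 - \<beta>) * ((\<phi> + 1) / p)) / real n powr \<phi>)"
      by (simp add: K mult_ac)
    also have "real n powr ((1 - \<beta>) * ((\<phi> + 1) / p)) / real n powr \<phi> = real n powr (1 - 2 * R)"
      using n unfolding two_R by (simp add: powr_diff[symmetric] algebra_simps)
    finally show "\<tau> n \<le> C powr (1 - \<beta>) / ?k * real n powr (1 - 2 * R)" .
  qed
qed

lemma \<delta>_nonneg: "0 \<le> \<delta> n" using K_nonneg by (simp add: \<delta>_def)

lemma \<delta>_lim: "\<delta> \<longlonglongrightarrow> 0"
proof -
  obtain C where C: "C > 0" "\<And>n. n \<ge> 1 \<Longrightarrow> M powr real (s n) \<le> C * real n powr ((\<phi> + 1) / p)" using M_s_upper by blast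
  have "(\<lambda>n. C / (\<kappa>\<^sub>K * (\<phi> + 1)) * (real n powr ((\<phi> + 1) / p) / real n powr \<phi>)) \<longlonglongrightarrow> C / (\<kappa>\<^sub>K * (\<phi> + 1)) * 0"
    using \<phi>p by (intro tendsto_mult tendsto_const) real_asymp
  then have lim: "(\<lambda>n. C * real n powr ((\<phi> + 1) / p) / K n) \<longlonglongrightarrow> 0" by (simp add: K)
  show ?thesis
  proof (rule tendsto_sandwich[OF _ _ tendsto_const lim])
    show "eventually (\<lambda>n. \<delta> n \<le> C * real n powr ((\<phi> + 1) / p) / K n) sequentially"
      using eventually_ge_at_top[of 1] unfolding \<delta>_def
      by eventually_elim (intro divide_right_mono C K_nonneg, auto)
  qed (simp add: \<delta>_nonneg)
qed

lemma bbar_asymp: "(\<lambda>n. bbar n / real n powr (\<rho> + 1)) \<longlonglongrightarrow> 1 / (\<rho> + 1)"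
  using power_sum_asymp[OF \<rho>1] by (simp add: bbar_def b)

lemma bbar_pos: "n \<ge> 1 \<Longrightarrow> bbar n > 0" unfolding bbar_def by (intro sum_pos) (auto simp: b)

lemma L_increment_ratio:
  assumes a: "a > 0"
  shows "(\<lambda>k. real k powr (a - 1) / (L k powr (a / (\<phi> + 1) * p) - L (k - 1) powr (a / (\<phi> + 1) * p))) \<longlonglongrightarrow>
    1 / (\<kappa>\<^sub>s powr (a / (\<phi> + 1) * p) * (a * \<kappa>\<^sub>K powr (a / (\<phi> + 1))))"
proof -
  let ?e = "a / (\<phi> + 1)"
  have e: "?e > 0" using a \<phi>0 by simp
  have "(\<lambda>k. (1 / \<kappa>\<^sub>s powr (?e * p)) * (real k powr ((\<phi> + 1) * ?e - 1) / (Kbar k powr ?e - Kbar (k - 1) powr ?e))) \<longlonglongrightarrow>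
     (1 / \<kappa>\<^sub>s powr (?e * p)) * (1 / ((\<phi> + 1) * ?e * \<kappa>\<^sub>K powr ?e))"
    by (intro tendsto_mult tendsto_const power_sum_diff_asymp(2)[OF \<phi>0 \<kappa>(1) e K Kbar])
  moreover have "(1 / \<kappa>\<^sub>s powr (?e * p)) * (real k powr ((\<phi> + 1) * ?e - 1) / (Kbar k powr ?e - Kbar (k - 1) powr ?e)) =
     real k powr (a - 1) / (L k powr (?e * p) - L (k - 1) powr (?e * p))" for k
    unfolding L_powr_Kbar using p \<phi>0 by (simp add: right_diff_distrib[symmetric])
  moreover have "(1 / \<kappa>\<^sub>s powr (?e * p)) * (1 / ((\<phi> + 1) * ?e * \<kappa>\<^sub>K powr ?e)) = 1 / (\<kappa>\<^sub>s powr (?e * p) * (a * \<kappa>\<^sub>K powr ?e))"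
    using \<phi>0 by simp
  ultimately show ?thesis by (simp only:)
qed

lemma L_strict: "eventually (\<lambda>k. L (k - 1) < L k) sequentially"
  using eventually_ge_at_top[of 1]
proof eventually_elim
  case (elim k)
  have "Kbar (k - 1) powr (1 / p) < Kbar k powr (1 / p)"
    using Kbar_strict[OF elim] Kbar_mono[of 0 "k - 1"] p by (intro powr_less_mono2) (auto simp: Kbar)
  then show ?case using \<kappa> by (simp add: L_def)
qed

section \<open>The two normalisations of the weighted sum\<close>

definition A :: "nat \<Rightarrow> real" where "A n = bbar n * \<epsilon>diff n"
definition A' :: "nat \<Rightarrow> real" where "A' n = bbar n * \<epsilon>bias n"

lemma A_lower: "\<exists>cA>0. eventually (\<lambda>n. cA * real n powr (\<rho> + 1 - R) \<le> A n) sequentially"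
proof -
  let ?t = "(\<rho> + 1) / (\<phi> + 1)"
  define q where "q = M powr (- (\<rr>\<^sub>2 + (1 - \<beta>))) * ((M powr \<rr>\<^sub>2 - 1) / (M powr (\<rr>\<^sub>2 + (1 - \<beta>)) - 1))"
  have "M powr \<rr>\<^sub>2 > 1" "M powr (\<rr>\<^sub>2 + (1 - \<beta>)) > 1" using M \<rr>\<^sub>2_pos by (auto intro: gr_one_powr)
  then have q: "q > 0" unfolding q_def using M by (intro mult_pos_pos divide_pos_pos) auto
  define k where "k = 1 / sqrt (1 - M powr (- ((1 - \<beta>) / 2))) * (?t / sqrt (2 * ?t - 1)) * \<kappa>\<^sub>s powr ((1 - \<beta>) / 2) * \<kappa>\<^sub>K powr (- \<rr>)"
  have k: "k > 0" using g \<rho>1 \<phi>0 t_gt \<kappa> by (simp add: k_def g_def)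
  define cA where "cA = 1 / (2 * (\<rho> + 1)) * (k * sqrt q)"
  have "cA > 0" using \<rho>1 k q by (simp add: cA_def)
  moreover have "eventually (\<lambda>n. 1 / (2 * (\<rho> + 1)) < bbar n / real n powr (\<rho> + 1)) sequentially"
    using order_tendstoD(1)[OF bbar_asymp, of "1 / (2 * (\<rho> + 1))"] \<rho>1 by (simp add: field_simps)
  then have "eventually (\<lambda>n. cA * real n powr (\<rho> + 1 - R) \<le> A n) sequentially"
    using \<xi>_eventually
  proof eventually_elim
    case (elim n)
    have n: "n \<ge> 1" using elim by simp
    have "k * sqrt q * real n powr (- R) \<le> \<epsilon>diff n"
      unfolding \<epsilon>diff k_def[symmetric] R_def[symmetric]
      using k psi_fun_bounds(1)[OF M \<rr>\<^sub>2_pos, of "\<xi> n"] elim by (intro mult_right_mono mult_left_mono real_sqrt_le_mono) (auto simp: q_def)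
    moreover have "1 / (2 * (\<rho> + 1)) * real n powr (\<rho> + 1) \<le> bbar n"
      using elim(1) n by (simp add: field_simps)
    ultimately have "(1 / (2 * (\<rho> + 1)) * real n powr (\<rho> + 1)) * (k * sqrt q * real n powr (- R)) \<le> A n"
      unfolding A_def using k q \<rho>1 bbar_pos[OF n] by (intro mult_mono) auto
    moreover have "real n powr (\<rho> + 1) * real n powr (- R) = real n powr (\<rho> + 1 - R)" using n by (simp add: powr_add[symmetric])
    then have "(1 / (2 * (\<rho> + 1)) * real n powr (\<rho> + 1)) * (k * sqrt q * real n powr (- R)) = cA * real n powr (\<rho> + 1 - R)"
      by (simp add: cA_def mult_ac)
    ultimately show ?case by simp
  qed
  ultimately show ?thesis by blast
qed

lemma y_powr: "(\<lambda>n. y n powr c) \<longlonglongrightarrow> 1"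
  using tendsto_powr[OF y tendsto_const[of c]] by simp

text \<open>Up to constants this is the sum of k^(2\<rho>-\<phi>) M^((1-\<beta>) s), asymptotic to a
  multiple of \<open>LS2.Psi\<close>, which carries the same value of \<open>psi_fun\<close> as the
  square of \<open>A\<close>. The oscillating factors cancel exactly and only constants remain to be
  compared.\<close>

lemma variance_normalisation: "(\<lambda>n. \<Sum>k=1..n. (real k powr \<rho> / A n)\<^sup>2 * \<tau> k) \<longlonglongrightarrow> 1"
proof -
  define t where "t = (\<rho> + 1) / (\<phi> + 1)"
  \<comment> \<open>Growth exponent of the sum of the k^(2\<rho>-\<phi>); its positivity is the
    hypothesis \<phi> + 1 < 2 (\<rho> + 1).\<close>
  define a where "a = 2 * \<rho> - \<phi> + 1"
  define e where "e = a / (\<phi> + 1)"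
  have a: "a > 0" using \<rho> by (simp add: a_def)
  have e: "e = 2 * t - 1" using \<phi>0 by (simp add: e_def a_def t_def field_simps)
  have ep: "\<rr>\<^sub>2 = e * p" by (simp add: \<rr>\<^sub>2p e t_def)
  have t0: "t > 0" using \<rho>1 \<phi>0 by (simp add: t_def)
  have e0: "e > 0" using a \<phi>0 by (simp add: e_def)
  let ?S = "\<lambda>n. \<Sum>k=1..n. real k powr (a - 1) * M powr ((1 - \<beta>) * real (s k))"
  have S: "(\<lambda>n. ?S n / LS2.Psi n) \<longlonglongrightarrow> 1 / (\<kappa>\<^sub>s powr \<rr>\<^sub>2 * (a * \<kappa>\<^sub>K powr e))"
    using L_increment_ratio[OF a] unfolding e_def[symmetric] ep[symmetric] by (rule LS2.level_sum_asymp[OF L_strict])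
  define k0 where "k0 = 1 / (1 - g) * (t\<^sup>2 / (2 * t - 1)) * \<kappa>\<^sub>s powr (1 - \<beta>) * \<kappa>\<^sub>K powr (- 2 * \<rr>)"
  have k0: "k0 > 0" using g t0 e0 \<kappa> e by (simp add: k0_def)
  define k1 where "k1 = \<kappa>\<^sub>s powr (\<rr>\<^sub>2 + (1 - \<beta>)) * \<kappa>\<^sub>K powr (e + 1 - 2 * \<rr>)"
  define x where "x n = bbar n / real n powr (\<rho> + 1)" for n
  have x: "x \<longlonglongrightarrow> 1 / (\<rho> + 1)" using bbar_asymp by (simp add: x_def[abs_def])
  have cp: "(\<rr>\<^sub>2 + (1 - \<beta>)) / p = e + 1 - 2 * \<rr>"
  proof -
    have "(\<rr>\<^sub>2 + (1 - \<beta>)) / p = e + (1 - \<beta>) / p" using p by (simp add: ep add_divide_distrib)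
    also have "(1 - \<beta>) / p = 1 - 2 * \<rr>" using p by (simp add: \<rr>p p_def field_simps)
    finally show ?thesis by simp
  qed
  have np: "(\<phi> + 1) * (e + 1 - 2 * \<rr>) = 2 * (\<rho> + 1) - 2 * R"
  proof -
    have "(\<phi> + 1) * t = \<rho> + 1" using \<phi>0 by (simp add: t_def)
    moreover have "(\<phi> + 1) * (e + 1 - 2 * \<rr>) = 2 * ((\<phi> + 1) * t) - 2 * ((\<phi> + 1) * \<rr>)" unfolding e by (simp add: algebra_simps)
    ultimately show ?thesis by (simp only: R_def)
  qed
  have "(\<lambda>n. (1 / (\<kappa>\<^sub>K * (\<phi> + 1) * (1 - g))) * (?S n / LS2.Psi n) * (k1 / k0 * y n powr (e + 1 - 2 * \<rr>) / (x n)\<^sup>2)) \<longlonglongrightarrow>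
     (1 / (\<kappa>\<^sub>K * (\<phi> + 1) * (1 - g))) * (1 / (\<kappa>\<^sub>s powr \<rr>\<^sub>2 * (a * \<kappa>\<^sub>K powr e))) * (k1 / k0 * 1 / (1 / (\<rho> + 1))\<^sup>2)"
    using \<rho>1 by (intro tendsto_intros S y_powr x) auto
  moreover have "(1 / (\<kappa>\<^sub>K * (\<phi> + 1) * (1 - g))) * (1 / (\<kappa>\<^sub>s powr \<rr>\<^sub>2 * (a * \<kappa>\<^sub>K powr e))) * (k1 / k0 * 1 / (1 / (\<rho> + 1))\<^sup>2) = 1"
  proof -
    have kk: "k1 = \<kappa>\<^sub>s powr \<rr>\<^sub>2 * \<kappa>\<^sub>s powr (1 - \<beta>) * (\<kappa>\<^sub>K powr e * \<kappa>\<^sub>K * \<kappa>\<^sub>K powr (- 2 * \<rr>))"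
      using \<kappa> by (simp add: k1_def powr_add[symmetric] powr_mult_base[symmetric] add.commute)
        (simp add: powr_add powr_diff powr_minus field_simps)
    have tt: "t = (\<rho> + 1) / (\<phi> + 1)" "2 * t - 1 = a / (\<phi> + 1)" using e by (auto simp: t_def e_def)
    have pos: "\<kappa>\<^sub>s powr \<rr>\<^sub>2 > 0" "\<kappa>\<^sub>s powr (1 - \<beta>) > 0" "\<kappa>\<^sub>K powr e > 0" "\<kappa>\<^sub>K powr (- 2 * \<rr>) > 0" "1 - g > 0" "\<phi> + 1 > 0" using \<kappa> g \<phi>0 by auto
    \<comment> \<open>The constants match by pure algebra once the powers are treated as opaque
      positive numbers.\<close>
    have gen: "(1 / (kk * h * u)) * (1 / (A1 * (a * A3))) * (A1 * A2 * (A3 * kk * A4) / (1 / u * ((q / h)\<^sup>2 / (a / h)) * A2 * A4) * 1 / (1 / q)\<^sup>2) = 1"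
      if "kk > 0" "h > 0" "u > 0" "A1 > 0" "A2 > 0" "A3 > 0" "A4 > 0" "q > 0" for kk h u A1 A2 A3 A4 q
      using that a by (simp add: field_simps power2_eq_square)
    show ?thesis unfolding kk k0_def tt(2) unfolding tt(1)
      by (rule gen) (use pos \<kappa> \<rho>1 in auto)
  qed
  moreover have "eventually (\<lambda>n. (1 / (\<kappa>\<^sub>K * (\<phi> + 1) * (1 - g))) * (?S n / LS2.Psi n) * (k1 / k0 * y n powr (e + 1 - 2 * \<rr>) / (x n)\<^sup>2) =
      (\<Sum>k=1..n. (real k powr \<rho> / A n)\<^sup>2 * \<tau> k)) sequentially"
    using \<xi>_eventually
  proof eventually_elim
    case (elim n)
    then have n: "n \<ge> 1" by simp
    define ps where "ps = psi_fun M \<rr>\<^sub>2 (1 - \<beta>) (\<xi> n)"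
    have ps: "ps > 0" using psi_fun_bounds(3)[OF M \<rr>\<^sub>2_pos, of "\<xi> n"] elim by (simp add: ps_def)
    have Psi: "LS2.Psi n = k1 * y n powr (e + 1 - 2 * \<rr>) * real n powr (2 * (\<rho> + 1) - 2 * R) * ps"
      unfolding LS2.Psi_eq[OF n] LS_\<xi> ps_def L_powr[OF n] cp np k1_def by simp
    have "(\<epsilon>diff n)\<^sup>2 = k0 * ps * real n powr (- 2 * R)"
    proof -
      have "(\<epsilon>diff n)\<^sup>2 = (1 / (sqrt (1 - g))\<^sup>2) * (t\<^sup>2 / (sqrt (2 * t - 1))\<^sup>2) * (\<kappa>\<^sub>s powr ((1 - \<beta>) / 2))\<^sup>2 * (\<kappa>\<^sub>K powr (- \<rr>))\<^sup>2 * (sqrt ps)\<^sup>2 * (real n powr (- R))\<^sup>2"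
        unfolding \<epsilon>diff g_def[symmetric] t_def[symmetric] ps_def[symmetric] R_def[symmetric]
        by (simp add: power_mult_distrib power_divide)
      also have "(sqrt (1 - g))\<^sup>2 = 1 - g" using g by simp
      also have "(sqrt (2 * t - 1))\<^sup>2 = 2 * t - 1" using e0 e by simp
      also have "(\<kappa>\<^sub>s powr ((1 - \<beta>) / 2))\<^sup>2 = \<kappa>\<^sub>s powr (1 - \<beta>)" using \<kappa> by (simp add: power2_eq_square powr_add[symmetric])
      also have "(\<kappa>\<^sub>K powr (- \<rr>))\<^sup>2 = \<kappa>\<^sub>K powr (- 2 * \<rr>)" using \<kappa> by (simp add: power2_eq_square powr_add[symmetric])
      also have "(real n powr (- R))\<^sup>2 = real n powr (- 2 * R)" using n by (simp add: power2_eq_square powr_add[symmetric])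
      also have "(sqrt ps)\<^sup>2 = ps" using ps by simp
      finally show ?thesis by (simp add: k0_def)
    qed
    moreover have "bbar n = x n * real n powr (\<rho> + 1)" using n by (simp add: x_def)
    ultimately have "(A n)\<^sup>2 = (x n)\<^sup>2 * (real n powr (\<rho> + 1))\<^sup>2 * (k0 * ps * real n powr (- 2 * R))"
      by (simp add: A_def power_mult_distrib)
    also have "\<dots> = (x n)\<^sup>2 * (k0 * ps) * ((real n powr (\<rho> + 1))\<^sup>2 * real n powr (- 2 * R))" by simp
    also have "(real n powr (\<rho> + 1))\<^sup>2 * real n powr (- 2 * R) = real n powr (2 * (\<rho> + 1) - 2 * R)"
      using n by (simp add: power2_eq_square powr_add[symmetric])
    finally have A2: "(A n)\<^sup>2 = (x n)\<^sup>2 * (k0 * ps) * real n powr (2 * (\<rho> + 1) - 2 * R)" .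
    have xn: "x n > 0" using bbar_pos[OF n] n by (simp add: x_def)
    have yn: "y n powr (e + 1 - 2 * \<rr>) > 0" using y_pos[OF n] by simp
    have k1: "k1 > 0" using \<kappa> by (simp add: k1_def)
    have nn: "real n powr (2 * (\<rho> + 1) - 2 * R) > 0" using n by simp
    have "(1 / LS2.Psi n) * (k1 / k0 * y n powr (e + 1 - 2 * \<rr>) / (x n)\<^sup>2) = 1 / (A n)\<^sup>2"
      unfolding Psi A2 using ps k1 k0 xn yn nn by (simp add: field_simps)
    then have "(1 / (\<kappa>\<^sub>K * (\<phi> + 1) * (1 - g))) * (?S n / LS2.Psi n) * (k1 / k0 * y n powr (e + 1 - 2 * \<rr>) / (x n)\<^sup>2) =
        (1 / (\<kappa>\<^sub>K * (\<phi> + 1) * (1 - g))) * ?S n * (1 / (A n)\<^sup>2)"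
    proof -
      assume h: "(1 / LS2.Psi n) * (k1 / k0 * y n powr (e + 1 - 2 * \<rr>) / (x n)\<^sup>2) = 1 / (A n)\<^sup>2"
      have "c * (S / P) * X = c * S * ((1 / P) * X)" for c S P X :: real by simp
      then show ?thesis unfolding h[symmetric] .
    qed
    also have "\<dots> = (\<Sum>k=1..n. (1 / (\<kappa>\<^sub>K * (\<phi> + 1) * (1 - g))) * (real k powr (a - 1) * M powr ((1 - \<beta>) * real (s k))) * (1 / (A n)\<^sup>2))"
      by (simp only: sum_distrib_left sum_distrib_right)
    also have "\<dots> = (\<Sum>k=1..n. (real k powr \<rho> / A n)\<^sup>2 * \<tau> k)"
    proof (rule sum.cong[OF refl])
      fix k assume "k \<in> {1..n}"
      then have k: "real k > 0" by simp
      have "real k powr (a - 1) = (real k powr \<rho>)\<^sup>2 / real k powr \<phi>"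
        using k by (simp add: a_def power2_eq_square powr_add[symmetric] powr_diff[symmetric])
      then show "(1 / (\<kappa>\<^sub>K * (\<phi> + 1) * (1 - g))) * (real k powr (a - 1) * M powr ((1 - \<beta>) * real (s k))) * (1 / (A n)\<^sup>2) = (real k powr \<rho> / A n)\<^sup>2 * \<tau> k"
        by (simp add: \<tau>_def K power_divide mult_ac)
    qed
    finally show ?case .
  qed
  ultimately show ?thesis by (auto intro: Lim_transform_eventually)
qed

text \<open>A difference is estimated and not a ratio, because the limit law asks for the bias only
  up to o(n^(\<rho>+1-R)). Both terms carry the same value of \<open>psi_fun\<close>, which is
  pulled out and is bounded.\<close>

lemma bias_normalisation:
  "(\<lambda>n. ((\<Sum>k=1..n. real k powr \<rho> * \<eta> k) - A' n) / real n powr (\<rho> + 1 - R)) \<longlonglongrightarrow> 0"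
proof -
  define t where "t = (\<rho> + 1) / (\<phi> + 1)"
  have rt: "\<rr>\<^sub>1 = t * p" by (simp add: \<rr>\<^sub>1p t_def)
  let ?S = "\<lambda>n. \<Sum>k=1..n. real k powr \<rho> * \<eta> k"
  have S: "(\<lambda>n. ?S n / LS1.Psi n) \<longlonglongrightarrow> 1 / (\<kappa>\<^sub>s powr \<rr>\<^sub>1 * ((\<rho> + 1) * \<kappa>\<^sub>K powr t))"
    using L_increment_ratio[OF \<rho>1] LS1.level_sum_asymp[OF L_strict, of "\<lambda>k. real k powr \<rho>"]
    unfolding t_def[symmetric] rt[symmetric] by (simp add: \<eta>_def)
  define x where "x n = bbar n / real n powr (\<rho> + 1)" for n
  have x: "x \<longlonglongrightarrow> 1 / (\<rho> + 1)" using bbar_asymp by (simp add: x_def[abs_def])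
  define k1 where "k1 = \<kappa>\<^sub>s powr (\<rr>\<^sub>1 + (- \<alpha>)) * \<kappa>\<^sub>K powr (t - \<rr>)"
  define k2 where "k2 = \<kappa>\<^sub>s powr (- \<alpha>) * \<kappa>\<^sub>K powr (- \<rr>)"
  have "(\<lambda>n. (?S n / LS1.Psi n) * k1 * y n powr (t - \<rr>) - x n * k2) \<longlonglongrightarrow>
     1 / (\<kappa>\<^sub>s powr \<rr>\<^sub>1 * ((\<rho> + 1) * \<kappa>\<^sub>K powr t)) * k1 * 1 - 1 / (\<rho> + 1) * k2"
    by (intro tendsto_intros S y_powr x)
  moreover have "1 / (\<kappa>\<^sub>s powr \<rr>\<^sub>1 * ((\<rho> + 1) * \<kappa>\<^sub>K powr t)) * k1 * 1 - 1 / (\<rho> + 1) * k2 = 0"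
  proof -
    have "k1 = \<kappa>\<^sub>s powr \<rr>\<^sub>1 * \<kappa>\<^sub>K powr t * k2"
      by (simp add: k1_def k2_def powr_add powr_diff powr_minus field_simps)
    then show ?thesis using \<kappa> \<rho>1 by simp
  qed
  ultimately have D: "(\<lambda>n. (?S n / LS1.Psi n) * k1 * y n powr (t - \<rr>) - x n * k2) \<longlonglongrightarrow> 0" by simp
  define C where "C = (M powr \<rr>\<^sub>1 - 1) / (M powr (\<rr>\<^sub>1 + (- \<alpha>)) - 1) + M powr \<rr>\<^sub>1"
  show ?thesis
  proof (rule tendsto_0_le[OF D, of _ C])
    show "eventually (\<lambda>n. norm ((?S n - A' n) / real n powr (\<rho> + 1 - R)) \<le> norm ((?S n / LS1.Psi n) * k1 * y n powr (t - \<rr>) - x n * k2) * C) sequentially"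
      using \<xi>_eventually
    proof eventually_elim
      case (elim n)
      then have n: "n \<ge> 1" by simp
      define ps where "ps = psi_fun M \<rr>\<^sub>1 (- \<alpha>) (\<xi> n)"
      have ps: "ps > 0" "ps \<le> C" using psi_fun_bounds[OF M \<rr>\<^sub>1_pos, of "\<xi> n"] elim by (auto simp: ps_def C_def)
      have cp: "(\<rr>\<^sub>1 + (- \<alpha>)) / p = t - \<rr>" using p by (simp add: rt \<rr>p diff_divide_distrib)
      have pt: "(\<phi> + 1) * t = \<rho> + 1" using \<phi>0 by (simp add: t_def)
      have np: "(\<phi> + 1) * (t - \<rr>) = \<rho> + 1 - R" unfolding right_diff_distrib pt R_def ..
      have Psi: "LS1.Psi n = k1 * y n powr (t - \<rr>) * real n powr (\<rho> + 1 - R) * ps"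
        unfolding LS1.Psi_eq[OF n] LS_\<xi> ps_def L_powr[OF n] cp np k1_def by simp
      have k1: "k1 > 0" using \<kappa> by (simp add: k1_def)
      have yn: "y n powr (t - \<rr>) > 0" using y_pos[OF n] by simp
      have nn: "real n powr (\<rho> + 1 - R) > 0" using n by simp
      have P0: "LS1.Psi n > 0" unfolding Psi using k1 yn nn ps by simp
      have "A' n = x n * k2 * ps * (real n powr (\<rho> + 1) * real n powr (- R))"
        using n by (simp add: A'_def x_def \<epsilon>bias k2_def ps_def R_def)
      also have "real n powr (\<rho> + 1) * real n powr (- R) = real n powr (\<rho> + 1 - R)" using n by (simp add: powr_add[symmetric])
      finally have A': "A' n / real n powr (\<rho> + 1 - R) = x n * k2 * ps" using nn by simp
      have "?S n / real n powr (\<rho> + 1 - R) = (?S n / LS1.Psi n) * (LS1.Psi n / real n powr (\<rho> + 1 - R))" using P0 by simp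
      also have "LS1.Psi n / real n powr (\<rho> + 1 - R) = k1 * y n powr (t - \<rr>) * ps" unfolding Psi using nn by simp
      finally have "(?S n - A' n) / real n powr (\<rho> + 1 - R) = ((?S n / LS1.Psi n) * k1 * y n powr (t - \<rr>) - x n * k2) * ps"
        unfolding diff_divide_distrib A' by (simp add: algebra_simps)
      then show ?case using ps by (simp add: abs_mult mult_left_mono)
    qed
  qed
qed

end

section \<open>The multilevel innovations\<close>

lemma eventually_joint_limit:
  fixes D :: "(real^'d) set"
  shows "eventually P (joint_limit D xs) \<longleftrightarrow> (\<exists>r>0. \<exists>k0. \<forall>x\<in>D. dist x xs < r \<longrightarrow> (\<forall>k\<ge>k0. P (x, k)))"
proof
  assume "eventually P (joint_limit D xs)"
  then obtain Pf Pg where Pf: "eventually Pf (inf (nhds xs) (principal D))" and Pg: "eventually Pg sequentially"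
    and P: "\<And>x k. Pf x \<Longrightarrow> Pg k \<Longrightarrow> P (x, k)"
    unfolding joint_limit_def eventually_prod_filter by blast
  from Pf obtain r where "r > 0" "\<And>x. dist x xs < r \<Longrightarrow> x \<in> D \<Longrightarrow> Pf x"
    unfolding eventually_inf_principal eventually_nhds_metric by blast
  moreover from Pg obtain k0 where "\<And>k. k \<ge> k0 \<Longrightarrow> Pg k" by (auto simp: eventually_sequentially)
  ultimately show "\<exists>r>0. \<exists>k0. \<forall>x\<in>D. dist x xs < r \<longrightarrow> (\<forall>k\<ge>k0. P (x, k))" using P by blast
next
  assume "\<exists>r>0. \<exists>k0. \<forall>x\<in>D. dist x xs < r \<longrightarrow> (\<forall>k\<ge>k0. P (x, k))"
  then obtain r k0 where r: "r > 0" and P: "\<And>x k. x \<in> D \<Longrightarrow> dist x xs < r \<Longrightarrow> k \<ge> k0 \<Longrightarrow> P (x, k)" by blast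
  have "eventually (\<lambda>x. x \<in> D \<and> dist x xs < r) (inf (nhds xs) (principal D))"
    unfolding eventually_inf_principal eventually_nhds_metric using r by blast
  moreover have "eventually (\<lambda>k. k \<ge> k0) sequentially" by (rule eventually_ge_at_top)
  ultimately show "eventually P (joint_limit D xs)"
    unfolding joint_limit_def eventually_prod_filter using P by blast
qed

lemma joint_limit_nontrivial: "xs \<in> D \<Longrightarrow> joint_limit D xs \<noteq> bot"
  unfolding trivial_limit_def eventually_joint_limit by (auto intro!: bexI[of _ xs])

lemma filterlim_snd_joint_limit: "filterlim snd sequentially (joint_limit D xs)"
  unfolding filterlim_at_top eventually_joint_limit by (auto intro: exI[of _ 1])

text \<open>A joint limit controls only small distances and large n. On the rest of the ball the
  difference is at most C, and |x - xs| \<ge> r there allows C to be replaced by C / r^2 times the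
  squared distance. In this form the estimate can be averaged against a mean square error.\<close>

lemma joint_limit_uniform:
  fixes f :: "(real^'d) \<Rightarrow> nat \<Rightarrow> 'b::real_normed_vector"
  assumes lim: "((\<lambda>(x, n). f x n) \<longlongrightarrow> l) (joint_limit D xs)"
    and B: "B \<subseteq> D" and bd: "\<And>n x. n \<ge> n1 \<Longrightarrow> x \<in> B \<Longrightarrow> norm (f x n - l) \<le> C" and e: "e > 0"
  shows "\<exists>C' k0. \<forall>n\<ge>k0. \<forall>x\<in>B. norm (f x n - l) \<le> e + C' * (norm (x - xs))\<^sup>2"
proof -
  from tendstoD[OF lim e] obtain r k0 where r: "r > 0" and le: "\<And>x k. x \<in> D \<Longrightarrow> dist x xs < r \<Longrightarrow> k \<ge> k0 \<Longrightarrow> dist (f x k) l < e"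
    unfolding eventually_joint_limit by auto
  show ?thesis
  proof (intro exI[of _ "\<bar>C\<bar> / r\<^sup>2"] exI[of _ "max k0 n1"] allI ballI impI)
    fix n x assume n: "max k0 n1 \<le> n" and x: "x \<in> B"
    show "norm (f x n - l) \<le> e + \<bar>C\<bar> / r\<^sup>2 * (norm (x - xs))\<^sup>2"
    proof (cases "dist x xs < r")
      case True
      then have "norm (f x n - l) < e" using le[of x n] x B n by (auto simp: dist_norm)
      moreover have "0 \<le> \<bar>C\<bar> / r\<^sup>2 * (norm (x - xs))\<^sup>2" by simp
      ultimately show ?thesis by linarith
    next
      case False
      then have "r\<^sup>2 \<le> (norm (x - xs))\<^sup>2" using r by (intro power_mono) (auto simp: dist_norm)
      then have "\<bar>C\<bar> / r\<^sup>2 * r\<^sup>2 \<le> \<bar>C\<bar> / r\<^sup>2 * (norm (x - xs))\<^sup>2" by (intro mult_left_mono) auto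
      moreover have "\<bar>C\<bar> / r\<^sup>2 * r\<^sup>2 = \<bar>C\<bar>" using r by simp
      moreover have "norm (f x n - l) \<le> C" using bd n x by simp
      ultimately show ?thesis using e by linarith
    qed
  qed
qed

lemma (in prob_space) cov_matrix_quadratic:
  fixes X :: "'a \<Rightarrow> real^'d"
  assumes X: "integrable M X" and X2: "integrable M (\<lambda>\<omega>. (norm (X \<omega> - expectation X))\<^sup>2)"
  shows "u \<bullet> (cov_matrix M X *v u) = expectation (\<lambda>\<omega>. (u \<bullet> (X \<omega> - expectation X))\<^sup>2)"
proof -
  have [measurable]: "X \<in> borel_measurable M" using X by auto
  let ?Y = "\<lambda>\<omega>. X \<omega> - expectation X"
  have "(\<lambda>\<omega>. ?Y \<omega> \<bullet> axis i 1) \<in> borel_measurable M" for i by measurable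
  then have [measurable]: "(\<lambda>\<omega>. ?Y \<omega> $ i) \<in> borel_measurable M" for i by (simp add: inner_axis)
  have int: "integrable M (\<lambda>\<omega>. ?Y \<omega> $ i * ?Y \<omega> $ j)" for i j
  proof (rule Bochner_Integration.integrable_bound[OF X2])
    have "\<bar>?Y \<omega> $ i\<bar> * \<bar>?Y \<omega> $ j\<bar> \<le> norm (?Y \<omega>) * norm (?Y \<omega>)" for \<omega>
      by (intro mult_mono component_le_norm_cart) auto
    then show "AE \<omega> in M. norm (?Y \<omega> $ i * ?Y \<omega> $ j) \<le> norm ((norm (?Y \<omega>))\<^sup>2)"
      by (simp add: abs_mult power2_eq_square)
  qed measurable
  have "(u \<bullet> ?Y \<omega>)\<^sup>2 = (\<Sum>i\<in>UNIV. \<Sum>j\<in>UNIV. u $ i * u $ j * (?Y \<omega> $ i * ?Y \<omega> $ j))" for \<omega>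
    by (simp add: inner_vec_def power2_eq_square sum_product mult_ac)
  then have "expectation (\<lambda>\<omega>. (u \<bullet> ?Y \<omega>)\<^sup>2) = (\<Sum>i\<in>UNIV. \<Sum>j\<in>UNIV. u $ i * u $ j * expectation (\<lambda>\<omega>. ?Y \<omega> $ i * ?Y \<omega> $ j))"
    using int by (simp add: Bochner_Integration.integral_sum)
  also have "\<dots> = u \<bullet> (cov_matrix M X *v u)"
    by (simp add: inner_vec_def matrix_vector_mult_def cov_matrix_def sum_distrib_left mult_ac)
  finally show ?thesis by simp
qed

locale multilevel = prob_space P + ml_parameters M \<alpha> \<beta> \<phi> \<rho> \<kappa>\<^sub>K \<kappa>\<^sub>s \<rr> \<rr>\<^sub>1 \<rr>\<^sub>2 K Kbar b \<xi> \<epsilon>bias \<epsilon>diff s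
  for P :: "'w measure"
    and M \<alpha> \<beta> \<phi> \<rho> \<kappa>\<^sub>K \<kappa>\<^sub>s \<rr> \<rr>\<^sub>1 \<rr>\<^sub>2 :: real and K Kbar b \<xi> \<epsilon>bias \<epsilon>diff :: "nat \<Rightarrow> real" and s :: "nat \<Rightarrow> nat" +
  fixes S :: "'u measure" and U :: "'w \<Rightarrow> 'u" and D :: "(real^'d) set"
    and F :: "real^'d \<Rightarrow> 'u \<Rightarrow> real^'d" and Fs :: "nat \<Rightarrow> real^'d \<Rightarrow> 'u \<Rightarrow> real^'d"
    and proj :: "real^'d \<Rightarrow> real^'d" and \<theta>s \<theta>\<^sub>0 \<mu> :: "real^'d" and H \<Gamma> :: "real^'d^'d"
    and UU :: "nat \<times> nat \<Rightarrow> 'w \<Rightarrow> 'u" and Us :: "nat \<Rightarrow> 'w \<Rightarrow> nat \<times> nat \<Rightarrow> 'u"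
    and lam \<psi> :: real and \<gamma> :: "nat \<Rightarrow> real"
    and \<theta> \<theta>bar :: "nat \<Rightarrow> 'w \<Rightarrow> real^'d" and conv :: "'w set"
  assumes U [measurable]: "U \<in> measurable P S"
    and D_closed: "closed D"
    and proj [measurable]: "proj \<in> borel_measurable borel"
    and proj_D: "\<And>\<theta>. \<theta> \<in> D \<Longrightarrow> proj \<theta> = \<theta>"
    and proj_not_D: "\<And>\<theta>. \<theta> \<notin> D \<Longrightarrow> proj \<theta> \<in> frontier D"
    and Fs_meas: "\<And>k. k \<ge> 1 \<Longrightarrow> (\<lambda>(\<theta>, u). Fs k \<theta> u) \<in> borel_measurable (restrict_space borel D \<Otimes>\<^sub>M S)"
    and Fs_int: "\<And>k \<theta>. k \<ge> 1 \<Longrightarrow> \<theta> \<in> D \<Longrightarrow> integrable P (\<lambda>\<omega>. Fs k \<theta> (U \<omega>))"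
    and Fs_0: "Fs 0 = (\<lambda>_ _. 0)"
    and UU_copies: "independent_copies P S U ({1..} \<times> {1..}) UU"
    and Us_copies: "independent_copies P (Pi\<^sub>M ({1..} \<times> {1..}) (\<lambda>_. S))
           (\<lambda>\<omega>. \<lambda>kl \<in> {1..} \<times> {1..}. UU kl \<omega>) {1..} Us"
    and \<theta>\<^sub>0: "\<theta>\<^sub>0 \<in> D"
    and zero: "contracting_zero D (mean_field P U F) \<theta>s H"
    and lam: "0 < lam" "lam \<le> 1"
    and taylor: "(\<lambda>\<theta>. norm (mean_field P U F \<theta> - H *v (\<theta> - \<theta>s)))
           \<in> O[at \<theta>s within D](\<lambda>\<theta>. norm (\<theta> - \<theta>s) powr (1 + lam))"
    and approx: "approximations P U D F Fs \<alpha> \<beta> \<mu> \<Gamma> \<theta>s M"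
    and \<psi>: "max (1 - 2 * lam / (lam + 1) * (\<phi> + 1) * \<rr>) 0 < \<psi>" "\<psi> < 1"
    and \<gamma>: "\<And>n. \<gamma> n = real n powr (- \<psi>)"
    and \<theta>: "\<And>n \<omega>. \<theta> n \<omega> = ml_iter M \<beta> Fs proj \<gamma> K s \<theta>\<^sub>0 (\<lambda>m. Us m \<omega>) n"
    and \<theta>bar: "\<And>n \<omega>. \<theta>bar n \<omega> = ml_average b (\<lambda>m. \<theta> m \<omega>) n"
    and conv: "conv = {\<omega> \<in> space P. (\<lambda>n. \<theta> n \<omega>) \<longlonglongrightarrow> \<theta>s}"
begin

abbreviation "I \<equiv> {1..} \<times> {1..} :: (nat \<times> nat) set"
abbreviation "f \<equiv> mean_field P U F"

text \<open>The family \<open>UU\<close> serves as a representative of this law, so expectations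
  over one innovation are computed on P.\<close>

definition E :: "(nat \<times> nat \<Rightarrow> 'u) measure" where
  "E = distr P (Pi\<^sub>M I (\<lambda>_. S)) (\<lambda>\<omega>. \<lambda>kl \<in> I. UU kl \<omega>)"

lemma sets_E [measurable_cong, simp]: "sets E = sets (Pi\<^sub>M I (\<lambda>_. S))" by (simp add: E_def)

lemma UU_meas: "kl \<in> I \<Longrightarrow> UU kl \<in> measurable P S"
  using UU_copies by (auto simp: independent_copies_def indep_vars_def)

lemma UU_distr: "kl \<in> I \<Longrightarrow> distr P S (UU kl) = distr P S U"
  using UU_copies by (auto simp: independent_copies_def)

lemma UU_PiM [measurable]: "(\<lambda>\<omega>. \<lambda>kl \<in> I. UU kl \<omega>) \<in> measurable P (Pi\<^sub>M I (\<lambda>_. S))"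
  by (rule measurable_restrict) (rule UU_meas)

sublocale innovations P E Us
proof (intro innovations.intro innovations_axioms.intro)
  show "prob_space P" by unfold_locales
  have *: "indep_vars (\<lambda>_. Pi\<^sub>M I (\<lambda>_. S)) Us {1..}" using Us_copies by (simp add: independent_copies_def)
  show "prob_space E" unfolding E_def by (rule prob_space_distr[OF UU_PiM])
  show "indep_vars (\<lambda>_. E) Us {1..}"
    using * unfolding indep_vars_def2 by (simp add: measurable_cong_sets[OF refl sets_E])
  show "distr P E (Us n) = E" if "1 \<le> n" for n
  proof -
    have "distr P E (Us n) = distr P (Pi\<^sub>M I (\<lambda>_. S)) (Us n)" by (rule distr_cong) auto
    then show ?thesis using Us_copies that by (simp add: independent_copies_def E_def)
  qed
qed

text \<open>Measurability of the approximations is given on D only, so the state must enter as a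
  D-valued map; level 0 vanishes identically.\<close>

lemma Fs_comp:
  assumes x: "x \<in> measurable N (restrict_space borel D)" and h: "h \<in> measurable N S"
  shows "(\<lambda>z. Fs k (x z) (h z)) \<in> borel_measurable N"
proof (cases "k = 0")
  case False
  have "(\<lambda>z. (x z, h z)) \<in> measurable N (restrict_space borel D \<Otimes>\<^sub>M S)" using x h by (rule measurable_Pair)
  from measurable_compose[OF this Fs_meas[of k]] False show ?thesis by simp
qed (simp add: Fs_0)

lemma level_diff_comp:
  assumes "x \<in> measurable N (restrict_space borel D)" and "h \<in> measurable N S"
  shows "(\<lambda>z. level_diff Fs k (x z) (h z)) \<in> borel_measurable N"
  unfolding level_diff_def by (intro borel_measurable_diff Fs_comp assms)

lemma level_diff_meas [measurable]: "x \<in> D \<Longrightarrow> level_diff Fs k x \<in> borel_measurable S"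
  using level_diff_comp[of "\<lambda>_. x" S "\<lambda>u. u" k] by (simp add: space_restrict_space)

lemma Fs_integrable: "x \<in> D \<Longrightarrow> integrable P (\<lambda>\<omega>. Fs k x (U \<omega>))"
  using Fs_int[of k x] by (cases "k = 0") (auto simp: Fs_0)

lemma level_diff_integrable: "x \<in> D \<Longrightarrow> integrable P (\<lambda>\<omega>. level_diff Fs k x (U \<omega>))"
  unfolding level_diff_def by (intro Bochner_Integration.integrable_diff Fs_integrable)

definition mF :: "nat \<Rightarrow> real^'d \<Rightarrow> real^'d" where "mF k x = (\<integral>\<omega>. Fs k x (U \<omega>) \<partial>P)"

definition Y :: "nat \<Rightarrow> real^'d \<Rightarrow> 'u \<Rightarrow> real^'d" where
  "Y k x u = level_diff Fs k x u - (\<integral>\<omega>. level_diff Fs k x (U \<omega>) \<partial>P)"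

lemma Y_meas [measurable]: "x \<in> D \<Longrightarrow> Y k x \<in> borel_measurable S"
  unfolding Y_def by measurable

lemma Y_integrable: "x \<in> D \<Longrightarrow> integrable P (\<lambda>\<omega>. Y k x (U \<omega>))"
  unfolding Y_def by (intro Bochner_Integration.integrable_diff level_diff_integrable) auto

lemma Y_mean: "x \<in> D \<Longrightarrow> (\<integral>\<omega>. Y k x (U \<omega>) \<partial>P) = 0"
  unfolding Y_def using level_diff_integrable by (simp add: prob_space)

lemma sum_level_means: "x \<in> D \<Longrightarrow> (\<Sum>k=1..n. \<integral>\<omega>. level_diff Fs k x (U \<omega>) \<partial>P) = mF n x"
proof -
  assume x: "x \<in> D"
  have "(\<integral>\<omega>. level_diff Fs k x (U \<omega>) \<partial>P) = mF k x - mF (k - 1) x" for k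
    unfolding level_diff_def mF_def by (intro Bochner_Integration.integral_diff Fs_integrable x)
  then have "(\<Sum>k=1..n. \<integral>\<omega>. level_diff Fs k x (U \<omega>) \<partial>P) = mF n x - mF 0 x"
    using sum_telescope_from_1[of "\<lambda>k. mF k x" n] by simp
  then show ?thesis by (simp add: mF_def Fs_0)
qed

lemma integral_UU:
  assumes "kl \<in> I" and h: "h \<in> borel_measurable S"
  shows "(\<integral>\<omega>. h (UU kl \<omega>) \<partial>P) = (\<integral>\<omega>. (h (U \<omega>) :: 'z::{banach, second_countable_topology}) \<partial>P)"
    and "integrable P (\<lambda>\<omega>. h (UU kl \<omega>)) \<longleftrightarrow> integrable P (\<lambda>\<omega>. h (U \<omega>))"
proof -
  have "(\<integral>\<omega>. h (UU kl \<omega>) \<partial>P) = (\<integral>u. h u \<partial>distr P S (UU kl))"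
    using UU_meas[OF assms(1)] h by (simp add: integral_distr)
  also have "\<dots> = (\<integral>\<omega>. h (U \<omega>) \<partial>P)"
    unfolding UU_distr[OF assms(1)] using h by (simp add: integral_distr)
  finally show "(\<integral>\<omega>. h (UU kl \<omega>) \<partial>P) = (\<integral>\<omega>. h (U \<omega>) \<partial>P)" .
  have "integrable P (\<lambda>\<omega>. h (UU kl \<omega>)) \<longleftrightarrow> integrable (distr P S (UU kl)) h"
    using UU_meas[OF assms(1)] h by (simp add: integrable_distr_eq)
  also have "\<dots> \<longleftrightarrow> integrable P (\<lambda>\<omega>. h (U \<omega>))"
    unfolding UU_distr[OF assms(1)] using h by (simp add: integrable_distr_eq)
  finally show "integrable P (\<lambda>\<omega>. h (UU kl \<omega>)) \<longleftrightarrow> integrable P (\<lambda>\<omega>. h (U \<omega>))" .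
qed

section \<open>Replication numbers and the profiles of variance and cost\<close>

definition N :: "nat \<Rightarrow> nat \<Rightarrow> nat" where "N n k = ml_N M \<beta> k (s n) (K n)"

text \<open>The number of replications before rounding up.\<close>

definition N\<^sub>0 :: "nat \<Rightarrow> nat \<Rightarrow> real" where
  "N\<^sub>0 n k = K n / M powr real (s n) * M powr ((\<beta> + 1) / 2 * (real (s n) - real k))"

lemma N\<^sub>0_pos: "n \<ge> 1 \<Longrightarrow> N\<^sub>0 n k > 0" using K_pos M by (simp add: N\<^sub>0_def)

lemma N_bounds: "n \<ge> 1 \<Longrightarrow> N\<^sub>0 n k \<le> real (N n k)" "n \<ge> 1 \<Longrightarrow> real (N n k) \<le> N\<^sub>0 n k + 1" "n \<ge> 1 \<Longrightarrow> N n k \<ge> 1"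
proof -
  assume n: "n \<ge> 1"
  have "N n k = nat \<lceil>N\<^sub>0 n k\<rceil>" using M by (simp add: N_def ml_N_def N\<^sub>0_def powr_realpow)
  moreover have c: "1 \<le> \<lceil>N\<^sub>0 n k\<rceil>" using N\<^sub>0_pos[OF n, of k] by linarith
  moreover have "nat 1 \<le> nat \<lceil>N\<^sub>0 n k\<rceil>" by (rule nat_mono[OF c])
  ultimately have "real (N n k) = real_of_int \<lceil>N\<^sub>0 n k\<rceil>" "N n k \<ge> 1" by auto
  then show "N\<^sub>0 n k \<le> real (N n k)" "real (N n k) \<le> N\<^sub>0 n k + 1" "N n k \<ge> 1" by linarith+
qed

lemma N\<^sub>0_lower: "n \<ge> 1 \<Longrightarrow> k \<le> s n \<Longrightarrow> 1 / N\<^sub>0 n k \<le> \<delta> n"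
proof -
  assume n: "n \<ge> 1" and k: "k \<le> s n"
  have K: "K n > 0" using K_pos n by simp
  have "1 \<le> M powr ((\<beta> + 1) / 2 * (real (s n) - real k))" using M \<beta> k by (intro ge_one_powr_ge_zero) auto
  then have "K n / M powr real (s n) * 1 \<le> N\<^sub>0 n k" unfolding N\<^sub>0_def using K M by (intro mult_left_mono) auto
  then have "1 / N\<^sub>0 n k \<le> 1 / (K n / M powr real (s n))" using K M N\<^sub>0_pos[OF n] by (intro divide_left_mono) auto
  then show ?thesis by (simp add: \<delta>_def)
qed

lemma g_power: "k \<le> s n \<Longrightarrow> g ^ (s n - k) = M powr (- ((1 - \<beta>) / 2) * (real (s n) - real k))"
  using M by (simp add: g_def powr_power of_nat_diff mult_ac)

text \<open>The exponent (\<beta>+1)/2 is the classical allocation, with replications proportional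
  to the square root of variance over cost. It makes the profiles of variance and of cost decay with
  the same ratio g below the finest level.\<close>

lemma variance_kernel:
  assumes "n \<ge> 1" "k \<le> s n"
  shows "M powr (- \<beta> * real k) / N\<^sub>0 n k = M powr ((1 - \<beta>) * real (s n)) / K n * g ^ (s n - k)"
proof -
  have "M powr (- \<beta> * real k) * M powr real (s n) =
      M powr ((1 - \<beta>) * real (s n)) * M powr (- ((1 - \<beta>) / 2) * (real (s n) - real k)) * M powr ((\<beta> + 1) / 2 * (real (s n) - real k))"
    unfolding powr_add[symmetric] by (rule arg_cong[of _ _ "\<lambda>e. M powr e"]) (simp add: field_simps)
  then show ?thesis using K_pos[OF assms(1)] M unfolding g_power[OF assms(2)] by (simp add: N\<^sub>0_def field_simps)
qed

lemma cost_kernel: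
  assumes "n \<ge> 1" "k \<le> s n"
  shows "M powr real k * N\<^sub>0 n k = K n * g ^ (s n - k)"
proof -
  have "M powr real k * M powr ((\<beta> + 1) / 2 * (real (s n) - real k)) =
      M powr (- ((1 - \<beta>) / 2) * (real (s n) - real k)) * M powr real (s n)"
    unfolding powr_add[symmetric] by (rule arg_cong[of _ _ "\<lambda>e. M powr e"]) (simp add: field_simps)
  then show ?thesis using K_pos[OF assms(1)] M unfolding g_power[OF assms(2)] by (simp add: N\<^sub>0_def field_simps)
qed

lemma variance_sum_bound:
  assumes n: "n \<ge> 1"
  shows "(\<Sum>k=1..s n. M powr (- \<beta> * real k) / real (N n k)) \<le> \<tau> n"
proof -
  have "(\<Sum>k=1..s n. M powr (- \<beta> * real k) / real (N n k)) \<le> (\<Sum>k=1..s n. M powr ((1 - \<beta>) * real (s n)) / K n * g ^ (s n - k))"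
  proof (rule sum_mono)
    fix k assume k: "k \<in> {1..s n}"
    have "M powr (- \<beta> * real k) / real (N n k) \<le> M powr (- \<beta> * real k) / N\<^sub>0 n k"
      using N_bounds[OF n, of k] N\<^sub>0_pos[OF n, of k] by (intro divide_left_mono) auto
    then show "M powr (- \<beta> * real k) / real (N n k) \<le> M powr ((1 - \<beta>) * real (s n)) / K n * g ^ (s n - k)"
      using variance_kernel[OF n, of k] k by simp
  qed
  also have "\<dots> = M powr ((1 - \<beta>) * real (s n)) / K n * (\<Sum>k=1..s n. g ^ (s n - k))"
    by (rule sum_distrib_left[symmetric])
  also have "(\<Sum>k=1..s n. g ^ (s n - k)) = (\<Sum>k<s n. g ^ k)"
    by (rule sum.reindex_bij_witness[of _ "\<lambda>k. s n - k" "\<lambda>k. s n - k"]) auto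
  also have "\<dots> = (1 - g ^ s n) / (1 - g)" using g by (simp add: sum_gp_strict)
  also have "M powr ((1 - \<beta>) * real (s n)) / K n * ((1 - g ^ s n) / (1 - g)) \<le> M powr ((1 - \<beta>) * real (s n)) / K n * (1 / (1 - g))"
    using g K_nonneg by (intro mult_left_mono divide_right_mono divide_nonneg_nonneg) auto
  finally show ?thesis by (simp add: \<tau>_def)
qed

text \<open>All single samples of step n as one index set, so that independence is used once for the
  whole step and not level by level.\<close>

definition J :: "nat \<Rightarrow> (nat \<times> nat) set" where "J n = Sigma {1..s n} (\<lambda>k. {1..N n k})"

lemma J_finite [simp]: "finite (J n)" by (simp add: J_def)
lemma J_I: "kl \<in> J n \<Longrightarrow> kl \<in> I" by (auto simp: J_def)
lemma J_sum: "(\<Sum>kl\<in>J n. h (fst kl)) = (\<Sum>k=1..s n. real (N n k) * h k)"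
proof -
  have "(\<Sum>kl\<in>J n. h (fst kl)) = (\<Sum>k=1..s n. \<Sum>l=1..N n k. h k)"
    unfolding J_def by (subst sum.Sigma) (auto simp: case_prod_beta)
  then show ?thesis by simp
qed

text \<open>The argument is replaced by \<open>\<theta>s\<close> outside the ball; means and noise
  thereby become measurable on the whole space although the approximations live on D.\<close>

definition retract :: "real \<Rightarrow> real^'d \<Rightarrow> real^'d" where
  "retract r x = (if x \<in> cball \<theta>s r then x else \<theta>s)"

definition Zc :: "real \<Rightarrow> nat \<Rightarrow> real^'d \<Rightarrow> (nat \<times> nat \<Rightarrow> 'u) \<Rightarrow> real^'d" where
  "Zc r n x w = ml_Z M \<beta> Fs w (retract r x) (s n) (K n) - mF (s n) (retract r x)"

lemma ml_Z_centred:
  assumes x: "x \<in> D" and n: "n \<ge> 1"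
  shows "ml_Z M \<beta> Fs w x (s n) (K n) - mF (s n) x = (\<Sum>kl\<in>J n. (1 / real (N n (fst kl))) *\<^sub>R Y (fst kl) x (w kl))"
proof -
  have N0: "N n k \<noteq> 0" for k using N_bounds(3)[OF n, of k] by simp
  have "(\<Sum>kl\<in>J n. (1 / real (N n (fst kl))) *\<^sub>R Y (fst kl) x (w kl))
      = (\<Sum>k=1..s n. \<Sum>l=1..N n k. (1 / real (N n k)) *\<^sub>R Y k x (w (k, l)))"
    unfolding J_def by (subst sum.Sigma) (auto simp: case_prod_beta)
  also have "\<dots> = (\<Sum>k=1..s n. (1 / real (N n k)) *\<^sub>R (\<Sum>l=1..N n k. level_diff Fs k x (w (k, l))) - (\<integral>\<omega>. level_diff Fs k x (U \<omega>) \<partial>P))"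
    by (intro sum.cong refl) (simp add: N0 Y_def scaleR_sum_right[symmetric] sum_subtractf scaleR_diff_right sum_constant_scaleR del: sum_constant)
  also have "\<dots> = ml_Z M \<beta> Fs w x (s n) (K n) - mF (s n) x"
    unfolding sum_subtractf sum_level_means[OF x] by (simp add: ml_Z_def N_def)
  finally show ?thesis ..
qed

text \<open>The centred estimator realised on P through \<open>UU\<close>, where the independence of
  the samples is at hand.\<close>

definition noise :: "nat \<Rightarrow> real^'d \<Rightarrow> 'w \<Rightarrow> real^'d" where
  "noise n x \<omega> = (\<Sum>kl\<in>J n. (1 / real (N n (fst kl))) *\<^sub>R Y (fst kl) x (UU kl \<omega>))"

lemma Zc_meas_w:
  assumes "x \<in> D"
  shows "(\<lambda>w. ml_Z M \<beta> Fs w x (s n) (K n) - mF (s n) x) \<in> borel_measurable E"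
proof -
  have "(\<lambda>w. level_diff Fs k x (w (k, l))) \<in> borel_measurable E" if "k \<in> {1..s n}" "l \<in> {1..ml_N M \<beta> k (s n) (K n)}" for k l
  proof -
    have "(k, l) \<in> I" using that by auto
    then have "(\<lambda>w. w (k, l)) \<in> measurable E S"
      unfolding measurable_cong_sets[OF sets_E refl] by (rule measurable_component_singleton)
    then show ?thesis by (rule measurable_compose) (rule level_diff_meas[OF assms])
  qed
  then show ?thesis unfolding ml_Z_def
    by (intro borel_measurable_diff borel_measurable_sum borel_measurable_scaleR borel_measurable_const)
qed

lemma integral_Zc:
  fixes h :: "real^'d \<Rightarrow> 'z::{banach, second_countable_topology}"
  assumes x: "x \<in> cball \<theta>s r" "x \<in> D" and n: "n \<ge> 1" and h [measurable]: "h \<in> borel_measurable borel"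
  shows "(\<integral>w. h (Zc r n x w) \<partial>E) = (\<integral>\<omega>. h (noise n x \<omega>) \<partial>P)"
    and "integrable E (\<lambda>w. h (Zc r n x w)) \<longleftrightarrow> integrable P (\<lambda>\<omega>. h (noise n x \<omega>))"
proof -
  have Z: "Zc r n x w = ml_Z M \<beta> Fs w x (s n) (K n) - mF (s n) x" for w using x by (simp add: Zc_def retract_def)
  have m: "(\<lambda>w. h (Zc r n x w)) \<in> borel_measurable (Pi\<^sub>M I (\<lambda>_. S))"
    using measurable_compose[OF Zc_meas_w[OF x(2), of n] h] unfolding Z measurable_cong_sets[OF sets_E refl] .
  have eq: "Zc r n x (\<lambda>kl \<in> I. UU kl \<omega>) = noise n x \<omega>" for \<omega>
    unfolding Z ml_Z_centred[OF x(2) n] noise_def using J_I by (intro sum.cong) auto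
  show "(\<integral>w. h (Zc r n x w) \<partial>E) = (\<integral>\<omega>. h (noise n x \<omega>) \<partial>P)"
    unfolding E_def integral_distr[OF UU_PiM m] eq ..
  show "integrable E (\<lambda>w. h (Zc r n x w)) \<longleftrightarrow> integrable P (\<lambda>\<omega>. h (noise n x \<omega>))"
    unfolding E_def integrable_distr_eq[OF UU_PiM m] eq ..
qed

lemma noise_integrable: "x \<in> D \<Longrightarrow> integrable P (noise n x)" "x \<in> D \<Longrightarrow> (\<integral>\<omega>. noise n x \<omega> \<partial>P) = 0"
proof -
  assume x: "x \<in> D"
  have i: "integrable P (\<lambda>\<omega>. Y (fst kl) x (UU kl \<omega>))" if "kl \<in> J n" for kl
    using integral_UU(2)[OF J_I[OF that] Y_meas[OF x]] Y_integrable[OF x] by blast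
  then show "integrable P (noise n x)" unfolding noise_def by auto
  have "(\<integral>\<omega>. noise n x \<omega> \<partial>P) = (\<Sum>kl\<in>J n. (1 / real (N n (fst kl))) *\<^sub>R (\<integral>\<omega>. Y (fst kl) x (UU kl \<omega>) \<partial>P))"
    unfolding noise_def using i by simp
  also have "\<dots> = 0" using integral_UU(1)[OF J_I Y_meas[OF x]] Y_mean[OF x] by (intro sum.neutral) auto
  finally show "(\<integral>\<omega>. noise n x \<omega> \<partial>P) = 0" .
qed

lemma indep_terms:
  assumes x: "x \<in> D"
  shows "indep_vars (\<lambda>_. borel) (\<lambda>kl \<omega>. c (fst kl) * (u \<bullet> Y (fst kl) x (UU kl \<omega>)) :: real) (J n)"
proof -
  have "indep_vars (\<lambda>_. S) UU I" using UU_copies by (simp add: independent_copies_def)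
  then have "indep_vars (\<lambda>_. S) UU (J n)" by (rule indep_vars_subset) (intro subsetI J_I)
  then show ?thesis
    by (rule indep_vars_compose2[where Y = "\<lambda>kl y. c (fst kl) * (u \<bullet> Y (fst kl) x y)"])
      (intro borel_measurable_times borel_measurable_const borel_measurable_inner Y_meas x)
qed

definition v :: "nat \<Rightarrow> real^'d \<Rightarrow> real^'d \<Rightarrow> real" where
  "v n x u = (\<Sum>k=1..s n. (1 / real (N n k)) * (\<integral>\<omega>. (u \<bullet> Y k x (U \<omega>))\<^sup>2 \<partial>P))"

lemma noise_variance:
  assumes x: "x \<in> D" and n: "n \<ge> 1" and int: "\<And>k. k \<ge> 1 \<Longrightarrow> integrable P (\<lambda>\<omega>. (u \<bullet> Y k x (U \<omega>))\<^sup>2)"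
  shows "integrable P (\<lambda>\<omega>. (u \<bullet> noise n x \<omega>)\<^sup>2)" "(\<integral>\<omega>. (u \<bullet> noise n x \<omega>)\<^sup>2 \<partial>P) = v n x u"
proof -
  let ?X = "\<lambda>kl \<omega>. (1 / real (N n (fst kl))) * (u \<bullet> Y (fst kl) x (UU kl \<omega>))"
  have eq: "u \<bullet> noise n x \<omega> = (\<Sum>kl\<in>J n. ?X kl \<omega>)" for \<omega> by (simp add: noise_def inner_sum_right)
  have N0: "real (N n k) \<noteq> 0" for k using N_bounds(3)[OF n, of k] by simp
  have m: "(\<lambda>y. u \<bullet> Y k x y) \<in> borel_measurable S" "(\<lambda>y. (u \<bullet> Y k x y)\<^sup>2) \<in> borel_measurable S" for k
    using Y_meas[OF x] by auto
  have i1: "integrable P (\<lambda>\<omega>. u \<bullet> Y (fst kl) x (UU kl \<omega>))" "(\<integral>\<omega>. u \<bullet> Y (fst kl) x (UU kl \<omega>) \<partial>P) = 0" if "kl \<in> J n" for kl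
    unfolding integral_UU[OF J_I[OF that] m(1)] using Y_integrable[OF x, of "fst kl"] Y_mean[OF x] by (simp_all add: integral_inner_right)
  have i2: "integrable P (\<lambda>\<omega>. (u \<bullet> Y (fst kl) x (UU kl \<omega>))\<^sup>2)" "(\<integral>\<omega>. (u \<bullet> Y (fst kl) x (UU kl \<omega>))\<^sup>2 \<partial>P) = (\<integral>\<omega>. (u \<bullet> Y (fst kl) x (U \<omega>))\<^sup>2 \<partial>P)" if "kl \<in> J n" for kl
    unfolding integral_UU[OF J_I[OF that] m(2)] using int[of "fst kl"] that by (auto simp: J_def)
  have "integrable P (\<lambda>\<omega>. (\<Sum>kl\<in>J n. ?X kl \<omega>)\<^sup>2) \<and> (\<integral>\<omega>. (\<Sum>kl\<in>J n. ?X kl \<omega>)\<^sup>2 \<partial>P) = (\<Sum>kl\<in>J n. \<integral>\<omega>. (?X kl \<omega>)\<^sup>2 \<partial>P)"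
  proof (rule indep_centred_sum_square[OF J_finite indep_terms[OF x]])
    fix kl assume kl: "kl \<in> J n"
    show "integrable P (?X kl)" "(\<integral>\<omega>. ?X kl \<omega> \<partial>P) = 0" using i1[OF kl] by auto
    show "integrable P (\<lambda>\<omega>. (?X kl \<omega>)\<^sup>2)" unfolding power_mult_distrib using i2(1)[OF kl] by (rule integrable_mult_right)
  qed
  moreover have "(\<Sum>kl\<in>J n. \<integral>\<omega>. (?X kl \<omega>)\<^sup>2 \<partial>P) = (\<Sum>kl\<in>J n. (1 / real (N n (fst kl)))\<^sup>2 * (\<integral>\<omega>. (u \<bullet> Y (fst kl) x (U \<omega>))\<^sup>2 \<partial>P))"
    by (intro sum.cong) (auto simp: i2 power_mult_distrib power_divide)
  moreover have "\<dots> = v n x u"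
    unfolding v_def J_sum[of "\<lambda>k. (1 / real (N n k))\<^sup>2 * (\<integral>\<omega>. (u \<bullet> Y k x (U \<omega>))\<^sup>2 \<partial>P)"]
    using N0 by (intro sum.cong) (auto simp: power2_eq_square)
  ultimately show "integrable P (\<lambda>\<omega>. (u \<bullet> noise n x \<omega>)\<^sup>2)" "(\<integral>\<omega>. (u \<bullet> noise n x \<omega>)\<^sup>2 \<partial>P) = v n x u"
    unfolding eq by auto
qed

lemma noise_char:
  assumes x: "x \<in> D"
  shows "(\<integral>\<omega>. iexp (a * (u \<bullet> noise n x \<omega>)) \<partial>P) = (\<Prod>kl\<in>J n. \<integral>\<omega>. iexp (a / real (N n (fst kl)) * (u \<bullet> Y (fst kl) x (U \<omega>))) \<partial>P)"
proof -
  let ?X = "\<lambda>kl \<omega>. (a / real (N n (fst kl))) * (u \<bullet> Y (fst kl) x (UU kl \<omega>))"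
  have "a * (u \<bullet> noise n x \<omega>) = (\<Sum>kl\<in>J n. ?X kl \<omega>)" for \<omega> by (simp add: noise_def inner_sum_right sum_distrib_left)
  then have "iexp (a * (u \<bullet> noise n x \<omega>)) = (\<Prod>kl\<in>J n. iexp (?X kl \<omega>))" for \<omega>
    by (simp add: exp_sum[symmetric] sum_distrib_left)
  then have "(\<integral>\<omega>. iexp (a * (u \<bullet> noise n x \<omega>)) \<partial>P) = (\<integral>\<omega>. (\<Prod>kl\<in>J n. iexp (?X kl \<omega>)) \<partial>P)" by simp
  also have "\<dots> = (\<Prod>kl\<in>J n. \<integral>\<omega>. iexp (?X kl \<omega>) \<partial>P)"
  proof (rule indep_vars_lebesgue_integral)
    show "indep_vars (\<lambda>_. borel) (\<lambda>kl \<omega>. iexp (?X kl \<omega>)) (J n)"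
      by (rule indep_vars_compose2[OF indep_terms[OF x], where Y = "\<lambda>_ z. iexp z"]) measurable
    show "integrable P (\<lambda>\<omega>. iexp (?X kl \<omega>))" if "kl \<in> J n" for kl
    proof (rule integrable_const_bound[of _ 1])
      have [measurable]: "UU kl \<in> measurable P S" using UU_meas[OF J_I[OF that]] .
      have [measurable]: "(\<lambda>\<omega>. Y (fst kl) x (UU kl \<omega>)) \<in> borel_measurable P" using Y_meas[OF x] by measurable
      show "(\<lambda>\<omega>. iexp (?X kl \<omega>)) \<in> borel_measurable P" by measurable
    qed simp
  qed simp
  also have "\<dots> = (\<Prod>kl\<in>J n. \<integral>\<omega>. iexp (a / real (N n (fst kl)) * (u \<bullet> Y (fst kl) x (U \<omega>))) \<partial>P)"
  proof (rule prod.cong[OF refl])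
    fix kl assume kl: "kl \<in> J n"
    have [measurable]: "Y (fst kl) x \<in> borel_measurable S" by (rule Y_meas[OF x])
    show "(\<integral>\<omega>. iexp (?X kl \<omega>) \<partial>P) = (\<integral>\<omega>. iexp (a / real (N n (fst kl)) * (u \<bullet> Y (fst kl) x (U \<omega>))) \<partial>P)"
      by (rule integral_UU(1)[OF J_I[OF kl], of "\<lambda>y. iexp (a / real (N n (fst kl)) * (u \<bullet> Y (fst kl) x y))"]) measurable
  qed
  finally show ?thesis .
qed

end

section \<open>Local moments, characteristic function of the noise and the covariance limit\<close>

context multilevel
begin

lemma \<theta>s_interior: "\<theta>s \<in> interior D" and f_zero: "f \<theta>s = 0" and H_eigen: "\<And>c. complex_eigenvalue H c \<Longrightarrow> Re c < 0"
  using zero by (auto simp: contracting_zero_def)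

lemma \<theta>s_D: "\<theta>s \<in> D" using \<theta>s_interior interior_subset by blast

lemma bias_limit: "((\<lambda>(x, k). M powr (\<alpha> * real k) *\<^sub>R (mF k x - f x)) \<longlongrightarrow> \<mu>) (joint_limit D \<theta>s)"
  and variance_limit: "((\<lambda>(x, k). M powr (\<beta> * real k) *\<^sub>R cov_matrix P (\<lambda>\<omega>. level_diff Fs k x (U \<omega>))) \<longlongrightarrow> \<Gamma>) (joint_limit D \<theta>s)"
  using approx by (auto simp: approximations_def mF_def)

text \<open>C M^(-\<beta> k) plays the role of a variance, hence the power q/2. The order q is at
  most 3 to fit the second-order expansion of the exponential; the factors 2 come from passing to
  lower moments.\<close>

definition moments :: "real \<Rightarrow> real \<Rightarrow> real \<Rightarrow> bool" where
  "moments r C q \<longleftrightarrow> r > 0 \<and> C > 0 \<and> 2 < q \<and> q \<le> 3 \<and> cball \<theta>s r \<subseteq> D \<and>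
    (\<forall>x\<in>cball \<theta>s r. \<forall>k\<ge>1. integrable P (\<lambda>\<omega>. (norm (Y k x (U \<omega>)))\<^sup>2) \<and>
       (\<integral>\<omega>. (norm (Y k x (U \<omega>)))\<^sup>2 \<partial>P) \<le> 2 * (C * M powr (- \<beta> * real k)) \<and>
       integrable P (\<lambda>\<omega>. norm (Y k x (U \<omega>)) powr q) \<and>
       (\<integral>\<omega>. norm (Y k x (U \<omega>)) powr q \<partial>P) \<le> 2 * (C * M powr (- \<beta> * real k)) powr (q / 2))"

lemma ex_moments: "\<exists>r C q. moments r C q"
proof -
  obtain q V C where q: "q > 2" and V: "open V" "\<theta>s \<in> V" and tail: "\<And>x k. x \<in> V \<inter> D \<Longrightarrow> k \<ge> 1 \<Longrightarrow>
      integrable P (\<lambda>\<omega>. norm (Y k x (U \<omega>)) powr q) \<and> (\<integral>\<omega>. norm (Y k x (U \<omega>)) powr q \<partial>P) powr (2 / q) \<le> C * M powr (- \<beta> * real k)"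
    using approx unfolding approximations_def Let_def Y_def by blast
  have "open (V \<inter> interior D)" "\<theta>s \<in> V \<inter> interior D" using V \<theta>s_interior by auto
  then obtain r where r: "r > 0" "cball \<theta>s r \<subseteq> V \<inter> interior D" using open_contains_cball by blast
  define C1 where "C1 = max C 1"
  define q' where "q' = min q 3"
  have "moments r C1 q'"
    unfolding moments_def
  proof (intro conjI ballI allI impI)
    show "r > 0" by fact
    show "C1 > 0" by (simp add: C1_def)
    show "2 < q'" "q' \<le> 3" using q by (auto simp: q'_def)
    show "cball \<theta>s r \<subseteq> D" using r interior_subset by blast
    fix x k assume x: "x \<in> cball \<theta>s r" and k: "1 \<le> (k::nat)"
    have xD: "x \<in> V \<inter> D" using r x interior_subset by blast
    have m: "(\<lambda>\<omega>. norm (Y k x (U \<omega>))) \<in> borel_measurable P"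
      using measurable_compose[OF U Y_meas[of x k]] xD by auto
    define \<sigma>2 where "\<sigma>2 = C1 * M powr (- \<beta> * real k)"
    have \<sigma>2: "\<sigma>2 > 0" using M by (simp add: \<sigma>2_def C1_def)
    define \<sigma> where "\<sigma> = sqrt \<sigma>2"
    have \<sigma>: "\<sigma> > 0" using \<sigma>2 by (simp add: \<sigma>_def)
    have \<sigma>p: "\<sigma> powr c = \<sigma>2 powr (c / 2)" for c
      using \<sigma>2 by (simp add: \<sigma>_def powr_half_sqrt[symmetric] powr_powr mult.commute)
    let ?E = "\<integral>\<omega>. norm (Y k x (U \<omega>)) powr q \<partial>P"
    have E0: "0 \<le> ?E" by (rule Bochner_Integration.integral_nonneg) simp
    have "?E powr (2 / q) \<le> \<sigma>2"
    proof -
      have "C * M powr (- \<beta> * real k) \<le> \<sigma>2" unfolding \<sigma>2_def C1_def by (intro mult_right_mono) auto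
      then show ?thesis using tail[OF xD k] by linarith
    qed
    then have "(?E powr (2 / q)) powr (q / 2) \<le> \<sigma>2 powr (q / 2)" using q by (intro powr_mono2) auto
    then have Eq: "?E \<le> \<sigma> powr q" using E0 q by (simp add: powr_powr \<sigma>p)
    note low = lower_moment[OF m norm_ge_zero conjunct1[OF tail[OF xD k]] Eq \<sigma>]
    have n2: "norm z powr 2 = (norm z)\<^sup>2" for z :: "real^'d" by (simp add: powr_numeral)
    show "integrable P (\<lambda>\<omega>. (norm (Y k x (U \<omega>)))\<^sup>2)" using low(1)[of 2] q by (simp add: n2)
    show "(\<integral>\<omega>. (norm (Y k x (U \<omega>)))\<^sup>2 \<partial>P) \<le> 2 * (C1 * M powr (- \<beta> * real k))"
      unfolding \<sigma>2_def[symmetric] using low(2)[of 2] q \<sigma>2 by (simp add: n2 \<sigma>p)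
    show "integrable P (\<lambda>\<omega>. norm (Y k x (U \<omega>)) powr q')" using low(1)[of q'] q by (simp add: q'_def)
    show "(\<integral>\<omega>. norm (Y k x (U \<omega>)) powr q' \<partial>P) \<le> 2 * (C1 * M powr (- \<beta> * real k)) powr (q' / 2)"
      unfolding \<sigma>2_def[symmetric] using low(2)[of q'] q by (simp add: q'_def \<sigma>p)
  qed
  then show ?thesis by blast
qed

context
  fixes r C q :: real
  assumes mom: "moments r C q"
begin

lemma mom_simps: "r > 0" "C > 0" "2 < q" "q \<le> 3" "cball \<theta>s r \<subseteq> D"
  using mom by (auto simp: moments_def)

lemma mom_Y:
  assumes "x \<in> cball \<theta>s r" "k \<ge> 1"
  shows "integrable P (\<lambda>\<omega>. (norm (Y k x (U \<omega>)))\<^sup>2)"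
    "(\<integral>\<omega>. (norm (Y k x (U \<omega>)))\<^sup>2 \<partial>P) \<le> 2 * (C * M powr (- \<beta> * real k))"
    "integrable P (\<lambda>\<omega>. norm (Y k x (U \<omega>)) powr q)"
    "(\<integral>\<omega>. norm (Y k x (U \<omega>)) powr q \<partial>P) \<le> 2 * (C * M powr (- \<beta> * real k)) powr (q / 2)"
  using mom assms by (auto simp: moments_def)

lemma xD: "x \<in> cball \<theta>s r \<Longrightarrow> x \<in> D" using mom_simps by blast

lemma YU_meas: "x \<in> cball \<theta>s r \<Longrightarrow> (\<lambda>\<omega>. Y k x (U \<omega>)) \<in> borel_measurable P"
  using measurable_compose[OF U Y_meas[OF xD]] .

lemma inner_Y:
  assumes x: "x \<in> cball \<theta>s r" and k: "k \<ge> 1" and B: "norm u \<le> B" "B > 0"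
  shows "integrable P (\<lambda>\<omega>. (u \<bullet> Y k x (U \<omega>))\<^sup>2)"
    "(\<integral>\<omega>. (u \<bullet> Y k x (U \<omega>))\<^sup>2 \<partial>P) \<le> 2 * (B\<^sup>2 * (C * M powr (- \<beta> * real k)))"
    "integrable P (\<lambda>\<omega>. \<bar>u \<bullet> Y k x (U \<omega>)\<bar> powr q)"
    "(\<integral>\<omega>. \<bar>u \<bullet> Y k x (U \<omega>)\<bar> powr q \<partial>P) \<le> 2 * (B powr q * (C * M powr (- \<beta> * real k)) powr (q / 2))"
proof -
  note [measurable] = YU_meas[OF x]
  note m = mom_Y[OF x k]
  have b: "\<bar>u \<bullet> z\<bar> \<le> B * norm z" for z
    using order_trans[OF Cauchy_Schwarz_ineq2 mult_right_mono[OF B(1)]] by simp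
  have b2: "(u \<bullet> z)\<^sup>2 \<le> B\<^sup>2 * (norm z)\<^sup>2" for z
    using power_mono[OF b[of z], of 2] by (simp add: power_mult_distrib)
  have bq: "\<bar>u \<bullet> z\<bar> powr q \<le> B powr q * norm z powr q" for z
    using powr_mono2[OF _ _ b[of z], of q] mom_simps B by (simp add: powr_mult)
  show i2: "integrable P (\<lambda>\<omega>. (u \<bullet> Y k x (U \<omega>))\<^sup>2)"
    by (rule Bochner_Integration.integrable_bound[OF integrable_mult_right[OF m(1), of "B\<^sup>2"]]) (use b2 in auto)
  show iq: "integrable P (\<lambda>\<omega>. \<bar>u \<bullet> Y k x (U \<omega>)\<bar> powr q)"
    by (rule Bochner_Integration.integrable_bound[OF integrable_mult_right[OF m(3), of "B powr q"]]) (use bq in auto)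
  have "(\<integral>\<omega>. (u \<bullet> Y k x (U \<omega>))\<^sup>2 \<partial>P) \<le> (\<integral>\<omega>. B\<^sup>2 * (norm (Y k x (U \<omega>)))\<^sup>2 \<partial>P)"
    by (rule Bochner_Integration.integral_mono[OF i2 integrable_mult_right[OF m(1)] b2])
  also have "\<dots> \<le> B\<^sup>2 * (2 * (C * M powr (- \<beta> * real k)))" using m(2) by (simp add: mult_left_mono)
  finally show "(\<integral>\<omega>. (u \<bullet> Y k x (U \<omega>))\<^sup>2 \<partial>P) \<le> 2 * (B\<^sup>2 * (C * M powr (- \<beta> * real k)))" by simp
  have "(\<integral>\<omega>. \<bar>u \<bullet> Y k x (U \<omega>)\<bar> powr q \<partial>P) \<le> (\<integral>\<omega>. B powr q * norm (Y k x (U \<omega>)) powr q \<partial>P)"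
    by (rule Bochner_Integration.integral_mono[OF iq integrable_mult_right[OF m(3)] bq])
  also have "\<dots> \<le> B powr q * (2 * (C * M powr (- \<beta> * real k)) powr (q / 2))" using m(4) by (simp add: mult_left_mono)
  finally show "(\<integral>\<omega>. \<bar>u \<bullet> Y k x (U \<omega>)\<bar> powr q \<partial>P) \<le> 2 * (B powr q * (C * M powr (- \<beta> * real k)) powr (q / 2))" by simp
qed

lemma v_bound:
  assumes x: "x \<in> cball \<theta>s r" and n: "n \<ge> 1" and B: "norm u \<le> B" "B > 0"
  shows "0 \<le> v n x u" "v n x u \<le> 2 * B\<^sup>2 * C * \<tau> n"
proof -
  show "0 \<le> v n x u" unfolding v_def by (intro sum_nonneg mult_nonneg_nonneg Bochner_Integration.integral_nonneg) auto
  have "v n x u \<le> (\<Sum>k=1..s n. (1 / real (N n k)) * (2 * (B\<^sup>2 * (C * M powr (- \<beta> * real k)))))"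
    unfolding v_def by (intro sum_mono mult_left_mono inner_Y(2)[OF x _ B]) auto
  also have "\<dots> = 2 * B\<^sup>2 * C * (\<Sum>k=1..s n. M powr (- \<beta> * real k) / real (N n k))"
    by (simp add: sum_distrib_left mult_ac)
  also have "\<dots> \<le> 2 * B\<^sup>2 * C * \<tau> n"
    using variance_sum_bound[OF n] mom_simps by (intro mult_left_mono) auto
  finally show "v n x u \<le> 2 * B\<^sup>2 * C * \<tau> n" .
qed

lemma noise_second_moment:
  assumes x: "x \<in> cball \<theta>s r" and n: "n \<ge> 1"
  shows "integrable P (\<lambda>\<omega>. (norm (noise n x \<omega>))\<^sup>2)" "(\<integral>\<omega>. (norm (noise n x \<omega>))\<^sup>2 \<partial>P) \<le> real CARD('d) * (2 * C * \<tau> n)"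
proof -
  have eq: "(norm (noise n x \<omega>))\<^sup>2 = (\<Sum>b\<in>Basis. (b \<bullet> noise n x \<omega>)\<^sup>2)" for \<omega>
    unfolding power2_norm_eq_inner by (subst euclidean_inner) (simp add: power2_eq_square inner_commute)
  have nv: "integrable P (\<lambda>\<omega>. (b \<bullet> noise n x \<omega>)\<^sup>2)" "(\<integral>\<omega>. (b \<bullet> noise n x \<omega>)\<^sup>2 \<partial>P) = v n x b" if "b \<in> Basis" for b
    using noise_variance[OF xD[OF x] n inner_Y(1)[OF x, of _ b 1]] that by auto
  show "integrable P (\<lambda>\<omega>. (norm (noise n x \<omega>))\<^sup>2)" unfolding eq using nv by auto
  have "(\<integral>\<omega>. (norm (noise n x \<omega>))\<^sup>2 \<partial>P) = (\<Sum>b\<in>(Basis::(real^'d) set). v n x b)" unfolding eq using nv by simp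
  also have "\<dots> \<le> (\<Sum>b\<in>(Basis::(real^'d) set). 2 * C * \<tau> n)"
    using v_bound(2)[OF x n, of _ 1] by (intro sum_mono) auto
  also have "\<dots> = real CARD('d) * (2 * C * \<tau> n)" by simp
  finally show "(\<integral>\<omega>. (norm (noise n x \<omega>))\<^sup>2 \<partial>P) \<le> real CARD('d) * (2 * C * \<tau> n)" .
qed

text \<open>The replications are independent, so the characteristic function is a product over all single
  samples and no moment inequality for sums is needed.\<close>

lemma noise_char_approx:
  assumes x: "x \<in> cball \<theta>s r" and n: "n \<ge> 1"
  shows "norm ((\<integral>\<omega>. iexp (a * (u \<bullet> noise n x \<omega>)) \<partial>P) - exp (- (a\<^sup>2 * v n x u / 2)))
    \<le> 3 * (norm u + 1) powr q * C powr (q / 2) * (a\<^sup>2 * \<tau> n * (a\<^sup>2 * \<tau> n * \<delta> n) powr ((q - 2) / 2))"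
proof -
  define B where "B = norm u + 1"
  have B: "norm u \<le> B" "B > 0" by (auto simp: B_def add_nonneg_pos)
  define \<sigma>2 where "\<sigma>2 k = C * M powr (- \<beta> * real k)" for k :: nat
  have \<sigma>2: "\<sigma>2 k > 0" for k using mom_simps M by (simp add: \<sigma>2_def)
  define sg where "sg k = B * sqrt (\<sigma>2 k)" for k
  have sg: "sg k > 0" for k using B \<sigma>2 by (simp add: sg_def)
  have sgq: "sg k powr q = B powr q * \<sigma>2 k powr (q / 2)" for k
    using B \<sigma>2[of k] by (simp add: sg_def powr_mult powr_half_sqrt[symmetric] powr_powr mult.commute)
  have sg2: "(sg k)\<^sup>2 = B\<^sup>2 * \<sigma>2 k" for k using \<sigma>2[of k] by (simp add: sg_def power_mult_distrib)
  have N0: "real (N n k) > 0" for k using N_bounds(3)[OF n, of k] by simp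
  let ?V = "\<lambda>k. \<integral>\<omega>. (u \<bullet> Y k x (U \<omega>))\<^sup>2 \<partial>P"
  let ?\<phi> = "\<lambda>k. \<integral>\<omega>. iexp (a / real (N n k) * (u \<bullet> Y k x (U \<omega>))) \<partial>P"
  let ?e = "\<lambda>k. complex_of_real (exp (- ((a / real (N n k))\<^sup>2 * ?V k / 2)))"
  have iY: "integrable P (\<lambda>\<omega>. u \<bullet> Y k x (U \<omega>))" "(\<integral>\<omega>. u \<bullet> Y k x (U \<omega>) \<partial>P) = 0" for k
    using Y_integrable[OF xD[OF x], of k] Y_mean[OF xD[OF x], of k] by (simp_all add: integral_inner_right)
  have prod_e: "(\<Prod>kl\<in>J n. ?e (fst kl)) = exp (- (a\<^sup>2 * v n x u / 2))"
  proof -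
    have "(\<Prod>kl\<in>J n. ?e (fst kl)) = complex_of_real (exp (\<Sum>kl\<in>J n. - ((a / real (N n (fst kl)))\<^sup>2 * ?V (fst kl) / 2)))"
      by (simp add: exp_sum)
    also have "(\<Sum>kl\<in>J n. - ((a / real (N n (fst kl)))\<^sup>2 * ?V (fst kl) / 2)) = (\<Sum>k=1..s n. real (N n k) * - ((a / real (N n k))\<^sup>2 * ?V k / 2))"
      by (rule J_sum)
    also have "\<dots> = (\<Sum>k=1..s n. - (a\<^sup>2 / 2 * ((1 / real (N n k)) * ?V k)))"
    proof (intro sum.cong refl)
      fix k
      show "real (N n k) * - ((a / real (N n k))\<^sup>2 * ?V k / 2) = - (a\<^sup>2 / 2 * ((1 / real (N n k)) * ?V k))"
        using N0[of k] by (simp add: power2_eq_square)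
    qed
    also have "\<dots> = - (a\<^sup>2 * v n x u / 2)" unfolding v_def sum_negf by (subst sum_distrib_left[symmetric]) (simp only: times_divide_eq_left)
    finally show ?thesis by simp
  qed
  have single: "norm (?\<phi> k - ?e k) \<le> 3 * (\<bar>a / real (N n k)\<bar> * sg k) powr q" if k: "k \<ge> 1" for k
    by (rule char_normal_approx[OF iY mom_simps(3,4) sg inner_Y(1)[OF x k B] _ inner_Y(3)[OF x k B]])
      (use inner_Y(2,4)[OF x k B] in \<open>simp_all add: sg2 sgq \<sigma>2_def\<close>)
  have "norm ((\<Prod>kl\<in>J n. ?\<phi> (fst kl)) - (\<Prod>kl\<in>J n. ?e (fst kl))) \<le> (\<Sum>kl\<in>J n. norm (?\<phi> (fst kl) - ?e (fst kl)))"
  proof (rule norm_prod_diff)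
    fix kl
    have "norm (?\<phi> (fst kl)) \<le> (\<integral>\<omega>. norm (iexp (a / real (N n (fst kl)) * (u \<bullet> Y (fst kl) x (U \<omega>)))) \<partial>P)"
      by (rule integral_norm_bound)
    then show "norm (?\<phi> (fst kl)) \<le> 1" by (simp add: prob_space)
    show "norm (?e (fst kl)) \<le> 1" by (simp add: Bochner_Integration.integral_nonneg)
  qed
  also have "\<dots> \<le> (\<Sum>kl\<in>J n. 3 * (\<bar>a / real (N n (fst kl))\<bar> * sg (fst kl)) powr q)"
    by (intro sum_mono single) (auto simp: J_def)
  also have "\<dots> = (\<Sum>k=1..s n. real (N n k) * (3 * (\<bar>a / real (N n k)\<bar> * sg k) powr q))"
    by (rule J_sum[of "\<lambda>k. 3 * (\<bar>a / real (N n k)\<bar> * sg k) powr q"])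
  also have "\<dots> \<le> (\<Sum>k=1..s n. (3 * \<bar>a\<bar> powr q * B powr q * (C * \<delta> n * \<tau> n) powr ((q - 2) / 2) * C) * (M powr (- \<beta> * real k) / real (N n k)))"
  proof (rule sum_mono)
    fix k assume k: "k \<in> {1..s n}"
    \<comment> \<open>Squared scale of one sample in the average: one factor 1/N is at most
      \<delta>, the other one times the level variance at most C \<tau>.\<close>
    define h where "h = \<sigma>2 k / (real (N n k))\<^sup>2"
    have h0: "h \<ge> 0" using \<sigma>2[of k] by (simp add: h_def)
    have h: "h \<le> C * \<delta> n * \<tau> n"
    proof -
      have Kp: "K n > 0" using K_pos n by simp
      have "\<sigma>2 k / (real (N n k))\<^sup>2 \<le> \<sigma>2 k / (N\<^sub>0 n k)\<^sup>2"
        using N_bounds(1)[OF n, of k] N\<^sub>0_pos[OF n, of k] \<sigma>2[of k] by (intro divide_left_mono power_mono) auto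
      also have "\<dots> = C * (1 / N\<^sub>0 n k) * (M powr (- \<beta> * real k) / N\<^sub>0 n k)"
        by (simp add: \<sigma>2_def power2_eq_square)
      also have "\<dots> = C * (1 / N\<^sub>0 n k) * (M powr ((1 - \<beta>) * real (s n)) / K n * g ^ (s n - k))"
        using variance_kernel[OF n, of k] k by simp
      also have "\<dots> \<le> C * \<delta> n * \<tau> n"
      proof (rule mult_mono)
        show "C * (1 / N\<^sub>0 n k) \<le> C * \<delta> n" using N\<^sub>0_lower[OF n, of k] k mom_simps by (intro mult_left_mono) auto
        have "M powr ((1 - \<beta>) * real (s n)) / K n * g ^ (s n - k) \<le> M powr ((1 - \<beta>) * real (s n)) / K n * 1"
          using g Kp by (intro mult_left_mono power_le_one) auto
        also have "\<dots> \<le> \<tau> n"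
        proof -
          have "K n * (1 - g) \<le> K n * 1" using g Kp by (intro mult_left_mono) auto
          then show ?thesis unfolding \<tau>_def using g Kp by (simp add: divide_left_mono)
        qed
        finally show "M powr ((1 - \<beta>) * real (s n)) / K n * g ^ (s n - k) \<le> \<tau> n" .
        show "0 \<le> C * \<delta> n" using mom_simps \<delta>_nonneg by simp
        show "0 \<le> M powr ((1 - \<beta>) * real (s n)) / K n * g ^ (s n - k)" using g Kp by simp
      qed
      finally show ?thesis by (simp add: h_def)
    qed
    have "real (N n k) * (\<bar>a / real (N n k)\<bar> * sg k) powr q = \<bar>a\<bar> powr q * B powr q * (real (N n k) * (\<sigma>2 k powr (q / 2) / real (N n k) powr q))"
      using N0[of k] sg[of k] by (simp add: powr_mult powr_divide abs_divide sgq)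
    also have "\<sigma>2 k powr (q / 2) / real (N n k) powr q = h powr (q / 2)"
    proof -
      have "((real (N n k))\<^sup>2) powr (q / 2) = real (N n k) powr q"
        using N0[of k] by (simp add: powr_numeral[symmetric] powr_powr del: powr_numeral)
      then show ?thesis using \<sigma>2[of k] by (simp add: h_def powr_divide)
    qed
    \<comment> \<open>One power of h is kept for the sum over the samples, which yields \<tau>; the
      excess power is uniformly small and is the gain of a Lyapunov condition.\<close>
    also have "h powr (q / 2) = h * h powr ((q - 2) / 2)"
    proof -
      have "h > 0" using \<sigma>2[of k] N0[of k] by (simp add: h_def)
      then have "h * h powr ((q - 2) / 2) = h powr (1 + (q - 2) / 2)" by (simp add: powr_add)
      also have "1 + (q - 2) / 2 = q / 2" by (simp add: field_simps)
      finally show ?thesis ..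
    qed
    also have "real (N n k) * (h * h powr ((q - 2) / 2)) = C * h powr ((q - 2) / 2) * (M powr (- \<beta> * real k) / real (N n k))"
    proof -
      have "real (N n k) * h = C * (M powr (- \<beta> * real k) / real (N n k))"
        using N0[of k] by (simp add: h_def \<sigma>2_def power2_eq_square)
      then show ?thesis by (simp only: mult.assoc[symmetric]) (simp add: mult_ac)
    qed
    also have "\<bar>a\<bar> powr q * B powr q * (C * h powr ((q - 2) / 2) * (M powr (- \<beta> * real k) / real (N n k)))
        \<le> \<bar>a\<bar> powr q * B powr q * (C * (C * \<delta> n * \<tau> n) powr ((q - 2) / 2) * (M powr (- \<beta> * real k) / real (N n k)))"
      using h h0 mom_simps N0[of k] by (intro mult_left_mono mult_right_mono powr_mono2) auto
    finally have "3 * (real (N n k) * (\<bar>a / real (N n k)\<bar> * sg k) powr q) \<le> 3 * (\<bar>a\<bar> powr q * B powr q * (C * (C * \<delta> n * \<tau> n) powr ((q - 2) / 2) * (M powr (- \<beta> * real k) / real (N n k))))"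
      by (rule mult_left_mono) simp
    then show "real (N n k) * (3 * (\<bar>a / real (N n k)\<bar> * sg k) powr q) \<le>
        (3 * \<bar>a\<bar> powr q * B powr q * (C * \<delta> n * \<tau> n) powr ((q - 2) / 2) * C) * (M powr (- \<beta> * real k) / real (N n k))"
      by (simp add: mult_ac)
  qed
  also have "\<dots> = (3 * \<bar>a\<bar> powr q * B powr q * (C * \<delta> n * \<tau> n) powr ((q - 2) / 2) * C) * (\<Sum>k=1..s n. M powr (- \<beta> * real k) / real (N n k))"
    by (rule sum_distrib_left[symmetric])
  also have "\<dots> \<le> (3 * \<bar>a\<bar> powr q * B powr q * (C * \<delta> n * \<tau> n) powr ((q - 2) / 2) * C) * \<tau> n"
    using variance_sum_bound[OF n] mom_simps by (intro mult_left_mono) auto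
  also have "\<dots> = 3 * B powr q * C powr (q / 2) * (a\<^sup>2 * \<tau> n * (a\<^sup>2 * \<tau> n * \<delta> n) powr ((q - 2) / 2))"
  proof -
    have aq: "\<bar>a\<bar> powr q = a\<^sup>2 * (a\<^sup>2) powr ((q - 2) / 2)"
    proof (cases "a = 0")
      case False
      then have "a\<^sup>2 = \<bar>a\<bar> powr 2" by (simp add: powr_numeral)
      then have "a\<^sup>2 * (a\<^sup>2) powr ((q - 2) / 2) = \<bar>a\<bar> powr 2 * \<bar>a\<bar> powr (2 * ((q - 2) / 2))" by (simp only: powr_powr)
      also have "\<dots> = \<bar>a\<bar> powr q"
        unfolding powr_add[symmetric] by (rule arg_cong[of _ _ "\<lambda>e. \<bar>a\<bar> powr e"]) (simp add: field_simps)
      finally show ?thesis ..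
    qed simp
    have Cq: "C powr (q / 2) = C * C powr ((q - 2) / 2)"
    proof -
      have "C * C powr ((q - 2) / 2) = C powr (1 + (q - 2) / 2)" using mom_simps by (simp add: powr_add)
      also have "1 + (q - 2) / 2 = q / 2" by (simp add: field_simps)
      finally show ?thesis ..
    qed
    show ?thesis unfolding aq Cq using mom_simps \<delta>_nonneg \<tau>_nonneg by (simp add: powr_mult mult_ac)
  qed
  finally show ?thesis unfolding noise_char[OF xD[OF x]] prod_e[symmetric] B_def .
qed

text \<open>After division by \<tau> the variance is a geometric average of rescaled level
  variances. The weight concentrates on the fine levels, where the rescaled covariances are close to
  \<Gamma>, and rounding changes a term only by a factor between 1 - \<delta> and 1.\<close>

lemma v_limit:
  "((\<lambda>(x, n). v n x u / \<tau> n) \<longlongrightarrow> u \<bullet> (\<Gamma> *v u)) (joint_limit D \<theta>s)"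
proof -
  define V where "V k x = (\<integral>\<omega>. (u \<bullet> Y k x (U \<omega>))\<^sup>2 \<partial>P)" for k x
  define B where "B = norm u + 1"
  have B: "norm u \<le> B" "B > 0" by (auto simp: B_def add_nonneg_pos)
  define l where "l = u \<bullet> (\<Gamma> *v u)"
  have Vc: "V k x = u \<bullet> (cov_matrix P (\<lambda>\<omega>. level_diff Fs k x (U \<omega>)) *v u)" if "x \<in> cball \<theta>s r" "k \<ge> 1" for x k
    using cov_matrix_quadratic[OF level_diff_integrable[OF xD[OF that(1)]], of k u] mom_Y(1)[OF that]
    by (simp add: V_def Y_def)
  have "((\<lambda>z. u \<bullet> ((case z of (x, k) \<Rightarrow> M powr (\<beta> * real k) *\<^sub>R cov_matrix P (\<lambda>\<omega>. level_diff Fs k x (U \<omega>))) *v u)) \<longlongrightarrow> l) (joint_limit D \<theta>s)"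
    unfolding l_def
  proof (intro tendsto_inner tendsto_const)
    have "bounded_linear (\<lambda>G :: real^'d^'d. G *v u)"
      by (rule linear_conv_bounded_linear[THEN iffD1], rule linearI)
        (simp_all add: matrix_vector_mult_add_rdistrib scaleR_matrix_vector_assoc)
    from bounded_linear.tendsto[OF this variance_limit]
    show "((\<lambda>z. (case z of (x, k) \<Rightarrow> M powr (\<beta> * real k) *\<^sub>R cov_matrix P (\<lambda>\<omega>. level_diff Fs k x (U \<omega>))) *v u) \<longlongrightarrow> \<Gamma> *v u) (joint_limit D \<theta>s)" .
  qed
  then have lim: "((\<lambda>(x, k). M powr (\<beta> * real k) * (u \<bullet> (cov_matrix P (\<lambda>\<omega>. level_diff Fs k x (U \<omega>)) *v u))) \<longlongrightarrow> l) (joint_limit D \<theta>s)"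
    by (simp add: case_prod_unfold scaleR_matrix_vector_assoc[symmetric])
  define cc where "cc z k = M powr (\<beta> * real k) * V k (fst z) * (N\<^sub>0 (snd z) k / real (N (snd z) k))" for z :: "(real^'d) \<times> nat" and k
  have near: "eventually (\<lambda>z. fst z \<in> cball \<theta>s r \<and> snd z \<ge> 1) (joint_limit D \<theta>s)"
    unfolding eventually_joint_limit using mom_simps(1)
    by (intro exI[of _ r] conjI exI[of _ 1]) (auto simp: dist_commute less_imp_le)
  have Vb: "\<bar>M powr (\<beta> * real k) * V k x\<bar> \<le> 2 * B\<^sup>2 * C" if "x \<in> cball \<theta>s r" "k \<ge> 1" for x k
  proof -
    have "0 \<le> V k x" unfolding V_def by (rule Bochner_Integration.integral_nonneg) simp
    then have "\<bar>M powr (\<beta> * real k) * V k x\<bar> = M powr (\<beta> * real k) * V k x" by (simp add: abs_mult)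
    also have "\<dots> \<le> M powr (\<beta> * real k) * (2 * (B\<^sup>2 * (C * M powr (- \<beta> * real k))))"
      using inner_Y(2)[OF that B] by (intro mult_left_mono) (auto simp: V_def)
    also have "\<dots> = 2 * B\<^sup>2 * C * (M powr (\<beta> * real k) * M powr (- \<beta> * real k))" by simp
    also have "M powr (\<beta> * real k) * M powr (- \<beta> * real k) = 1" using M by (simp add: powr_add[symmetric])
    finally show ?thesis by simp
  qed
  have ratio: "0 \<le> N\<^sub>0 n k / real (N n k)" "N\<^sub>0 n k / real (N n k) \<le> 1" "k \<le> s n \<Longrightarrow> 1 - \<delta> n \<le> N\<^sub>0 n k / real (N n k)" if n: "n \<ge> 1" for n k
  proof -
    have p: "N\<^sub>0 n k > 0" "real (N n k) > 0" using N\<^sub>0_pos[OF n, of k] N_bounds(3)[OF n, of k] by auto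
    show "0 \<le> N\<^sub>0 n k / real (N n k)" "N\<^sub>0 n k / real (N n k) \<le> 1" using p N_bounds(1)[OF n, of k] by auto
    assume k: "k \<le> s n"
    have "real (N n k) - N\<^sub>0 n k \<le> 1" using N_bounds(2)[OF n, of k] by simp
    also have "1 \<le> \<delta> n * N\<^sub>0 n k" using N\<^sub>0_lower[OF n k] p by (simp add: field_simps)
    also have "\<dots> \<le> \<delta> n * real (N n k)" using N_bounds(1)[OF n, of k] \<delta>_nonneg by (intro mult_left_mono) auto
    finally show "1 - \<delta> n \<le> N\<^sub>0 n k / real (N n k)" using p by (simp add: field_simps)
  qed
  have "((\<lambda>z. \<Sum>k=1..s (snd z). g ^ (s (snd z) - k) * cc z k) \<longlongrightarrow> l / (1 - g)) (joint_limit D \<theta>s)"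
  proof (rule geometric_kernel_limit[OF g])
    show "filterlim (\<lambda>z. s (snd z)) at_top (joint_limit D \<theta>s)"
      by (rule filterlim_compose[OF LS1.s_top filterlim_snd_joint_limit])
    show "eventually (\<lambda>z. \<forall>k\<in>{1..s (snd z)}. \<bar>cc z k\<bar> \<le> 2 * B\<^sup>2 * C) (joint_limit D \<theta>s)"
      using near
    proof eventually_elim
      case (elim z)
      show ?case
      proof
        fix k assume k: "k \<in> {1..s (snd z)}"
        have "\<bar>cc z k\<bar> = \<bar>M powr (\<beta> * real k) * V k (fst z)\<bar> * (N\<^sub>0 (snd z) k / real (N (snd z) k))"
          using ratio(1)[of "snd z" k] elim by (simp only: cc_def abs_mult[of _ "N\<^sub>0 (snd z) k / real (N (snd z) k)"] abs_of_nonneg)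
        also have "\<dots> \<le> (2 * B\<^sup>2 * C) * 1"
          using Vb[of "fst z" k] ratio[of "snd z" k] elim k mom_simps by (intro mult_mono) auto
        finally show "\<bar>cc z k\<bar> \<le> 2 * B\<^sup>2 * C" by simp
      qed
    qed
    fix e :: real assume e: "e > 0"
    from tendstoD[OF lim, of "e / 2"] e obtain r1 k1 where r1: "r1 > 0"
      and k1: "\<And>x k. x \<in> D \<Longrightarrow> dist x \<theta>s < r1 \<Longrightarrow> k \<ge> k1 \<Longrightarrow>
        dist (M powr (\<beta> * real k) * (u \<bullet> (cov_matrix P (\<lambda>\<omega>. level_diff Fs k x (U \<omega>)) *v u))) l < e / 2"
      unfolding eventually_joint_limit by auto
    have "eventually (\<lambda>n. \<delta> n < e / (2 * (2 * B\<^sup>2 * C))) sequentially"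
      using order_tendstoD(2)[OF \<delta>_lim, of "e / (2 * (2 * B\<^sup>2 * C))"] e B mom_simps by simp
    then have ev\<delta>: "eventually (\<lambda>z. \<delta> (snd z) < e / (2 * (2 * B\<^sup>2 * C))) (joint_limit D \<theta>s)"
      using filterlim_snd_joint_limit[of D \<theta>s] unfolding filterlim_iff by blast
    have near2: "eventually (\<lambda>z. dist (fst z) \<theta>s < r1) (joint_limit D \<theta>s)"
      unfolding eventually_joint_limit using r1 by auto
    show "\<exists>k0. eventually (\<lambda>z. \<forall>k\<in>{k0..s (snd z)}. \<bar>cc z k - l\<bar> \<le> e) (joint_limit D \<theta>s)"
    proof (intro exI[of _ "max k1 1"])
      show "eventually (\<lambda>z. \<forall>k\<in>{max k1 1..s (snd z)}. \<bar>cc z k - l\<bar> \<le> e) (joint_limit D \<theta>s)"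
        using near near2 ev\<delta>
      proof eventually_elim
        case (elim z)
        show ?case
        proof
          fix k assume k: "k \<in> {max k1 1..s (snd z)}"
          define w where "w = M powr (\<beta> * real k) * V k (fst z)"
          define q0 where "q0 = N\<^sub>0 (snd z) k / real (N (snd z) k)"
          have q0: "0 \<le> q0" "q0 \<le> 1" "1 - \<delta> (snd z) \<le> q0" using ratio[of "snd z" k] elim k by (auto simp: q0_def)
          have wl: "\<bar>w - l\<bar> < e / 2"
            using k1[of "fst z" k] Vc[of "fst z" k] elim k xD by (auto simp: w_def dist_real_def)
          have wb: "\<bar>w\<bar> \<le> 2 * B\<^sup>2 * C" using Vb[of "fst z" k] elim k by (simp add: w_def)
          have "\<bar>w * (1 - q0)\<bar> \<le> (2 * B\<^sup>2 * C) * \<delta> (snd z)"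
            unfolding abs_mult using wb q0 mom_simps by (intro mult_mono) auto
          also have "\<dots> \<le> (2 * B\<^sup>2 * C) * (e / (2 * (2 * B\<^sup>2 * C)))"
            using elim B mom_simps by (intro mult_left_mono) auto
          also have "\<dots> = e / 2" using B mom_simps by simp
          finally have "\<bar>w - w * q0\<bar> \<le> e / 2" by (simp add: algebra_simps)
          then have "\<bar>w * q0 - l\<bar> \<le> e" using wl by linarith
          then show "\<bar>cc z k - l\<bar> \<le> e" by (simp add: cc_def w_def q0_def)
        qed
      qed
    qed
  qed
  then have "((\<lambda>z. (1 - g) * (\<Sum>k=1..s (snd z). g ^ (s (snd z) - k) * cc z k)) \<longlongrightarrow> (1 - g) * (l / (1 - g))) (joint_limit D \<theta>s)"
    by (intro tendsto_mult tendsto_const)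
  then have lim2: "((\<lambda>z. (1 - g) * (\<Sum>k=1..s (snd z). g ^ (s (snd z) - k) * cc z k)) \<longlongrightarrow> l) (joint_limit D \<theta>s)"
    using g by simp
  have "eventually (\<lambda>z. (1 - g) * (\<Sum>k=1..s (snd z). g ^ (s (snd z) - k) * cc z k) = (case z of (x, n) \<Rightarrow> v n x u / \<tau> n)) (joint_limit D \<theta>s)"
    using near
  proof eventually_elim
    case (elim z)
    define x n where "x = fst z" and "n = snd z"
    have n: "n \<ge> 1" using elim by (simp add: n_def)
    have Kp: "K n > 0" using K_pos n by simp
    define m where "m = M powr ((1 - \<beta>) * real (s n)) / K n"
    have m: "m > 0" using M Kp by (simp add: m_def)
    have \<tau>m: "\<tau> n = m / (1 - g)" by (simp add: \<tau>_def m_def)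
    have term_eq: "m * (g ^ (s n - k) * cc z k) = (1 / real (N n k)) * V k x" if k: "k \<in> {1..s n}" for k
    proof -
      have "m * (g ^ (s n - k) * cc z k) = (M powr (- \<beta> * real k) / N\<^sub>0 n k) * cc z k"
        using variance_kernel[OF n, of k] k by (simp add: m_def)
      also have "\<dots> = (M powr (- \<beta> * real k) * M powr (\<beta> * real k)) * ((1 / real (N n k)) * V k x)"
        using N\<^sub>0_pos[OF n, of k] by (simp add: cc_def x_def n_def)
      also have "M powr (- \<beta> * real k) * M powr (\<beta> * real k) = 1" using M by (simp add: powr_add[symmetric])
      finally show ?thesis by simp
    qed
    have "v n x u = (\<Sum>k=1..s n. m * (g ^ (s n - k) * cc z k))"
      unfolding v_def V_def[symmetric] by (rule sum.cong[OF refl]) (rule term_eq[symmetric])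
    also have "\<dots> = m * (\<Sum>k=1..s n. g ^ (s n - k) * cc z k)" by (rule sum_distrib_left[symmetric])
    finally have "v n x u / \<tau> n = (1 - g) * (\<Sum>k=1..s n. g ^ (s n - k) * cc z k)"
      unfolding \<tau>m using m g by simp
    then show ?case by (simp add: x_def n_def case_prod_beta)
  qed
  from Lim_transform_eventually[OF lim2 this] show ?thesis unfolding l_def .
qed

lemma \<Gamma>_symmetric: "transpose \<Gamma> = \<Gamma>"
proof -
  let ?c = "\<lambda>(x, k). M powr (\<beta> * real k) *\<^sub>R cov_matrix P (\<lambda>\<omega>. level_diff Fs k x (U \<omega>))"
  have "\<Gamma> $ j $ i = \<Gamma> $ i $ j" for i j
  proof (rule tendsto_unique[OF joint_limit_nontrivial[OF \<theta>s_D]])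
    show "((\<lambda>z. ?c z $ j $ i) \<longlongrightarrow> \<Gamma> $ j $ i) (joint_limit D \<theta>s)" by (intro tendsto_vec_nth variance_limit)
    have "?c z $ j $ i = ?c z $ i $ j" for z by (simp add: case_prod_beta cov_matrix_def mult.commute)
    then show "((\<lambda>z. ?c z $ j $ i) \<longlongrightarrow> \<Gamma> $ i $ j) (joint_limit D \<theta>s)" by (simp only:) (intro tendsto_vec_nth variance_limit)
  qed
  then show ?thesis by (simp add: transpose_def vec_eq_iff)
qed

lemma \<Gamma>_psd: "0 \<le> u \<bullet> (\<Gamma> *v u)"
proof (rule tendsto_lowerbound[OF v_limit _ joint_limit_nontrivial[OF \<theta>s_D]])
  have "0 \<le> v n x u / \<tau> n" for n x
    unfolding v_def using \<tau>_nonneg by (intro divide_nonneg_nonneg sum_nonneg mult_nonneg_nonneg Bochner_Integration.integral_nonneg) auto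
  then show "\<forall>\<^sub>F z in joint_limit D \<theta>s. 0 \<le> (case z of (x, n) \<Rightarrow> v n x u / \<tau> n)"
    by (intro always_eventually) (auto simp: case_prod_beta)
qed

end

end

section \<open>The limit law and the cost of the algorithm\<close>

lemma exp_neg_diff_le:
  fixes x y :: real
  assumes "0 \<le> x" "0 \<le> y"
  shows "norm (complex_of_real (exp (- x)) - complex_of_real (exp (- y))) \<le> \<bar>x - y\<bar>"
proof -
  have *: "\<bar>exp (- a) - exp (- b)\<bar> \<le> b - a" if "0 \<le> a" "a \<le> b" for a b :: real
  proof -
    have "exp (- a) - exp (- b) = exp (- a) * (1 - exp (- (b - a)))" by (simp add: algebra_simps flip: exp_add)
    also have "\<dots> \<le> 1 * (b - a)"
    proof (rule mult_mono)
      show "1 - exp (- (b - a)) \<le> b - a" using exp_ge_add_one_self[of "- (b - a)"] by linarith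
    qed (use that in auto)
    finally show ?thesis using that by simp
  qed
  show ?thesis unfolding of_real_diff[symmetric] norm_of_real
    using *[of x y] *[of y x] assms by (cases "x \<le> y") auto
qed

context multilevel
begin

lemma D_cball_interior: "cball \<theta>s r \<subseteq> interior D \<Longrightarrow> cball \<theta>s r \<subseteq> D"
  using interior_subset by blast

text \<open>A closed set contains its frontier, so the projection is D-valued everywhere.\<close>

lemma proj_meas_D: "proj \<in> measurable borel (restrict_space borel D)"
proof (rule measurable_restrict_space2)
  have "proj x \<in> D" for x
    using proj_D[of x] proj_not_D[of x] frontier_subset_closed[OF D_closed] by (cases "x \<in> D") auto
  then show "proj \<in> space borel \<rightarrow> D" by auto
qed (rule proj)

lemma level_component_meas: "kl \<in> I \<Longrightarrow> (\<lambda>w. w kl) \<in> measurable E S"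
  unfolding measurable_cong_sets[OF sets_E refl] by (rule measurable_component_singleton)

lemma ml_Z_comp:
  assumes x: "x \<in> measurable N' (restrict_space borel D)" and w: "\<And>kl. kl \<in> I \<Longrightarrow> (\<lambda>z. w z kl) \<in> measurable N' S"
  shows "(\<lambda>z. ml_Z M \<beta> Fs (w z) (x z) n k) \<in> borel_measurable N'"
  unfolding ml_Z_def
  by (intro borel_measurable_sum borel_measurable_scaleR borel_measurable_const level_diff_comp x w) auto

lemma \<theta>_Suc:
  "\<theta> (Suc n) \<omega> = proj (\<theta> n \<omega> + \<gamma> (Suc n) *\<^sub>R ml_Z M \<beta> Fs (Us (Suc n) \<omega>) (\<theta> n \<omega>) (s (Suc n)) (K (Suc n)))"
  by (simp add: \<theta> Let_def)

lemma \<theta>_Fil_D: "\<theta> n \<in> measurable (Fil n) (restrict_space borel D)"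
proof (induction n)
  case 0
  have "\<theta> 0 = (\<lambda>_. \<theta>\<^sub>0)" by (simp add: \<theta> fun_eq_iff)
  then show ?case using \<theta>\<^sub>0 by (simp add: space_restrict_space)
next
  case (Suc n)
  have IH: "\<theta> n \<in> measurable (Fil (Suc n)) (restrict_space borel D)" by (rule measurable_Fil_mono[OF _ Suc.IH]) simp
  then have IH': "\<theta> n \<in> borel_measurable (Fil (Suc n))" by (simp add: measurable_restrict_space2_iff)
  have W: "(\<lambda>\<omega>. Us (Suc n) \<omega> kl) \<in> measurable (Fil (Suc n)) S" if "kl \<in> I" for kl
    by (rule measurable_compose[OF W_Fil level_component_meas[OF that]]) auto
  show ?case unfolding \<theta>_Suc[abs_def]
    by (intro measurable_compose[OF _ proj_meas_D] borel_measurable_add borel_measurable_scaleR borel_measurable_const ml_Z_comp IH IH' W)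
qed

lemma \<theta>_D: "\<omega> \<in> space P \<Longrightarrow> \<theta> n \<omega> \<in> D"
  using measurable_space[OF \<theta>_Fil_D, of \<omega> n] by (simp add: space_restrict_space)

lemma retract_meas: "cball \<theta>s r \<subseteq> D \<Longrightarrow> retract r \<in> measurable borel (restrict_space borel D)"
proof (rule measurable_restrict_space2)
  assume "cball \<theta>s r \<subseteq> D"
  then show "retract r \<in> space borel \<rightarrow> D" using \<theta>s_D by (auto simp: retract_def)
  have [measurable]: "cball \<theta>s r \<in> sets borel" by simp
  show "retract r \<in> borel_measurable borel" unfolding retract_def[abs_def] by measurable
qed

lemma mF_meas: "cball \<theta>s r \<subseteq> D \<Longrightarrow> (\<lambda>x. mF k (retract r x)) \<in> borel_measurable borel"
  unfolding mF_def
proof (rule borel_measurable_lebesgue_integral)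
  assume r: "cball \<theta>s r \<subseteq> D"
  show "(\<lambda>(x, \<omega>). Fs k (retract r x) (U \<omega>)) \<in> borel_measurable (borel \<Otimes>\<^sub>M P)"
    unfolding case_prod_unfold
    by (intro Fs_comp measurable_compose[OF measurable_fst retract_meas[OF r]] measurable_compose[OF measurable_snd U])
qed

lemma Zc_meas: "cball \<theta>s r \<subseteq> D \<Longrightarrow> (\<lambda>(x, w). Zc r n x w) \<in> borel_measurable (borel \<Otimes>\<^sub>M E)"
proof -
  assume r: "cball \<theta>s r \<subseteq> D"
  show ?thesis unfolding Zc_def case_prod_unfold
    by (intro borel_measurable_diff ml_Z_comp measurable_compose[OF measurable_fst retract_meas[OF r]]
        measurable_compose[OF measurable_fst mF_meas[OF r]] measurable_compose[OF measurable_snd level_component_meas])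
qed

text \<open>If the projection had acted, the new iterate would lie on the frontier of D, yet the
  ball lies in the interior.\<close>

lemma \<theta>_step:
  assumes r: "cball \<theta>s r \<subseteq> interior D" and x: "\<theta> n \<omega> \<in> cball \<theta>s r" "\<theta> (Suc n) \<omega> \<in> cball \<theta>s r"
  shows "\<theta> (Suc n) \<omega> = \<theta> n \<omega> + real (Suc n) powr (- \<psi>) *\<^sub>R
    (mF (s (Suc n)) (retract r (\<theta> n \<omega>)) + Zc r (Suc n) (\<theta> n \<omega>) (Us (Suc n) \<omega>))"
proof -
  let ?y = "\<theta> n \<omega> + \<gamma> (Suc n) *\<^sub>R ml_Z M \<beta> Fs (Us (Suc n) \<omega>) (\<theta> n \<omega>) (s (Suc n)) (K (Suc n))"
  have "?y \<in> D"
  proof (rule ccontr)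
    assume "?y \<notin> D"
    then have "\<theta> (Suc n) \<omega> \<in> frontier D" unfolding \<theta>_Suc by (rule proj_not_D)
    then show False using x(2) r by (auto simp: frontier_def)
  qed
  then have "\<theta> (Suc n) \<omega> = ?y" unfolding \<theta>_Suc by (rule proj_D)
  then show ?thesis using x(1) by (simp add: Zc_def retract_def \<gamma>)
qed

lemma taylor_bound:
  obtains CO ro where "CO > 0" "ro > 0"
    "\<And>x. x \<in> D \<Longrightarrow> dist x \<theta>s < ro \<Longrightarrow> norm (f x - H *v (x - \<theta>s)) \<le> CO * norm (x - \<theta>s) powr (1 + lam)"
proof -
  obtain c where c: "c > 0" and
    "eventually (\<lambda>x. norm (norm (f x - H *v (x - \<theta>s))) \<le> c * norm (norm (x - \<theta>s) powr (1 + lam))) (at \<theta>s within D)"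
    using landau_o.bigE[OF taylor] by blast
  then obtain d where d: "d > 0" and le: "\<And>x. x \<in> D \<Longrightarrow> x \<noteq> \<theta>s \<Longrightarrow> dist x \<theta>s < d \<Longrightarrow>
      norm (f x - H *v (x - \<theta>s)) \<le> c * norm (x - \<theta>s) powr (1 + lam)"
    unfolding eventually_at by auto
  show thesis
  proof (rule that[OF c d])
    fix x assume x: "x \<in> D" "dist x \<theta>s < d"
    show "norm (f x - H *v (x - \<theta>s)) \<le> c * norm (x - \<theta>s) powr (1 + lam)"
      \<comment> \<open>The filter leaves out the point \<open>\<theta>s\<close> itself, where both
        sides vanish.\<close>
      using le[OF x(1) _ x(2)] f_zero by (cases "x = \<theta>s") auto
  qed
qed

lemma bias_limit_s:
  "((\<lambda>(x, n). M powr (\<alpha> * real (s n)) *\<^sub>R (mF (s n) x - f x)) \<longlongrightarrow> \<mu>) (joint_limit D \<theta>s)"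
proof -
  have "filterlim (\<lambda>(x, n). (x, s n)) (joint_limit D \<theta>s) (joint_limit D \<theta>s)"
    unfolding filterlim_iff
  proof (intro allI impI)
    fix Q assume "eventually Q (joint_limit D \<theta>s)"
    then obtain r k0 where r: "r > 0" and Q: "\<And>x k. x \<in> D \<Longrightarrow> dist x \<theta>s < r \<Longrightarrow> k \<ge> k0 \<Longrightarrow> Q (x, k)"
      unfolding eventually_joint_limit by blast
    from LS1.s_top obtain n0 where "\<And>n. n \<ge> n0 \<Longrightarrow> k0 \<le> s n"
      unfolding filterlim_at_top eventually_sequentially by blast
    with r Q show "eventually (\<lambda>z. Q (case z of (x, n) \<Rightarrow> (x, s n))) (joint_limit D \<theta>s)"
      unfolding eventually_joint_limit by (auto intro!: exI[of _ r] exI[of _ n0])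
  qed
  from filterlim_compose[OF bias_limit this] show ?thesis by (simp add: case_prod_unfold)
qed

lemma moments_mono: "moments r C q \<Longrightarrow> 0 < r' \<Longrightarrow> r' \<le> r \<Longrightarrow> moments r' C q"
  using subset_cball[of r' r \<theta>s] unfolding moments_def by blast

abbreviation "char_dev r u k x a \<equiv>
  norm ((\<integral>w. iexp (a * (u \<bullet> Zc r k x w)) \<partial>E) - exp (- (a\<^sup>2 * \<tau> k * (u \<bullet> (\<Gamma> *v u)) / 2)))"

text \<open>Two approximations are chained: the product over the samples gives a normal factor with
  the exact variance v, and v is replaced by \<tau> times the limiting quadratic form, uniformly on
  the ball up to a multiple of the squared distance.\<close>

lemma noise_char_uniform:
  assumes mom: "moments r C q"
  shows "\<exists>p>0. \<exists>d Cd. (d \<longlonglongrightarrow> 0) \<and> (\<forall>k. 0 \<le> d k) \<and> (\<forall>\<epsilon>>0. \<exists>C' k0. \<forall>k\<ge>k0. \<forall>x\<in>cball \<theta>s r. \<forall>a.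
      char_dev r u k x a
        \<le> a\<^sup>2 * \<tau> k * (\<epsilon> + C' * (norm (x - \<theta>s))\<^sup>2 + Cd * (a\<^sup>2 * \<tau> k * d k) powr p))"
proof -
  note ms = mom_simps[OF mom]
  have main: "\<exists>C' k0. \<forall>k\<ge>k0. \<forall>x\<in>cball \<theta>s r. \<forall>a.
      char_dev r u k x a
        \<le> a\<^sup>2 * \<tau> k * (\<epsilon> + C' * (norm (x - \<theta>s))\<^sup>2 + 3 * (norm u + 1) powr q * C powr (q / 2) * (a\<^sup>2 * \<tau> k * \<delta> k) powr ((q - 2) / 2))"
    if \<epsilon>: "\<epsilon> > 0" for \<epsilon> :: real
  proof -
    define B where "B = norm u + 1"
    have B: "norm u \<le> B" "B > 0" by (auto simp: B_def add_nonneg_pos)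
    define l where "l = u \<bullet> (\<Gamma> *v u)"
    have l0: "0 \<le> l" unfolding l_def by (rule \<Gamma>_psd[OF mom])
    have \<tau>p: "\<tau> n > 0" if "n \<ge> 1" for n using g K_pos[OF that] M by (simp add: \<tau>_def)
    have bd: "norm (v n x u / \<tau> n - l) \<le> 2 * B\<^sup>2 * C + l" if n: "n \<ge> 1" and x: "x \<in> cball \<theta>s r" for n x
    proof -
      have "0 \<le> v n x u / \<tau> n" "v n x u / \<tau> n \<le> 2 * B\<^sup>2 * C"
        using v_bound[OF mom x n B] \<tau>p[OF n] by (auto simp: field_simps)
      then show ?thesis using l0 by auto
    qed
    from joint_limit_uniform[OF v_limit[OF mom, of u, folded l_def] ms(5) bd \<epsilon>]
    obtain C' k0 where C': "\<And>n x. n \<ge> k0 \<Longrightarrow> x \<in> cball \<theta>s r \<Longrightarrow> norm (v n x u / \<tau> n - l) \<le> \<epsilon> + C' * (norm (x - \<theta>s))\<^sup>2"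
      by blast
    show "\<exists>C' k0. \<forall>k\<ge>k0. \<forall>x\<in>cball \<theta>s r. \<forall>a.
        char_dev r u k x a
          \<le> a\<^sup>2 * \<tau> k * (\<epsilon> + C' * (norm (x - \<theta>s))\<^sup>2 + 3 * (norm u + 1) powr q * C powr (q / 2) * (a\<^sup>2 * \<tau> k * \<delta> k) powr ((q - 2) / 2))"
    proof (intro exI[of _ C'] exI[of _ "max k0 1"] allI ballI impI)
      fix k x and a :: real
      assume "max k0 1 \<le> k" and x: "x \<in> cball \<theta>s r"
      then have k: "k \<ge> k0" "k \<ge> 1" by auto
      have "(\<integral>w. iexp (a * (u \<bullet> Zc r k x w)) \<partial>E) = (\<integral>\<omega>. iexp (a * (u \<bullet> noise k x \<omega>)) \<partial>P)"
        using ms(5) x k by (intro integral_Zc(1)[of x r k "\<lambda>z. iexp (a * (u \<bullet> z))"]) auto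
      then have 1: "norm ((\<integral>w. iexp (a * (u \<bullet> Zc r k x w)) \<partial>E) - exp (- (a\<^sup>2 * v k x u / 2)))
          \<le> a\<^sup>2 * \<tau> k * (3 * (norm u + 1) powr q * C powr (q / 2) * (a\<^sup>2 * \<tau> k * \<delta> k) powr ((q - 2) / 2))"
        using noise_char_approx[OF mom x k(2), of a u] by (simp add: mult_ac)
      have "norm (complex_of_real (exp (- (a\<^sup>2 * v k x u / 2))) - complex_of_real (exp (- (a\<^sup>2 * \<tau> k * l / 2)))) \<le> \<bar>a\<^sup>2 * v k x u / 2 - a\<^sup>2 * \<tau> k * l / 2\<bar>"
        using v_bound(1)[OF mom x k(2) B] l0 \<tau>_nonneg by (intro exp_neg_diff_le) auto
      also have "\<dots> = a\<^sup>2 * \<tau> k * \<bar>v k x u / \<tau> k - l\<bar> / 2"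
      proof -
        have "a\<^sup>2 * v k x u / 2 - a\<^sup>2 * \<tau> k * l / 2 = a\<^sup>2 * \<tau> k / 2 * (v k x u / \<tau> k - l)"
          using \<tau>p[OF k(2)] by (simp add: algebra_simps)
        then show ?thesis using \<tau>p[OF k(2)] by (simp only: abs_mult) simp
      qed
      also have "\<dots> \<le> a\<^sup>2 * \<tau> k * \<bar>v k x u / \<tau> k - l\<bar>" using \<tau>_nonneg by simp
      also have "\<dots> \<le> a\<^sup>2 * \<tau> k * (\<epsilon> + C' * (norm (x - \<theta>s))\<^sup>2)"
        using C'[OF k(1) x] \<tau>_nonneg by (intro mult_left_mono) auto
      finally have 2: "norm (complex_of_real (exp (- (a\<^sup>2 * v k x u / 2))) - complex_of_real (exp (- (a\<^sup>2 * \<tau> k * l / 2)))) \<le> \<dots>" .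
      show "char_dev r u k x a
          \<le> a\<^sup>2 * \<tau> k * (\<epsilon> + C' * (norm (x - \<theta>s))\<^sup>2 + 3 * (norm u + 1) powr q * C powr (q / 2) * (a\<^sup>2 * \<tau> k * \<delta> k) powr ((q - 2) / 2))"
        unfolding l_def[symmetric] distrib_left[of "a\<^sup>2 * \<tau> k" "\<epsilon> + C' * (norm (x - \<theta>s))\<^sup>2"]
        using norm_diff_triangle_le[OF 1 2] by linarith
    qed
  qed
  show ?thesis
  proof (rule exI[of _ "(q - 2) / 2"], rule conjI)
    show "0 < (q - 2) / 2" using ms by simp
    show "\<exists>d Cd. (d \<longlonglongrightarrow> 0) \<and> (\<forall>k. 0 \<le> d k) \<and> (\<forall>\<epsilon>>0. \<exists>C' k0. \<forall>k\<ge>k0. \<forall>x\<in>cball \<theta>s r. \<forall>a.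
      char_dev r u k x a
        \<le> a\<^sup>2 * \<tau> k * (\<epsilon> + C' * (norm (x - \<theta>s))\<^sup>2 + Cd * (a\<^sup>2 * \<tau> k * d k) powr ((q - 2) / 2)))"
      using \<delta>_lim \<delta>_nonneg main by blast
  qed
qed

text \<open>The first inequality is the lower bound on \<psi> multiplied by lam + 1 and rearranged;
  the second rests on 2R > 1.\<close>

lemma step_size_condition: "R < (1 + lam) * ((2 * R + \<psi> - 1) / 2)" "0 < 2 * R + \<psi> - 1" "0 < \<psi>"
proof -
  show "0 < \<psi>" using \<psi> by simp
  then show "0 < 2 * R + \<psi> - 1" using two_R_gt_1 by simp
  have "1 - 2 * lam / (lam + 1) * R < \<psi>" using \<psi> by (simp add: R_def mult.assoc)
  then have "(lam + 1) * (1 - 2 * lam / (lam + 1) * R) < (lam + 1) * \<psi>" using lam by (intro mult_strict_left_mono) auto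
  also have "(lam + 1) * (1 - 2 * lam / (lam + 1) * R) = (lam + 1) - 2 * lam * R" using lam by (simp add: field_simps)
  finally show "R < (1 + lam) * ((2 * R + \<psi> - 1) / 2)" by (simp add: field_simps)
qed

text \<open>All local hypotheses have to hold on one ball. Its radius is limited by the moment
  bounds, the interior of D, the Taylor estimate, the convergence of the bias, and the size at which
  the Taylor error takes half of the Lyapunov contraction.\<close>

lemma ex_stochastic_approximation:
  "\<exists>Q r cQ Cd C\<tau> n0. stochastic_approximation P E Us \<theta> (Zc r) (\<lambda>n x. mF (s n) (retract r x)) \<theta>s \<mu> H (matrix_inv H) \<Gamma> Q
     r \<psi> R \<rho> cQ Cd C\<tau> lam A A' \<tau> \<eta> n0"
proof -
  obtain Q cL where Q: "bounded_bilinear Q" "\<And>x y. Q x y = Q y x" "\<And>x. (norm x)\<^sup>2 \<le> Q x x"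
    and cL: "cL > 0" "\<And>x. Q x (H *v x) \<le> - cL * (norm x)\<^sup>2"
    using lyapunov_form[OF H_eigen] by metis
  interpret Q: bounded_bilinear Q by (rule Q(1))
  obtain KQ where KQ: "KQ > 0" "\<And>a b. norm (Q a b) \<le> norm a * norm b * KQ" using Q.pos_bounded by blast
  obtain CO ro where CO: "CO > 0" and ro: "ro > 0"
    and tay: "\<And>x. x \<in> D \<Longrightarrow> dist x \<theta>s < ro \<Longrightarrow> norm (f x - H *v (x - \<theta>s)) \<le> CO * norm (x - \<theta>s) powr (1 + lam)"
    using taylor_bound by blast
  define G where "G x n = M powr (\<alpha> * real (s n)) *\<^sub>R (mF (s n) x - f x)" for x n
  have G_lim: "((\<lambda>(x, n). G x n) \<longlongrightarrow> \<mu>) (joint_limit D \<theta>s)" using bias_limit_s by (simp add: G_def)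
  from tendstoD[OF G_lim, of 1] obtain r1 k1 where r1: "r1 > 0"
    and G1: "\<And>x k. x \<in> D \<Longrightarrow> dist x \<theta>s < r1 \<Longrightarrow> k \<ge> k1 \<Longrightarrow> norm (G x k - \<mu>) < 1"
    unfolding eventually_joint_limit dist_norm by auto
  obtain rm C q where mom: "moments rm C q" using ex_moments by blast
  obtain ri where ri: "ri > 0" "cball \<theta>s ri \<subseteq> interior D"
    using open_contains_cball[of "interior D"] \<theta>s_interior by auto
  \<comment> \<open>If |x - \<theta>s|^lam \<le> dl, the Taylor error costs at most cL/2 of the
    contraction cL; hence the constant cL/2 in the instance.\<close>
  define dl where "dl = cL / (2 * KQ * CO)"
  have dl: "dl > 0" using cL KQ CO by (simp add: dl_def)
  \<comment> \<open>Halving turns the open neighbourhoods of the Taylor and bias estimates into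
    strict bounds on the closed ball.\<close>
  define r where "r = Min {rm, ri, ro / 2, r1 / 2, dl powr (1 / lam)}"
  have rm: "rm > 0" using mom_simps[OF mom] by simp
  have r0: "r > 0" using rm ri ro r1 dl by (simp add: r_def)
  have r_le: "r \<le> rm" "r \<le> ri" "r < ro" "r < r1" "r \<le> dl powr (1 / lam)"
  proof -
    have "r \<le> y" if "y \<in> {rm, ri, ro / 2, r1 / 2, dl powr (1 / lam)}" for y
      unfolding r_def using that by (intro Min_le) auto
    from this[of rm] this[of ri] this[of "ro / 2"] this[of "r1 / 2"] this[of "dl powr (1 / lam)"]
    show "r \<le> rm" "r \<le> ri" "r < ro" "r < r1" "r \<le> dl powr (1 / lam)" using ro r1 by auto
  qed
  have r_int: "cball \<theta>s r \<subseteq> interior D" using subset_cball[OF r_le(2)] ri(2) by blast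
  have rD: "cball \<theta>s r \<subseteq> D" by (rule D_cball_interior[OF r_int])
  have mom': "moments r C q" by (rule moments_mono[OF mom r0 r_le(1)])
  have rdl: "r powr lam \<le> dl"
  proof -
    have "r powr lam \<le> (dl powr (1 / lam)) powr lam" using r_le r0 lam by (intro powr_mono2) auto
    then show ?thesis using lam dl by (simp add: powr_powr)
  qed
  have inD: "x \<in> D" "dist x \<theta>s < ro" "dist x \<theta>s < r1" "retract r x = x" if "x \<in> cball \<theta>s r" for x
    using that r_le rD by (auto simp: dist_commute retract_def)
  obtain C\<eta> where C\<eta>: "\<And>n. n \<ge> 1 \<Longrightarrow> 0 \<le> \<eta> n" "\<And>n. n \<ge> 1 \<Longrightarrow> \<eta> n \<le> C\<eta> * real n powr (- R)" using \<eta>_bound by blast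
  have C\<eta>0: "C\<eta> \<ge> 0" using C\<eta>[of 1] by simp
  obtain C\<tau> where C\<tau>: "C\<tau> > 0" "\<And>n. n \<ge> 1 \<Longrightarrow> \<tau> n \<le> C\<tau> * real n powr (1 - 2 * R)" using \<tau>_bound by blast
  obtain KH where KH: "KH > 0" "\<And>x. norm (H *v x) \<le> norm x * KH"
    using bounded_linear.pos_bounded[OF matrix_vector_mul_bounded_linear[of H]] by blast
  \<comment> \<open>Linear part, Taylor error and bias; G is the bias on the scale on which it
    converges, and \<eta> undoes that scaling.\<close>
  have decomp: "mF (s n) x = H *v (x - \<theta>s) + (f x - H *v (x - \<theta>s)) + \<eta> n *\<^sub>R G x n" for x n
    using M by (simp add: G_def \<eta>_def powr_add[symmetric])
  have tay_lin: "norm (f x - H *v (x - \<theta>s)) \<le> cL / (2 * KQ) * norm (x - \<theta>s)" if x: "x \<in> cball \<theta>s r" for x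
  proof -
    have "norm (f x - H *v (x - \<theta>s)) \<le> CO * (norm (x - \<theta>s) * norm (x - \<theta>s) powr lam)"
      using tay[OF inD(1,2)[OF x]] by (simp add: powr_add powr_one_gt_zero_iff[symmetric])
    also have "\<dots> \<le> CO * (norm (x - \<theta>s) * dl)"
    proof (intro mult_left_mono)
      have "norm (x - \<theta>s) powr lam \<le> r powr lam" using x lam by (intro powr_mono2) (auto simp: dist_norm norm_minus_commute)
      then show "norm (x - \<theta>s) powr lam \<le> dl" using rdl by simp
    qed (use CO in auto)
    also have "\<dots> = cL / (2 * KQ) * norm (x - \<theta>s)" using CO by (simp add: dl_def)
    finally show ?thesis .
  qed
  define m1 where "m1 = (norm \<mu> + 1) * C\<eta>"
  have m1: "m1 \<ge> 0" using C\<eta>0 by (simp add: m1_def)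
  have G_bound: "norm (\<eta> n *\<^sub>R G x n) \<le> m1 * real n powr (- R)" if "n \<ge> max 1 k1" "x \<in> cball \<theta>s r" for n x
  proof -
    have "norm (G x n) \<le> norm \<mu> + 1"
      using G1[OF inD(1,3)[OF that(2)], of n] norm_triangle_ineq2[of "G x n" \<mu>] that by simp
    then have "\<eta> n * norm (G x n) \<le> (C\<eta> * real n powr (- R)) * (norm \<mu> + 1)"
      using C\<eta>[of n] C\<eta>0 that by (intro mult_mono) auto
    then show ?thesis using C\<eta>(1)[of n] that by (simp add: m1_def mult_ac)
  qed
  define Cd where "Cd = max (KQ * m1) (max (KH + cL / (2 * KQ)) m1) + 1"
  have Cd: "Cd > 0" "KQ * m1 \<le> Cd" "KH + cL / (2 * KQ) \<le> Cd" "m1 \<le> Cd"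
    using m1 KQ by (auto simp: Cd_def add_nonneg_pos max.coboundedI1 max.coboundedI2)
  have sa: "stochastic_approximation P E Us \<theta> (Zc r) (\<lambda>n x. mF (s n) (retract r x)) \<theta>s \<mu> H (matrix_inv H) \<Gamma> Q
     r \<psi> R \<rho> (cL / 2) Cd (real CARD('d) * (2 * C * C\<tau>)) lam A A' \<tau> \<eta> (max 1 k1)"
  proof (intro stochastic_approximation.intro stochastic_approximation_axioms.intro)
    show "innovations P E Us" by unfold_locales
    show "\<theta> n \<in> borel_measurable (Fil n)" for n using \<theta>_Fil_D[of n] by (simp add: measurable_restrict_space2_iff)
    show "(\<lambda>(x, w). Zc r n x w) \<in> borel_measurable (borel \<Otimes>\<^sub>M E)" for n by (rule Zc_meas[OF rD])
    show "(\<lambda>x. mF (s n) (retract r x)) \<in> borel_measurable borel" for n by (rule mF_meas[OF rD])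
    show "0 < r" by fact
    show "\<theta> (Suc n) \<omega> = \<theta> n \<omega> + real (Suc n) powr (- \<psi>) *\<^sub>R
        (mF (s (Suc n)) (retract r (\<theta> n \<omega>)) + Zc r (Suc n) (\<theta> n \<omega>) (Us (Suc n) \<omega>))"
      if "\<theta> n \<omega> \<in> cball \<theta>s r" "\<theta> (Suc n) \<omega> \<in> cball \<theta>s r" for n \<omega> by (rule \<theta>_step[OF r_int that])
    show "bounded_bilinear Q" "\<And>x y. Q x y = Q y x" "\<And>x. (norm x)\<^sup>2 \<le> Q x x" by fact+
    show "0 < cL / 2" using cL by simp
    show "0 < Cd" by fact
    show "0 < real CARD('d) * (2 * C * C\<tau>)" using mom_simps[OF mom] C\<tau> by simp
    show "1 \<le> max 1 k1" by simp
    fix n x assume n: "max 1 k1 \<le> n" and x: "x \<in> cball \<theta>s r"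
    let ?h = "x - \<theta>s"
    let ?e = "f x - H *v ?h"
    have "Q ?h (mF (s n) x) = Q ?h (H *v ?h) + Q ?h ?e + Q ?h (\<eta> n *\<^sub>R G x n)"
      by (subst decomp) (simp only: Q.add_right)
    also have "\<dots> \<le> - cL * (norm ?h)\<^sup>2 + cL / 2 * (norm ?h)\<^sup>2 + Cd * norm ?h * real n powr (- R)"
    proof (intro add_mono cL(2))
      have "Q ?h ?e \<le> norm ?h * norm ?e * KQ" using KQ(2)[of ?h ?e] by simp
      also have "\<dots> \<le> norm ?h * (cL / (2 * KQ) * norm ?h) * KQ"
        using tay_lin[OF x] KQ by (intro mult_right_mono mult_left_mono) auto
      also have "\<dots> = cL / 2 * (norm ?h)\<^sup>2" using KQ by (simp add: power2_eq_square)
      finally show "Q ?h ?e \<le> cL / 2 * (norm ?h)\<^sup>2" .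
      have "Q ?h (\<eta> n *\<^sub>R G x n) \<le> norm ?h * norm (\<eta> n *\<^sub>R G x n) * KQ" using KQ(2)[of ?h "\<eta> n *\<^sub>R G x n"] by simp
      also have "\<dots> \<le> norm ?h * (m1 * real n powr (- R)) * KQ"
        using G_bound[OF n x] KQ by (intro mult_right_mono mult_left_mono) auto
      also have "\<dots> = (KQ * m1) * (norm ?h * real n powr (- R))" by simp
      also have "\<dots> \<le> Cd * (norm ?h * real n powr (- R))" using Cd by (intro mult_right_mono) auto
      finally show "Q ?h (\<eta> n *\<^sub>R G x n) \<le> Cd * norm ?h * real n powr (- R)" by simp
    qed
    finally show "Q ?h (mF (s n) (retract r x)) \<le> - (cL / 2) * (norm ?h)\<^sup>2 + Cd * norm ?h * real n powr (- R)"
      using inD(4)[OF x] by simp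
    have "norm (mF (s n) x) \<le> norm (H *v ?h) + norm ?e + norm (\<eta> n *\<^sub>R G x n)"
      by (subst decomp) (intro norm_triangle_le add_mono order_refl)
    also have "\<dots> \<le> (KH + cL / (2 * KQ)) * norm ?h + m1 * real n powr (- R)"
      using KH(2)[of ?h] tay_lin[OF x] G_bound[OF n x] by (simp add: algebra_simps)
    also have "\<dots> \<le> Cd * norm ?h + Cd * real n powr (- R)" using Cd by (intro add_mono mult_right_mono) auto
    finally show "norm (mF (s n) (retract r x)) \<le> Cd * (norm ?h + real n powr (- R))"
      using inD(4)[OF x] by (simp add: distrib_left)
  next
    fix n x assume n: "1 \<le> (n::nat)" and x: "x \<in> cball \<theta>s r"
    note iz = integral_Zc[OF x inD(1)[OF x] n]
    show "integrable E (Zc r n x)" "(\<integral>w. Zc r n x w \<partial>E) = 0"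
      using iz[of "\<lambda>z. z"] noise_integrable[OF inD(1)[OF x], of n] by auto
    show "integrable E (\<lambda>w. (norm (Zc r n x w))\<^sup>2)"
      using iz(2)[of "\<lambda>z. (norm z)\<^sup>2"] noise_second_moment(1)[OF mom' x n] by auto
    have "(\<integral>w. (norm (Zc r n x w))\<^sup>2 \<partial>E) \<le> real CARD('d) * (2 * C * \<tau> n)"
      using iz(1)[of "\<lambda>z. (norm z)\<^sup>2"] noise_second_moment(2)[OF mom' x n] by auto
    also have "\<dots> \<le> real CARD('d) * (2 * C * (C\<tau> * real n powr (1 - 2 * R)))"
      using C\<tau>(2)[OF n] mom_simps[OF mom] by (intro mult_left_mono) auto
    finally show "(\<integral>w. (norm (Zc r n x w))\<^sup>2 \<partial>E) \<le> real CARD('d) * (2 * C * C\<tau>) * real n powr (1 - 2 * R)"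
      by (simp add: mult_ac)
  next
    show "0 < \<psi>" "\<psi> < 1" "0 < R" "R < \<rho> + 1" "0 < 2 * R + \<psi> - 1" "0 < lam" "lam \<le> 1" "R < (1 + lam) * ((2 * R + \<psi> - 1) / 2)"
      using step_size_condition \<psi> R0 R_less lam by auto
    show "0 \<le> \<tau> k" for k by (rule \<tau>_nonneg)
    show "0 \<le> u \<bullet> (\<Gamma> *v u)" for u by (rule \<Gamma>_psd[OF mom])
    show "matrix_inv H ** H = mat 1" using contracting_invertible(1)[OF H_eigen] .
    show "\<exists>C. \<forall>\<epsilon>>0. \<exists>C' k0. \<forall>k\<ge>k0. \<forall>x\<in>cball \<theta>s r.
      norm (mF (s k) (retract r x) - H *v (x - \<theta>s) - \<eta> k *\<^sub>R \<mu>) \<le> C * norm (x - \<theta>s) powr (1 + lam) + \<eta> k * (\<epsilon> + C' * (norm (x - \<theta>s))\<^sup>2)"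
    proof (rule exI[of _ CO], intro allI impI)
      fix \<epsilon> :: real assume \<epsilon>: "\<epsilon> > 0"
      have "norm (G x n - \<mu>) \<le> 1" if "n \<ge> k1" "x \<in> cball \<theta>s r" for n x
        using G1[OF inD(1,3)[OF that(2)] that(1)] by simp
      from joint_limit_uniform[OF G_lim rD this \<epsilon>]
      obtain C' k0 where C': "\<And>n x. n \<ge> k0 \<Longrightarrow> x \<in> cball \<theta>s r \<Longrightarrow> norm (G x n - \<mu>) \<le> \<epsilon> + C' * (norm (x - \<theta>s))\<^sup>2" by blast
      show "\<exists>C' k0. \<forall>k\<ge>k0. \<forall>x\<in>cball \<theta>s r.
        norm (mF (s k) (retract r x) - H *v (x - \<theta>s) - \<eta> k *\<^sub>R \<mu>) \<le> CO * norm (x - \<theta>s) powr (1 + lam) + \<eta> k * (\<epsilon> + C' * (norm (x - \<theta>s))\<^sup>2)"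
      proof (intro exI[of _ C'] exI[of _ k0] allI ballI impI)
        fix k x assume k: "k0 \<le> k" and x: "x \<in> cball \<theta>s r"
        have "mF (s k) (retract r x) - H *v (x - \<theta>s) - \<eta> k *\<^sub>R \<mu> = (f x - H *v (x - \<theta>s)) + \<eta> k *\<^sub>R (G x k - \<mu>)"
          unfolding inD(4)[OF x] by (subst decomp) (simp add: scaleR_diff_right)
        also have "norm \<dots> \<le> CO * norm (x - \<theta>s) powr (1 + lam) + \<eta> k * (\<epsilon> + C' * (norm (x - \<theta>s))\<^sup>2)"
          using tay[OF inD(1,2)[OF x]] C'[OF k x]
          by (intro norm_triangle_le add_mono) (auto simp: \<eta>_def intro!: mult_left_mono)
        finally show "norm (mF (s k) (retract r x) - H *v (x - \<theta>s) - \<eta> k *\<^sub>R \<mu>) \<le> CO * norm (x - \<theta>s) powr (1 + lam) + \<eta> k * (\<epsilon> + C' * (norm (x - \<theta>s))\<^sup>2)" .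
      qed
    qed
  qed (rule A_lower variance_normalisation noise_char_uniform[OF mom'] \<eta>_bound bias_normalisation)+
  then show ?thesis by blast
qed

text \<open>Multiplication by the total weight \<open>bbar\<close> turns the average into the
  weighted sum of the abstract scheme, with \<open>A\<close> and \<open>A'\<close> in the place of
  the two rates. The identity holds from n = 1 on, which is enough for the limit.\<close>

lemma conv_law:
  "converges_in_law_on P conv (\<lambda>n \<omega>. (1 / \<epsilon>diff n) *\<^sub>R (\<theta>bar n \<omega> - \<theta>s + \<epsilon>bias n *\<^sub>R (matrix_inv H *v \<mu>)))
     (normal_vec 0 (matrix_inv H ** \<Gamma> ** transpose (matrix_inv H)))"
proof -
  define Hi where "Hi = matrix_inv H"
  define V where "V = Hi ** \<Gamma> ** transpose Hi"
  define X' where "X' n \<omega> = (1 / \<epsilon>diff n) *\<^sub>R (\<theta>bar n \<omega> - \<theta>s + \<epsilon>bias n *\<^sub>R (Hi *v \<mu>))" for n \<omega>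
  obtain Q r cQ Cd C\<tau> n0 where "stochastic_approximation P E Us \<theta> (Zc r) (\<lambda>n x. mF (s n) (retract r x)) \<theta>s \<mu> H Hi \<Gamma> Q
     r \<psi> R \<rho> cQ Cd C\<tau> lam A A' \<tau> \<eta> n0"
    using ex_stochastic_approximation unfolding Hi_def by blast
  then interpret SA: stochastic_approximation P E Us \<theta> "Zc r" "\<lambda>n x. mF (s n) (retract r x)" \<theta>s \<mu> H Hi \<Gamma> Q
     r \<psi> R \<rho> cQ Cd C\<tau> lam A A' \<tau> \<eta> n0 .
  have SA_conv: "SA.conv = conv" by (simp add: SA.conv_def conv)
  have X_eq: "SA.X n \<omega> = X' n \<omega>" if n: "n \<ge> 1" for n \<omega>
  proof -
    have "bbar n *\<^sub>R \<theta>bar n \<omega> = (\<Sum>k=1..n. b k *\<^sub>R \<theta> k \<omega>)"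
      using bbar_pos[OF n] unfolding \<theta>bar ml_average_def bbar_def[symmetric] by simp
    moreover have "bbar n *\<^sub>R \<theta>s = (\<Sum>k=1..n. b k *\<^sub>R \<theta>s)" unfolding bbar_def by (rule scaleR_sum_left)
    ultimately have "(\<Sum>k=1..n. real k powr \<rho> *\<^sub>R (\<theta> k \<omega> - \<theta>s)) = bbar n *\<^sub>R (\<theta>bar n \<omega> - \<theta>s)"
      by (simp add: b scaleR_diff_right sum_subtractf)
    moreover have "A' n *\<^sub>R (Hi *v \<mu>) = bbar n *\<^sub>R (\<epsilon>bias n *\<^sub>R (Hi *v \<mu>))" by (simp add: A'_def)
    ultimately have "SA.X n \<omega> = (1 / A n) *\<^sub>R (bbar n *\<^sub>R (\<theta>bar n \<omega> - \<theta>s + \<epsilon>bias n *\<^sub>R (Hi *v \<mu>)))"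
      by (simp only: SA.X_def scaleR_add_right)
    then show ?thesis using bbar_pos[OF n] by (simp add: X'_def A_def)
  qed
  have X'_meas: "X' n \<in> borel_measurable P" for n
    unfolding X'_def \<theta>bar ml_average_def using SA.\<theta>_meas by measurable
  obtain rm C q where mom: "moments rm C q" using ex_moments by blast
  \<comment> \<open>\<Gamma> inherits symmetry and positivity from the covariances, and
    \<open>Hi\<close> times a square root of \<Gamma> is a square root of the limit
    covariance.\<close>
  have root: "\<exists>B :: real^'d^'d. B ** transpose B = V"
  proof -
    obtain B :: "real^'d^'d" where B: "B ** transpose B = \<Gamma>"
      using psd_matrix_sqrt[OF \<Gamma>_symmetric[OF mom] \<Gamma>_psd[OF mom]] by blast
    have "(Hi ** B) ** transpose (Hi ** B) = V"
      unfolding V_def B[symmetric] by (simp add: matrix_transpose_mul matrix_mul_assoc)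
    then show ?thesis by blast
  qed
  have form: "u \<bullet> (V *v u) = (transpose Hi *v u) \<bullet> (\<Gamma> *v (transpose Hi *v u))" for u
    unfolding V_def by (simp add: matrix_vector_mul_assoc[symmetric] inner_matrix_vector[of u Hi])
  interpret CC: char_convergence P conv X' "normal_vec 0 V"
  proof (intro char_convergence.intro char_convergence_axioms.intro)
    show "prob_space P" by unfold_locales
    show "conv \<in> sets P" using SA.conv_sets SA_conv by simp
    show "X' n \<in> borel_measurable P" for n by (rule X'_meas)
    show "prob_space (normal_vec 0 V)" "sets (normal_vec 0 V) = sets borel" using normal_vec_char[OF root] by auto
    fix u
    have "(\<lambda>n. \<integral>\<omega>. indicator conv \<omega> * iexp (u \<bullet> SA.X n \<omega>) \<partial>P) \<longlonglongrightarrow> measure P conv * (\<integral>x. iexp (u \<bullet> x) \<partial>normal_vec 0 V)"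
      using SA.char_limit[of u] unfolding normal_vec_char(1)[OF root] form SA_conv .
    moreover have "eventually (\<lambda>n. (\<integral>\<omega>. indicator conv \<omega> * iexp (u \<bullet> SA.X n \<omega>) \<partial>P) = (\<integral>\<omega>. indicator conv \<omega> * iexp (u \<bullet> X' n \<omega>) \<partial>P)) sequentially"
      using eventually_ge_at_top[of "1::nat"] by eventually_elim (simp only: X_eq)
    ultimately show "(\<lambda>n. \<integral>\<omega>. indicator conv \<omega> * iexp (u \<bullet> X' n \<omega>) \<partial>P) \<longlonglongrightarrow> measure P conv * (\<integral>x. iexp (u \<bullet> x) \<partial>normal_vec 0 V)"
      by (rule Lim_transform_eventually)
  qed
  show ?thesis using CC.converges_in_law unfolding X'_def V_def Hi_def .
qed

section \<open>Rates in terms of the cost\<close>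

abbreviation "cost C \<omega> \<equiv> ml_cost M \<beta> C K s (\<lambda>m. \<theta> m \<omega>)"

lemma Kbar_at_top: "filterlim Kbar at_top sequentially"
proof (rule filterlim_at_top_mono)
  have "filterlim (\<lambda>n. real n powr \<phi>) at_top sequentially" using \<phi>0 by real_asymp
  then show "filterlim K at_top sequentially"
    unfolding K[abs_def] using \<kappa> \<phi>0 by (intro filterlim_tendsto_pos_mult_at_top[OF tendsto_const]) auto
  have "K n \<le> Kbar n" if "n \<ge> 1" for n
    unfolding Kbar using that K_nonneg by (intro member_le_sum) auto
  then show "eventually (\<lambda>n. K n \<le> Kbar n) sequentially"
    by (rule eventually_mono[OF eventually_ge_at_top])
qed

text \<open>Along a convergent path the cost of step m is K m times a geometric average of rescaled
  unit costs, which tends to kC / (1 - g); a Cesaro mean with weights K sums the steps. The fine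
  levels dominate as they do for the variance.\<close>

lemma cost_limit:
  assumes C: "cost_functions D C M kC \<theta>s" and \<omega>: "\<omega> \<in> conv"
  shows "(\<lambda>n. cost C \<omega> n / Kbar n) \<longlonglongrightarrow> kC / (1 - g)"
proof -
  define d where "d m k = M powr (- real k) * C k (\<theta> (m - 1) \<omega>)" for m k
  define c where "c m k = real (N m k) / N\<^sub>0 m k * d m k" for m k
  define inner where "inner m = (\<Sum>k=1..s m. real (N m k) * C k (\<theta> (m - 1) \<omega>))" for m
  have \<omega>P: "\<omega> \<in> space P" and conv_\<omega>: "(\<lambda>n. \<theta> n \<omega>) \<longlonglongrightarrow> \<theta>s" using \<omega> by (auto simp: conv)
  \<comment> \<open>The cost of step m is charged at the iterate before it, hence the shift.\<close>
  have near: "eventually (\<lambda>m. dist (\<theta> (m - 1) \<omega>) \<theta>s < e) sequentially" if "e > 0" for e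
  proof -
    have "eventually (\<lambda>n. dist (\<theta> n \<omega>) \<theta>s < e) sequentially" by (rule tendstoD[OF conv_\<omega> that])
    then have "eventually (\<lambda>n. dist (\<theta> (Suc n - 1) \<omega>) \<theta>s < e) sequentially" by simp
    then show ?thesis by (subst (asm) eventually_sequentially_Suc)
  qed
  have ratio: "1 \<le> real (N m k) / N\<^sub>0 m k" "real (N m k) / N\<^sub>0 m k \<le> 1 + \<delta> m" if m: "m \<ge> 1" "k \<le> s m" for m k
  proof -
    have p: "N\<^sub>0 m k > 0" by (rule N\<^sub>0_pos[OF m(1)])
    show "1 \<le> real (N m k) / N\<^sub>0 m k" using p N_bounds(1)[OF m(1), of k] by simp
    have "real (N m k) / N\<^sub>0 m k \<le> (N\<^sub>0 m k + 1) / N\<^sub>0 m k" using p N_bounds(2)[OF m(1), of k] by (intro divide_right_mono) auto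
    also have "\<dots> = 1 + 1 / N\<^sub>0 m k" using p by (simp add: field_simps)
    also have "\<dots> \<le> 1 + \<delta> m" using N\<^sub>0_lower[OF m] by simp
    finally show "real (N m k) / N\<^sub>0 m k \<le> 1 + \<delta> m" .
  qed
  have pos: "0 < C k x" if "k \<ge> 1" "x \<in> D" for k x using C that by (auto simp: cost_functions_def)
  obtain W B where W: "open W" "\<theta>s \<in> W" and B: "\<And>x k. x \<in> W \<inter> D \<Longrightarrow> k \<ge> 1 \<Longrightarrow> C k x \<le> B * M ^ k"
    using C unfolding cost_functions_def by blast
  obtain rW where rW: "rW > 0" "\<And>x. dist x \<theta>s < rW \<Longrightarrow> x \<in> W" using W unfolding open_dist by blast
  have d_bound: "0 \<le> d m k" "d m k \<le> B" if "dist (\<theta> (m - 1) \<omega>) \<theta>s < rW" "k \<ge> 1" for m k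
  proof -
    show "0 \<le> d m k" using pos[OF that(2) \<theta>_D[OF \<omega>P, of "m - 1"]] by (simp add: d_def)
    have "d m k \<le> M powr (- real k) * (B * M ^ k)"
      unfolding d_def using rW(2)[OF that(1)] \<theta>_D[OF \<omega>P] that(2) by (intro mult_left_mono B) auto
    also have "\<dots> = B" using M by (simp add: powr_realpow powr_minus)
    finally show "d m k \<le> B" .
  qed
  have B0: "0 \<le> B" using B[of \<theta>s 1] pos[of 1 \<theta>s] \<theta>s_D W(2) M by (auto simp: zero_less_mult_iff dest: less_le_trans)
  have \<delta>_small: "eventually (\<lambda>m. \<delta> m < e) sequentially" if "e > 0" for e
    using order_tendstoD(2)[OF \<delta>_lim that] .
  have "(\<lambda>m. \<Sum>k=1..s m. g ^ (s m - k) * c m k) \<longlonglongrightarrow> kC / (1 - g)"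
  proof (rule geometric_kernel_limit[OF g LS1.s_top])
    show "eventually (\<lambda>m. \<forall>k\<in>{1..s m}. \<bar>c m k\<bar> \<le> 2 * B) sequentially"
      using near[OF rW(1)] \<delta>_small[of 1, OF zero_less_one] eventually_ge_at_top[of 1]
    proof eventually_elim
      case (elim m)
      show ?case
      proof
        fix k assume k: "k \<in> {1..s m}"
        have "\<bar>c m k\<bar> = real (N m k) / N\<^sub>0 m k * d m k"
          using ratio[of m k] d_bound[of m k] elim k by (auto simp: c_def abs_mult)
        also have "\<dots> \<le> 2 * B" using ratio[of m k] d_bound[of m k] elim k by (intro mult_mono) auto
        finally show "\<bar>c m k\<bar> \<le> 2 * B" .
      qed
    qed
    fix e :: real assume e: "e > 0"
    have lim: "((\<lambda>(x, k). M powr (- real k) * C k x) \<longlongrightarrow> kC) (joint_limit D \<theta>s)" using C by (simp add: cost_functions_def)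
    from tendstoD[OF lim, of "e / 2"] e obtain r1 k1 where r1: "r1 > 0"
      and k1: "\<And>x k. x \<in> D \<Longrightarrow> dist x \<theta>s < r1 \<Longrightarrow> k \<ge> k1 \<Longrightarrow> \<bar>M powr (- real k) * C k x - kC\<bar> < e / 2"
      unfolding eventually_joint_limit dist_real_def by auto
    have e': "e / (2 * (B + 1)) > 0" using e B0 by simp
    show "\<exists>k0. eventually (\<lambda>m. \<forall>k\<in>{k0..s m}. \<bar>c m k - kC\<bar> \<le> e) sequentially"
    proof (rule exI[of _ "max k1 1"])
      show "eventually (\<lambda>m. \<forall>k\<in>{max k1 1..s m}. \<bar>c m k - kC\<bar> \<le> e) sequentially"
        using near[OF rW(1)] near[OF r1] \<delta>_small[OF e'] eventually_ge_at_top[of 1]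
      proof eventually_elim
        case (elim m)
        show ?case
        proof
          fix k assume k: "k \<in> {max k1 1..s m}"
          define q0 where "q0 = real (N m k) / N\<^sub>0 m k"
          have q0: "1 \<le> q0" "q0 \<le> 1 + \<delta> m" using ratio[of m k] elim k by (auto simp: q0_def)
          have db: "0 \<le> d m k" "d m k \<le> B" using d_bound[of m k] elim k by auto
          have "\<bar>d m k - kC\<bar> < e / 2" unfolding d_def using k1[OF \<theta>_D[OF \<omega>P]] elim k by auto
          moreover have "\<bar>(q0 - 1) * d m k\<bar> \<le> e / 2"
          proof -
            have "\<bar>(q0 - 1) * d m k\<bar> = (q0 - 1) * d m k" using q0 db by simp
            also have "\<dots> \<le> (e / (2 * (B + 1))) * (B + 1)" using q0 db elim B0 e' by (intro mult_mono) auto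
            also have "\<dots> = e / 2" using B0 by (simp add: field_simps)
            finally show ?thesis .
          qed
          moreover have "c m k - kC = (q0 - 1) * d m k + (d m k - kC)" by (simp add: c_def q0_def algebra_simps)
          ultimately show "\<bar>c m k - kC\<bar> \<le> e" by linarith
        qed
      qed
    qed
  qed
  moreover have "eventually (\<lambda>m. (\<Sum>k=1..s m. g ^ (s m - k) * c m k) = inner m / K m) sequentially"
    using eventually_ge_at_top[of 1]
  proof eventually_elim
    case (elim m)
    have "real (N m k) * C k (\<theta> (m - 1) \<omega>) = K m * (g ^ (s m - k) * c m k)" if k: "k \<in> {1..s m}" for k
    proof -
      have "K m * (g ^ (s m - k) * c m k) = (M powr real k * N\<^sub>0 m k) * c m k" using cost_kernel[OF elim, of k] k by simp
      also have "\<dots> = (M powr real k * M powr (- real k)) * (real (N m k) * C k (\<theta> (m - 1) \<omega>))"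
        using N\<^sub>0_pos[OF elim, of k] by (simp add: c_def d_def)
      also have "M powr real k * M powr (- real k) = 1" using M by (simp add: powr_add[symmetric])
      finally show ?thesis by simp
    qed
    then have "inner m = K m * (\<Sum>k=1..s m. g ^ (s m - k) * c m k)" by (simp add: inner_def sum_distrib_left)
    then show ?case using K_pos[OF elim] by simp
  qed
  ultimately have "(\<lambda>m. inner m / K m) \<longlonglongrightarrow> kC / (1 - g)" by (rule Lim_transform_eventually)
  from weighted_cesaro[OF K_nonneg Kbar_at_top[unfolded Kbar[abs_def]] this]
  have "(\<lambda>n. (\<Sum>m=1..n. K m * (inner m / K m)) / Kbar n) \<longlonglongrightarrow> kC / (1 - g)" by (simp only: Kbar)
  moreover have "(\<Sum>m=1..n. K m * (inner m / K m)) = cost C \<omega> n" for n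
    unfolding ml_cost_def
  proof (rule sum.cong[OF refl])
    fix m assume "m \<in> {1..n}"
    then show "K m * (inner m / K m) = (\<Sum>k=1..s m. real (ml_N M \<beta> k (s m) (K m)) * C k (\<theta> (m - 1) \<omega>))"
      using K_pos[of m] by (simp add: inner_def N_def)
  qed
  ultimately show ?thesis by simp
qed

text \<open>The only part of the two rates that has to be expressed through the cost: the cost is
  asymptotically kC / (1 - g) times \<open>Kbar\<close>, whose power \<rr> is n^R up to a constant
  and a factor tending to 1.\<close>

lemma cost_rate:
  assumes C: "cost_functions D C M kC \<theta>s" and kC: "kC > 0" and \<omega>: "\<omega> \<in> conv"
  shows "(\<lambda>n. \<kappa>\<^sub>K powr (- \<rr>) * real n powr (- R) /
     (kC powr \<rr> * (1 - g) powr (- \<rr>) * cost C \<omega> n powr (- \<rr>))) \<longlonglongrightarrow> 1"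
proof -
  define T where "T n = cost C \<omega> n / Kbar n" for n
  have T: "T \<longlonglongrightarrow> kC / (1 - g)" using cost_limit[OF C \<omega>] by (simp add: T_def[abs_def])
  have l: "kC / (1 - g) > 0" using kC g by simp
  have "(\<lambda>n. y n powr \<rr> * (T n powr \<rr> / (kC / (1 - g)) powr \<rr>)) \<longlonglongrightarrow> 1 * ((kC / (1 - g)) powr \<rr> / (kC / (1 - g)) powr \<rr>)"
    using l by (intro tendsto_intros y_powr T) auto
  then have "(\<lambda>n. y n powr \<rr> * (T n powr \<rr> / (kC / (1 - g)) powr \<rr>)) \<longlonglongrightarrow> 1" using kC g by simp
  moreover have "eventually (\<lambda>n. y n powr \<rr> * (T n powr \<rr> / (kC / (1 - g)) powr \<rr>) =
      \<kappa>\<^sub>K powr (- \<rr>) * real n powr (- R) /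
     (kC powr \<rr> * (1 - g) powr (- \<rr>) * cost C \<omega> n powr (- \<rr>))) sequentially"
    using eventually_ge_at_top[of 1] order_tendstoD(1)[OF T l]
  proof eventually_elim
    case (elim n)
    have yn: "y n > 0" and Kn: "Kbar n > 0" using y_pos Kbar_pos elim by auto
    have "cost C \<omega> n = Kbar n * T n" using Kn by (simp add: T_def)
    also have "Kbar n = \<kappa>\<^sub>K * real n powr (\<phi> + 1) * y n" by (rule Kbar_y[OF elim(1)])
    finally have "cost C \<omega> n = \<kappa>\<^sub>K * real n powr (\<phi> + 1) * y n * T n" .
    also have "\<dots> powr \<rr> = \<kappa>\<^sub>K powr \<rr> * real n powr R * y n powr \<rr> * T n powr \<rr>"
      using \<kappa> yn elim by (simp add: powr_mult powr_powr R_def)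
    finally have cost: "cost C \<omega> n powr \<rr> = \<kappa>\<^sub>K powr \<rr> * real n powr R * y n powr \<rr> * T n powr \<rr>" .
    show ?case using \<kappa> kC g elim by (simp add: powr_minus cost powr_divide field_simps)
  qed
  ultimately show ?thesis by (rule Lim_transform_eventually)
qed

text \<open>Positivity allows the oscillating factors to be cancelled in the quotients of the two
  cost statements.\<close>

lemma psi_positive:
  "eventually (\<lambda>n. 0 < psi_fun M \<rr>\<^sub>1 (- \<alpha>) (\<xi> n) \<and> 0 < psi_fun M \<rr>\<^sub>2 (1 - \<beta>) (\<xi> n)) sequentially"
  using \<xi>_eventually by eventually_elim (auto intro!: psi_fun_bounds(3) M \<rr>\<^sub>1_pos \<rr>\<^sub>2_pos)

lemma bias_cost_rate:
  assumes C: "cost_functions D C M kC \<theta>s" and kC: "kC > 0" and \<omega>: "\<omega> \<in> conv"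
  shows "(\<lambda>n. \<epsilon>bias n / (kC powr \<rr> * (1 - g) powr (- \<rr>) * \<kappa>\<^sub>s powr (- \<alpha>) * psi_fun M \<rr>\<^sub>1 (- \<alpha>) (\<xi> n)
      * cost C \<omega> n powr (- \<rr>))) \<longlonglongrightarrow> 1"
  by (rule Lim_transform_eventually[OF cost_rate[OF assms] eventually_mono[OF psi_positive]])
    (use \<kappa> in \<open>simp add: \<epsilon>bias R_def[symmetric]\<close>)

lemma diff_cost_rate:
  assumes C: "cost_functions D C M kC \<theta>s" and kC: "kC > 0" and \<omega>: "\<omega> \<in> conv"
  shows "(\<lambda>n. \<epsilon>diff n / (kC powr \<rr> * (1 - g) powr (- (\<rr> + 1 / 2))
      * (((\<rho> + 1) / (\<phi> + 1)) / sqrt (2 * ((\<rho> + 1) / (\<phi> + 1)) - 1))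
      * \<kappa>\<^sub>s powr ((1 - \<beta>) / 2) * sqrt (psi_fun M \<rr>\<^sub>2 (1 - \<beta>) (\<xi> n))
      * cost C \<omega> n powr (- \<rr>))) \<longlonglongrightarrow> 1"
proof (rule Lim_transform_eventually[OF cost_rate[OF assms] eventually_mono[OF psi_positive]])
  fix n assume psi: "0 < psi_fun M \<rr>\<^sub>1 (- \<alpha>) (\<xi> n) \<and> 0 < psi_fun M \<rr>\<^sub>2 (1 - \<beta>) (\<xi> n)"
  define k ps sg where "k = ((\<rho> + 1) / (\<phi> + 1)) / sqrt (2 * ((\<rho> + 1) / (\<phi> + 1)) - 1)"
    and "ps = sqrt (psi_fun M \<rr>\<^sub>2 (1 - \<beta>) (\<xi> n))" and "sg = 1 / sqrt (1 - g)"
  note defs = k_def ps_def sg_def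
  have "k > 0" unfolding k_def using t_gt \<rho>1 \<phi>0 by (intro divide_pos_pos) auto
  then have c: "sg * k * \<kappa>\<^sub>s powr ((1 - \<beta>) / 2) * ps \<noteq> 0" (is "?c \<noteq> 0")
    using psi g \<kappa> by (simp add: ps_def sg_def)
  \<comment> \<open>The extra half power is the prefactor 1 / sqrt (1 - g) of the diffusive
    rate.\<close>
  have "(1 - g) powr (- (1 / 2)) = sg" unfolding sg_def using g by (subst powr_minus_divide, subst powr_half_sqrt) auto
  then have h: "(1 - g) powr (- (\<rr> + 1 / 2)) = (1 - g) powr (- \<rr>) * sg" by (simp only: minus_add_distrib powr_add)
  have e: "\<epsilon>diff n = sg * k * \<kappa>\<^sub>s powr ((1 - \<beta>) / 2) * \<kappa>\<^sub>K powr (- \<rr>) * ps * real n powr (- R)"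
    unfolding \<epsilon>diff defs g_def R_def ..
  let ?a = "\<kappa>\<^sub>K powr (- \<rr>) * real n powr (- R)"
  let ?b = "kC powr \<rr> * (1 - g) powr (- \<rr>) * cost C \<omega> n powr (- \<rr>)"
  have "?a / ?b = (?c * ?a) / (?c * ?b)" using c by (rule mult_divide_mult_cancel_left[symmetric])
  then show "?a / ?b = \<epsilon>diff n / (kC powr \<rr> * (1 - g) powr (- (\<rr> + 1 / 2))
      * (((\<rho> + 1) / (\<phi> + 1)) / sqrt (2 * ((\<rho> + 1) / (\<phi> + 1)) - 1))
      * \<kappa>\<^sub>s powr ((1 - \<beta>) / 2) * sqrt (psi_fun M \<rr>\<^sub>2 (1 - \<beta>) (\<xi> n)) * cost C \<omega> n powr (- \<rr>))"
    unfolding e h defs[symmetric] by (simp only: mult_ac)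
qed

end

theorem theorem1p8:
  fixes P :: "'w measure" and S :: "'u measure" and U :: "'w \<Rightarrow> 'u"
    and D :: "(real^'d) set"
    and F :: "real^'d \<Rightarrow> 'u \<Rightarrow> real^'d"
    and Fs :: "nat \<Rightarrow> real^'d \<Rightarrow> 'u \<Rightarrow> real^'d"
    and proj :: "real^'d \<Rightarrow> real^'d"
    and \<theta>s \<theta>\<^sub>0 \<mu> :: "real^'d" and H \<Gamma> :: "real^'d^'d"
    and UU :: "nat \<times> nat \<Rightarrow> 'w \<Rightarrow> 'u"
    and Us :: "nat \<Rightarrow> 'w \<Rightarrow> nat \<times> nat \<Rightarrow> 'u"
    and M \<alpha> \<beta> lam \<phi> \<rho> \<psi> \<kappa>\<^sub>K \<kappa>\<^sub>s \<rr> \<rr>\<^sub>1 \<rr>\<^sub>2 :: real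
    and \<gamma> K Kbar b \<xi> \<epsilon>bias \<epsilon>diff :: "nat \<Rightarrow> real" and s :: "nat \<Rightarrow> nat"
    and \<theta> \<theta>bar :: "nat \<Rightarrow> 'w \<Rightarrow> real^'d" and conv :: "'w set"
  \<comment> \<open>setting\<close>
  assumes "prob_space P" and "U \<in> measurable P S"
    and "closed D"
    and "(\<lambda>(\<theta>, u). F \<theta> u) \<in> borel_measurable (restrict_space borel D \<Otimes>\<^sub>M S)"
    and "\<And>\<theta>. \<theta> \<in> D \<Longrightarrow> integrable P (\<lambda>\<omega>. F \<theta> (U \<omega>))"
    and "proj \<in> borel_measurable borel"
    and "\<And>\<theta>. \<theta> \<in> D \<Longrightarrow> proj \<theta> = \<theta>"
    and "\<And>\<theta>. \<theta> \<notin> D \<Longrightarrow> proj \<theta> \<in> frontier D"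
    and "\<And>k. k \<ge> 1 \<Longrightarrow> (\<lambda>(\<theta>, u). Fs k \<theta> u) \<in> borel_measurable (restrict_space borel D \<Otimes>\<^sub>M S)"
    and "\<And>k \<theta>. k \<ge> 1 \<Longrightarrow> \<theta> \<in> D \<Longrightarrow> integrable P (\<lambda>\<omega>. Fs k \<theta> (U \<omega>))"
    and "Fs 0 = (\<lambda>_ _. 0)"
    and "independent_copies P S U ({1..} \<times> {1..}) UU"
    and "independent_copies P (Pi\<^sub>M ({1..} \<times> {1..}) (\<lambda>_. S))
           (\<lambda>\<omega>. \<lambda>kl \<in> {1..} \<times> {1..}. UU kl \<omega>) {1..} Us"
    and "\<theta>\<^sub>0 \<in> D"
  \<comment> \<open>assumptions on the zero and on the approximations\<close>
    and "contracting_zero D (mean_field P U F) \<theta>s H"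
    and "0 < lam" and "lam \<le> 1"
    and "(\<lambda>\<theta>. norm (mean_field P U F \<theta> - H *v (\<theta> - \<theta>s)))
           \<in> O[at \<theta>s within D](\<lambda>\<theta>. norm (\<theta> - \<theta>s) powr (1 + lam))"
    and "M > 1" and "\<alpha> > 0" and "\<beta> > 0" and "\<beta> < 2 * \<alpha>" and "\<beta> < 1"
    and "approximations P U D F Fs \<alpha> \<beta> \<mu> \<Gamma> \<theta>s M"
  \<comment> \<open>parameters\<close>
    and "\<rr> = \<alpha> / (2 * \<alpha> - \<beta> + 1)"
    and "1 / (2 * \<alpha> - \<beta>) < \<phi>" and "\<phi> + 1 < 2 * (\<rho> + 1)"
    and "max (1 - 2 * lam / (lam + 1) * (\<phi> + 1) * \<rr>) 0 < \<psi>" and "\<psi> < 1"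
    and "\<kappa>\<^sub>K > 0" and "\<kappa>\<^sub>s > 0"
    and "\<And>n. \<gamma> n = real n powr (- \<psi>)"
    and "\<And>n. K n = \<kappa>\<^sub>K * (\<phi> + 1) * real n powr \<phi>"
    and "\<And>n. Kbar n = (\<Sum>k = 1..n. K k)"
    and "\<And>n. s n = nat (max \<lfloor>log M (\<kappa>\<^sub>s * Kbar n powr (1 / (2 * \<alpha> - \<beta> + 1)))\<rfloor> 1)"
    and "\<And>n. b n = real n powr \<rho>"
  \<comment> \<open>iterates, output and event of convergence\<close>
    and "\<And>n \<omega>. \<theta> n \<omega> = ml_iter M \<beta> Fs proj \<gamma> K s \<theta>\<^sub>0 (\<lambda>m. Us m \<omega>) n"
    and "\<And>n \<omega>. \<theta>bar n \<omega> = ml_average b (\<lambda>m. \<theta> m \<omega>) n"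
    and "conv = {\<omega> \<in> space P. (\<lambda>n. \<theta> n \<omega>) \<longlonglongrightarrow> \<theta>s}"
  \<comment> \<open>abbreviations of the theorem\<close>
    and "\<rr>\<^sub>1 = (\<rho> + 1) / (\<phi> + 1) * (2 * \<alpha> - \<beta> + 1)"
    and "\<rr>\<^sub>2 = (2 * ((\<rho> + 1) / (\<phi> + 1)) - 1) * (2 * \<alpha> - \<beta> + 1)"
    and "\<And>n. \<xi> n = log M (\<kappa>\<^sub>s * Kbar n powr (1 / (2 * \<alpha> - \<beta> + 1))) - real (s n)"
    and "\<And>n. \<epsilon>bias n = \<kappa>\<^sub>s powr (- \<alpha>) * \<kappa>\<^sub>K powr (- \<rr>) * psi_fun M \<rr>\<^sub>1 (- \<alpha>) (\<xi> n)
                  * real n powr (- ((\<phi> + 1) * \<rr>))"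
    and "\<And>n. \<epsilon>diff n = 1 / sqrt (1 - M powr (- ((1 - \<beta>) / 2)))
                  * (((\<rho> + 1) / (\<phi> + 1)) / sqrt (2 * ((\<rho> + 1) / (\<phi> + 1)) - 1))
                  * \<kappa>\<^sub>s powr ((1 - \<beta>) / 2) * \<kappa>\<^sub>K powr (- \<rr>)
                  * sqrt (psi_fun M \<rr>\<^sub>2 (1 - \<beta>) (\<xi> n)) * real n powr (- ((\<phi> + 1) * \<rr>))"
  shows "converges_in_law_on P conv
           (\<lambda>n \<omega>. (1 / \<epsilon>diff n) *\<^sub>R (\<theta>bar n \<omega> - \<theta>s + \<epsilon>bias n *\<^sub>R (matrix_inv H *v \<mu>)))
           (normal_vec 0 (matrix_inv H ** \<Gamma> ** transpose (matrix_inv H)))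
       \<and> (\<forall>C \<kappa>\<^sub>C. \<kappa>\<^sub>C > 0 \<longrightarrow> cost_functions D C M \<kappa>\<^sub>C \<theta>s \<longrightarrow>
           (AE \<omega> in P. \<omega> \<in> conv \<longrightarrow>
              (\<lambda>n. \<epsilon>bias n /
                 (\<kappa>\<^sub>C powr \<rr> * (1 - M powr (- ((1 - \<beta>) / 2))) powr (- \<rr>) * \<kappa>\<^sub>s powr (- \<alpha>)
                  * psi_fun M \<rr>\<^sub>1 (- \<alpha>) (\<xi> n)
                  * ml_cost M \<beta> C K s (\<lambda>m. \<theta> m \<omega>) n powr (- \<rr>))) \<longlonglongrightarrow> 1)
         \<and> (AE \<omega> in P. \<omega> \<in> conv \<longrightarrow>
              (\<lambda>n. \<epsilon>diff n /
                 (\<kappa>\<^sub>C powr \<rr> * (1 - M powr (- ((1 - \<beta>) / 2))) powr (- (\<rr> + 1 / 2))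
                  * (((\<rho> + 1) / (\<phi> + 1)) / sqrt (2 * ((\<rho> + 1) / (\<phi> + 1)) - 1))
                  * \<kappa>\<^sub>s powr ((1 - \<beta>) / 2) * sqrt (psi_fun M \<rr>\<^sub>2 (1 - \<beta>) (\<xi> n))
                  * ml_cost M \<beta> C K s (\<lambda>m. \<theta> m \<omega>) n powr (- \<rr>))) \<longlonglongrightarrow> 1))"
proof -
  interpret multilevel P M \<alpha> \<beta> \<phi> \<rho> \<kappa>\<^sub>K \<kappa>\<^sub>s \<rr> \<rr>\<^sub>1 \<rr>\<^sub>2 K Kbar b \<xi> \<epsilon>bias \<epsilon>diff s S U D F Fs proj
    \<theta>s \<theta>\<^sub>0 \<mu> H \<Gamma> UU Us lam \<psi> \<gamma> \<theta> \<theta>bar conv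
    by (intro multilevel.intro ml_parameters.intro multilevel_axioms.intro) (fact assms)+
  \<comment> \<open>The cost statements hold for every single path in \<open>conv\<close>, so the
    almost sure form is immediate.\<close>
  show ?thesis
    by (intro conjI allI impI AE_I2 conv_law bias_cost_rate[unfolded g_def] diff_cost_rate[unfolded g_def])
qed

end
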